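(* Let $k\in\frac12\mathbb Z$ with $k>2$, let $\Gamma$ be a finite index subgroup of $\mathrm{SL}(2,\mathbb Z)$ and $\nu$ a multiplier system of weight $2-k$ for $\Gamma$. Then the space $H^{\#}_{2-k}(\Gamma,\nu)$ is spanned by the mock Eisenstein series $\mathcal E_{2-k}(\Gamma,\nu,z,\mathfrak a)$, as $\mathfrak a$ varies over the inequivalent (singular) cusps of $\Gamma$, and $H^{\#}_{2-k}(\Gamma,\nu)\cong\mathfrak E_k(\Gamma,\overline\nu)$ as vector spaces. Moreover, if $k\ge3$ is an integer and $\chi$ is a Dirichlet character modulo $N$ with $\chi(-1)=(-1)^k$, then $$\dim H^{\#}_{2-k}(\Gamma_0(N),\chi)=\sum_{\substack{C\mid N\\ \gcd(C,N/C)\mid N/m_{\overline\chi}}}\phi(\gcd(C,N/C)),$$ where $C$ runs over positive divisors of $N$, $m_{\overline\chi}$ is the conductor of $\overline\chi$ and $\phi$ is Euler's function.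
   Context: Notation. $z\in\mathbb H$, $y=\mathrm{Im}(z)$; powers use the principal branch ($-\pi<\arg\le\pi$); $j(\gamma,z)=cz+d$ for $\gamma\in\mathrm{SL}(2,\mathbb R)$ with bottom row $(c,d)$. For $\kappa\in\frac12\mathbb Z$ put $w_\kappa(\gamma_1,\gamma_2)=j(\gamma_1,\gamma_2z)^\kappa j(\gamma_2,z)^\kappa j(\gamma_1\gamma_2,z)^{-\kappa}$ (independent of $z$). A multiplier system of weight $\kappa$ for $\Gamma$ is $\nu:\Gamma\to\{|u|=1\}$ with $\nu(\gamma_1\gamma_2)=\nu(\gamma_1)\nu(\gamma_2)w_\kappa(\gamma_1,\gamma_2)$ and $\nu(-I)=e^{-\pi i\kappa}$ if $-I\in\Gamma$; if $\nu$ has weight $2-k$, then $\overline\nu$ is a multiplier system of weight $k$. $\Gamma_0(N),\chi$ means $\Gamma=\Gamma_0(N)$ and $\nu\left(\begin{smallmatrix}a&b\\c&d\end{smallmatrix}\right)=\chi(d)$. Harmonic Maass forms. $\Delta_\kappa=-4y^2\frac{\partial}{\partial z}\frac{\partial}{\partial\bar z}+2i\kappa y\frac{\partial}{\partial\bar z}$. $H^{\#}_\kappa(\Gamma,\nu)$ is the space of smooth $f:\mathbb H\to\mathbb C$ with $f(\gamma z)=\nu(\gamma)j(\gamma,z)^\kappa f(z)$ for all $\gamma\in\Gamma$, $\Delta_\kappa f=0$, and at most polynomial growth (in $y$, as $y\to\infty$) at every cusp of $\Gamma$. Eisenstein series. For a cusp $\mathfrak a$ let $\Gamma_{\mathfrak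 a}$ be its stabilizer in $\Gamma$ and choose a scaling matrix $\sigma_{\mathfrak a}\in\mathrm{SL}(2,\mathbb R)$ with $\sigma_{\mathfrak a}\infty=\mathfrak a$ and $\sigma_{\mathfrak a}^{-1}(\{\pm I\}\Gamma_{\mathfrak a})\sigma_{\mathfrak a}=\{\pm\left(\begin{smallmatrix}1&n\\0&1\end{smallmatrix}\right):n\in\mathbb Z\}$. The cusp is singular for $\nu$ (weight $\kappa$) if $\nu(\gamma)w_\kappa(\sigma_{\mathfrak a}^{-1},\gamma)j(\sigma_{\mathfrak a}^{-1}\gamma,z)^\kappa=j(\sigma_{\mathfrak a}^{-1},z)^\kappa$ for all $\gamma\in\Gamma_{\mathfrak a}$. For a singular cusp and $\kappa+2\mathrm{Re}(s)>2$, $$E_\kappa(\Gamma,\nu,z,\mathfrak a,s)=\sum_{\gamma\in\Gamma_{\mathfrak a}\backslash\Gamma}\overline{\nu(\gamma)}\,\overline{w_\kappa(\sigma_{\mathfrak a}^{-1},\gamma)}\,j(\sigma_{\mathfrak a}^{-1}\gamma,z)^{-\kappa}|j(\sigma_{\mathfrak a}^{-1}\gamma,z)|^{-2s}.$$ For $k>2$ and $\overline\nu$ of weight $k$, $E_k(\Gamma,\overline\nu,z,\mathfrak a)=E_k(\Gamma,\overline\nu,z,\mathfrak a,0)$, and $\mathfrak E_k(\Gamma,\overline\nu)$ is the Eisenstein subspace of the space $M_k(\Gamma,\overline\nu)$ of holomorphic modular forms, i.e. the span of the $E_k(\Gamma,\overline\nu,z,\mathfrak a)$ over singular cusps $\mathfrak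 a$. For $\nu$ of weight $2-k$ the mock Eisenstein series is $$\mathcal E_{2-k}(\Gamma,\nu,z,\mathfrak a)=\frac{y^{k-1}}{k-1}E_{2-k}(\Gamma,\nu,z,\mathfrak a,k-1).$$ *)

theory Defs
  imports
    "HOL-Analysis.Analysis"
    "HOL-Algebra.Coset"
    "HOL-Library.Function_Algebras"
    "HOL-Number_Theory.Totient"
begin

section \<open>Matrices acting on the upper half plane and its boundary\<close>

definition uhp :: "complex set" where
  "uhp = {z. Im z > 0}"

definition SL2R :: "(real^2^2) set" where
  "SL2R = {A. det A = 1}"

text \<open>The modular group is kept inside the real matrices, so that its elements can be
  multiplied with real scaling matrices.\<close>

definition SL2Z :: "(real^2^2) monoid" where
  "SL2Z = \<lparr>carrier = {A. det A = 1 \<and> (\<forall>i j. A $ i $ j \<in> \<int>)}, mult = (**), one = mat 1\<rparr>"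

definition translation :: "int \<Rightarrow> real^2^2" where
  "translation n = vector [vector [1, of_int n], vector [0, 1]]"

definition mobius :: "real^2^2 \<Rightarrow> complex \<Rightarrow> complex" where
  "mobius A z = (of_real (A$1$1) * z + of_real (A$1$2)) / (of_real (A$2$1) * z + of_real (A$2$2))"

definition automorphy :: "real^2^2 \<Rightarrow> complex \<Rightarrow> complex" where
  "automorphy A z = of_real (A$2$1) * z + of_real (A$2$2)"

text \<open>Points of \<open>\<real> \<union> {\<infinity>}\<close> are encoded in \<^typ>\<open>real option\<close>, with \<^term>\<open>None\<close>
  standing for \<open>\<infinity>\<close>.\<close>

fun bdry_mobius :: "real^2^2 \<Rightarrow> real option \<Rightarrow> real option" where
  "bdry_mobius A None = (if A$2$1 = 0 then None else Some (A$1$1 / A$2$1))"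
| "bdry_mobius A (Some x) =
     (if A$2$1 * x + A$2$2 = 0 then None
      else Some ((A$1$1 * x + A$1$2) / (A$2$1 * x + A$2$2)))"

definition finite_index_subgroup :: "(real^2^2) set \<Rightarrow> bool" where
  "finite_index_subgroup \<Gamma> \<longleftrightarrow> subgroup \<Gamma> SL2Z \<and> finite (rcosets\<^bsub>SL2Z\<^esub> \<Gamma>)"

definition Gamma0 :: "nat \<Rightarrow> (real^2^2) set" where
  "Gamma0 N = {A \<in> carrier SL2Z. int N dvd \<lfloor>A$2$1\<rfloor>}"


section \<open>Multiplier systems\<close>

text \<open>The weight is a real parameter; \<open>powr\<close> on the complex numbers is the principal branch
  (\<open>-\<pi> < arg \<le> \<pi>\<close>).  The cocycle does not depend on the base point, which is therefore
  taken to be \<open>\<i>\<close>; the lemma \<open>wcocycle_eq\<close> below gives the formula at every point.\<close>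

definition wcocycle :: "real \<Rightarrow> real^2^2 \<Rightarrow> real^2^2 \<Rightarrow> complex" where
  "wcocycle \<kappa> A B =
     automorphy A (mobius B \<i>) powr of_real \<kappa> * automorphy B \<i> powr of_real \<kappa>
       * automorphy (A ** B) \<i> powr (- of_real \<kappa>)"

definition multiplier_system :: "(real^2^2) set \<Rightarrow> (real^2^2 \<Rightarrow> complex) \<Rightarrow> real \<Rightarrow> bool" where
  "multiplier_system \<Gamma> \<nu> \<kappa> \<longleftrightarrow>
     (\<forall>A\<in>\<Gamma>. norm (\<nu> A) = 1) \<and>
     (\<forall>A\<in>\<Gamma>. \<forall>B\<in>\<Gamma>. \<nu> (A ** B) = \<nu> A * \<nu> B * wcocycle \<kappa> A B) \<and>
     (- mat 1 \<in> \<Gamma> \<longrightarrow> \<nu> (- mat 1) = exp (- of_real pi * \<i> * of_real \<kappa>))"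


section \<open>Cusps\<close>

text \<open>For a finite index subgroup of \<open>SL(2,\<int>)\<close> the cusps are the points of \<open>\<rat> \<union> {\<infinity>}\<close>.\<close>

definition cusps :: "real option set" where
  "cusps = insert None (Some ` \<rat>)"

definition cusp_stabilizer :: "(real^2^2) set \<Rightarrow> real option \<Rightarrow> (real^2^2) set" where
  "cusp_stabilizer \<Gamma> \<aa> = {A \<in> \<Gamma>. bdry_mobius A \<aa> = \<aa>}"

definition scaling_matrix :: "(real^2^2) set \<Rightarrow> real option \<Rightarrow> real^2^2 \<Rightarrow> bool" where
  "scaling_matrix \<Gamma> \<aa> \<sigma> \<longleftrightarrow>
     \<sigma> \<in> SL2R \<and> bdry_mobius \<sigma> None = \<aa> \<and>
     (\<lambda>A. matrix_inv \<sigma> ** A ** \<sigma>) ` (cusp_stabilizer \<Gamma> \<aa> \<union> uminus ` cusp_stabilizer \<Gamma> \<aa>)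
       = range translation \<union> uminus ` range translation"

definition singular_cusp ::
  "(real^2^2) set \<Rightarrow> (real^2^2 \<Rightarrow> complex) \<Rightarrow> real \<Rightarrow> real option \<Rightarrow> real^2^2 \<Rightarrow> bool" where
  "singular_cusp \<Gamma> \<nu> \<kappa> \<aa> \<sigma> \<longleftrightarrow>
     (\<forall>A \<in> cusp_stabilizer \<Gamma> \<aa>. \<forall>z\<in>uhp.
        \<nu> A * wcocycle \<kappa> (matrix_inv \<sigma>) A * automorphy (matrix_inv \<sigma> ** A) z powr of_real \<kappa>
          = automorphy (matrix_inv \<sigma>) z powr of_real \<kappa>)"

definition cusp_representatives :: "(real^2^2) set \<Rightarrow> real option set \<Rightarrow> bool" where
  "cusp_representatives \<Gamma> R \<longleftrightarrow>
     R \<subseteq> cusps \<and> (\<forall>\<aa>\<in>cusps. \<exists>!\<bb>. \<bb> \<in> R \<and> (\<exists>A\<in>\<Gamma>. bdry_mobius A \<bb> = \<aa>))"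


section \<open>Harmonic Maass forms of polynomial growth\<close>

text \<open>Real differentiability: on \<^typ>\<open>complex\<close>, \<open>differentiable\<close> and
  \<^const>\<open>frechet_derivative\<close> refer to the underlying real vector space.\<close>

primrec times_cont_diff_on :: "nat \<Rightarrow> complex set \<Rightarrow> (complex \<Rightarrow> complex) \<Rightarrow> bool" where
  "times_cont_diff_on 0 S f \<longleftrightarrow> continuous_on S f"
| "times_cont_diff_on (Suc n) S f \<longleftrightarrow>
     (\<forall>z\<in>S. f differentiable (at z)) \<and>
     (\<forall>v. times_cont_diff_on n S (\<lambda>z. frechet_derivative f (at z) v))"

definition smooth_on :: "complex set \<Rightarrow> (complex \<Rightarrow> complex) \<Rightarrow> bool" where
  "smooth_on S f \<longleftrightarrow> (\<forall>n. times_cont_diff_on n S f)"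

definition d_dz :: "(complex \<Rightarrow> complex) \<Rightarrow> complex \<Rightarrow> complex" where
  "d_dz f z = (frechet_derivative f (at z) 1 - \<i> * frechet_derivative f (at z) \<i>) / 2"

definition d_dzbar :: "(complex \<Rightarrow> complex) \<Rightarrow> complex \<Rightarrow> complex" where
  "d_dzbar f z = (frechet_derivative f (at z) 1 + \<i> * frechet_derivative f (at z) \<i>) / 2"

definition weight_laplacian :: "real \<Rightarrow> (complex \<Rightarrow> complex) \<Rightarrow> complex \<Rightarrow> complex" where
  "weight_laplacian \<kappa> f z =
     - 4 * of_real ((Im z)\<^sup>2) * d_dz (d_dzbar f) z
     + 2 * \<i> * of_real \<kappa> * of_real (Im z) * d_dzbar f z"

text \<open>Growth at \<open>\<aa>\<close> is that of \<open>j(\<sigma>,z)\<^bsup>-\<kappa>\<^esup> f(\<sigma>z)\<close> as \<open>y \<rightarrow> \<infinity>\<close>, uniformly in \<open>x\<close>,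
  for the matrices \<open>\<sigma>\<close> that carry \<open>\<infinity>\<close> to \<open>\<aa>\<close>.\<close>

definition polynomial_growth_at :: "real \<Rightarrow> (complex \<Rightarrow> complex) \<Rightarrow> real option \<Rightarrow> bool" where
  "polynomial_growth_at \<kappa> f \<aa> \<longleftrightarrow>
     (\<forall>\<sigma>\<in>SL2R. bdry_mobius \<sigma> None = \<aa> \<longrightarrow>
        (\<exists>a C Y. \<forall>z\<in>uhp. Im z \<ge> Y \<longrightarrow>
           norm (automorphy \<sigma> z powr (- of_real \<kappa>) * f (mobius \<sigma> z)) \<le> C * Im z powr a))"

text \<open>Functions on the upper half plane are represented by their extension by \<open>0\<close> to the
  whole complex plane, so that they form a subspace of \<^typ>\<open>complex \<Rightarrow> complex\<close>.\<close>

definition H_sharp :: "real \<Rightarrow> (real^2^2) set \<Rightarrow> (real^2^2 \<Rightarrow> complex) \<Rightarrow> (complex \<Rightarrow> complex) set" where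
  "H_sharp \<kappa> \<Gamma> \<nu> = {f.
     (\<forall>z. z \<notin> uhp \<longrightarrow> f z = 0) \<and>
     smooth_on uhp f \<and>
     (\<forall>A\<in>\<Gamma>. \<forall>z\<in>uhp. f (mobius A z) = \<nu> A * automorphy A z powr of_real \<kappa> * f z) \<and>
     (\<forall>z\<in>uhp. weight_laplacian \<kappa> f z = 0) \<and>
     (\<forall>\<aa>\<in>cusps. polynomial_growth_at \<kappa> f \<aa>)}"

definition cfun_scale :: "complex \<Rightarrow> (complex \<Rightarrow> complex) \<Rightarrow> complex \<Rightarrow> complex" where
  "cfun_scale c f = (\<lambda>z. c * f z)"

global_interpretation cfun: vector_space cfun_scale
  by unfold_locales (auto simp: cfun_scale_def fun_eq_iff algebra_simps)

definition isomorphic_subspaces :: "(complex \<Rightarrow> complex) set \<Rightarrow> (complex \<Rightarrow> complex) set \<Rightarrow> bool" where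
  "isomorphic_subspaces V W \<longleftrightarrow>
     (\<exists>T. bij_betw T V W \<and>
          (\<forall>f\<in>V. \<forall>g\<in>V. T (f + g) = T f + T g) \<and>
          (\<forall>c. \<forall>f\<in>V. T (cfun_scale c f) = cfun_scale c (T f)))"


section \<open>Eisenstein series\<close>

definition eisenstein_term ::
  "(real^2^2 \<Rightarrow> complex) \<Rightarrow> real \<Rightarrow> real^2^2 \<Rightarrow> complex \<Rightarrow> complex \<Rightarrow> real^2^2 \<Rightarrow> complex" where
  "eisenstein_term \<nu> \<kappa> \<sigma> s z A =
     cnj (\<nu> A) * cnj (wcocycle \<kappa> (matrix_inv \<sigma>) A)
       * automorphy (matrix_inv \<sigma> ** A) z powr (- of_real \<kappa>)
       * of_real (norm (automorphy (matrix_inv \<sigma> ** A) z)) powr (- 2 * s)"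

text \<open>The sum over \<open>\<Gamma>\<^sub>\<aa>\<setminus>\<Gamma>\<close> is evaluated at an arbitrary representative of each coset; for a
  singular cusp the choice is irrelevant by lemma \<open>eisenstein_term_coset\<close>.\<close>

definition eisenstein ::
  "real \<Rightarrow> (real^2^2) set \<Rightarrow> (real^2^2 \<Rightarrow> complex) \<Rightarrow> real option \<Rightarrow> real^2^2 \<Rightarrow> complex
     \<Rightarrow> complex \<Rightarrow> complex" where
  "eisenstein \<kappa> \<Gamma> \<nu> \<aa> \<sigma> s z =
     (if z \<in> uhp then
        (\<Sum>\<^sub>\<infinity> K \<in> rcosets\<^bsub>SL2Z\<lparr>carrier := \<Gamma>\<rparr>\<^esub> (cusp_stabilizer \<Gamma> \<aa>).
           eisenstein_term \<nu> \<kappa> \<sigma> s z (SOME A. A \<in> K))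
      else 0)"

definition mock_eisenstein ::
  "real \<Rightarrow> (real^2^2) set \<Rightarrow> (real^2^2 \<Rightarrow> complex) \<Rightarrow> real option \<Rightarrow> real^2^2 \<Rightarrow> complex \<Rightarrow> complex" where
  "mock_eisenstein k \<Gamma> \<nu> \<aa> \<sigma> z =
     of_real (Im z powr (k - 1) / (k - 1)) * eisenstein (2 - k) \<Gamma> \<nu> \<aa> \<sigma> (of_real (k - 1)) z"

text \<open>Here \<open>\<sigma>\<close> selects a scaling matrix for each cusp.\<close>

definition eisenstein_space ::
  "real \<Rightarrow> (real^2^2) set \<Rightarrow> (real^2^2 \<Rightarrow> complex) \<Rightarrow> (real option \<Rightarrow> real^2^2)
     \<Rightarrow> (complex \<Rightarrow> complex) set" where
  "eisenstein_space k \<Gamma> \<mu> \<sigma> =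
     cfun.span {eisenstein k \<Gamma> \<mu> \<aa> (\<sigma> \<aa>) 0 | \<aa>. \<aa> \<in> cusps \<and> singular_cusp \<Gamma> \<mu> k \<aa> (\<sigma> \<aa>)}"


section \<open>Dirichlet characters\<close>

definition dirichlet_character :: "nat \<Rightarrow> (int \<Rightarrow> complex) \<Rightarrow> bool" where
  "dirichlet_character N \<psi> \<longleftrightarrow>
     N > 0 \<and>
     (\<forall>a. \<psi> (a + int N) = \<psi> a) \<and>
     (\<forall>a b. \<psi> (a * b) = \<psi> a * \<psi> b) \<and>
     (\<forall>a. \<psi> a \<noteq> 0 \<longleftrightarrow> coprime a (int N))"

definition conductor :: "nat \<Rightarrow> (int \<Rightarrow> complex) \<Rightarrow> nat" where
  "conductor N \<psi> =
     (LEAST M. M dvd N \<and>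
        (\<exists>\<theta>. dirichlet_character M \<theta> \<and> (\<forall>a. coprime a (int N) \<longrightarrow> \<psi> a = \<theta> a)))"

definition character_multiplier :: "(int \<Rightarrow> complex) \<Rightarrow> real^2^2 \<Rightarrow> complex" where
  "character_multiplier \<psi> A = \<psi> \<lfloor>A$2$2\<rfloor>"


section \<open>The notions above are well defined\<close>

lemma SL2Z_mult_closed:
  assumes "A \<in> carrier SL2Z" "B \<in> carrier SL2Z"
  shows "A ** B \<in> carrier SL2Z"
proof -
  have "(A ** B) $ i $ j \<in> \<int>" for i j
    using assms unfolding matrix_matrix_mult_def SL2Z_def by (auto intro!: Ints_sum Ints_mult)
  thus ?thesis using assms by (simp add: SL2Z_def det_mul)
qed

lemma SL2Z_group: "group SL2Z"
proof (rule groupI)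
  fix A assume A: "A \<in> carrier SL2Z"
  define B :: "real^2^2" where "B = vector [vector [A$2$2, - (A$1$2)], vector [- (A$2$1), A$1$1]]"
  have "B \<in> carrier SL2Z"
    using A by (auto simp: SL2Z_def B_def det_2 forall_2 vector_2 algebra_simps)
  moreover have "B ** A = mat 1"
    using A by (auto simp: SL2Z_def B_def det_2 vec_eq_iff forall_2 sum_2 matrix_matrix_mult_def
        mat_def vector_2 algebra_simps)
  ultimately show "\<exists>B\<in>carrier SL2Z. B \<otimes>\<^bsub>SL2Z\<^esub> A = \<one>\<^bsub>SL2Z\<^esub>"
    by (auto simp: SL2Z_def)
next
  fix A B assume "A \<in> carrier SL2Z" "B \<in> carrier SL2Z"
  thus "A \<otimes>\<^bsub>SL2Z\<^esub> B \<in> carrier SL2Z" using SL2Z_mult_closed by (simp add: SL2Z_def)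
next
  have "(mat 1 :: real^2^2) $ i $ j \<in> \<int>" for i j by (simp add: mat_def)
  thus "\<one>\<^bsub>SL2Z\<^esub> \<in> carrier SL2Z" by (simp add: SL2Z_def)
qed (simp_all add: SL2Z_def matrix_mul_assoc)

lemma automorphy_nonzero:
  assumes "det A = 1" "z \<in> uhp"
  shows "automorphy A z \<noteq> 0"
proof
  assume "automorphy A z = 0"
  hence "A$2$1 * Im z = 0" "A$2$1 * Re z + A$2$2 = 0"
    by (auto simp: automorphy_def complex_eq_iff)
  thus False using assms by (auto simp: uhp_def det_2)
qed

lemma mobius_uhp:
  assumes "det A = 1" "z \<in> uhp"
  shows "mobius A z \<in> uhp"
proof -
  let ?j = "automorphy A z"
  let ?n = "of_real (A$1$1) * z + of_real (A$1$2)"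
  have nz: "?j \<noteq> 0" using assms by (rule automorphy_nonzero)
  have "mobius A z = ?n * cnj ?j / of_real ((norm ?j)\<^sup>2)"
    unfolding mobius_def automorphy_def by (rule complex_div_cnj)
  hence "Im (mobius A z) = Im (?n * cnj ?j) / (norm ?j)\<^sup>2"
    by (simp only: Im_divide_of_real)
  also have "Im (?n * cnj ?j) = det A * Im z"
    by (simp add: automorphy_def det_2 algebra_simps)
  finally show ?thesis using assms nz by (simp add: uhp_def)
qed

lemma mobius_mult:
  assumes "det B = 1" "z \<in> uhp"
  shows "mobius (A ** B) z = mobius A (mobius B z)"
proof -
  let ?j = "automorphy B z"
  have nz: "?j \<noteq> 0" using assms by (rule automorphy_nonzero)
  have m: "mobius B z = (of_real (B$1$1) * z + of_real (B$1$2)) / ?j"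
    by (simp add: mobius_def automorphy_def)
  have "mobius A (mobius B z) =
      ((of_real (A$1$1) * mobius B z + of_real (A$1$2)) * ?j) /
      ((of_real (A$2$1) * mobius B z + of_real (A$2$2)) * ?j)"
    using nz by (simp add: mobius_def)
  also have "\<dots> = mobius (A ** B) z"
    using nz unfolding m distrib_right times_divide_eq_right times_divide_eq_left
      nonzero_mult_div_cancel_right[OF nz]
    by (simp add: mobius_def automorphy_def matrix_matrix_mult_def sum_2 algebra_simps)
  finally show ?thesis ..
qed

lemma automorphy_mult:
  assumes "det B = 1" "z \<in> uhp"
  shows "automorphy (A ** B) z = automorphy A (mobius B z) * automorphy B z"
proof -
  have "automorphy B z \<noteq> 0" using assms by (rule automorphy_nonzero)
  thus ?thesis
    by (simp add: automorphy_def mobius_def matrix_matrix_mult_def sum_2 field_simps)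
qed

lemma continuous_on_mobius: "det A = 1 \<Longrightarrow> continuous_on uhp (mobius A)"
  using automorphy_nonzero unfolding mobius_def[abs_def] automorphy_def
  by (intro continuous_intros) auto

lemma continuous_on_Ln_automorphy:
  assumes "det A = 1"
  shows "continuous_on uhp (\<lambda>z. Ln (automorphy A z))"
proof (cases "A$2$1 = 0")
  case True
  then show ?thesis by (simp add: automorphy_def)
next
  case False
  then have "automorphy A z \<notin> \<real>\<^sub>\<le>\<^sub>0" if "z \<in> uhp" for z
    using that by (auto simp: complex_nonpos_Reals_iff automorphy_def uhp_def)
  moreover have "continuous_on uhp (automorphy A)"
    unfolding automorphy_def[abs_def] by (intro continuous_intros)
  ultimately show ?thesis by (intro continuous_intros) auto
qed

lemma wcocycle_eq:
  assumes A: "det A = 1" and B: "det B = 1" and z: "z \<in> uhp"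
  shows "wcocycle \<kappa> A B =
     automorphy A (mobius B z) powr of_real \<kappa> * automorphy B z powr of_real \<kappa>
       * automorphy (A ** B) z powr (- of_real \<kappa>)"
proof -
  define L where "L = (\<lambda>z. Ln (automorphy A (mobius B z)) + Ln (automorphy B z)
                            - Ln (automorphy (A ** B) z))"
  have AB: "det (A ** B) = 1" using A B by (simp add: det_mul)
  have nz: "automorphy A (mobius B z) \<noteq> 0" "automorphy B z \<noteq> 0" "automorphy (A ** B) z \<noteq> 0"
    if "z \<in> uhp" for z
    using that A B AB by (metis automorphy_nonzero mobius_uhp)+
  have *: "automorphy A (mobius B z) powr of_real \<kappa> * automorphy B z powr of_real \<kappa>
       * automorphy (A ** B) z powr (- of_real \<kappa>) = exp (of_real \<kappa> * L z)" if "z \<in> uhp" for z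
    using nz[OF that] by (simp add: powr_def L_def exp_add[symmetric] algebra_simps)
  have expL: "exp (L z) = 1" if "z \<in> uhp" for z
    using nz[OF that] automorphy_mult[OF B that, of A] by (simp add: L_def exp_diff exp_add)
  have conn: "connected uhp"
    unfolding uhp_def by (intro convex_connected convex_halfspace_Im_gt)
  have cont: "continuous_on uhp L"
    unfolding L_def
    by (intro continuous_intros continuous_on_Ln_automorphy A B AB
        continuous_on_compose2[OF continuous_on_Ln_automorphy[OF A] continuous_on_mobius[OF B]])
       (auto intro: mobius_uhp[OF B])
  have "L constant_on uhp"
  proof (rule continuous_discrete_range_constant[OF conn cont])
    fix z assume z: "z \<in> uhp"
    show "\<exists>e>0. \<forall>y. y \<in> uhp \<and> L y \<noteq> L z \<longrightarrow> e \<le> norm (L y - L z)"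
    proof (intro exI[of _ "1::real"] conjI allI impI)
      fix y assume y: "y \<in> uhp \<and> L y \<noteq> L z"
      have "exp (L y - L z) = 1" using y z expL by (simp add: exp_diff)
      then obtain n :: int where "Re (L y - L z) = 0" "Im (L y - L z) = of_int (2 * n) * pi"
        by (subst (asm) exp_eq_1) blast
      hence n: "L y - L z = of_real (of_int (2 * n) * pi) * \<i>"
        by (simp add: complex_eq_iff)
      have "n \<noteq> 0" using n y by auto
      hence "1 \<le> \<bar>real_of_int n\<bar>" by linarith
      moreover have "2 * pi \<ge> 1" using pi_ge_two by simp
      ultimately have "1 * 1 \<le> \<bar>real_of_int n\<bar> * (2 * pi)" by (intro mult_mono) auto
      moreover have "norm (L y - L z) = \<bar>real_of_int n\<bar> * (2 * pi)"
        by (simp add: n norm_mult)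
      ultimately show "1 \<le> norm (L y - L z)" by simp
    qed auto
  qed
  then obtain c where c: "\<And>z. z \<in> uhp \<Longrightarrow> L z = c" by (auto simp: constant_on_def)
  have i: "\<i> \<in> uhp" by (simp add: uhp_def)
  show ?thesis unfolding wcocycle_def *[OF i] *[OF z] using c i z by simp
qed

lemma wcocycle_powr:
  assumes "det A = 1" "det B = 1" "z \<in> uhp"
  shows "wcocycle \<kappa> A B * automorphy (A ** B) z powr of_real \<kappa>
          = automorphy A (mobius B z) powr of_real \<kappa> * automorphy B z powr of_real \<kappa>"
  using automorphy_nonzero[of "A ** B" z] assms
  by (simp add: wcocycle_eq[OF assms] powr_minus det_mul)

lemma norm_wcocycle:
  assumes "det A = 1" "det B = 1"
  shows "norm (wcocycle \<kappa> A B) = 1"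
proof -
  have i: "\<i> \<in> uhp" by (simp add: uhp_def)
  have nz: "automorphy (A ** B) \<i> \<noteq> 0" "automorphy A (mobius B \<i>) \<noteq> 0" "automorphy B \<i> \<noteq> 0"
    using assms i by (metis automorphy_nonzero mobius_uhp det_mul mult_1)+
  show ?thesis using nz automorphy_mult[OF assms(2) i, of A]
    by (simp only: wcocycle_def norm_mult norm_powr_real_powr' powr_mult powr_minus norm_inverse
          norm_ge_zero Reals_of_real Re_complex_of_real) (simp add: powr_mult field_simps)
qed

lemma SL2R_matrix_inv:
  assumes "\<sigma> \<in> SL2R"
  shows "\<sigma> ** matrix_inv \<sigma> = mat 1" "matrix_inv \<sigma> ** \<sigma> = mat 1" "det (matrix_inv \<sigma>) = 1"
proof -
  have "invertible \<sigma>" using assms by (simp add: SL2R_def invertible_det_nz)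
  hence "\<exists>B. \<sigma> ** B = mat 1 \<and> B ** \<sigma> = mat 1" by (simp add: invertible_def)
  hence "\<sigma> ** matrix_inv \<sigma> = mat 1 \<and> matrix_inv \<sigma> ** \<sigma> = mat 1"
    unfolding matrix_inv_def by (rule someI_ex)
  thus 1: "\<sigma> ** matrix_inv \<sigma> = mat 1" "matrix_inv \<sigma> ** \<sigma> = mat 1" by auto
  have "det \<sigma> * det (matrix_inv \<sigma>) = 1" using 1(1) by (metis det_mul det_I)
  thus "det (matrix_inv \<sigma>) = 1" using assms by (simp add: SL2R_def)
qed

lemma scaled_stabilizer:
  assumes "scaling_matrix \<Gamma> \<aa> \<sigma>" "A \<in> cusp_stabilizer \<Gamma> \<aa>"
  obtains n where "matrix_inv \<sigma> ** A = translation n ** matrix_inv \<sigma> \<or>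
                   matrix_inv \<sigma> ** A = - translation n ** matrix_inv \<sigma>"
proof -
  have inv: "\<sigma> ** matrix_inv \<sigma> = mat 1"
    using assms(1) by (intro SL2R_matrix_inv) (auto simp: scaling_matrix_def)
  have "matrix_inv \<sigma> ** A ** \<sigma> \<in> range translation \<union> uminus ` range translation"
    using assms unfolding scaling_matrix_def by blast
  then obtain P n where P: "matrix_inv \<sigma> ** A ** \<sigma> = P" "P = translation n \<or> P = - translation n"
    by auto
  have "matrix_inv \<sigma> ** A = (matrix_inv \<sigma> ** A ** \<sigma>) ** matrix_inv \<sigma>"
    by (simp add: matrix_mul_assoc[symmetric] inv)
  thus ?thesis using that[of n] P by auto
qed

lemma eisenstein_term_coset:
  assumes \<Gamma>: "\<Gamma> \<subseteq> SL2R" and \<nu>: "multiplier_system \<Gamma> \<nu> \<kappa>"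
    and \<sigma>: "scaling_matrix \<Gamma> \<aa> \<sigma>" and sing: "singular_cusp \<Gamma> \<nu> \<kappa> \<aa> \<sigma>"
    and D: "D \<in> cusp_stabilizer \<Gamma> \<aa>" and A: "A \<in> \<Gamma>" and DA: "D ** A \<in> \<Gamma>" and z: "z \<in> uhp"
  shows "eisenstein_term \<nu> \<kappa> \<sigma> s z (D ** A) = eisenstein_term \<nu> \<kappa> \<sigma> s z A"
proof -
  define S where "S = matrix_inv \<sigma>"
  have D': "D \<in> \<Gamma>" using D by (simp add: cusp_stabilizer_def)
  have dS: "det S = 1"
    using \<sigma> SL2R_matrix_inv by (simp add: S_def scaling_matrix_def)
  have dets: "det D = 1" "det A = 1" "det (D ** A) = 1"
    using \<Gamma> A D' DA by (auto simp: SL2R_def)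
  have Az: "mobius A z \<in> uhp" using mobius_uhp dets z by blast
  have norm: "norm (automorphy (S ** (D ** A)) z) = norm (automorphy (S ** A) z)"
  proof -
    obtain n where n: "S ** D = translation n ** S \<or> S ** D = - translation n ** S"
      using scaled_stabilizer[OF \<sigma> D] unfolding S_def by metis
    have "automorphy (translation n ** S) w = automorphy S w"
         "automorphy (- translation n ** S) w = - automorphy S w" for w
      by (simp_all add: automorphy_def translation_def matrix_matrix_mult_def sum_2 vector_2)
    hence "norm (automorphy (S ** D) w) = norm (automorphy S w)" for w
      using n by auto
    thus ?thesis
      using dets z by (simp add: matrix_mul_assoc automorphy_mult norm_mult)
  qed
  define F where "F = (\<lambda>A. \<nu> A * wcocycle \<kappa> S A * automorphy (S ** A) z powr of_real \<kappa>)"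
  have F: "F B = \<nu> B * (automorphy S (mobius B z) powr of_real \<kappa> * automorphy B z powr of_real \<kappa>)"
    if "det B = 1" for B
    unfolding F_def wcocycle_powr[OF dS that z, symmetric] by (simp add: mult.assoc)
  have "F (D ** A) = F A"
  proof -
    have "\<nu> D * (automorphy S (mobius D (mobius A z)) powr of_real \<kappa> * automorphy D (mobius A z) powr of_real \<kappa>)
           = automorphy S (mobius A z) powr of_real \<kappa>"
      using sing D Az unfolding wcocycle_powr[OF dS dets(1) Az, symmetric]
      by (simp add: singular_cusp_def S_def mult.assoc)
    moreover have "\<nu> (D ** A) = \<nu> D * \<nu> A * wcocycle \<kappa> D A"
      using \<nu> D' A by (simp add: multiplier_system_def)
    moreover have "wcocycle \<kappa> D A * automorphy (D ** A) z powr of_real \<kappa>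
        = automorphy D (mobius A z) powr of_real \<kappa> * automorphy A z powr of_real \<kappa>"
      by (rule wcocycle_powr) (use dets z in auto)
    moreover have "\<nu> D * \<nu> A * w * (p * q) = \<nu> A * (r * t)"
      if "\<nu> D * (p * u) = r" "w * q = u * t" for w p q r t u :: complex
    proof -
      have "\<nu> D * \<nu> A * w * (p * q) = \<nu> D * \<nu> A * p * (w * q)" by (simp only: mult_ac)
      also have "\<dots> = \<nu> A * ((\<nu> D * (p * u)) * t)" unfolding that(2) by (simp only: mult_ac)
      finally show ?thesis unfolding that(1) .
    qed
    ultimately show ?thesis
      unfolding F[OF dets(3)] F[OF dets(2)] mobius_mult[OF dets(2) z] by simp
  qed
  have "eisenstein_term \<nu> \<kappa> \<sigma> s z B =
      inverse (F B) * of_real (norm (automorphy (S ** B) z)) powr (- 2 * s)" if "B \<in> \<Gamma>" for B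
  proof -
    have "norm (\<nu> B) = 1" using \<nu> that by (simp add: multiplier_system_def)
    moreover have "norm (wcocycle \<kappa> S B) = 1"
      by (rule norm_wcocycle) (use dS \<Gamma> that in \<open>auto simp: SL2R_def\<close>)
    ultimately have "cnj (\<nu> B) = inverse (\<nu> B)" "cnj (wcocycle \<kappa> S B) = inverse (wcocycle \<kappa> S B)"
      by (simp_all add: inverse_eq_divide complex_div_cnj[of 1])
    thus ?thesis by (simp add: eisenstein_term_def F_def S_def powr_minus)
  qed
  thus ?thesis using \<open>F (D ** A) = F A\<close> A DA norm by simp
qed

end

theory Submission
  imports Defs "HOL-Complex_Analysis.Cauchy_Integral_Formula" "HOL-Real_Asymp.Real_Asymp"
begin

text \<open>Let \<open>f\<close> be harmonic of weight \<open>\<kappa> = 2 - k < 0\<close>.  The conjugate of \<open>y\<^bsup>\<kappa>\<^esup> \<partial>f/\<partial>z'\<close> (\<open>z'\<close> the conjugate of \<open>z\<close>) is holomorphic,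
  so at each cusp the Fourier coefficients of \<open>f\<close> solve first order linear equations in \<open>y\<close>.  Polynomial
  growth kills all but exponentially small coefficients and a constant term \<open>D + C y\<^bsup>k-1\<^esup>\<close>, where \<open>C = 0\<close>
  unless the cusp is singular.  The mock Eisenstein series at a singular cusp has such an expansion with
  \<open>C \<noteq> 0\<close> there and \<open>C = 0\<close> at the inequivalent cusps, so a linear combination of them cancels all the
  coefficients \<open>C\<close>.  The difference \<open>g\<close> has \<open>y\<^bsup>\<kappa>/2\<^esup> |g|\<close> tending to \<open>0\<close> at every cusp; this invariant function
  then attains its maximum, which contradicts the equation \<open>\<Delta>\<^sub>\<kappa> g = 0\<close> in negative weight unless \<open>g = 0\<close>.
  The same asymptotics, for weight \<open>2 - k\<close> and for weight \<open>k\<close>, show that both families of Eisenstein series are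
  linearly independent, and a cusp is singular for \<open>\<nu>\<close> in weight \<open>2 - k\<close> iff it is singular for the
  conjugate of \<open>\<nu>\<close> in weight \<open>k\<close>.

  For \<open>\<Gamma>\<^sub>0(N)\<close> the dimension is therefore the number of singular cusps.  The class of \<open>a/c\<close> is determined by
  \<open>C = gcd(c, N)\<close> and the unit \<open>a c/C\<close> modulo \<open>g = gcd(C, N/C)\<close>, and the cusp is singular iff the character is
  trivial on the classes \<open>1\<close> modulo \<open>N/g\<close>, i.e. iff the conductor divides \<open>N/g\<close>.\<close>

section \<open>Differentiation of series and second derivatives\<close>

text \<open>The weight 2 - k is negative, and the size of a form is measured by y^((2-k)/2) |f|,
  which the group leaves invariant. In this measure a leading term C y^(k-1) grows like y^(k/2),
  while the constant D and the exponential remainder die out. So C alone obstructs smallness at a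
  cusp, and a space of unknown dimension is controlled by one number per cusp, without a pairing
  with cusp forms and without special functions. The price is uniformity in x: the Fourier
  coefficients need bounds that are summable over all frequencies, and not just a limit for each of
  them. The mock series has weight 2 - k and s = k - 1, hence terms of modulus |j|^(-k), as in
  weight k. One set of estimates therefore serves both families, and one comparison of leading
  coefficients gives both independence statements. The isomorphism comes from two bases indexed by
  the same singular cusps: it sends the mock Eisenstein series at a cusp to the weight k series at
  that cusp.\<close>

lemma has_derivative_infsum:
  fixes f :: "'i \<Rightarrow> 'a::real_normed_vector \<Rightarrow> 'b::banach"
  assumes S: "open S" "convex S" "x0 \<in> S"
    and der: "\<And>i x. i \<in> I \<Longrightarrow> x \<in> S \<Longrightarrow> (f i has_derivative f' i x) (at x)"
    and bd: "\<And>i x h. i \<in> I \<Longrightarrow> x \<in> S \<Longrightarrow> norm (f' i x h) \<le> b i * norm h"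
    and b0: "\<And>i. i \<in> I \<Longrightarrow> b i \<ge> 0" and b: "b summable_on I"
    and sm: "\<And>x. x \<in> S \<Longrightarrow> (\<lambda>i. f i x) summable_on I"
  shows "((\<lambda>x. \<Sum>\<^sub>\<infinity>i\<in>I. f i x) has_derivative (\<lambda>h. \<Sum>\<^sub>\<infinity>i\<in>I. f' i x0 h)) (at x0)"
  unfolding has_derivative_at_alt
proof (intro conjI allI impI)
  have bh: "(\<lambda>i. b i * c) summable_on J" if "J \<subseteq> I" for c J
    using summable_on_subset_banach[OF b that] by (rule summable_on_cmult_left)
  have sm': "(\<lambda>i. norm (f' i x0 h)) summable_on J" if "J \<subseteq> I" for h J
    using that S(3) by (intro Infinite_Sum.abs_summable_on_comparison_test'[OF bh[OF that, of "norm h"]] bd) auto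
  have sf': "(\<lambda>i. f' i x0 h) summable_on J" if "J \<subseteq> I" for h J
    using sm'[OF that] by (rule abs_summable_summable)
  have lin: "linear (f' i x0)" if "i \<in> I" for i
    using der[OF that S(3)] by (rule has_derivative_linear)
  show "bounded_linear (\<lambda>h. \<Sum>\<^sub>\<infinity>i\<in>I. f' i x0 h)"
  proof (rule bounded_linear_intro[where K = "infsum b I"])
    fix x y
    have "(\<Sum>\<^sub>\<infinity>i\<in>I. f' i x0 (x + y)) = (\<Sum>\<^sub>\<infinity>i\<in>I. f' i x0 x + f' i x0 y)"
      by (intro infsum_cong) (simp add: linear_add[OF lin])
    thus "(\<Sum>\<^sub>\<infinity>i\<in>I. f' i x0 (x + y)) = (\<Sum>\<^sub>\<infinity>i\<in>I. f' i x0 x) + (\<Sum>\<^sub>\<infinity>i\<in>I. f' i x0 y)"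
      by (simp add: infsum_add sf')
  next
    fix r x
    have "(\<Sum>\<^sub>\<infinity>i\<in>I. f' i x0 (r *\<^sub>R x)) = (\<Sum>\<^sub>\<infinity>i\<in>I. r *\<^sub>R f' i x0 x)"
      by (intro infsum_cong) (simp add: linear_cmul[OF lin])
    thus "(\<Sum>\<^sub>\<infinity>i\<in>I. f' i x0 (r *\<^sub>R x)) = r *\<^sub>R (\<Sum>\<^sub>\<infinity>i\<in>I. f' i x0 x)"
      by (simp add: infsum_scaleR_right)
  next
    fix x
    have "norm (\<Sum>\<^sub>\<infinity>i\<in>I. f' i x0 x) \<le> (\<Sum>\<^sub>\<infinity>i\<in>I. b i * norm x)"
      
      by (rule norm_infsum_le[OF has_sum_infsum[OF sf'] has_sum_infsum[OF bh]]) (use bd[OF _ S(3)] in auto)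
    also have "\<dots> = norm x * infsum b I"
      by (subst infsum_cmult_left') (simp add: mult.commute)
    finally show "norm (\<Sum>\<^sub>\<infinity>i\<in>I. f' i x0 x) \<le> norm x * infsum b I" .
  qed
  fix e :: real assume e: "e > 0"
  have "(sum b \<longlongrightarrow> infsum b I) (finite_subsets_at_top I)"
    using has_sum_infsum[OF b] by (simp add: has_sum_def)
  hence "\<forall>\<^sub>F X in finite_subsets_at_top I. dist (sum b X) (infsum b I) < e / 4"
    by (rule tendstoD) (use e in simp)
  then obtain X where X: "finite X" "X \<subseteq> I" "dist (sum b X) (infsum b I) < e / 4"
    unfolding eventually_finite_subsets_at_top by blast
  \<comment> \<open>Outside X the remainder consists of the increment of f i (mean value inequality)
    and the linear part, each at most b i times the distance. This factor 2 is why the tail of b is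
    taken below e/4; the finite sum over X uses the other e/2.\<close>
  have tail: "infsum b (I - X) < e / 4"
    using infsum_Diff[OF b summable_on_finite[OF X(1)] X(2)] X(1,3) by (simp add: dist_real_def abs_if split: if_splits)
  have "((\<lambda>x. \<Sum>i\<in>X. f i x) has_derivative (\<lambda>h. \<Sum>i\<in>X. f' i x0 h)) (at x0)"
    using X S by (intro has_derivative_sum der) auto
  then obtain d1 where d1: "d1 > 0" "\<And>y. norm (y - x0) < d1 \<Longrightarrow>
      norm ((\<Sum>i\<in>X. f i y) - (\<Sum>i\<in>X. f i x0) - (\<Sum>i\<in>X. f' i x0 (y - x0))) \<le> e/2 * norm (y - x0)"
    using e unfolding has_derivative_at_alt by (meson half_gt_zero)
  obtain d2 where d2: "d2 > 0" "ball x0 d2 \<subseteq> S"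
    using S by (meson openE)
  show "\<exists>d>0. \<forall>y. norm (y - x0) < d \<longrightarrow> norm ((\<Sum>\<^sub>\<infinity>i\<in>I. f i y) - (\<Sum>\<^sub>\<infinity>i\<in>I. f i x0)
           - (\<Sum>\<^sub>\<infinity>i\<in>I. f' i x0 (y - x0))) \<le> e * norm (y - x0)"
  proof (intro exI[of _ "min d1 d2"] conjI allI impI)
    fix y assume y: "norm (y - x0) < min d1 d2"
    have yS: "y \<in> S" using y d2 by (auto simp: dist_norm norm_minus_commute subset_eq)
    define r where "r = (\<lambda>i. f i y + - f i x0 + - f' i x0 (y - x0))"
    have sr: "r summable_on J" if "J \<subseteq> I" for J
      unfolding r_def using that sm[OF yS] sm[OF S(3)] sf'
      by (intro summable_on_add) (auto simp: summable_on_uminus intro: summable_on_subset_banach)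
    have "(r has_sum (infsum (\<lambda>i. f i y) I + - infsum (\<lambda>i. f i x0) I
        + - (\<Sum>\<^sub>\<infinity>i\<in>I. f' i x0 (y - x0)))) I"
      unfolding r_def using sm[OF yS] sm[OF S(3)] sf'[OF subset_refl]
      by (intro has_sum_add) (simp_all add: has_sum_uminus has_sum_infsum)
    hence "(\<Sum>\<^sub>\<infinity>i\<in>I. f i y) - (\<Sum>\<^sub>\<infinity>i\<in>I. f i x0) - (\<Sum>\<^sub>\<infinity>i\<in>I. f' i x0 (y - x0)) = infsum r I"
      by (simp add: infsumI)
    also have "\<dots> = sum r X + infsum r (I - X)"
      using infsum_Diff[OF sr summable_on_finite[OF X(1)] X(2), of] X by simp
    finally have eq: "(\<Sum>\<^sub>\<infinity>i\<in>I. f i y) - (\<Sum>\<^sub>\<infinity>i\<in>I. f i x0) - (\<Sum>\<^sub>\<infinity>i\<in>I. f' i x0 (y - x0))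
        = sum r X + infsum r (I - X)" .
    have n1: "norm (sum r X) \<le> e/2 * norm (y - x0)"
      using d1(2)[of y] y by (simp add: r_def sum_subtractf sum.distrib sum_negf)
    have "norm (r i) \<le> b i * (2 * norm (y - x0))" if "i \<in> I" for i
    proof -
      have "norm (f i y - f i x0) \<le> b i * norm (y - x0)"
      proof (rule differentiable_bound[of S "f i" "f' i" "b i"])
        show "onorm (f' i x) \<le> b i" if "x \<in> S" for x
          by (intro onorm_bound b0 bd \<open>i \<in> I\<close> that)
      qed (use S that yS has_derivative_at_withinI[OF der[OF that]] in auto)
      moreover have "norm (f' i x0 (y - x0)) \<le> b i * norm (y - x0)" using bd that S by auto
      ultimately show ?thesis unfolding r_def
        using norm_triangle_ineq4[of "f i y - f i x0" "f' i x0 (y - x0)"] by simp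
    qed
    note r_le = this
    have "norm (infsum r (I - X)) \<le> (\<Sum>\<^sub>\<infinity>i\<in>I - X. b i * (2 * norm (y - x0)))"
      by (rule norm_infsum_le[OF has_sum_infsum[OF sr] has_sum_infsum[OF bh]]) (use r_le in auto)
    also have "\<dots> = infsum b (I - X) * (2 * norm (y - x0))"
      by (rule infsum_cmult_left')
    also have "\<dots> \<le> e/4 * (2 * norm (y - x0))"
      using tail by (intro mult_right_mono) auto
    finally have "norm (infsum r (I - X)) \<le> e/2 * norm (y - x0)" by simp
    with n1 show "norm ((\<Sum>\<^sub>\<infinity>i\<in>I. f i y) - (\<Sum>\<^sub>\<infinity>i\<in>I. f i x0)
           - (\<Sum>\<^sub>\<infinity>i\<in>I. f' i x0 (y - x0))) \<le> e * norm (y - x0)"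
      unfolding eq using norm_triangle_ineq[of "sum r X" "infsum r (I - X)"] by linarith
  qed (use d1 d2 in auto)
qed

lemma has_vector_derivative_along_line:
  fixes f :: "complex \<Rightarrow> 'b::real_normed_vector"
  assumes "(f has_derivative D) (at (w + of_real t * v))"
  shows "((\<lambda>t. f (w + of_real t * v)) has_vector_derivative D v) (at t)"
proof -
  have "((\<lambda>t. w + of_real t * v) has_derivative (\<lambda>h. of_real h * v)) (at t)"
    by (auto intro!: derivative_eq_intros)
  from has_derivative_compose[OF this assms]
  have "((\<lambda>t. f (w + of_real t * v)) has_derivative (\<lambda>h. D (of_real h * v))) (at t)" .
  moreover have "D (of_real h * v) = h *\<^sub>R D v" for h
    using linear_cmul[OF has_derivative_linear[OF assms], of h v] by (simp add: scaleR_conv_of_real)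
  ultimately show ?thesis by (simp add: has_vector_derivative_def)
qed

text \<open>Schwarz's theorem by the second difference over a small square: the mean value theorem,
  applied twice in either order of the variables, writes it as h^2 times a mixed derivative at an
  interior point, and continuity at z0 compares the two. The Laplacian is built from iterated
  Wirtinger derivatives, which contain both mixed derivatives.\<close>

lemma mixed_derivatives_eq_real:
  fixes f :: "complex \<Rightarrow> real"
  assumes S: "open S" "z0 \<in> S"
    and f: "\<And>z. z \<in> S \<Longrightarrow> (f has_derivative f' z) (at z)"
    and g: "\<And>z v. z \<in> S \<Longrightarrow> ((\<lambda>z. f' z v) has_derivative g' v z) (at z)"
    and cont: "continuous_on S (\<lambda>z. g' 1 z \<i>)" "continuous_on S (\<lambda>z. g' \<i> z 1)"
  shows "g' 1 z0 \<i> = g' \<i> z0 1"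
proof (rule ccontr)
  assume ne: "g' 1 z0 \<i> \<noteq> g' \<i> z0 1"
  define e where "e = \<bar>g' 1 z0 \<i> - g' \<i> z0 1\<bar> / 2"
  have e: "e > 0" using ne by (simp add: e_def)
  have "isCont (\<lambda>z. g' 1 z \<i>) z0" "isCont (\<lambda>z. g' \<i> z 1) z0"
    using cont S by (auto simp: continuous_on_eq_continuous_at)
  then obtain d1 d2 where d: "d1 > 0" "\<And>z. dist z z0 < d1 \<Longrightarrow> dist (g' 1 z \<i>) (g' 1 z0 \<i>) < e"
      "d2 > 0" "\<And>z. dist z z0 < d2 \<Longrightarrow> dist (g' \<i> z 1) (g' \<i> z0 1) < e"
    using e unfolding continuous_at_eps_delta by metis
  obtain d3 where d3: "d3 > 0" "ball z0 d3 \<subseteq> S" using S by (meson openE)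
  define h where "h = min d1 (min d2 d3) / 3"
  have h: "h > 0" "3 * h \<le> d1" "3 * h \<le> d2" "3 * h \<le> d3" using d d3 by (auto simp: h_def)
  have nr: "dist (z0 + of_real s + of_real t * \<i>) z0 < 3 * h" if "0 \<le> s" "s \<le> h" "0 \<le> t" "t \<le> h" for s t
  proof -
    have "norm (of_real s + of_real t * \<i> :: complex) \<le> norm (of_real s :: complex) + norm (of_real t * \<i>)"
      by (rule norm_triangle_ineq)
    also have "\<dots> < 3 * h" using that h by (simp add: norm_mult)
    finally show ?thesis by (simp add: dist_norm)
  qed
  have inS: "z0 + of_real s + of_real t * \<i> \<in> S" if "0 \<le> s" "s \<le> h" "0 \<le> t" "t \<le> h" for s t
    using nr[OF that] h d3 by (auto simp: dist_commute subset_eq)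
  define \<Delta> where "\<Delta> = f (z0 + of_real h + of_real h * \<i>) - f (z0 + of_real h)
      - f (z0 + of_real h * \<i>) + f z0"
  have l1: "((\<lambda>s. \<phi> (z0 + of_real s + of_real t * \<i>)) has_real_derivative D 1) (at s)"
    if "(\<phi> has_derivative D) (at (z0 + of_real s + of_real t * \<i>))" for \<phi> D s t
    using has_vector_derivative_along_line[of \<phi> D "z0 + of_real t * \<i>" s 1] that
    by (simp add: has_real_derivative_iff_has_vector_derivative algebra_simps)
  have l2: "((\<lambda>t. \<phi> (z0 + of_real s + of_real t * \<i>)) has_real_derivative D \<i>) (at t)"
    if "(\<phi> has_derivative D) (at (z0 + of_real s + of_real t * \<i>))" for \<phi> D s t
    using has_vector_derivative_along_line[of \<phi> D "z0 + of_real s" t \<i>] that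
    by (simp add: has_real_derivative_iff_has_vector_derivative)
  have "\<exists>s1>0. s1 < h \<and> (f (z0 + of_real h + of_real h * \<i>) - f (z0 + of_real h + of_real 0 * \<i>))
      - (f (z0 + of_real 0 + of_real h * \<i>) - f (z0 + of_real 0 + of_real 0 * \<i>)) = (h - 0) *
      (f' (z0 + of_real s1 + of_real h * \<i>) 1 - f' (z0 + of_real s1 + of_real 0 * \<i>) 1)"
    by (rule MVT2[of 0 h "\<lambda>s. f (z0 + of_real s + of_real h * \<i>) - f (z0 + of_real s + of_real 0 * \<i>)"
       "\<lambda>s. f' (z0 + of_real s + of_real h * \<i>) 1 - f' (z0 + of_real s + of_real 0 * \<i>) 1"]; (intro DERIV_diff l1 f)?) (use h inS inS[where t = 0, simplified] inS[where s = 0, simplified] in auto)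
  then obtain s1 where s1: "0 < s1" "s1 < h"
    "(f (z0 + of_real h + of_real h * \<i>) - f (z0 + of_real h + of_real 0 * \<i>))
      - (f (z0 + of_real 0 + of_real h * \<i>) - f (z0 + of_real 0 + of_real 0 * \<i>)) = (h - 0) *
      (f' (z0 + of_real s1 + of_real h * \<i>) 1 - f' (z0 + of_real s1 + of_real 0 * \<i>) 1)"
    by blast
  have "\<exists>t1>0. t1 < h \<and> f' (z0 + of_real s1 + of_real h * \<i>) 1 - f' (z0 + of_real s1 + of_real 0 * \<i>) 1 = 
      (h - 0) * g' 1 (z0 + of_real s1 + of_real t1 * \<i>) \<i>"
    by (rule MVT2[of 0 h "\<lambda>t. f' (z0 + of_real s1 + of_real t * \<i>) 1"
       "\<lambda>t. g' 1 (z0 + of_real s1 + of_real t * \<i>) \<i>"]; (intro l2 g)?) (use h inS inS[where t = 0, simplified] inS[where s = 0, simplified] s1 in auto)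
  then obtain t1 where t1: "0 < t1" "t1 < h"
    "f' (z0 + of_real s1 + of_real h * \<i>) 1 - f' (z0 + of_real s1 + of_real 0 * \<i>) 1 = 
      (h - 0) * g' 1 (z0 + of_real s1 + of_real t1 * \<i>) \<i>"
    by blast
  have "\<exists>t2>0. t2 < h \<and> (f (z0 + of_real h + of_real h * \<i>) - f (z0 + of_real 0 + of_real h * \<i>))
      - (f (z0 + of_real h + of_real 0 * \<i>) - f (z0 + of_real 0 + of_real 0 * \<i>)) = (h - 0) *
      (f' (z0 + of_real h + of_real t2 * \<i>) \<i> - f' (z0 + of_real 0 + of_real t2 * \<i>) \<i>)"
    by (rule MVT2[of 0 h "\<lambda>t. f (z0 + of_real h + of_real t * \<i>) - f (z0 + of_real 0 + of_real t * \<i>)"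
       "\<lambda>t. f' (z0 + of_real h + of_real t * \<i>) \<i> - f' (z0 + of_real 0 + of_real t * \<i>) \<i>"]; (intro DERIV_diff l2 f)?) (use h inS inS[where t = 0, simplified] inS[where s = 0, simplified] in auto)
  then obtain t2 where t2: "0 < t2" "t2 < h"
    "(f (z0 + of_real h + of_real h * \<i>) - f (z0 + of_real 0 + of_real h * \<i>))
      - (f (z0 + of_real h + of_real 0 * \<i>) - f (z0 + of_real 0 + of_real 0 * \<i>)) = (h - 0) *
      (f' (z0 + of_real h + of_real t2 * \<i>) \<i> - f' (z0 + of_real 0 + of_real t2 * \<i>) \<i>)"
    by blast
  have "\<exists>s2>0. s2 < h \<and> f' (z0 + of_real h + of_real t2 * \<i>) \<i> - f' (z0 + of_real 0 + of_real t2 * \<i>) \<i> = 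
      (h - 0) * g' \<i> (z0 + of_real s2 + of_real t2 * \<i>) 1"
    by (rule MVT2[of 0 h "\<lambda>s. f' (z0 + of_real s + of_real t2 * \<i>) \<i>"
       "\<lambda>s. g' \<i> (z0 + of_real s + of_real t2 * \<i>) 1"]; (intro l1 g)?) (use h inS inS[where t = 0, simplified] inS[where s = 0, simplified] t2 in auto)
  then obtain s2 where s2: "0 < s2" "s2 < h"
    "f' (z0 + of_real h + of_real t2 * \<i>) \<i> - f' (z0 + of_real 0 + of_real t2 * \<i>) \<i> = 
      (h - 0) * g' \<i> (z0 + of_real s2 + of_real t2 * \<i>) 1"
    by blast
  have "(h - 0) * ((h - 0) * g' 1 (z0 + of_real s1 + of_real t1 * \<i>) \<i>)
      = (h - 0) * ((h - 0) * g' \<i> (z0 + of_real s2 + of_real t2 * \<i>) 1)"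
    using s1(3) t2(3) unfolding t1(3) s2(3) by linarith
  hence eq: "g' 1 (z0 + of_real s1 + of_real t1 * \<i>) \<i> = g' \<i> (z0 + of_real s2 + of_real t2 * \<i>) 1"
    using h by simp
  have "dist (g' 1 (z0 + of_real s1 + of_real t1 * \<i>) \<i>) (g' 1 z0 \<i>) < e"
    using d(2) nr[of s1 t1] s1 t1 h by (smt (verit))
  moreover have "dist (g' \<i> (z0 + of_real s2 + of_real t2 * \<i>) 1) (g' \<i> z0 1) < e"
    using d(4) nr[of s2 t2] s2 t2 h by (smt (verit))
  ultimately have "\<bar>g' 1 z0 \<i> - g' \<i> z0 1\<bar> < 2 * e"
    unfolding eq dist_real_def by linarith
  thus False by (simp add: e_def)
qed

lemma mixed_derivatives_eq:
  fixes f :: "complex \<Rightarrow> complex"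
  assumes S: "open S" "z0 \<in> S"
    and f: "\<And>z. z \<in> S \<Longrightarrow> (f has_derivative f' z) (at z)"
    and g: "\<And>z v. z \<in> S \<Longrightarrow> ((\<lambda>z. f' z v) has_derivative g' v z) (at z)"
    and cont: "continuous_on S (\<lambda>z. g' 1 z \<i>)" "continuous_on S (\<lambda>z. g' \<i> z 1)"
  shows "g' 1 z0 \<i> = g' \<i> z0 1"
proof (rule complex_eqI)
  show "Re (g' 1 z0 \<i>) = Re (g' \<i> z0 1)"
    by (rule mixed_derivatives_eq_real[OF S, of "\<lambda>z. Re (f z)" "\<lambda>z h. Re (f' z h)" "\<lambda>v z h. Re (g' v z h)"])
       (intro has_derivative_Re f g continuous_intros cont; assumption)+
  show "Im (g' 1 z0 \<i>) = Im (g' \<i> z0 1)"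
    by (rule mixed_derivatives_eq_real[OF S, of "\<lambda>z. Im (f z)" "\<lambda>z h. Im (f' z h)" "\<lambda>v z h. Im (g' v z h)"])
       (intro has_derivative_Im f g continuous_intros cont; assumption)+
qed

lemma local_max_second_derivative_nonpos:
  fixes f f' :: "real \<Rightarrow> real"
  assumes e: "e > 0"
    and f: "\<And>t. \<bar>t\<bar> < e \<Longrightarrow> (f has_real_derivative f' t) (at t)"
    and f': "(f' has_real_derivative f'') (at 0)"
    and max: "\<And>t. \<bar>t\<bar> < e \<Longrightarrow> f t \<le> f 0"
  shows "f' 0 = 0" "f'' \<le> 0"
proof -
  show 0: "f' 0 = 0"
    using DERIV_local_max[OF f[of 0] e] max e by auto
  show "f'' \<le> 0"
  proof (rule ccontr)
    assume "\<not> f'' \<le> 0"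
    hence "f'' > 0" by simp
    from DERIV_pos_inc_right[OF f' this] obtain d where d: "d > 0" "\<And>h. 0 < h \<Longrightarrow> h < d \<Longrightarrow> f' h > 0"
      using 0 by auto
    define h where "h = min d e / 2"
    have h: "0 < h" "h < d" "h < e" using d e by (auto simp: h_def)
    have "\<exists>t>0. t < h \<and> f h - f 0 = (h - 0) * f' t"
      by (rule MVT2; (intro f)?) (use h in auto)
    then obtain t where t: "0 < t" "t < h" "f h - f 0 = (h - 0) * f' t" by blast
    have "f' t > 0" using d t h by auto
    hence "f h > f 0" using t h by (metis diff_gt_0_iff_gt diff_zero mult_pos_pos)
    thus False using max[of h] h by auto
  qed
qed

section \<open>Decay of Fourier coefficients\<close>

lemma powr_exp_decay:
  fixes a q :: real assumes "q > 0"
  shows "((\<lambda>y. y powr a * exp (- q * y)) \<longlongrightarrow> 0) at_top"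
proof -
  have "((\<lambda>y. y powr (real (nat \<lceil>\<bar>a\<bar>\<rceil>)) * exp (- q * y)) \<longlongrightarrow> 0) at_top"
    using assms by real_asymp
  moreover have "a \<le> real (nat \<lceil>\<bar>a\<bar>\<rceil>)" by linarith
  hence "\<forall>\<^sub>F y in at_top. norm (y powr a * exp (- q * y)) \<le> y powr (real (nat \<lceil>\<bar>a\<bar>\<rceil>)) * exp (- q * y)"
    by (intro eventually_mono[OF eventually_ge_at_top[of 1]]) (auto intro!: powr_mono)
  ultimately show ?thesis by (rule Lim_null_comparison[rotated])
qed

text \<open>With the integrating factor e^(py) the equation becomes v' = C y^r e^(2py) for v =
  e^(py) u. If p > 0 and C is nonzero, u grows at least like e^(py), against \<open>growth\<close>;
  so C = 0 and u is a multiple of e^(-py). If p < 0, growth forces v to tend to 0; then v is 0 or a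
  multiple of an incomplete gamma function, the tail integral of its derivative. One inequality
  covers all cases, the factor (y/y0)^r paying for the last one.\<close>

lemma ode_decay:
  fixes u :: "real \<Rightarrow> complex" and C :: complex and p r a B Y :: real
  assumes p: "p \<noteq> 0" and r: "r \<ge> 0"
    and der: "\<And>y. y > 0 \<Longrightarrow>
      (u has_vector_derivative (C * of_real (y powr r * exp (p * y)) - of_real p * u y)) (at y)"
    and growth: "\<And>y. y \<ge> Y \<Longrightarrow> norm (u y) \<le> B * y powr a"
    and y: "y0 > 0" "y \<ge> y0"
  shows "norm (u y) \<le> norm (u y0) * (y / y0) powr r * exp (- \<bar>p\<bar> * (y - y0))"
proof -
  define v where "v = (\<lambda>y. of_real (exp (p * y)) * u y)"
  have nv: "norm (v y) = exp (p * y) * norm (u y)" for y by (simp add: v_def norm_mult)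
  have dv: "(v has_vector_derivative C * of_real (y powr r * exp (2 * p * y))) (at y)" if "y > 0" for y
  proof -
    have e: "((\<lambda>y. of_real (exp (p * y)) :: complex) has_vector_derivative of_real (p * exp (p * y))) (at y)"
      by (auto intro!: derivative_eq_intros has_vector_derivative_of_real)
    have "exp (2 * p * y) = exp (p * y) * exp (p * y)" by (simp add: exp_add[symmetric])
    thus ?thesis unfolding v_def
      by (intro has_vector_derivative_eq_rhs[OF has_vector_derivative_mult[OF e der[OF that]]])
         (simp add: algebra_simps)
  qed
  have ratio: "(y / y0) powr r \<ge> 1" using y r by (simp add: ge_one_powr_ge_zero)
  have vlim: "(v \<longlongrightarrow> 0) at_top" if "p < 0"
  proof (rule Lim_null_comparison)
    show "((\<lambda>y. B * (y powr a * exp (- (-p) * y))) \<longlongrightarrow> 0) at_top"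
      using that by (intro tendsto_mult_right_zero powr_exp_decay) auto
    show "\<forall>\<^sub>F y in at_top. norm (v y) \<le> B * (y powr a * exp (- (-p) * y))"
      using growth by (intro eventually_mono[OF eventually_ge_at_top[of Y]]) (auto simp: nv mult_ac)
  qed
  show ?thesis
  proof (cases "C = 0")
    case True
    have "\<exists>c. \<forall>x\<in>{0<..}. v x = c"
      by (rule has_vector_derivative_zero_constant[of "{0<..}" v])
         (use dv True in \<open>auto intro: has_vector_derivative_at_within\<close>)
    then obtain c where c: "\<And>x. x > 0 \<Longrightarrow> v x = c" by auto
    show ?thesis
    proof (cases "p > 0")
      case True
      have "norm (v y) = norm (v y0)" using c y by simp
      hence "norm (u y) = norm (u y0) * 1 * exp (- \<bar>p\<bar> * (y - y0))"
        using True by (simp add: nv exp_diff exp_minus field_simps right_diff_distrib)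
      also have "\<dots> \<le> norm (u y0) * (y / y0) powr r * exp (- \<bar>p\<bar> * (y - y0))"
        by (intro mult_right_mono mult_left_mono ratio) auto
      finally show ?thesis .
    next
      case False
      have "(v \<longlongrightarrow> c) at_top"
        by (rule tendsto_eventually) (use c in \<open>auto intro: eventually_mono[OF eventually_gt_at_top[of 0]]\<close>)
      hence "c = 0" using vlim False p by (intro tendsto_unique[of at_top v]) auto
      hence "v y = 0" using c y by auto
      thus ?thesis by (simp add: v_def)
    qed
  next
    case C: False
    define w where "w = (\<lambda>y. v y / C)"
    have dw: "(w has_vector_derivative of_real (y powr r * exp (2 * p * y))) (at y)" if "y > 0" for y
      unfolding w_def using has_vector_derivative_divide[OF dv[OF that], of C] C by simp
    have dRe: "((\<lambda>y. Re (w y)) has_real_derivative y powr r * exp (2 * p * y)) (at y)" if "y > 0" for y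
      using bounded_linear.has_vector_derivative[OF bounded_linear_Re dw[OF that]]
      by (simp add: has_real_derivative_iff_has_vector_derivative)
    have dIm: "((\<lambda>y. Im (w y)) has_vector_derivative 0) (at y)" if "y > 0" for y
      using bounded_linear.has_vector_derivative[OF bounded_linear_Im dw[OF that]] by simp
    show ?thesis
    proof (cases "p > 0")
      case True
      \<comment> \<open>For y \<ge> 1 the derivative of Re w is at least e^(2py); \<open>K\<close>
        is the constant that arises from integrating this from 1.\<close>
      define K where "K = exp (2 * p) / (2 * p) - Re (w 1)"
      have low: "exp (2 * p * y) / (2 * p) - K \<le> Re (w y)" if "y \<ge> 1" for y
      proof -
        have "Re (w 1) - exp (2 * p * 1) / (2 * p) \<le> Re (w y) - exp (2 * p * y) / (2 * p)"
        proof (rule DERIV_nonneg_imp_nondecreasing[OF that])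
          fix x :: real assume x: "1 \<le> x" "x \<le> y"
          have "((\<lambda>y. Re (w y) - exp (2 * p * y) / (2 * p)) has_real_derivative
             x powr r * exp (2 * p * x) - exp (2 * p * x)) (at x)"
            using x True
            by (intro DERIV_diff dRe DERIV_cdivide[THEN DERIV_cong]) (auto intro!: derivative_eq_intros)
          moreover have "1 * exp (2 * p * x) \<le> x powr r * exp (2 * p * x)"
            using x r by (intro mult_right_mono) (auto simp: ge_one_powr_ge_zero)
          ultimately show "\<exists>D. ((\<lambda>y. Re (w y) - exp (2 * p * y) / (2 * p)) has_real_derivative D) (at x) \<and> 0 \<le> D"
            by (intro exI conjI) auto
        qed
        thus ?thesis by (simp add: K_def)
      qed
      have bnd: "1 / (2 * p) - K * exp (- (2 * p) * y) \<le> (B / norm C) * (y powr a * exp (- p * y))"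
        if "y \<ge> max 1 Y" for y
      proof -
        have "exp (2 * p * y) / (2 * p) - K \<le> norm (w y)"
          using low[of y] that complex_Re_le_cmod[of "w y"] by linarith
        also have "\<dots> = exp (p * y) * norm (u y) / norm C" by (simp add: w_def norm_divide nv)
        also have "\<dots> \<le> exp (p * y) * (B * y powr a) / norm C"
          using that growth by (intro divide_right_mono mult_left_mono) auto
        finally have "(exp (2 * p * y) / (2 * p) - K) * exp (- (2 * p) * y) \<le>
             exp (p * y) * (B * y powr a) / norm C * exp (- (2 * p) * y)"
          by (intro mult_right_mono) auto
        moreover have "exp (2 * p * y) * exp (- (2 * p) * y) = 1" "exp (p * y) * exp (- (2 * p) * y) = exp (- p * y)"
          by (simp_all add: exp_add[symmetric])
        ultimately show ?thesis by (simp add: field_simps)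
      qed
      have "((\<lambda>y. 1 / (2 * p) - K * exp (- (2 * p) * y)) \<longlongrightarrow> 1 / (2 * p)) at_top"
        using True by real_asymp
      moreover have "((\<lambda>y. (B / norm C) * (y powr a * exp (- p * y))) \<longlongrightarrow> 0) at_top"
        using True by (intro tendsto_mult_right_zero powr_exp_decay)
      moreover have "\<forall>\<^sub>F y in at_top. 1 / (2 * p) - K * exp (- (2 * p) * y) \<le> (B / norm C) * (y powr a * exp (- p * y))"
        using bnd by (intro eventually_mono[OF eventually_ge_at_top[of "max 1 Y"]]) auto
      ultimately have "1 / (2 * p) \<le> 0" by (intro tendsto_le[OF trivial_limit_at_top_linorder])
      thus ?thesis using True by simp
    next
      case False
      hence p0: "p < 0" using p by simp
      have wlim: "(w \<longlongrightarrow> 0) at_top"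
        unfolding w_def using tendsto_divide[OF vlim[OF p0] tendsto_const[of C]] C by simp
      have "\<exists>c. \<forall>x\<in>{0<..}. Im (w x) = c"
        by (rule has_vector_derivative_zero_constant[of "{0<..}" "\<lambda>x. Im (w x)"])
           (use dIm in \<open>auto intro: has_vector_derivative_at_within\<close>)
      then obtain c where c: "\<And>x. x > 0 \<Longrightarrow> Im (w x) = c" by auto
      have "((\<lambda>x. Im (w x)) \<longlongrightarrow> c) at_top"
        by (rule tendsto_eventually) (use c in \<open>auto intro: eventually_mono[OF eventually_gt_at_top[of 0]]\<close>)
      hence "c = 0" using tendsto_Im[OF wlim] by (metis tendsto_unique trivial_limit_at_top_linorder zero_complex.sel(2))
      hence im: "\<And>x. x > 0 \<Longrightarrow> Im (w x) = 0" using c by auto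
      \<comment> \<open>\<open>R\<close> is the tail integral of s^r e^(2ps) from y to infinity,
        known here through its derivative and its limit 0.\<close>
      define R where "R = (\<lambda>y. - Re (w y))"
      have Rlim: "(R \<longlongrightarrow> 0) at_top"
        unfolding R_def using tendsto_minus[OF tendsto_Re[OF wlim]] by simp
      have nonneg: "h x \<ge> 0" if "\<And>s. s \<ge> x \<Longrightarrow> (h has_real_derivative h' s) (at s)"
        "\<And>s. s \<ge> x \<Longrightarrow> h' s \<le> 0" "(h \<longlongrightarrow> 0) at_top" for h h' :: "real \<Rightarrow> real" and x
      proof (rule tendsto_upperbound[OF that(3)])
        show "\<forall>\<^sub>F s in at_top. h s \<le> h x"
          using that(1,2)
          by (intro eventually_mono[OF eventually_ge_at_top[of x]]) (rule DERIV_nonpos_imp_nonincreasing, auto)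
      qed auto
      have dR: "(R has_real_derivative - (s powr r * exp (2 * p * s))) (at s)" if "s > 0" for s
        unfolding R_def using DERIV_minus[OF dRe[OF that]] .
      have R0: "R s \<ge> 0" if "s > 0" for s
        by (rule nonneg[OF dR]) (use that Rlim in auto)
      define d where "d = y - y0"
      have d: "d \<ge> 0" using y by (simp add: d_def)
      \<comment> \<open>Shifting the variable of this integral by d replaces s by s + d \<le> (y/y0)
        s for s \<ge> y0, so the integrand grows by a factor of at most \<open>A\<close>.
        Monotonicity of A R(s) - R(s + d), which tends to 0, expresses this without the
        integral.\<close>
      define A where "A = (y / y0) powr r * exp (2 * p * d)"
      have "0 \<le> A * R y0 - R (y0 + d)"
      proof (rule nonneg[of y0 "\<lambda>s. A * R s - R (s + d)" "\<lambda>s. A * - (s powr r * exp (2 * p * s)) - - ((s + d) powr r * exp (2 * p * (s + d)))"])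
        fix s assume s: "s \<ge> y0"
        show "((\<lambda>s. A * R s - R (s + d)) has_real_derivative
           A * - (s powr r * exp (2 * p * s)) - - ((s + d) powr r * exp (2 * p * (s + d)))) (at s)"
          using s y d by (intro DERIV_diff DERIV_cmult dR)
             (auto simp: DERIV_shift[symmetric] add.commute intro!: dR)
        have "(s + d) powr r \<le> (y / y0) powr r * s powr r"
        proof -
          have "y0 * d \<le> s * d" using s d by (intro mult_right_mono) auto
          hence "s + d \<le> y / y0 * s" using y s d by (simp add: d_def field_simps)
          hence "(s + d) powr r \<le> (y / y0 * s) powr r" using s d y r by (intro powr_mono2) auto
          also have "(y / y0 * s) powr r = (y / y0) powr r * s powr r"
            by (subst powr_mult) (use s y in auto)
          finally show ?thesis .
        qed
        hence "(s + d) powr r * exp (2 * p * (s + d)) \<le> (y / y0) powr r * s powr r * exp (2 * p * (s + d))"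
          by (intro mult_right_mono) auto
        thus "A * - (s powr r * exp (2 * p * s)) - - ((s + d) powr r * exp (2 * p * (s + d))) \<le> 0"
          by (simp add: A_def exp_add distrib_left mult_ac)
      next
        have "filterlim (\<lambda>s. s + d) at_top at_top" by real_asymp
        from filterlim_compose[OF Rlim this]
        show "((\<lambda>s. A * R s - R (s + d)) \<longlongrightarrow> 0) at_top"
          using tendsto_diff[OF tendsto_mult[OF tendsto_const[of A] Rlim]] by fastforce
      qed
      hence le: "R y \<le> A * R y0" by (simp add: d_def)
      have nw: "norm (v x) = norm C * R x" if "x > 0" for x
      proof -
        have "v x = C * w x" using C by (simp add: w_def)
        moreover have "norm (w x) = R x"
          using R0[OF that] im[OF that] by (simp add: cmod_def R_def)
        ultimately show ?thesis by (simp add: norm_mult)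
      qed
      have "norm (v y) \<le> A * norm (v y0)"
        using nw[of y] nw[of y0] y mult_left_mono[OF le, of "norm C"] by (simp add: mult_ac)
      hence "exp (- p * y) * norm (v y) \<le> exp (- p * y) * (A * norm (v y0))"
        by (intro mult_left_mono) auto
      moreover have "exp (- p * y) * norm (v y) = norm (u y)" by (simp add: nv exp_minus)
      moreover have "exp (- p * y) * (exp (2 * p * d) * exp (p * y0)) = exp (- \<bar>p\<bar> * (y - y0))"
        using p0 unfolding exp_add[symmetric] by (simp add: d_def algebra_simps)
      moreover have "exp (- p * y) * (A * norm (v y0)) = norm (u y0) * (y / y0) powr r *
          (exp (- p * y) * (exp (2 * p * d) * exp (p * y0)))"
        by (simp add: A_def nv mult_ac)
      ultimately show ?thesis by metis
    qed
  qed
qed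

abbreviation fourier_coeff :: "(real \<Rightarrow> complex) \<Rightarrow> int \<Rightarrow> complex" where
  "fourier_coeff f n \<equiv> integral {0..1} (\<lambda>x. f x * cis (- (2 * pi * of_int n * x)))"

text \<open>The powers of a trigonometric polynomial q that exceeds 1 only near x0 concentrate mass
  at x0. All integrals of f q^n vanish, because q^n has finitely many frequencies, while the part
  near x0 would grow geometrically if f(x0) were nonzero and the rest stays bounded.\<close>

lemma fourier_coeff_zero_imp_zero:
  fixes f :: "real \<Rightarrow> complex"
  assumes cont: "continuous_on UNIV f" and per: "\<And>x. f (x + 1) = f x"
    and zero: "\<And>n. fourier_coeff f n = 0"
  shows "f x = 0"
proof (rule ccontr)
  assume "f x \<noteq> 0"
  have pern: "f (x + of_int n) = f x" for x n
  proof (induction n rule: int_induct[where k = 0])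
    case (step1 i) thus ?case using per[of "x + of_int i"] by (simp add: algebra_simps)
  next
    case (step2 i) thus ?case using per[of "x + of_int (i - 1)"] by (simp add: algebra_simps)
  qed simp
  define x0 where "x0 = frac x"
  have x0: "0 \<le> x0" "x0 < 1" "f x0 \<noteq> 0"
    using pern[of x0 "\<lfloor>x\<rfloor>"] \<open>f x \<noteq> 0\<close> frac_lt_1[of x] frac_ge_0[of x]
    by (auto simp: x0_def frac_def)
  \<comment> \<open>Multiplying by the conjugate of f(x0) makes the real part positive at x0, so
    that the argument runs with the real function g.\<close>
  define c where "c = cnj (f x0)"
  define g where "g = (\<lambda>x. Re (c * f x))"
  have g_cont: "continuous_on A g" for A
    unfolding g_def by (intro continuous_intros continuous_on_subset[OF cont]) auto
  have g0: "g x0 > 0" using x0 by (simp add: g_def c_def complex_neq_0 power2_eq_square)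
  define r0 where "r0 = g x0 / 2"
  have r0: "r0 > 0" using g0 by (simp add: r0_def)
  have "isCont g x0" using g_cont[of UNIV] by (simp add: continuous_on_eq_continuous_at)
  then obtain d where d: "d > 0" "\<And>y. dist y x0 < d \<Longrightarrow> dist (g y) (g x0) < r0"
    using r0 unfolding continuous_at_eps_delta by meson
  define \<delta> where "\<delta> = min (d / 2) (1 / 4)"
  have \<delta>: "0 < \<delta>" "\<delta> < d" "\<delta> \<le> 1/4" using d by (auto simp: \<delta>_def)
  have gr0: "g y \<ge> r0" if "\<bar>y - x0\<bar> \<le> \<delta>" for y
    using d(2)[of y] that \<delta> by (auto simp: dist_real_def r0_def abs_if split: if_splits)
  \<comment> \<open>q > 1 holds only within \<delta> of x0 modulo 1; everywhere q \<ge> -1, so that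
    off this neighbourhood |q| \<le> 1.\<close>
  define q where "q = (\<lambda>y. 1 + cos (2 * pi * (y - x0)) - cos (2 * pi * \<delta>))"
  have q_cont: "continuous_on A q" for A unfolding q_def by (intro continuous_intros)
  have near: "g y \<ge> r0" if "q y > 1" for y
  proof -
    define t where "t = y - x0 - of_int (round (y - x0))"
    have t: "\<bar>t\<bar> \<le> 1/2" unfolding t_def using of_int_round_abs_le[of "y - x0"] by (simp add: abs_minus_commute)
    have "cos (2 * pi * (y - x0)) = cos (2 * pi * t + 2 * pi * of_int (round (y - x0)))"
      by (simp add: t_def algebra_simps)
    also have "\<dots> = cos (2 * pi * t)" 
      by (simp add: cos_add cos_int_2pin sin_int_2pin)
    also have "\<dots> = cos (2 * pi * \<bar>t\<bar>)" by (cases "t \<ge> 0") auto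
    finally have "cos (2 * pi * \<bar>t\<bar>) > cos (2 * pi * \<delta>)" using that by (simp add: q_def)
    hence "2 * pi * \<bar>t\<bar> < 2 * pi * \<delta>"
      using t \<delta> by (subst (asm) cos_mono_less_eq) auto
    hence "\<bar>(x0 + t) - x0\<bar> \<le> \<delta>" by simp
    from gr0[OF this] show ?thesis
      using pern[of "x0 + t" "round (y - x0)"] by (simp add: g_def t_def)
  qed
  have q_low: "q y \<ge> - 1" for y
    using cos_ge_minus_one[of "2 * pi * (y - x0)"] cos_le_one[of "2 * pi * \<delta>"]
    unfolding q_def by linarith
  have "bounded (g ` {0..1})" by (intro compact_imp_bounded compact_continuous_image g_cont) auto
  then obtain M where M: "M > 0" "\<And>y. y \<in> {0..1} \<Longrightarrow> \<bar>g y\<bar> \<le> M"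
    unfolding bounded_pos by auto
  define m where "m = 1 + cos (pi * \<delta>) - cos (2 * pi * \<delta>)"
  have m: "m > 1" unfolding m_def using \<delta> by (simp add: cos_mono_less_eq)
  \<comment> \<open>A piece to the right of x0 on which q \<ge> m > 1; the cut at 1 - x0, which is
    positive as x0 < 1, keeps it inside the interval of integration.\<close>
  define l where "l = min (\<delta> / 2) (1 - x0)"
  have l: "l > 0" "l \<le> \<delta> / 2" "x0 + l \<le> 1"
    using \<delta> x0 unfolding l_def by (simp, intro min.cobounded1) (simp add: min_def)
  have qm: "q y \<ge> m" if "y \<in> {x0..x0 + l}" for y
  proof -
    have "cos (pi * \<delta>) \<le> cos (2 * pi * (y - x0))"
      using that l \<delta> by (subst cos_mono_le_eq) auto
    thus ?thesis by (simp add: q_def m_def)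
  qed
  have low: "- M + (if y \<in> {x0..x0 + l} then r0 * m ^ n else 0) \<le> g y * q y ^ n" if "y \<in> {0..1}" for y n
  proof (cases "q y > 1")
    case True
    have g: "g y \<ge> r0" by (rule near[OF True])
    show ?thesis
    proof (cases "y \<in> {x0..x0 + l}")
      case True
      hence "r0 * m ^ n \<le> g y * q y ^ n"
        using g r0 qm[of y] m by (intro mult_mono power_mono) auto
      thus ?thesis using True M by auto
    next
      case False
      have "g y * q y ^ n \<ge> 0" using g r0 \<open>q y > 1\<close> by auto
      thus ?thesis using M False by (auto split: if_splits)
    qed
  next
    case False
    hence "y \<notin> {x0..x0 + l}" using qm[of y] m by auto
    moreover have "\<bar>g y * q y ^ n\<bar> \<le> M * 1"
      unfolding abs_mult power_abs using M(2)[OF that] q_low[of y] False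
      by (intro mult_mono power_le_one) auto
    ultimately show ?thesis by (auto simp: abs_le_iff)
  qed
  define Q where "Q = (\<lambda>y. of_real (q y) :: complex)"
  have Q_cont: "continuous_on A Q" for A unfolding Q_def by (intro continuous_intros q_cont)
  have Q_eq: "Q y = of_real (1 - cos (2 * pi * \<delta>)) + (cis (- 2 * pi * x0) / 2) * cis (2 * pi * y)
       + (cis (2 * pi * x0) / 2) * cis (- (2 * pi * y))" for y
    unfolding Q_def q_def
    by (simp add: complex_eq_iff cos_diff right_diff_distrib algebra_simps diff_divide_distrib)
  \<comment> \<open>q has only the frequencies -1, 0 and 1, so a factor q combines three
    neighbouring coefficients; this is why the induction needs all j at once.\<close>
  have int0: "integral {0..1} (\<lambda>y. f y * Q y ^ n * cis (- (2 * pi * of_int j * y))) = 0" for n j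
  proof (induction n arbitrary: j)
    case 0 show ?case using zero[of j] by simp
  next
    case (Suc n)
    have i: "(\<lambda>y. a * (f y * Q y ^ n * cis (- (2 * pi * of_int j * y)))) integrable_on {0..1}" for a j
      by (intro integrable_continuous_interval continuous_intros Q_cont continuous_on_subset[OF cont] continuous_on_cis) auto
    have hi: "((\<lambda>y. a * (f y * Q y ^ n * cis (- (2 * pi * of_int j * y)))) has_integral 0) {0..1}" for a j
      using has_integral_mult_right[OF integrable_integral[OF i[of 1 j]], of a] Suc[of j] by simp
    have eq: "(\<lambda>y. f y * Q y ^ Suc n * cis (- (2 * pi * of_int j * y))) =
      (\<lambda>y. of_real (1 - cos (2 * pi * \<delta>)) * (f y * Q y ^ n * cis (- (2 * pi * of_int j * y)))
        + (cis (- 2 * pi * x0) / 2) * (f y * Q y ^ n * cis (- (2 * pi * of_int (j - 1) * y)))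
        + (cis (2 * pi * x0) / 2) * (f y * Q y ^ n * cis (- (2 * pi * of_int (j + 1) * y))))"
    proof
      fix y
      have 1: "cis (- (2 * pi * of_int (j - 1) * y)) = cis (2 * pi * y) * cis (- (2 * pi * of_int j * y))"
        and 2: "cis (- (2 * pi * of_int (j + 1) * y)) = cis (- (2 * pi * y)) * cis (- (2 * pi * of_int j * y))"
        by (simp_all add: cis_mult algebra_simps)
      show "f y * Q y ^ Suc n * cis (- (2 * pi * of_int j * y)) =
        of_real (1 - cos (2 * pi * \<delta>)) * (f y * Q y ^ n * cis (- (2 * pi * of_int j * y)))
        + (cis (- 2 * pi * x0) / 2) * (f y * Q y ^ n * cis (- (2 * pi * of_int (j - 1) * y)))
        + (cis (2 * pi * x0) / 2) * (f y * Q y ^ n * cis (- (2 * pi * of_int (j + 1) * y)))"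
        unfolding 1 2 power_Suc Q_eq[of y] by (simp only: algebra_simps)
    qed
    show ?case
      unfolding eq
      by (rule integral_unique, rule has_integral_add[OF has_integral_add[OF hi hi] hi, unfolded add_0])
  qed
  have "integral {0..1} (\<lambda>y. g y * q y ^ n) = 0" for n
  proof -
    have "(\<lambda>y. f y * Q y ^ n * cis (- (2 * pi * of_int 0 * y))) integrable_on {0..1}"
      by (intro integrable_continuous_interval continuous_intros Q_cont continuous_on_subset[OF cont] continuous_on_cis) auto
    from integrable_integral[OF this]
    have "((\<lambda>y. f y * Q y ^ n) has_integral 0) {0..1}" using int0[of n 0] by simp
    from has_integral_linear[OF has_integral_mult_right[OF this, of c] bounded_linear_Re]
    have "((\<lambda>y. Re (c * (f y * Q y ^ n))) has_integral 0) {0..1}" by (simp add: o_def)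
    moreover have "Re (c * (f y * Q y ^ n)) = g y * q y ^ n" for y
      by (simp add: g_def Q_def flip: of_real_power mult.assoc)
    ultimately show ?thesis by (simp add: integral_unique)
  qed
  hence up: "- M + l * (r0 * m ^ n) \<le> 0" for n
  proof -
    have "((\<lambda>y. if y \<in> {x0..x0 + l} then r0 * m ^ n else 0) has_integral l * (r0 * m ^ n)) {0..1}"
      using has_integral_restrict[of "{x0..x0 + l}" "{0..1}" "\<lambda>_. r0 * m ^ n" "l * (r0 * m ^ n)"]
        has_integral_const_real[of "r0 * m ^ n" x0 "x0 + l"] x0 l by auto
    from has_integral_add[OF has_integral_const_real[of "- M" 0 1] this]
    have h1: "((\<lambda>y. - M + (if y \<in> {x0..x0 + l} then r0 * m ^ n else 0)) has_integral - M + l * (r0 * m ^ n)) {0..1}"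
      by simp
    have "(\<lambda>y. g y * q y ^ n) integrable_on {0..1}"
      by (intro integrable_continuous_interval continuous_intros g_cont q_cont)
    hence "((\<lambda>y. g y * q y ^ n) has_integral 0) {0..1}"
      using \<open>integral {0..1} (\<lambda>y. g y * q y ^ n) = 0\<close> by (metis integrable_integral)
    from has_integral_le[OF h1 this low] show ?thesis by auto
  qed
  obtain n where "m ^ n > M / (l * r0)" using m by (metis real_arch_pow)
  hence "l * (r0 * m ^ n) > M" using l r0 by (simp add: field_simps)
  thus False using up[of n] by linarith
qed

text \<open>A summable bound on the coefficients makes the Fourier series converge uniformly; its
  sum is continuous, has the coefficients of f and equals f by
  \<open>fourier_coeff_zero_imp_zero\<close>. The bound is uniform in x, as the estimate at a cusp
  demands.\<close>

lemma norm_le_fourier_coeff_bound: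
  fixes f :: "real \<Rightarrow> complex"
  assumes cont: "continuous_on UNIV f" and per: "\<And>x. f (x + 1) = f x"
    and bd: "\<And>n. norm (fourier_coeff f n) \<le> b n" and b: "b summable_on UNIV"
  shows "norm (f x) \<le> infsum b UNIV"
proof -
  define t where "t = (\<lambda>n x. fourier_coeff f n * cis (2 * pi * of_int n * x))"
  define g where "g = (\<lambda>x. \<Sum>\<^sub>\<infinity>n. t n x)"
  have t_le: "norm (t n x) \<le> b n" for n x using bd by (simp add: t_def norm_mult)
  have t_cont: "continuous_on A (t n)" for A n
    unfolding t_def by (intro continuous_intros continuous_on_cis)
  have ul: "uniform_limit A (\<lambda>X x. \<Sum>n\<in>X. t n x) g (finite_subsets_at_top UNIV)" for A
    unfolding g_def by (rule Weierstrass_m_test_general[OF t_le b])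
  have g_cont: "continuous_on UNIV g"
    by (rule uniform_limit_theorem[OF _ ul]) (auto intro!: always_eventually continuous_on_sum t_cont)
  have g_per: "g (x + 1) = g x" for x
  proof -
    have "t n (x + 1) = t n x" for n
    proof -
      have "cis (2 * pi * of_int n * (x + 1)) = cis (2 * pi * of_int n * x) * cis (2 * pi * of_int n)"
        by (simp add: cis_mult algebra_simps)
      thus ?thesis by (simp add: t_def cis_multiple_2pi)
    qed
    thus ?thesis by (simp add: g_def)
  qed
  have orth: "((\<lambda>x. cis (2 * pi * of_int n * x)) has_integral (if n = 0 then 1 else 0)) {0..1}" for n :: int
  proof (cases "n = 0")
    case True
    thus ?thesis using has_integral_const_real[of "1::complex" 0 1] by simp
  next
    case False
    define c where "c = \<i> * of_real (2 * pi * of_int n)"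
    have c: "c \<noteq> 0" using False by (simp add: c_def)
    have "((\<lambda>x. exp (c * of_real x)) has_integral exp (c * of_real 1) / c - exp (c * of_real 0) / c) {0..1}"
      by (rule fundamental_theorem_of_calculus)
         (use c in \<open>auto intro!: derivative_eq_intros has_vector_derivative_real_field\<close>)
    moreover have "exp (c * of_real 1) = 1"
      using cis_multiple_2pi[of "of_int n"] by (simp add: c_def cis_conv_exp)
    moreover have "exp (c * of_real x) = cis (2 * pi * of_int n * x)" for x
      by (simp add: c_def cis_conv_exp mult_ac)
    ultimately show ?thesis using False by simp
  qed
  have g_coeff: "fourier_coeff g j = fourier_coeff f j" for j
  proof -
    let ?e = "\<lambda>x. cis (- (2 * pi * of_int j * x))"
    have "uniform_limit (cbox 0 1) (\<lambda>X x. (\<Sum>n\<in>X. t n x) * ?e x) (\<lambda>x. g x * ?e x) (finite_subsets_at_top UNIV)"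
    proof (rule uniform_lim_mult[OF ul uniform_limit_const])
      show "bounded (g ` cbox 0 1)"
        by (intro compact_imp_bounded compact_continuous_image continuous_on_subset[OF g_cont]) auto
      show "bounded (?e ` cbox 0 1)" by (auto simp: bounded_iff intro!: exI[of _ 1])
    qed
    then obtain I J where IJ: "\<And>X. ((\<lambda>x. (\<Sum>n\<in>X. t n x) * ?e x) has_integral I X) (cbox 0 1)"
        "((\<lambda>x. g x * ?e x) has_integral J) (cbox 0 1)" "(I \<longlongrightarrow> J) (finite_subsets_at_top UNIV)"
      by (rule uniform_limit_integral_cbox)
         (auto intro!: continuous_intros continuous_on_cis t_cont)
    have "I X = fourier_coeff f j" if "finite X" "{j} \<subseteq> X" for X
    proof -
      have eq: "t n x * ?e x = fourier_coeff f n * cis (2 * pi * of_int (n - j) * x)" for n x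
        by (simp add: t_def mult.assoc cis_mult algebra_simps)
      have "((\<lambda>x. t n x * ?e x) has_integral (if n = j then fourier_coeff f j else 0)) {0..1}" for n
        unfolding eq using has_integral_mult_right[OF orth[of "n - j"], of "fourier_coeff f n"] by auto
      from has_integral_sum[OF that(1) this]
      have "((\<lambda>x. (\<Sum>n\<in>X. t n x) * ?e x) has_integral (\<Sum>n\<in>X. if n = j then fourier_coeff f j else 0)) {0..1}"
        by (simp add: sum_distrib_right)
      from has_integral_unique[OF IJ(1)[of X, simplified] this] show ?thesis using that by simp
    qed
    hence "(I \<longlongrightarrow> fourier_coeff f j) (finite_subsets_at_top UNIV)"
      by (intro tendsto_eventually) (auto simp: eventually_finite_subsets_at_top intro!: exI[of _ "{j}"])
    hence "J = fourier_coeff f j" using IJ(3) by (metis tendsto_unique finite_subsets_at_top_neq_bot)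
    thus ?thesis using IJ(2) by (simp add: integral_unique)
  qed
  have "f x - g x = 0"
  proof (rule fourier_coeff_zero_imp_zero[of "\<lambda>x. f x - g x"])
    show "continuous_on UNIV (\<lambda>x. f x - g x)" by (intro continuous_intros cont g_cont)
    show "fourier_coeff (\<lambda>x. f x - g x) n = 0" for n
    proof -
      have i: "(\<lambda>x. h x * cis (- (2 * pi * of_int n * x))) integrable_on {0..1}" if "continuous_on UNIV h" for h
        by (intro integrable_continuous_interval continuous_intros continuous_on_cis continuous_on_subset[OF that]) auto
      show ?thesis unfolding left_diff_distrib
        by (subst integral_diff) (use i cont g_cont g_coeff in auto)
    qed
  qed (simp add: per g_per)
  moreover have "norm (g x) \<le> infsum b UNIV"
    unfolding g_def
    by (rule norm_infsum_le[OF has_sum_infsum[OF abs_summable_summable[OF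
          Infinite_Sum.abs_summable_on_comparison_test'[OF b t_le]]] has_sum_infsum[OF b] t_le])
  ultimately show ?thesis by simp
qed

section \<open>Smooth functions on the upper half plane and the maximum principle\<close>

lemma open_uhp: "open uhp" and convex_uhp: "convex uhp"
  unfolding uhp_def by (simp_all add: open_halfspace_Im_gt convex_halfspace_Im_gt)

text \<open>A class of functions closed under directional derivatives consists of smooth functions.
  Closure is asked only up to equality on S: derivatives at points of the open set S depend only on
  values there, and the explicit formulas for them hold only on the half plane.\<close>

lemma smooth_on_coinduct:
  assumes S: "open S" and "P f"
    and step: "\<And>f. P f \<Longrightarrow> \<exists>D. \<forall>z\<in>S. (f has_derivative D z) (at z) \<and>
                 (\<forall>v. \<exists>g. P g \<and> (\<forall>z\<in>S. D z v = g z))"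
  shows "smooth_on S f"
proof -
  have "times_cont_diff_on n S f" if "P g" "\<And>z. z \<in> S \<Longrightarrow> f z = g z" for n f g
    using that
  proof (induction n arbitrary: f g)
    case 0
    obtain D where "\<And>z. z \<in> S \<Longrightarrow> (g has_derivative D z) (at z)" using step[OF 0(1)] by blast
    hence "continuous_on S g"
      using has_derivative_continuous by (fastforce intro: continuous_at_imp_continuous_on)
    thus ?case using 0(2) by (simp cong: continuous_on_cong)
  next
    case (Suc n)
    show ?case
    \<comment> \<open>The function that represents a directional derivative on S is supplied only
      together with a point of S.\<close>
    proof (cases "S = {}")
      case True
      have "times_cont_diff_on m {} h" for m h by (induction m arbitrary: h) auto
      thus ?thesis using True by blast
    next
      case False
      obtain D where D: "\<And>z. z \<in> S \<Longrightarrow> (g has_derivative D z) (at z)"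
        "\<And>v. \<exists>h. P h \<and> (\<forall>z\<in>S. D z v = h z)"
        using step[OF Suc.prems(1)] False by blast
      have fD: "(f has_derivative D z) (at z)" if "z \<in> S" for z
        using has_derivative_transform_within_open[OF D(1)[OF that] S that] Suc.prems(2) by metis
      have "times_cont_diff_on n S (\<lambda>z. frechet_derivative f (at z) v)" for v
      proof -
        obtain h where h: "P h" "\<And>z. z \<in> S \<Longrightarrow> D z v = h z" using D(2) by blast
        show ?thesis
          by (rule Suc.IH[OF h(1)]) (metis fD frechet_derivative_at h(2))
      qed
      thus ?thesis using fD by (auto simp: differentiable_def)
    qed
  qed
  thus ?thesis using \<open>P f\<close> by (auto simp: smooth_on_def)
qed

lemma smooth_onD:
  assumes "smooth_on S f"
  shows "z \<in> S \<Longrightarrow> (f has_derivative frechet_derivative f (at z)) (at z)"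
    and "smooth_on S (\<lambda>z. frechet_derivative f (at z) v)"
    and "continuous_on S f"
proof -
  have "times_cont_diff_on (Suc n) S f" "times_cont_diff_on 0 S f" for n
    using assms unfolding smooth_on_def by blast+
  thus "z \<in> S \<Longrightarrow> (f has_derivative frechet_derivative f (at z)) (at z)"
    and "smooth_on S (\<lambda>z. frechet_derivative f (at z) v)" and "continuous_on S f"
    by (auto simp: smooth_on_def frechet_derivative_works)
qed

text \<open>Differentiation is linear, so closure has to be checked on generators only. This fits
  the Eisenstein series, whose derivatives are combinations of series of one type.\<close>

lemma smooth_on_span:
  assumes S: "open S" and f: "f \<in> cfun.span B"
    and B: "\<And>b. b \<in> B \<Longrightarrow> \<exists>D. \<forall>z\<in>S. (b has_derivative D z) (at z) \<and>
                 (\<forall>v. \<exists>g. g \<in> cfun.span B \<and> (\<forall>z\<in>S. D z v = g z))"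
  shows "smooth_on S f"
proof (rule smooth_on_coinduct[where P = "\<lambda>f. f \<in> cfun.span B", OF S f])
  fix f assume "f \<in> cfun.span B"
  thus "\<exists>D. \<forall>z\<in>S. (f has_derivative D z) (at z) \<and> (\<forall>v. \<exists>g. g \<in> cfun.span B \<and> (\<forall>z\<in>S. D z v = g z))"
  proof (induction rule: cfun.span_induct_alt)
    case base
    show ?case
      by (intro exI[of _ "\<lambda>_ _. 0"]) (auto simp: zero_fun_def cfun.span_zero[unfolded zero_fun_def] intro!: exI[of _ "\<lambda>_. 0"])
  next
    case (step c x y)
    obtain D1 where D1: "\<forall>z\<in>S. (x has_derivative D1 z) (at z) \<and> (\<forall>v. \<exists>g. g \<in> cfun.span B \<and> (\<forall>z\<in>S. D1 z v = g z))"
      using B[OF step(1)] by blast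
    obtain D2 where D2: "\<forall>z\<in>S. (y has_derivative D2 z) (at z) \<and> (\<forall>v. \<exists>g. g \<in> cfun.span B \<and> (\<forall>z\<in>S. D2 z v = g z))"
      using step(2) by blast
    show ?case
    proof (intro exI[of _ "\<lambda>z h. c * D1 z h + D2 z h"] ballI conjI allI)
      fix z assume z: "z \<in> S"
      show "(cfun_scale c x + y has_derivative (\<lambda>h. c * D1 z h + D2 z h)) (at z)"
        unfolding cfun_scale_def plus_fun_def using D1 D2 z
        by (intro has_derivative_add has_derivative_mult_right) auto
      fix v
      obtain g1 g2 where g: "g1 \<in> cfun.span B" "\<forall>z\<in>S. D1 z v = g1 z" "g2 \<in> cfun.span B" "\<forall>z\<in>S. D2 z v = g2 z"
        using D1 D2 z by metis
      show "\<exists>g. g \<in> cfun.span B \<and> (\<forall>z\<in>S. c * D1 z v + D2 z v = g z)"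
        using g cfun.span_add[OF cfun.span_scale[OF g(1), of c] g(3)] z
        by (intro exI[of _ "cfun_scale c g1 + g2"]) (simp add: cfun_scale_def)
    qed
  qed
qed

lemma smooth_on_lincomb:
  assumes S: "open S" and "smooth_on S f" "smooth_on S g"
  shows "smooth_on S (cfun_scale c f + g)"
proof (rule smooth_on_span[OF S, where B = "{f. smooth_on S f}"])
  show "cfun_scale c f + g \<in> cfun.span {f. smooth_on S f}"
    using assms by (intro cfun.span_add cfun.span_scale cfun.span_base) auto
  fix b assume "b \<in> {f. smooth_on S f}"
  thus "\<exists>D. \<forall>z\<in>S. (b has_derivative D z) (at z) \<and>
       (\<forall>v. \<exists>g. g \<in> cfun.span {f. smooth_on S f} \<and> (\<forall>z\<in>S. D z v = g z))"
    using smooth_onD by (intro exI[of _ "\<lambda>z. frechet_derivative b (at z)"]) (blast intro: cfun.span_base)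
qed

lemma Wirtinger_eqs:
  assumes "(f has_derivative (\<lambda>h. a * h + b * cnj h)) (at z)"
  shows "d_dz f z = a" "d_dzbar f z = b"
  unfolding d_dz_def d_dzbar_def frechet_derivative_at[OF assms, symmetric]
  by (simp_all add: field_simps)

lemma has_derivative_Wirtinger:
  assumes "f differentiable (at z)"
  shows "(f has_derivative (\<lambda>h. d_dz f z * h + d_dzbar f z * cnj h)) (at z)"
proof -
  let ?D = "frechet_derivative f (at z)"
  have D: "(f has_derivative ?D) (at z)" using assms by (simp add: frechet_derivative_works)
  have "?D = (\<lambda>h. d_dz f z * h + d_dzbar f z * cnj h)"
  proof
    fix h :: complex
    have "?D h = ?D (Re h *\<^sub>R 1 + Im h *\<^sub>R \<i>)" by (rule arg_cong) (simp add: complex_eq_iff)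
    also have "\<dots> = Re h *\<^sub>R ?D 1 + Im h *\<^sub>R ?D \<i>"
      using has_derivative_linear[OF D] by (simp only: linear_add linear_cmul)
    also have "\<dots> = d_dz f z * h + d_dzbar f z * cnj h"
      by (simp add: d_dz_def d_dzbar_def scaleR_conv_of_real complex_eq_iff field_simps)
    finally show "?D h = d_dz f z * h + d_dzbar f z * cnj h" .
  qed
  thus ?thesis using D by simp
qed

text \<open>Up to a factor 2i the conjugate of this is the operator \<xi> of weight \<kappa>, which
  maps harmonic forms to holomorphic forms of weight 2 - \<kappa>. Without the conjugation it is
  complex linear in f.\<close>

definition xi_bar :: "real \<Rightarrow> (complex \<Rightarrow> complex) \<Rightarrow> complex \<Rightarrow> complex" where
  "xi_bar \<kappa> f z = of_real (Im z powr \<kappa>) * d_dzbar f z"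

lemma has_derivative_Im_powr:
  assumes "Im z > 0"
  shows "((\<lambda>z. of_real (Im z powr r) :: complex) has_derivative (\<lambda>h. of_real (r * Im z powr (r - 1) * Im h))) (at z)"
proof -
  have "((\<lambda>y. y powr r) has_real_derivative r * Im z powr (r - 1)) (at (Im z))"
    using assms by (intro has_real_derivative_powr)
  hence "((\<lambda>y. y powr r) has_derivative (\<lambda>h. r * Im z powr (r - 1) * h)) (at (Im z))"
    by (simp add: has_field_derivative_def)
  from has_derivative_compose[OF has_derivative_Im[OF has_derivative_ident] this]
  show ?thesis by (intro has_derivative_of_real) simp
qed

text \<open>The Laplacian factors as -4 y^(2-\<kappa>) times the Wirtinger derivative d/dz of
  \<open>xi_bar\<close>, and a differentiable function is annihilated by d/dz iff its conjugate is
  holomorphic.\<close>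

lemma weight_laplacian_zero_iff:
  assumes f: "smooth_on uhp f"
  shows "(\<forall>z\<in>uhp. weight_laplacian \<kappa> f z = 0) \<longleftrightarrow> (\<lambda>z. cnj (xi_bar \<kappa> f z)) holomorphic_on uhp"
proof -
  have dbar: "smooth_on uhp (d_dzbar f)"
  proof -
    have eq: "d_dzbar f = cfun_scale (1/2) (\<lambda>z. frechet_derivative f (at z) 1) +
        (cfun_scale (\<i>/2) (\<lambda>z. frechet_derivative f (at z) \<i>) + cfun_scale 0 f)"
      by (auto simp: fun_eq_iff d_dzbar_def cfun_scale_def field_simps)
    show ?thesis
    proof (subst eq, intro smooth_on_lincomb open_uhp smooth_onD[OF f])
      have "cfun_scale 0 f + cfun_scale 0 f = cfun_scale 0 f" by (auto simp: cfun_scale_def)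
      moreover have "smooth_on uhp (cfun_scale (-1) f + f)" by (intro smooth_on_lincomb open_uhp f)
      moreover have "cfun_scale (-1) f + f = cfun_scale 0 f" by (auto simp: cfun_scale_def fun_eq_iff)
      ultimately show "smooth_on uhp (cfun_scale 0 f)" by simp
    qed
  qed
  have X: "(xi_bar \<kappa> f has_derivative (\<lambda>h. d_dz (xi_bar \<kappa> f) z * h + d_dzbar (xi_bar \<kappa> f) z * cnj h)) (at z)
      \<and> weight_laplacian \<kappa> f z = - 4 * of_real (Im z powr (2 - \<kappa>)) * d_dz (xi_bar \<kappa> f) z" if z: "z \<in> uhp" for z
  proof
    have y: "Im z > 0" using z by (simp add: uhp_def)
    have W: "(d_dzbar f has_derivative (\<lambda>h. d_dz (d_dzbar f) z * h + d_dzbar (d_dzbar f) z * cnj h)) (at z)"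
      using smooth_onD(1)[OF dbar z] by (intro has_derivative_Wirtinger) (auto simp: differentiable_def)
    have eq: "of_real (Im h) = (- \<i> / 2) * (h - cnj h)" for h :: complex
      by (simp add: complex_eq_iff)
    have *: "(xi_bar \<kappa> f has_derivative (\<lambda>h. 
        (of_real (Im z powr \<kappa>) * d_dz (d_dzbar f) z + of_real (\<kappa> * Im z powr (\<kappa> - 1)) * d_dzbar f z * (- \<i> / 2)) * h
        + (of_real (Im z powr \<kappa>) * d_dzbar (d_dzbar f) z - of_real (\<kappa> * Im z powr (\<kappa> - 1)) * d_dzbar f z * (- \<i> / 2)) * cnj h)) (at z)"
      unfolding xi_bar_def[abs_def]
      by (rule has_derivative_eq_rhs[OF has_derivative_mult[OF has_derivative_Im_powr[OF y] W]])
         (simp add: fun_eq_iff eq diff_divide_distrib add_divide_distrib algebra_simps)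
    show "(xi_bar \<kappa> f has_derivative (\<lambda>h. d_dz (xi_bar \<kappa> f) z * h + d_dzbar (xi_bar \<kappa> f) z * cnj h)) (at z)"
      using * by (intro has_derivative_Wirtinger) (auto simp: differentiable_def)
    have "Im z powr (2 - \<kappa>) * Im z powr \<kappa> = (Im z)\<^sup>2" "Im z powr (2 - \<kappa>) * Im z powr (\<kappa> - 1) = Im z"
      using y by (simp_all flip: powr_add add: powr_numeral)
    hence p: "of_real (Im z powr (2 - \<kappa>)) * of_real (Im z powr \<kappa>) = (of_real ((Im z)\<^sup>2) :: complex)"
      "of_real (Im z powr (2 - \<kappa>)) * of_real (Im z powr (\<kappa> - 1)) = (of_real (Im z) :: complex)"
      by (metis of_real_mult)+
    have "- 4 * of_real (Im z powr (2 - \<kappa>)) * d_dz (xi_bar \<kappa> f) z = 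
      - 4 * (of_real (Im z powr (2 - \<kappa>)) * of_real (Im z powr \<kappa>)) * d_dz (d_dzbar f) z
      - 4 * of_real \<kappa> * (of_real (Im z powr (2 - \<kappa>)) * of_real (Im z powr (\<kappa> - 1))) * d_dzbar f z * (- \<i> / 2)"
      unfolding Wirtinger_eqs(1)[OF *] by (simp add: algebra_simps)
    also have "\<dots> = weight_laplacian \<kappa> f z"
      unfolding p weight_laplacian_def by (simp add: field_simps)
    finally show "weight_laplacian \<kappa> f z = - 4 * of_real (Im z powr (2 - \<kappa>)) * d_dz (xi_bar \<kappa> f) z" by simp
  qed
  show ?thesis
  proof
    assume L: "\<forall>z\<in>uhp. weight_laplacian \<kappa> f z = 0"
    show "(\<lambda>z. cnj (xi_bar \<kappa> f z)) holomorphic_on uhp"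
    proof (rule holomorphic_onI, rule field_differentiable_at_within)
      fix z assume z: "z \<in> uhp"
      have "d_dz (xi_bar \<kappa> f) z = 0" using X[OF z] L z by (auto simp: uhp_def)
      hence "(xi_bar \<kappa> f has_derivative (\<lambda>h. d_dzbar (xi_bar \<kappa> f) z * cnj h)) (at z)" using X[OF z] by simp
      hence "((\<lambda>z. cnj (xi_bar \<kappa> f z)) has_derivative (\<lambda>h. cnj (d_dzbar (xi_bar \<kappa> f) z * cnj h))) (at z)"
        by (rule has_derivative_cnj)
      hence "((\<lambda>z. cnj (xi_bar \<kappa> f z)) has_field_derivative cnj (d_dzbar (xi_bar \<kappa> f) z)) (at z)"
        by (simp add: has_field_derivative_def mult_commute_abs)
      thus "(\<lambda>z. cnj (xi_bar \<kappa> f z)) field_differentiable at z" by (auto simp: field_differentiable_def)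
    qed
  next
    assume hol: "(\<lambda>z. cnj (xi_bar \<kappa> f z)) holomorphic_on uhp"
    show "\<forall>z\<in>uhp. weight_laplacian \<kappa> f z = 0"
    proof
      fix z assume z: "z \<in> uhp"
      obtain c where "((\<lambda>z. cnj (xi_bar \<kappa> f z)) has_field_derivative c) (at z)"
        using hol open_uhp z by (metis holomorphic_on_imp_differentiable_at field_differentiable_def)
      hence "((\<lambda>z. cnj (xi_bar \<kappa> f z)) has_derivative (\<lambda>h. c * h)) (at z)"
        by (simp add: has_field_derivative_def)
      from has_derivative_cnj[OF this]
      have "(xi_bar \<kappa> f has_derivative (\<lambda>h. 0 * h + cnj c * cnj h)) (at z)" by simp
      from Wirtinger_eqs(1)[OF this] show "weight_laplacian \<kappa> f z = 0" using X[OF z] by simp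
    qed
  qed
qed

text \<open>In terms of \<open>u = g(z)\<close>, the Laplacian of \<open>y\<^bsup>\<kappa>\<^esup> |g|\<^sup>2\<close> at a critical point of this function is
  bounded below by \<open>- \<kappa> y\<^bsup>\<kappa>-2\<^esup> |g|\<^sup>2\<close>, which is positive in negative weight.\<close>

lemma maximum_principle:
  assumes \<kappa>: "\<kappa> < 0" and g: "smooth_on uhp g" and lap: "weight_laplacian \<kappa> g z0 = 0" and z0: "z0 \<in> uhp"
    and max: "\<And>z. z \<in> uhp \<Longrightarrow> Im z powr \<kappa> * (norm (g z))\<^sup>2 \<le> Im z0 powr \<kappa> * (norm (g z0))\<^sup>2"
  shows "g z0 = 0"
proof -
  define y where "y = Im z0"
  have y: "y > 0" using z0 by (simp add: y_def uhp_def)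
  define D where "D = (\<lambda>v z. frechet_derivative g (at z) v)"
  define D2 where "D2 = (\<lambda>v w z. frechet_derivative (D v) (at z) w)"
  have sD: "smooth_on uhp (D v)" for v unfolding D_def by (rule smooth_onD[OF g])
  have dg: "(g has_derivative (\<lambda>v. D v z)) (at z)" if "z \<in> uhp" for z
    using smooth_onD(1)[OF g that] by (simp add: D_def)
  have dD: "(D v has_derivative (\<lambda>w. D2 v w z)) (at z)" if "z \<in> uhp" for v z
    using smooth_onD(1)[OF sD that] by (simp add: D2_def)
  have sD2: "smooth_on uhp (D2 v w)" for v w unfolding D2_def by (rule smooth_onD[OF sD])
  have sym: "D2 1 \<i> z0 = D2 \<i> 1 z0"
    by (rule mixed_derivatives_eq[OF open_uhp z0, of g "\<lambda>z v. D v z" "\<lambda>v z w. D2 v w z"])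
       (use dg dD smooth_onD(3)[OF sD2] in auto)
  define a where "a = g z0" define gx where "gx = D 1 z0" define gy where "gy = D \<i> z0"
  define gxx where "gxx = D2 1 1 z0" define gyy where "gyy = D2 \<i> \<i> z0"
  have dg_eq: "d_dzbar g = (\<lambda>z. (1/2) * (D 1 z + \<i> * D \<i> z))"
    by (simp add: fun_eq_iff d_dzbar_def D_def)
  have dbar: "(d_dzbar g has_derivative (\<lambda>w. (1/2) * (D2 1 w z0 + \<i> * D2 \<i> w z0))) (at z0)"
    unfolding dg_eq by (intro has_derivative_add has_derivative_mult_right dD z0)
  have d1: "d_dz (d_dzbar g) z0 = (gxx + gyy) / 4"
    unfolding d_dz_def frechet_derivative_at[OF dbar, symmetric]
    by (simp add: sym gxx_def gyy_def field_simps)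
  have d2: "d_dzbar g z0 = (gx + \<i> * gy) / 2" by (simp add: d_dzbar_def gx_def gy_def D_def)
  have pde: "of_real (y\<^sup>2) * (gxx + gyy) = \<i> * of_real \<kappa> * of_real y * (gx + \<i> * gy)"
  proof -
    have "of_real (y\<^sup>2) * (gxx + gyy) - \<i> * of_real \<kappa> * of_real y * (gx + \<i> * gy) =
        - (- 4 * of_real (y\<^sup>2) * ((gxx + gyy) / 4) + 2 * \<i> * of_real \<kappa> * of_real y * ((gx + \<i> * gy) / 2))"
      by (simp add: field_simps)
    also have "\<dots> = 0" using lap unfolding weight_laplacian_def d1 d2 y_def[symmetric] by (simp only: minus_zero)
    finally show ?thesis by (simp only: right_minus_eq)
  qed
  have line: "((\<lambda>t. F (z0 + of_real t * v)) has_vector_derivative F' v) (at t)"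
    if "(F has_derivative F') (at (z0 + of_real t * v))" for F :: "complex \<Rightarrow> complex" and F' t v
    using has_vector_derivative_along_line[OF that] .
  have sq: "((\<lambda>t. (norm (u t))\<^sup>2) has_real_derivative 2 * (u t \<bullet> u')) (at t)"
    if "(u has_vector_derivative u') (at t)" for u :: "real \<Rightarrow> complex" and u' t
    using has_derivative_inner[OF that[unfolded has_vector_derivative_def] that[unfolded has_vector_derivative_def]]
    unfolding has_field_derivative_def power2_norm_eq_inner
    by (rule has_derivative_eq_rhs) (auto simp: inner_commute algebra_simps)
  have inn: "((\<lambda>t. u t \<bullet> v t) has_real_derivative (u t \<bullet> v' + u' \<bullet> v t)) (at t)"
    if "(u has_vector_derivative u') (at t)" "(v has_vector_derivative v') (at t)"
    for u v :: "real \<Rightarrow> complex" and u' v' t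
    using has_derivative_inner[OF that[unfolded has_vector_derivative_def]]
    unfolding has_field_derivative_def
    by (rule has_derivative_eq_rhs) (auto simp: algebra_simps)
  have xin: "z0 + of_real t * 1 \<in> uhp" for t using z0 by (simp add: uhp_def)
  have yin: "z0 + of_real t * \<i> \<in> uhp" if "\<bar>t\<bar> < y" for t using that by (auto simp: uhp_def y_def)
  \<comment> \<open>Along the horizontal line y is constant, so the weight y^\<kappa> drops out of
    the maximum condition.\<close>
  have X: "2 * (a \<bullet> gxx + gx \<bullet> gx) \<le> 0"
  proof (rule local_max_second_derivative_nonpos(2)[of 1 "\<lambda>t. (norm (g (z0 + of_real t * 1)))\<^sup>2"
        "\<lambda>t. 2 * (g (z0 + of_real t * 1) \<bullet> D 1 (z0 + of_real t * 1))"])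
    show "((\<lambda>t. (norm (g (z0 + of_real t * 1)))\<^sup>2) has_real_derivative
        2 * (g (z0 + of_real t * 1) \<bullet> D 1 (z0 + of_real t * 1))) (at t)" for t
      by (rule sq[OF line[OF dg[OF xin]]])
    show "((\<lambda>t. 2 * (g (z0 + of_real t * 1) \<bullet> D 1 (z0 + of_real t * 1))) has_real_derivative
        2 * (a \<bullet> gxx + gx \<bullet> gx)) (at 0)"
      by (rule DERIV_cong[OF DERIV_cmult[OF inn[OF line[OF dg[OF xin]] line[OF dD[OF xin]]]]])
         (simp add: a_def gxx_def gx_def)
    show "(norm (g (z0 + of_real t * 1)))\<^sup>2 \<le> (norm (g (z0 + of_real 0 * 1)))\<^sup>2" for t
      using max[OF xin[of t]] y by (simp add: y_def)
  qed auto
  \<comment> \<open>Vertically the weight is differentiated too; the first order condition becomes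
    \<open>crit\<close>, which expresses the product of a and gy by |a|^2.\<close>
  define \<phi> where "\<phi> = (\<lambda>t. (y + t) powr \<kappa> * (norm (g (z0 + of_real t * \<i>)))\<^sup>2)"
  define \<phi>' where "\<phi>' = (\<lambda>t. \<kappa> * (y + t) powr (\<kappa> - 1) * (norm (g (z0 + of_real t * \<i>)))\<^sup>2
      + 2 * (y + t) powr \<kappa> * (g (z0 + of_real t * \<i>) \<bullet> D \<i> (z0 + of_real t * \<i>)))"
  have pw: "((\<lambda>t. (y + t) powr r) has_real_derivative r * (y + t) powr (r - 1)) (at t)" if "\<bar>t\<bar> < y" for r t
    using that by (auto intro!: derivative_eq_intros has_real_derivative_powr')
  have d\<phi>: "(\<phi> has_real_derivative \<phi>' t) (at t)" if "\<bar>t\<bar> < y" for t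
    unfolding \<phi>_def \<phi>'_def
    by (rule DERIV_cong[OF DERIV_mult[OF pw[OF that] sq[OF line[OF dg[OF yin[OF that]]]]]])
       (simp add: algebra_simps)
  define \<phi>'' where "\<phi>'' = \<kappa> * (\<kappa> - 1) * y powr (\<kappa> - 2) * (norm a)\<^sup>2 + 4 * \<kappa> * y powr (\<kappa> - 1) * (a \<bullet> gy)
      + 2 * y powr \<kappa> * (a \<bullet> gyy + gy \<bullet> gy)"
  have y0: "\<bar>0\<bar> < y" using y by simp
  have d\<phi>': "(\<phi>' has_real_derivative \<phi>'') (at 0)"
    unfolding \<phi>'_def
    by (rule DERIV_cong[OF DERIV_add[OF 
          DERIV_mult[OF DERIV_cmult[OF pw[OF y0]] sq[OF line[OF dg[OF yin[OF y0]]]]]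
          DERIV_mult[OF DERIV_cmult[OF pw[OF y0]] inn[OF line[OF dg[OF yin[OF y0]]] line[OF dD[OF yin[OF y0]]]]]]])
       (simp add: \<phi>''_def a_def gy_def gyy_def algebra_simps)
  have m\<phi>: "\<phi> t \<le> \<phi> 0" if "\<bar>t\<bar> < y" for t
    using max[OF yin[OF that]] by (simp add: \<phi>_def y_def)
  note Y = local_max_second_derivative_nonpos[OF y d\<phi> d\<phi>' m\<phi>]
  have pk: "y powr (\<kappa> - 1) = y powr \<kappa> / y" "y powr (\<kappa> - 2) = y powr \<kappa> / y\<^sup>2"
    using y by (simp_all add: powr_diff)
  have yk: "y powr \<kappa> > 0" using y by simp
  have crit: "2 * y * (a \<bullet> gy) = - \<kappa> * (norm a)\<^sup>2"
  proof -
    have "y powr \<kappa> * (\<kappa> * (norm a)\<^sup>2 + 2 * y * (a \<bullet> gy)) = 0"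
      using Y(1) y by (simp add: \<phi>'_def pk a_def gy_def field_simps)
    thus ?thesis using yk by simp
  qed
  have Y2: "\<kappa> * (\<kappa> - 1) * (norm a)\<^sup>2 + 4 * \<kappa> * y * (a \<bullet> gy) + 2 * y\<^sup>2 * (a \<bullet> gyy + gy \<bullet> gy) \<le> 0"
  proof -
    have "\<phi>'' = y powr \<kappa> / y\<^sup>2 * (\<kappa> * (\<kappa> - 1) * (norm a)\<^sup>2 + 4 * \<kappa> * y * (a \<bullet> gy) + 2 * y\<^sup>2 * (a \<bullet> gyy + gy \<bullet> gy))"
      using y by (simp add: \<phi>''_def pk field_simps power2_eq_square)
    moreover have "y powr \<kappa> / y\<^sup>2 > 0" using y by simp
    ultimately show ?thesis using Y(2) by (metis mult_pos_pos not_le)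
  qed
  have pde': "2 * y\<^sup>2 * (a \<bullet> (gxx + gyy)) = 2 * \<kappa> * y * (a \<bullet> (\<i> * gx)) - 2 * \<kappa> * y * (a \<bullet> gy)"
  proof -
    have "y\<^sup>2 *\<^sub>R (gxx + gyy) = (\<kappa> * y) *\<^sub>R (\<i> * gx) - (\<kappa> * y) *\<^sub>R gy"
      using pde by (simp add: scaleR_conv_of_real algebra_simps)
    hence "a \<bullet> (y\<^sup>2 *\<^sub>R (gxx + gyy)) = a \<bullet> ((\<kappa> * y) *\<^sub>R (\<i> * gx) - (\<kappa> * y) *\<^sub>R gy)" by simp
    thus ?thesis by (simp add: inner_diff_right)
  qed
  \<comment> \<open>Completing squares: the mixed term left by the equation costs (\<kappa>^2/2)
    |a|^2, and the critical point condition returns the same amount through gy in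
    \<open>cs2\<close>. What remains of the sum of both second order conditions is -\<kappa> |a|^2
    \<le> 0.\<close>
  have cs1: "2 * y\<^sup>2 * (gx \<bullet> gx) + 2 * \<kappa> * y * (a \<bullet> (\<i> * gx)) \<ge> - (\<kappa>\<^sup>2 / 2) * (norm a)\<^sup>2"
  proof -
    have "0 \<le> 2 * (norm (y *\<^sub>R (\<i> * gx) + (\<kappa> / 2) *\<^sub>R a))\<^sup>2" by simp
    also have "\<dots> = 2 * y\<^sup>2 * (gx \<bullet> gx) + 2 * \<kappa> * y * (a \<bullet> (\<i> * gx)) + (\<kappa>\<^sup>2 / 2) * (norm a)\<^sup>2"
    proof -
      have "(\<i> * gx) \<bullet> (\<i> * gx) = gx \<bullet> gx" by (simp add: inner_complex_def)
      thus ?thesis unfolding power2_norm_eq_inner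
        by (simp add: inner_add_left inner_add_right inner_commute algebra_simps power2_eq_square)
    qed
    finally show ?thesis by simp
  qed
  have cs2: "2 * y\<^sup>2 * (gy \<bullet> gy) \<ge> (\<kappa>\<^sup>2 / 2) * (norm a)\<^sup>2"
  proof -
    have "0 \<le> 2 * (norm (y *\<^sub>R gy + (\<kappa> / 2) *\<^sub>R a))\<^sup>2" by simp
    also have "\<dots> = 2 * y\<^sup>2 * (gy \<bullet> gy) + \<kappa> * (2 * y * (a \<bullet> gy)) + (\<kappa>\<^sup>2 / 2) * (norm a)\<^sup>2"
      unfolding power2_norm_eq_inner
      by (simp add: inner_add_left inner_add_right inner_commute algebra_simps power2_eq_square)
    finally show ?thesis unfolding crit by (simp add: power2_eq_square algebra_simps)
  qed
  have X2: "2 * y\<^sup>2 * (a \<bullet> gxx + gx \<bullet> gx) \<le> 0"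
    using X by (simp add: mult_le_0_iff)
  have "4 * \<kappa> * y * (a \<bullet> gy) = 2 * \<kappa> * (2 * y * (a \<bullet> gy))" "2 * \<kappa> * y * (a \<bullet> gy) = \<kappa> * (2 * y * (a \<bullet> gy))"
    by simp_all
  hence e1: "4 * \<kappa> * y * (a \<bullet> gy) = - 2 * \<kappa>\<^sup>2 * (norm a)\<^sup>2" and e2: "2 * \<kappa> * y * (a \<bullet> gy) = - \<kappa>\<^sup>2 * (norm a)\<^sup>2"
    unfolding crit by (simp_all add: power2_eq_square)
  have "(norm a)\<^sup>2 * (- \<kappa>) \<le> 0"
    using X2 Y2[unfolded e1] pde'[unfolded e2] cs1 cs2 by (simp add: inner_add_right algebra_simps power2_eq_square)
  hence "(norm a)\<^sup>2 \<le> 0" using \<kappa> by (simp add: mult_le_0_iff zero_le_mult_iff)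
  thus ?thesis by (simp add: a_def)
qed

section \<open>Expansion at a cusp\<close>

lemma summable_on_int_abs:
  fixes g :: "nat \<Rightarrow> real"
  assumes "g summable_on UNIV"
  shows "(\<lambda>n::int. g (nat \<bar>n\<bar>)) summable_on UNIV"
proof -
  have 1: "(\<lambda>n::int. g (nat \<bar>n\<bar>)) summable_on (range int)"
    using assms by (subst summable_on_reindex) (auto simp: o_def)
  have "g summable_on (range Suc)" by (rule summable_on_subset_banach[OF assms]) auto
  hence "(g \<circ> Suc) summable_on UNIV" by (subst (asm) summable_on_reindex) auto
  hence 2: "(\<lambda>n::int. g (nat \<bar>n\<bar>)) summable_on (range (\<lambda>n. - int (Suc n)))"
    by (subst summable_on_reindex) (auto simp: o_def inj_on_def nat_add_distrib)
  have "(UNIV :: int set) = range int \<union> range (\<lambda>n. - int (Suc n))"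
  proof -
    have "n \<in> range int \<union> range (\<lambda>n. - int (Suc n))" for n :: int
      by (cases n) (auto simp del: of_nat_Suc)
    thus ?thesis by blast
  qed
  moreover have "range int \<inter> range (\<lambda>n. - int (Suc n)) = {}" by auto
  ultimately show ?thesis using summable_on_Un_disjoint[OF 1 2] by simp
qed

text \<open>F changes by \<epsilon> = e^(2 pi i \<alpha>) under z + 1, so its frequencies are 2 pi
  (n + \<alpha>) with integral n; frequency 0 occurs only for \<epsilon> = 1, and only there can a
  power of y survive. The constant term D is absent from the conclusion because y^((2-k)/2) D tends
  to 0 for k > 2.\<close>

lemma cusp_expansion:
  fixes F :: "complex \<Rightarrow> complex" and F' :: "complex \<Rightarrow> complex \<Rightarrow> complex"
  assumes k: "k > 2"
    and dF: "\<And>z. z \<in> uhp \<Longrightarrow> (F has_derivative F' z) (at z)"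
    and cF: "\<And>v. continuous_on uhp (\<lambda>z. F' z v)"
    and hol: "(\<lambda>z. cnj (xi_bar (2 - k) F z)) holomorphic_on uhp"
    and per: "\<And>z. z \<in> uhp \<Longrightarrow> F (z + 1) = \<epsilon> * F z" and \<epsilon>: "norm \<epsilon> = 1"
    and Y: "Y > 0" and growth: "\<And>z. Im z \<ge> Y \<Longrightarrow> norm (F z) \<le> B * Im z powr a"
  shows "\<exists>C. (\<epsilon> \<noteq> 1 \<longrightarrow> C = 0) \<and> (\<forall>\<eta>>0. \<exists>Y. \<forall>z\<in>uhp. Im z \<ge> Y \<longrightarrow>
            Im z powr ((2 - k) / 2) * norm (F z - C * of_real (Im z powr (k - 1))) \<le> \<eta>)"
proof -
  define \<alpha> where "\<alpha> = Arg2pi \<epsilon> / (2 * pi)"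
  have \<alpha>: "0 \<le> \<alpha>" "\<alpha> < 1" using Arg2pi[of \<epsilon>] by (simp_all add: \<alpha>_def)
  have \<epsilon>_cis: "\<epsilon> = cis (2 * pi * \<alpha>)"
  proof -
    have "\<epsilon> = of_real (norm \<epsilon>) * exp (\<i> * of_real (Arg2pi \<epsilon>))" using Arg2pi[of \<epsilon>] by (simp add: is_Arg_def)
    also have "\<dots> = cis (2 * pi * \<alpha>)" using \<epsilon> by (simp add: \<alpha>_def cis_conv_exp)
    finally show ?thesis .
  qed
  have \<epsilon>1: "\<epsilon> = 1" if "\<alpha> = 0" using that by (simp add: \<epsilon>_cis)
  define p where "p = (\<lambda>n::int. 2 * pi * (of_int n + \<alpha>))"
  define Z where "Z = (\<lambda>x y. of_real x + of_real y * \<i>)"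
  have Zin: "Z x y \<in> uhp" if "y > 0" for x y using that by (simp add: Z_def uhp_def)
  have ImZ: "Im (Z x y) = y" for x y by (simp add: Z_def)
  have Z1: "Z 1 y = Z 0 y + 1" for y by (simp add: Z_def)
  have cZ: "continuous_on A (\<lambda>(y, x). Z x y)" "continuous_on A' (\<lambda>x. Z x y)" for A A' y
    unfolding Z_def case_prod_beta by (intro continuous_intros)+
  define H where "H = (\<lambda>z. cnj (xi_bar (2 - k) F z))"
  have cont_F: "continuous_on uhp F"
    using dF has_derivative_continuous by (blast intro: continuous_at_imp_continuous_on)
  have F'_per: "F' (z + 1) h = \<epsilon> * F' z h" if z: "z \<in> uhp" for z h
  proof -
    have z1: "z + 1 \<in> uhp" using z by (simp add: uhp_def)
    have "((\<lambda>z. F (z + 1)) has_derivative F' (z + 1)) (at z)"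
      by (rule has_derivative_compose[of "\<lambda>z. z + 1" "\<lambda>h. h"]) (auto intro!: derivative_eq_intros dF z1)
    moreover have "((\<lambda>z. F (z + 1)) has_derivative (\<lambda>h. \<epsilon> * F' z h)) (at z)"
      by (rule has_derivative_transform_within_open[OF has_derivative_mult_right[OF dF[OF z]] open_uhp z])
         (simp add: per)
    ultimately show ?thesis using has_derivative_unique by metis
  qed
  have F'_eq: "F' z = frechet_derivative F (at z)" if "z \<in> uhp" for z
    using frechet_derivative_at[OF dF[OF that]] .
  have Fzbar: "d_dzbar F z = of_real (Im z powr (k - 2)) * cnj (H z)" if "z \<in> uhp" for z
  proof -
    have "Im z powr (k - 2) * Im z powr (2 - k) = 1"
      using that by (simp add: uhp_def flip: powr_add)
    hence "of_real (Im z powr (k - 2)) * of_real (Im z powr (2 - k)) = (1 :: complex)"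
      by (metis of_real_1 of_real_mult)
    thus ?thesis by (simp add: H_def xi_bar_def mult.assoc[symmetric])
  qed
  have Fy: "F' z \<i> = \<i> * F' z 1 - 2 * \<i> * d_dzbar F z" if "z \<in> uhp" for z
    using that by (simp add: d_dzbar_def F'_eq field_simps)
  have H_per: "H (z + 1) = cnj \<epsilon> * H z" if "z \<in> uhp" for z
  proof -
    have z1: "z + 1 \<in> uhp" using that by (simp add: uhp_def)
    have D: "frechet_derivative F (at (z + 1)) h = \<epsilon> * frechet_derivative F (at z) h" for h
      using F'_per[OF that] by (simp add: F'_eq[OF z1, symmetric] F'_eq[OF that, symmetric])
    show ?thesis unfolding H_def xi_bar_def d_dzbar_def D by (simp add: field_simps)
  qed
  define u where "u = (\<lambda>n y. integral {0..1} (\<lambda>x. F (Z x y) * cis (- (p n * x))))"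
  \<comment> \<open>The coefficient of the holomorphic function H that is dual to u n. The integrand
    is the restriction of a periodic holomorphic function, so the integral is the same at every
    height (\<open>c_eq\<close>); height 1 is a mere choice.\<close>
  define c where "c = (\<lambda>n. integral {0..1} (\<lambda>x. H (Z x 1) * exp (\<i> * of_real (p n) * Z x 1)))"
  have int_F: "(\<lambda>x. F (Z x y) * cis (- (p n * x))) integrable_on {0..1}" if "y > 0" for n y
    by (intro integrable_continuous_interval continuous_intros continuous_on_cis
        continuous_on_compose2[OF cont_F cZ(2)]) (use Zin that in auto)
  have c_eq: "integral {0..1} (\<lambda>x. H (Z x y) * exp (\<i> * of_real (p n) * Z x y)) = c n" if y: "y > 0" for n y
  proof -
    define K where "K = (\<lambda>z. H z * exp (\<i> * of_real (p n) * z))"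
    have K_hol: "K holomorphic_on uhp"
      unfolding K_def H_def by (intro holomorphic_intros hol)
    have dK: "(K has_field_derivative deriv K z) (at z)" if "z \<in> uhp" for z
      by (rule holomorphic_derivI[OF K_hol open_uhp that])
    have cdK: "continuous_on uhp (deriv K)"
      by (intro holomorphic_on_imp_continuous_on holomorphic_deriv K_hol open_uhp)
    have cK: "continuous_on uhp K" by (rule holomorphic_on_imp_continuous_on[OF K_hol])
    have K_per: "K (z + 1) = K z" if "z \<in> uhp" for z
    proof -
      have "exp (\<i> * of_real (p n) * (z + 1)) = exp (\<i> * of_real (p n) * z) * cis (p n)"
        by (simp add: cis_conv_exp exp_add[symmetric] algebra_simps)
      moreover have "cis (p n) = \<epsilon>"
        using cis_multiple_2pi[of "of_int n"] 
        by (simp add: p_def \<epsilon>_cis distrib_left cis_mult[symmetric] mult.assoc)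
      moreover have "cnj \<epsilon> * \<epsilon> = 1" using \<epsilon> by (metis complex_norm_square mult.commute of_real_1 one_power2)
      ultimately show ?thesis using H_per[OF that] by (simp add: K_def mult_ac)
    qed
    have "((\<lambda>y. integral (cbox 0 1) (\<lambda>x. K (Z x y))) has_vector_derivative
        integral (cbox 0 1) (\<lambda>x. deriv K (Z x y) * \<i>)) (at y within {0<..})" if "y > 0" for y
    proof (rule leibniz_rule_vector_derivative)
      fix y x :: real assume "y \<in> {0<..}"
      hence "(K has_derivative (\<lambda>h. deriv K (Z x y) * h)) (at (Z x y))"
        using dK[OF Zin] by (simp add: has_field_derivative_def)
      from has_vector_derivative_along_line[OF this[unfolded Z_def]]
      show "((\<lambda>y. K (Z x y)) has_vector_derivative deriv K (Z x y) * \<i>) (at y within {0<..})"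
        unfolding Z_def by (rule has_vector_derivative_at_within)
    next
      show "(\<lambda>x. K (Z x y)) integrable_on cbox 0 1" if "y \<in> {0<..}" for y
        unfolding cbox_interval using that Zin
        by (intro integrable_continuous_interval continuous_on_compose2[OF cK cZ(2)]) auto
      have "continuous_on ({0<..} \<times> cbox 0 1) (\<lambda>q. deriv K ((\<lambda>(y, x). Z x y) q))"
        by (rule continuous_on_compose2[OF cdK cZ(1)]) (use Zin in auto)
      thus "continuous_on ({0<..} \<times> cbox 0 1) (\<lambda>(y, x). deriv K (Z x y) * \<i>)"
        by (auto simp: case_prod_beta intro: continuous_on_mult_right)
    qed (use that in auto)
    moreover have "integral (cbox 0 1) (\<lambda>x. deriv K (Z x y) * \<i>) = 0" if "y > 0" for y
    proof -
      have "((\<lambda>x. deriv K (Z x y)) has_integral (K (Z 1 y) - K (Z 0 y))) {0..1}"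
      proof (rule fundamental_theorem_of_calculus)
        fix x
        have "(K has_derivative (\<lambda>h. deriv K (Z x y) * h)) (at (of_real y * \<i> + of_real x * 1))"
          using dK[OF Zin[OF that]] by (simp add: has_field_derivative_def Z_def add.commute)
        from has_vector_derivative_along_line[OF this]
        show "((\<lambda>x. K (Z x y)) has_vector_derivative deriv K (Z x y)) (at x within {0..1})"
          by (simp add: Z_def add.commute has_vector_derivative_at_within)
      qed simp
      hence "((\<lambda>x. deriv K (Z x y)) has_integral 0) {0..1}"
        using K_per[OF Zin[OF that]] by (simp add: Z1)
      from has_integral_mult_left[OF this, of \<i>] show ?thesis
        by (intro integral_unique) (simp only: cbox_interval mult_zero_left)
    qed
    ultimately have d0: "((\<lambda>y. integral (cbox 0 1) (\<lambda>x. K (Z x y))) has_vector_derivative 0) (at y within {0<..})"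
      if "y > 0" for y using that by fastforce
    have "\<exists>c. \<forall>y\<in>{0<..}. integral (cbox 0 1) (\<lambda>x. K (Z x y)) = c"
      by (rule has_vector_derivative_zero_constant[of "{0<..}" "\<lambda>y. integral (cbox 0 1) (\<lambda>x. K (Z x y))"])
         (use d0 in auto)
    thus ?thesis using y by (auto simp: c_def K_def)
  qed
  \<comment> \<open>This comes from F_y = i F_x - 2i \<open>d_dzbar F\<close>. Integration by parts
    in x turns the first term into - p u; the second is y^(k-2) times the conjugate of H, whose
    coefficient at height y is e^(py) times the conjugate of c.\<close>
  have du: "(u n has_vector_derivative
      ((- 2 * \<i> * cnj (c n)) * of_real (y powr (k - 2) * exp (p n * y)) - of_real (p n) * u n y)) (at y)"
    if y: "y > 0" for n y
  proof -
    have 1: "((\<lambda>y. integral (cbox 0 1) (\<lambda>x. F (Z x y) * cis (- (p n * x)))) has_vector_derivative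
        integral (cbox 0 1) (\<lambda>x. F' (Z x y) \<i> * cis (- (p n * x)))) (at y within {0<..})"
    proof (rule leibniz_rule_vector_derivative)
      fix y x :: real assume "y \<in> {0<..}"
      hence "(F has_derivative F' (Z x y)) (at (Z x y))" using dF[OF Zin] by simp
      from has_vector_derivative_along_line[OF this[unfolded Z_def]]
      show "((\<lambda>y. F (Z x y) * cis (- (p n * x))) has_vector_derivative F' (Z x y) \<i> * cis (- (p n * x))) (at y within {0<..})"
        unfolding Z_def by (rule has_vector_derivative_at_within[OF has_vector_derivative_mult_left])
    next
      show "(\<lambda>x. F (Z x y) * cis (- (p n * x))) integrable_on cbox 0 1" if "y \<in> {0<..}" for y
        using int_F[of y] that by (simp add: cbox_interval)
      have "continuous_on ({0<..} \<times> cbox 0 1) (\<lambda>q. F' ((\<lambda>(y, x). Z x y) q) \<i> * cis (- (p n * snd q)))"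
        by (intro continuous_intros continuous_on_cis continuous_on_compose2[OF cF cZ(1)]) (use Zin in auto)
      thus "continuous_on ({0<..} \<times> cbox 0 1) (\<lambda>(y, x). F' (Z x y) \<i> * cis (- (p n * x)))"
        by (simp add: case_prod_beta)
    qed (use y in auto)
    have 2: "((\<lambda>x. F' (Z x y) 1 * cis (- (p n * x))) has_integral (\<i> * of_real (p n) * u n y)) {0..1}"
    proof -
      have "((\<lambda>x. F (Z x y) * (- \<i> * of_real (p n) * cis (- (p n * x))) + F' (Z x y) 1 * cis (- (p n * x)))
          has_integral (F (Z 1 y) * cis (- (p n * 1)) - F (Z 0 y) * cis (- (p n * 0)))) {0..1}"
      proof (rule fundamental_theorem_of_calculus)
        fix x
        have "(F has_derivative F' (Z x y)) (at (of_real y * \<i> + of_real x * 1))"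
          using dF[OF Zin[OF y]] by (simp add: Z_def add.commute)
        from has_vector_derivative_along_line[OF this]
        have a: "((\<lambda>x. F (Z x y)) has_vector_derivative F' (Z x y) 1) (at x)"
          by (simp add: Z_def add.commute)
        have "((\<lambda>x. exp (of_real x * (- \<i> * of_real (p n)))) has_vector_derivative
            (- \<i> * of_real (p n)) * exp (of_real x * (- \<i> * of_real (p n)))) (at x)"
          by (auto intro!: derivative_eq_intros has_vector_derivative_real_field)
        moreover have "exp (of_real x * (- \<i> * of_real (p n))) = cis (- (p n * x))" for x
          by (simp add: cis_conv_exp mult_ac)
        ultimately have "((\<lambda>x. cis (- (p n * x))) has_vector_derivative (- \<i> * of_real (p n) * cis (- (p n * x)))) (at x)"
          by simp
        from has_vector_derivative_mult[OF a this]
        show "((\<lambda>x. F (Z x y) * cis (- (p n * x))) has_vector_derivative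
          F (Z x y) * (- \<i> * of_real (p n) * cis (- (p n * x))) + F' (Z x y) 1 * cis (- (p n * x))) (at x within {0..1})"
          by (rule has_vector_derivative_at_within)
      qed simp
      moreover have "F (Z 1 y) * cis (- (p n * 1)) - F (Z 0 y) * cis (- (p n * 0)) = 0"
      proof -
        have "cis (p n) = \<epsilon>"
          using cis_multiple_2pi[of "of_int n"] 
          by (simp add: p_def \<epsilon>_cis distrib_left cis_mult[symmetric] mult.assoc)
        hence "\<epsilon> * cis (- p n) = 1" by (metis cis_mult add.right_inverse cis_zero)
        thus ?thesis using per[OF Zin[OF y], of 0] by (simp add: Z1 mult_ac)
      qed
      ultimately have "((\<lambda>x. F (Z x y) * (- \<i> * of_real (p n) * cis (- (p n * x))) + F' (Z x y) 1 * cis (- (p n * x)))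
          has_integral 0) {0..1}" by simp
      moreover have "((\<lambda>x. (- \<i> * of_real (p n)) * (F (Z x y) * cis (- (p n * x)))) has_integral ((- \<i> * of_real (p n)) * u n y)) {0..1}"
        unfolding u_def by (intro has_integral_mult_right integrable_integral int_F y)
      ultimately have "((\<lambda>x. (F (Z x y) * (- \<i> * of_real (p n) * cis (- (p n * x))) + F' (Z x y) 1 * cis (- (p n * x)))
           - (- \<i> * of_real (p n)) * (F (Z x y) * cis (- (p n * x)))) has_integral (0 - (- \<i> * of_real (p n)) * u n y)) {0..1}"
        by (rule has_integral_diff)
      thus ?thesis by (simp add: algebra_simps)
    qed
    have 3: "((\<lambda>x. d_dzbar F (Z x y) * cis (- (p n * x))) has_integral
        (of_real (y powr (k - 2) * exp (p n * y)) * cnj (c n))) {0..1}"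
    proof -
      have cH: "continuous_on uhp H" unfolding H_def by (rule holomorphic_on_imp_continuous_on[OF hol])
      have "(\<lambda>x. H (Z x y) * exp (\<i> * of_real (p n) * Z x y)) integrable_on {0..1}"
        by (intro integrable_continuous_interval continuous_intros continuous_on_compose2[OF cH cZ(2)] cZ(2)) (use Zin y in auto)
      from integrable_integral[OF this]
      have "((\<lambda>x. H (Z x y) * exp (\<i> * of_real (p n) * Z x y)) has_integral c n) {0..1}"
        by (simp add: c_eq[OF y])
      from has_integral_linear[OF this bounded_linear_cnj]
      have "((\<lambda>x. cnj (H (Z x y) * exp (\<i> * of_real (p n) * Z x y))) has_integral cnj (c n)) {0..1}" 
        unfolding o_def .
      from has_integral_mult_right[OF this, of "of_real (y powr (k - 2) * exp (p n * y))"]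
      show ?thesis
      proof (rule has_integral_eq[rotated])
        fix x
        have "of_real (exp (p n * y)) * cnj (exp (\<i> * of_real (p n) * Z x y)) = cis (- (p n * x))"
          by (simp add: Z_def cis_conv_exp exp_cnj exp_of_real[symmetric] exp_add[symmetric] algebra_simps del: exp_of_real)
        thus "of_real (y powr (k - 2) * exp (p n * y)) * cnj (H (Z x y) * exp (\<i> * of_real (p n) * Z x y)) =
            d_dzbar F (Z x y) * cis (- (p n * x))"
          unfolding Fzbar[OF Zin[OF y]] ImZ by (simp add: mult_ac)
      qed
    qed
    have "((\<lambda>x. F' (Z x y) \<i> * cis (- (p n * x))) has_integral
       (\<i> * (\<i> * of_real (p n) * u n y) - 2 * \<i> * (of_real (y powr (k - 2) * exp (p n * y)) * cnj (c n)))) {0..1}"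
      by (rule has_integral_eq[OF _ has_integral_diff[OF has_integral_mult_right[OF 2, of \<i>] has_integral_mult_right[OF 3, of "2 * \<i>"]]])
         (simp add: Fy[OF Zin[OF y]] algebra_simps)
    hence "integral (cbox 0 1) (\<lambda>x. F' (Z x y) \<i> * cis (- (p n * x))) = 
       (- 2 * \<i> * cnj (c n)) * of_real (y powr (k - 2) * exp (p n * y)) - of_real (p n) * u n y"
      by (simp add: integral_unique algebra_simps)
    thus ?thesis using 1 y by (simp add: u_def[abs_def] at_within_open[of y "{0<..}"])
  qed
  have u_le: "norm (u n y) \<le> B * y powr a" if "y \<ge> Y" for n y
  proof -
    have "norm (integral {0..1} (\<lambda>x. F (Z x y) * cis (- (p n * x)))) \<le> integral {0..1::real} (\<lambda>x. B * y powr a)"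
    proof (rule integral_norm_bound_integral)
      show "(\<lambda>x. F (Z x y) * cis (- (p n * x))) integrable_on {0..1}" using int_F that Y by simp
      show "norm (F (Z x y) * cis (- (p n * x))) \<le> B * y powr a" for x
        using growth[of "Z x y"] that by (simp add: norm_mult ImZ)
    qed auto
    thus ?thesis by (simp add: u_def)
  qed
  have decay: "norm (u n y) \<le> (B * Y powr a) * (y / Y) powr (k - 2) * exp (- \<bar>p n\<bar> * (y - Y))"
    if "p n \<noteq> 0" "y \<ge> Y" for n y
  proof -
    have "norm (u n y) \<le> norm (u n Y) * (y / Y) powr (k - 2) * exp (- \<bar>p n\<bar> * (y - Y))"
      by (rule ode_decay[OF that(1) _ du u_le]) (use k Y that in auto)
    also have "\<dots> \<le> (B * Y powr a) * (y / Y) powr (k - 2) * exp (- \<bar>p n\<bar> * (y - Y))"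
      by (intro mult_right_mono u_le) auto
    finally show ?thesis .
  qed
  \<comment> \<open>A constant with |n + \<alpha>| \<ge> m (1 + |n|) whenever n + \<alpha> is
    nonzero: for \<alpha> = 0 the worst case is |n| = 1, otherwise \<alpha> serves for n \<ge> 0 and
    (1 - \<alpha>)/2 for n < 0.\<close>
  define m where "m = (if \<alpha> = 0 then 1/2 else min \<alpha> ((1 - \<alpha>) / 2))"
  define \<mu> where "\<mu> = 2 * pi * m"
  have m: "m > 0" using \<alpha> by (auto simp: m_def)
  hence \<mu>: "\<mu> > 0" by (simp add: \<mu>_def)
  have low: "\<mu> * (1 + \<bar>of_int n\<bar>) \<le> \<bar>p n\<bar>" if "p n \<noteq> 0" for n
  proof -
    have "m * (1 + \<bar>of_int n\<bar>) \<le> \<bar>of_int n + \<alpha>\<bar>"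
    proof (cases "\<alpha> = 0")
      case True
      hence "n \<noteq> 0" using that by (auto simp: p_def)
      hence "1 \<le> \<bar>real_of_int n\<bar>" by linarith
      thus ?thesis using True by (simp add: m_def)
    next
      case False
      show ?thesis
      proof (cases "n \<ge> 0")
        case True
        have "m * (1 + \<bar>of_int n\<bar>) \<le> \<alpha> * (1 + \<bar>of_int n\<bar>)"
          using False by (intro mult_right_mono) (auto simp: m_def)
        also have "\<dots> = \<alpha> + \<alpha> * of_int n" using True by (simp add: algebra_simps)
        also have "\<alpha> * of_int n \<le> 1 * of_int n" using True \<alpha> by (intro mult_right_mono) auto
        finally show ?thesis using True \<alpha> by simp
      next
        case n: False
        hence n1: "\<bar>real_of_int n\<bar> \<ge> 1" by linarith
        have "m \<le> (1 - \<alpha>) / 2" using False unfolding m_def by (simp add: min_def)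
        hence "m * (1 + \<bar>of_int n\<bar>) \<le> (1 - \<alpha>) / 2 * (1 + \<bar>of_int n\<bar>)"
          by (rule mult_right_mono) auto
        also have "\<dots> \<le> (1 - \<alpha>) / 2 * (2 * \<bar>of_int n\<bar>)" using n1 \<alpha> by (intro mult_left_mono) auto
        also have "\<dots> = \<bar>of_int n\<bar> - \<alpha> * \<bar>of_int n\<bar>" by (simp add: field_simps)
        also have "\<dots> \<le> \<bar>of_int n\<bar> - \<alpha> * 1" using n1 \<alpha> by (intro diff_left_mono mult_left_mono) auto
        also have "\<dots> \<le> \<bar>of_int n + \<alpha>\<bar>" using n by simp
        finally show ?thesis .
      qed
    qed
    hence "2 * pi * (m * (1 + \<bar>of_int n\<bar>)) \<le> 2 * pi * \<bar>of_int n + \<alpha>\<bar>" by (intro mult_left_mono) auto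
    moreover have "\<bar>p n\<bar> = 2 * pi * \<bar>of_int n + \<alpha>\<bar>" by (simp add: p_def abs_mult)
    ultimately show ?thesis by (simp only: \<mu>_def mult.assoc)
  qed
  define S where "S = (\<Sum>\<^sub>\<infinity>n::int. exp (- \<mu> * \<bar>of_int n\<bar>))"
  have sumS: "(\<lambda>n::int. exp (- \<mu> * \<bar>of_int n\<bar>)) summable_on UNIV"
  proof -
    have "summable (\<lambda>n::nat. exp (- \<mu>) ^ n)" using \<mu> by (intro summable_geometric) auto
    hence "(\<lambda>n::nat. exp (- \<mu>) ^ n) summable_on UNIV"
      by (subst summable_on_UNIV_nonneg_real_iff) auto
    from summable_on_int_abs[OF this] show ?thesis
      by (simp add: exp_of_nat_mult[symmetric] mult.commute)
  qed
  \<comment> \<open>Bound for the sum over all nonzero frequencies at height y; the rest of the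
    expansion is the zero mode \<open>z0\<close>, present only for \<alpha> = 0.\<close>
  define E where "E = (\<lambda>y. (B * Y powr a) * (y / Y) powr (k - 2) * exp (- \<mu> * (y - Y)) * S)"
  define z0 where "z0 = (\<lambda>y. if \<alpha> = 0 then u 0 y else 0)"
  have p0: "p n = 0 \<longleftrightarrow> \<alpha> = 0 \<and> n = 0" for n
  proof
    assume "p n = 0"
    hence "of_int n = - \<alpha>" by (simp add: p_def)
    hence "- 1 < real_of_int n" "real_of_int n \<le> 0" using \<alpha> by auto
    hence "n = 0" by linarith
    thus "\<alpha> = 0 \<and> n = 0" using \<open>of_int n = - \<alpha>\<close> by simp
  qed (simp add: p_def)
  \<comment> \<open>For y \<ge> Y + 1 the factor y - Y \<ge> 1 splits e^(-\<mu> (1+|n|) (y-Y)) into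
    decay in y and a geometric factor in n. Multiplying F by e^(-2 pi i \<alpha> x) makes it
    periodic without changing its modulus.\<close>
  have main: "norm (F (Z x y) - z0 y) \<le> E y" if y: "y \<ge> Y + 1" for x y
  proof -
    have y0: "y > 0" using y Y by simp
    define f where "f = (\<lambda>x. F (Z x y) * cis (- (2 * pi * \<alpha> * x)) - z0 y)"
    define b where "b = (\<lambda>n::int. ((B * Y powr a) * (y / Y) powr (k - 2) * exp (- \<mu> * (y - Y))) * exp (- \<mu> * \<bar>of_int n\<bar>))"
    have BY: "B * Y powr a \<ge> 0" using order_trans[OF norm_ge_zero u_le[of Y 0]] by simp
    have "norm (f x) \<le> infsum b UNIV"
    proof (rule norm_le_fourier_coeff_bound)
      show "continuous_on UNIV f" unfolding f_def
        by (intro continuous_intros continuous_on_cis continuous_on_compose2[OF cont_F cZ(2)]) (use Zin y0 in auto)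
      fix x
      have "Z (x + 1) y = Z x y + 1" by (simp add: Z_def)
      hence 1: "F (Z (x + 1) y) = \<epsilon> * F (Z x y)" using per[OF Zin[OF y0]] by simp
      have 2: "cis (- (2 * pi * \<alpha> * (x + 1))) = cis (- (2 * pi * \<alpha> * x)) * cis (- (2 * pi * \<alpha>))"
        by (simp add: cis_mult algebra_simps)
      have 3: "\<epsilon> * cis (- (2 * pi * \<alpha>)) = 1" by (simp add: \<epsilon>_cis cis_mult)
      have "F (Z (x + 1) y) * cis (- (2 * pi * \<alpha> * (x + 1))) =
          F (Z x y) * cis (- (2 * pi * \<alpha> * x)) * (\<epsilon> * cis (- (2 * pi * \<alpha>)))"
        unfolding 1 2 by (simp only: mult_ac)
      thus "f (x + 1) = f x" unfolding 3 f_def by simp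
    next
      fix n :: int
      have e: "cis (- (2 * pi * \<alpha> * x)) * cis (- (2 * pi * of_int n * x)) = cis (- (p n * x))" for x
        by (simp add: cis_mult p_def algebra_simps)
      have 1: "((\<lambda>x. F (Z x y) * cis (- (p n * x))) has_integral u n y) {0..1}"
        unfolding u_def by (intro integrable_integral int_F y0)
      have "fourier_coeff f n = (if p n = 0 then 0 else u n y)"
      proof (cases "\<alpha> = 0")
        case False
        have "f x * cis (- (2 * pi * of_int n * x)) = F (Z x y) * cis (- (p n * x))" for x
          using False e[of x] by (simp add: f_def z0_def mult.assoc)
        thus ?thesis using 1 False by (simp add: integral_unique p0)
      next
        case True
        have "((\<lambda>x. cis (- (2 * pi * of_int n * x))) has_integral (if n = 0 then 1 else 0)) {0..1}"
        proof (cases "n = 0")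
          case True thus ?thesis using has_integral_const_real[of "1::complex" 0 1] by simp
        next
          case False
          define c where "c = - \<i> * of_real (2 * pi * of_int n)"
          have c: "c \<noteq> 0" using False by (simp add: c_def)
          have "((\<lambda>x. exp (c * of_real x)) has_integral exp (c * of_real 1) / c - exp (c * of_real 0) / c) {0..1}"
            by (rule fundamental_theorem_of_calculus)
               (use c in \<open>auto intro!: derivative_eq_intros has_vector_derivative_real_field\<close>)
          moreover have "exp (c * of_real 1) = 1"
            using cis_multiple_2pi[of "of_int (- n)"] by (simp add: c_def cis_conv_exp)
          moreover have "exp (c * of_real x) = cis (- (2 * pi * of_int n * x))" for x
            by (simp add: c_def cis_conv_exp mult_ac)
          ultimately show ?thesis using False by simp
        qed
        from has_integral_diff[OF 1 has_integral_mult_right[OF this, of "z0 y"]]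
        have "((\<lambda>x. F (Z x y) * cis (- (p n * x)) - z0 y * cis (- (2 * pi * of_int n * x))) has_integral
            (u n y - z0 y * (if n = 0 then 1 else 0))) {0..1}" .
        moreover have "f x * cis (- (2 * pi * of_int n * x)) = F (Z x y) * cis (- (p n * x)) - z0 y * cis (- (2 * pi * of_int n * x))" for x
          using e[of x] by (simp add: f_def left_diff_distrib mult.assoc)
        ultimately have "fourier_coeff f n = u n y - z0 y * (if n = 0 then 1 else 0)" by (simp add: integral_unique)
        thus ?thesis using True by (auto simp: p0 z0_def)
      qed
      moreover have "norm (u n y) \<le> b n" if "p n \<noteq> 0"
      proof -
        have "\<mu> * (y - Y) + \<mu> * \<bar>of_int n\<bar> \<le> \<mu> * (1 + \<bar>of_int n\<bar>) * (y - Y)"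
          using \<mu> y mult_right_mono[of 1 "y - Y" "\<mu> * \<bar>of_int n\<bar>"] by (simp add: algebra_simps)
        also have "\<dots> \<le> \<bar>p n\<bar> * (y - Y)" using low[OF that] y by (intro mult_right_mono) auto
        finally have "exp (- \<bar>p n\<bar> * (y - Y)) \<le> exp (- \<mu> * (y - Y)) * exp (- \<mu> * \<bar>of_int n\<bar>)"
          by (simp add: exp_add[symmetric])
        hence "(B * Y powr a) * (y / Y) powr (k - 2) * exp (- \<bar>p n\<bar> * (y - Y)) \<le>
            (B * Y powr a) * (y / Y) powr (k - 2) * (exp (- \<mu> * (y - Y)) * exp (- \<mu> * \<bar>of_int n\<bar>))"
          using BY by (intro mult_left_mono) auto
        thus ?thesis using decay[OF that, of y] y by (simp add: b_def mult.assoc)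
      qed
      moreover have "b n \<ge> 0" using BY by (simp add: b_def)
      ultimately show "norm (fourier_coeff f n) \<le> b n" by simp
    next
      show "b summable_on UNIV" unfolding b_def by (intro summable_on_cmult_right sumS)
    qed
    also have "infsum b UNIV = E y" unfolding b_def E_def S_def by (rule infsum_cmult_right')
    also have "norm (f x) = norm (F (Z x y) - z0 y)"
      by (cases "\<alpha> = 0") (auto simp: f_def z0_def norm_mult)
    finally show ?thesis .
  qed
  \<comment> \<open>At frequency 0 the equation reads u' = const y^(k-2); integrating it produces
    the exponent k - 1 and the constant D.\<close>
  obtain C D where CD: "(\<epsilon> \<noteq> 1 \<longrightarrow> C = 0)" "\<And>y. y > 0 \<Longrightarrow> z0 y = D + C * of_real (y powr (k - 1))"
  proof (cases "\<alpha> = 0")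
    case False
    thus ?thesis using that[of 0 0] by (simp add: z0_def)
  next
    case True
    define C where "C = (- 2 * \<i> * cnj (c 0)) / of_real (k - 1)"
    have p00: "p 0 = 0" using True by (simp add: p_def)
    have "\<exists>D. \<forall>y\<in>{0<..}. u 0 y - C * of_real (y powr (k - 1)) = D"
    proof (rule has_vector_derivative_zero_constant)
      fix y :: real assume "y \<in> {0<..}"
      hence y: "y > 0" by simp
      have "((\<lambda>y. y powr (k - 1)) has_real_derivative (k - 1) * y powr (k - 2)) (at y)"
        using has_real_derivative_powr[OF y, of "k - 1"] by simp
      hence "((\<lambda>y. C * of_real (y powr (k - 1))) has_vector_derivative C * of_real ((k - 1) * y powr (k - 2))) (at y)"
        by (intro has_vector_derivative_mult_right has_vector_derivative_of_real)
      moreover have "C * of_real ((k - 1) * y powr (k - 2)) = (- 2 * \<i> * cnj (c 0)) * of_real (y powr (k - 2))"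
        using k by (simp add: C_def)
      ultimately have "((\<lambda>y. u 0 y - C * of_real (y powr (k - 1))) has_vector_derivative 0) (at y)"
        using has_vector_derivative_diff[OF du[OF y, of 0]] p00 by fastforce
      thus "((\<lambda>y. u 0 y - C * of_real (y powr (k - 1))) has_vector_derivative 0) (at y within {0<..})"
        by (rule has_vector_derivative_at_within)
    qed auto
    then obtain D where "\<And>y. y > 0 \<Longrightarrow> u 0 y - C * of_real (y powr (k - 1)) = D" by auto
    hence "z0 y = D + C * of_real (y powr (k - 1))" if "y > 0" for y
      using True that by (auto simp: z0_def algebra_simps)
    thus ?thesis using that[of C D] \<epsilon>1[OF True] by blast
  qed
  have lim: "((\<lambda>y. y powr ((2 - k) / 2) * (norm D + E y)) \<longlongrightarrow> 0) at_top"
  proof -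
    have 1: "((\<lambda>y. y powr ((2 - k) / 2) * norm D) \<longlongrightarrow> 0) at_top"
      using k by (intro tendsto_mult_left_zero tendsto_neg_powr filterlim_ident) auto
    have "((\<lambda>y. (B * Y powr a) / Y powr (k - 2) * exp (\<mu> * Y) * S * (y powr ((2 - k) / 2 + (k - 2)) * exp (- \<mu> * y))) \<longlongrightarrow> 0) at_top"
      by (intro tendsto_mult_right_zero powr_exp_decay \<mu>)
    moreover have "\<forall>\<^sub>F y in at_top. (B * Y powr a) / Y powr (k - 2) * exp (\<mu> * Y) * S * (y powr ((2 - k) / 2 + (k - 2)) * exp (- \<mu> * y))
        = y powr ((2 - k) / 2) * E y"
    proof (rule eventually_mono[OF eventually_gt_at_top[of 0]])
      fix y :: real assume y: "y > 0"
      have "exp (- \<mu> * (y - Y)) = exp (\<mu> * Y) * exp (- \<mu> * y)" by (simp add: exp_add[symmetric] algebra_simps)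
      moreover have "(y / Y) powr (k - 2) = y powr (k - 2) / Y powr (k - 2)" using y Y by (simp add: powr_divide)
      ultimately show "(B * Y powr a) / Y powr (k - 2) * exp (\<mu> * Y) * S * (y powr ((2 - k) / 2 + (k - 2)) * exp (- \<mu> * y))
        = y powr ((2 - k) / 2) * E y"
        by (simp add: E_def powr_add mult_ac)
    qed
    ultimately have "((\<lambda>y. y powr ((2 - k) / 2) * E y) \<longlongrightarrow> 0) at_top" by (rule Lim_transform_eventually)
    from tendsto_add[OF 1 this] show ?thesis by (simp add: distrib_left)
  qed
  show ?thesis
  proof (intro exI[of _ C] conjI CD(1) allI impI)
    fix \<eta> :: real assume "\<eta> > 0"
    hence "\<forall>\<^sub>F y in at_top. y powr ((2 - k) / 2) * (norm D + E y) < \<eta>"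
      using lim by (intro order_tendstoD(2)) auto
    then obtain Y1 where Y1: "\<And>y. y \<ge> Y1 \<Longrightarrow> y powr ((2 - k) / 2) * (norm D + E y) < \<eta>"
      by (auto simp: eventually_at_top_linorder)
    show "\<exists>Y. \<forall>z\<in>uhp. Im z \<ge> Y \<longrightarrow>
            Im z powr ((2 - k) / 2) * norm (F z - C * of_real (Im z powr (k - 1))) \<le> \<eta>"
    proof (intro exI[of _ "max Y1 (Y + 1)"] ballI impI)
      fix z assume z: "z \<in> uhp" "Im z \<ge> max Y1 (Y + 1)"
      have zZ: "z = Z (Re z) (Im z)" by (simp add: Z_def complex_eq_iff)
      have "F z - C * of_real (Im z powr (k - 1)) = (F (Z (Re z) (Im z)) - z0 (Im z)) + D"
        using CD(2)[of "Im z"] z(1) zZ by (simp add: uhp_def)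
      also have "norm \<dots> \<le> E (Im z) + norm D"
        using main[of "Im z" "Re z"] z(2) by (intro norm_triangle_mono) auto
      finally have "Im z powr ((2 - k) / 2) * norm (F z - C * of_real (Im z powr (k - 1))) \<le>
          Im z powr ((2 - k) / 2) * (norm D + E (Im z))" by (intro mult_left_mono) auto
      thus "Im z powr ((2 - k) / 2) * norm (F z - C * of_real (Im z powr (k - 1))) \<le> \<eta>"
        using Y1[of "Im z"] z(2) by simp
    qed
  qed
qed

section \<open>The action of matrices\<close>

lemma mat2_eq_iff:
  "(A :: real^2^2) = B \<longleftrightarrow> A$1$1 = B$1$1 \<and> A$1$2 = B$1$2 \<and> A$2$1 = B$2$1 \<and> A$2$2 = B$2$2"
  by (auto simp: vec_eq_iff forall_2)

lemma mat2_mult: "((A :: real^2^2) ** B) $ i $ j = A$i$1 * B$1$j + A$i$2 * B$2$j"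
  by (simp add: matrix_matrix_mult_def sum_2)

lemma mat2_one: "(mat 1 :: real^2^2) $ 1 $ 1 = 1" "(mat 1 :: real^2^2) $ 1 $ 2 = 0"
  "(mat 1 :: real^2^2) $ 2 $ 1 = 0" "(mat 1 :: real^2^2) $ 2 $ 2 = 1"
  by (simp_all add: mat_def)

lemma matrix_inv_unique:
  fixes A B :: "real^2^2"
  assumes "det A = 1" "A ** B = mat 1"
  shows "matrix_inv A = B"
proof -
  have "matrix_inv A ** A = mat 1" using SL2R_matrix_inv[of A] assms by (simp add: SL2R_def)
  thus ?thesis by (metis assms(2) matrix_mul_assoc matrix_mul_lid matrix_mul_rid)
qed

lemma matrix_inv_2:
  fixes A :: "real^2^2"
  assumes "det A = 1"
  shows "matrix_inv A = vector [vector [A$2$2, - (A$1$2)], vector [- (A$2$1), A$1$1]]"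
  using assms by (intro matrix_inv_unique)
    (auto simp: mat2_eq_iff mat2_mult mat2_one vector_2 det_2 algebra_simps)

lemma matrix_inv_entries:
  fixes A :: "real^2^2"
  assumes "det A = 1"
  shows "matrix_inv A $ 1 $ 1 = A$2$2" "matrix_inv A $ 1 $ 2 = - (A$1$2)"
    "matrix_inv A $ 2 $ 1 = - (A$2$1)" "matrix_inv A $ 2 $ 2 = A$1$1"
  by (simp_all add: matrix_inv_2[OF assms] vector_2)

lemma det_matrix_inv:
  fixes A :: "real^2^2"
  shows "det A = 1 \<Longrightarrow> det (matrix_inv A) = 1"
  using SL2R_matrix_inv(3)[of A] by (simp add: SL2R_def)

lemma matrix_inv_cancel:
  fixes A B :: "real^2^2"
  assumes "det A = 1"
  shows "A ** (matrix_inv A ** B) = B" "matrix_inv A ** (A ** B) = B"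
    "B ** A ** matrix_inv A = B" "B ** matrix_inv A ** A = B"
    "A ** matrix_inv A = mat 1" "matrix_inv A ** A = mat 1"
  using SL2R_matrix_inv[of A] assms
  by (simp_all add: SL2R_def matrix_mul_assoc) (simp_all add: matrix_mul_assoc[symmetric])

lemma matrix_inv_mult:
  fixes A B :: "real^2^2"
  assumes "det A = 1" "det B = 1"
  shows "matrix_inv (A ** B) = matrix_inv B ** matrix_inv A"
  by (rule matrix_inv_unique)
     (use assms in \<open>simp_all add: det_mul matrix_mul_assoc matrix_inv_cancel\<close>)

lemma mat2_minus_mult:
  fixes A B :: "real^2^2"
  shows "(- A) ** B = - (A ** B)" "A ** (- B) = - (A ** B)"
  by (auto simp: mat2_eq_iff mat2_mult algebra_simps)

lemma det_minus_2: "det (- A :: real^2^2) = det A" by (simp add: det_2)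

lemma mobius_minus: "mobius (- A) z = mobius A z"
proof -
  define n where "n = of_real (A$1$1) * z + of_real (A$1$2)"
  define d where "d = of_real (A$2$1) * z + of_real (A$2$2)"
  have "of_real ((- A)$1$1) * z + of_real ((- A)$1$2) = - n" "of_real ((- A)$2$1) * z + of_real ((- A)$2$2) = - d"
    by (simp_all add: n_def d_def)
  thus ?thesis unfolding mobius_def n_def[symmetric] d_def[symmetric] by simp
qed

lemma automorphy_minus: "automorphy (- A) z = - automorphy A z"
  by (simp add: automorphy_def)

lemma mobius_one: "mobius (mat 1) z = z" and automorphy_one: "automorphy (mat 1) z = 1"
  by (simp_all add: mobius_def automorphy_def mat2_one)

lemma mobius_inverse:
  assumes "det A = 1" "z \<in> uhp"
  shows "mobius (matrix_inv A) (mobius A z) = z" "mobius A (mobius (matrix_inv A) z) = z"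
  using assms mobius_mult[of A z "matrix_inv A"] mobius_mult[of "matrix_inv A" z A]
  by (simp_all add: matrix_inv_cancel mobius_one det_matrix_inv)

lemma Im_mobius:
  assumes "det A = 1" "z \<in> uhp"
  shows "Im (mobius A z) = Im z / (norm (automorphy A z))\<^sup>2"
proof -
  let ?j = "automorphy A z"
  let ?n = "of_real (A$1$1) * z + of_real (A$1$2)"
  have "mobius A z = ?n * cnj ?j / of_real ((norm ?j)\<^sup>2)"
    unfolding mobius_def automorphy_def by (rule complex_div_cnj)
  hence "Im (mobius A z) = Im (?n * cnj ?j) / (norm ?j)\<^sup>2"
    by (simp only: Im_divide_of_real)
  also have "Im (?n * cnj ?j) = det A * Im z"
    by (simp add: automorphy_def det_2 algebra_simps)
  finally show ?thesis using assms by simp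
qed

lemma Im_mobius_powr:
  assumes "det A = 1" "z \<in> uhp"
  shows "Im (mobius A z) powr r = Im z powr r * norm (automorphy A z) powr (- 2 * r)"
proof -
  have "norm (automorphy A z) > 0" using automorphy_nonzero[OF assms] by simp
  hence "(norm (automorphy A z))\<^sup>2 powr r = norm (automorphy A z) powr (2 * r)"
    by (simp add: powr_powr flip: powr_numeral)
  thus ?thesis using assms(2)
    by (simp add: Im_mobius[OF assms] powr_divide uhp_def powr_minus field_simps)
qed

text \<open>Homogeneous coordinates on the boundary: \<open>None\<close> is \<open>(1 : 0)\<close> and \<open>Some x\<close> is \<open>(x : 1)\<close>.\<close>

definition proj_bdry :: "real \<Rightarrow> real \<Rightarrow> real option" where
  "proj_bdry u v = (if v = 0 then None else Some (u / v))"

definition bdry_num :: "real option \<Rightarrow> real" where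
  "bdry_num a = (case a of None \<Rightarrow> 1 | Some x \<Rightarrow> x)"

definition bdry_den :: "real option \<Rightarrow> real" where
  "bdry_den a = (case a of None \<Rightarrow> 0 | Some x \<Rightarrow> 1)"

lemma bdry_mobius_proj:
  "bdry_mobius A a = proj_bdry (A$1$1 * bdry_num a + A$1$2 * bdry_den a) (A$2$1 * bdry_num a + A$2$2 * bdry_den a)"
  by (cases a) (simp_all add: proj_bdry_def bdry_num_def bdry_den_def)

lemma proj_bdry_scale: "c \<noteq> 0 \<Longrightarrow> proj_bdry (c * u) (c * v) = proj_bdry u v"
  by (simp add: proj_bdry_def)

lemma bdry_coords_proj:
  assumes "u \<noteq> 0 \<or> v \<noteq> 0"
  obtains c where "c \<noteq> 0" "bdry_num (proj_bdry u v) = c * u" "bdry_den (proj_bdry u v) = c * v"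
  using assms that[of "1 / u"] that[of "1 / v"]
  by (cases "v = 0") (auto simp: proj_bdry_def bdry_num_def bdry_den_def)

text \<open>In homogeneous coordinates the action is linear, and the determinant keeps the image
  vector from vanishing; this replaces the case distinctions at infinity.\<close>

lemma bdry_mobius_mult:
  assumes "det B = 1"
  shows "bdry_mobius (A ** B) a = bdry_mobius A (bdry_mobius B a)"
proof -
  define u where "u = B$1$1 * bdry_num a + B$1$2 * bdry_den a"
  define v where "v = B$2$1 * bdry_num a + B$2$2 * bdry_den a"
  have "B$2$2 * u - B$1$2 * v = det B * bdry_num a" "B$1$1 * v - B$2$1 * u = det B * bdry_den a"
    by (simp_all add: u_def v_def det_2 algebra_simps)
  moreover have "bdry_num a \<noteq> 0 \<or> bdry_den a \<noteq> 0" by (cases a) (auto simp: bdry_num_def bdry_den_def)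
  ultimately have "u \<noteq> 0 \<or> v \<noteq> 0" using assms by auto
  then obtain c where c: "c \<noteq> 0" "bdry_num (proj_bdry u v) = c * u" "bdry_den (proj_bdry u v) = c * v"
    by (rule bdry_coords_proj)
  have "bdry_mobius A (bdry_mobius B a) = proj_bdry (c * (A$1$1 * u + A$1$2 * v)) (c * (A$2$1 * u + A$2$2 * v))"
    unfolding bdry_mobius_proj[of B] bdry_mobius_proj[of A] u_def[symmetric] v_def[symmetric] c
    by (simp add: algebra_simps)
  also have "\<dots> = bdry_mobius (A ** B) a"
    unfolding proj_bdry_scale[OF c(1)] bdry_mobius_proj[of "A ** B"] u_def v_def mat2_mult
    by (simp add: algebra_simps)
  finally show ?thesis ..
qed

lemma bdry_mobius_one: "bdry_mobius (mat 1) a = a"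
  by (cases a) (simp_all add: mat2_one)

lemma bdry_mobius_inverse:
  assumes "det A = 1"
  shows "bdry_mobius (matrix_inv A) (bdry_mobius A a) = a" "bdry_mobius A (bdry_mobius (matrix_inv A) a) = a"
  using assms by (simp_all add: bdry_mobius_mult[symmetric] det_matrix_inv matrix_inv_cancel bdry_mobius_one)

lemma bdry_mobius_None_iff: "bdry_mobius A None = None \<longleftrightarrow> A$2$1 = 0"
  by simp

text \<open>The quotient of the two matrices fixes infinity, hence is upper triangular. Through
  this, estimates for an integral matrix pass to a scaling matrix of the same cusp: the height is
  only rescaled, by \<alpha>^2.\<close>

lemma same_cusp_matrix:
  assumes "det \<sigma> = 1" "det \<rho> = 1" "bdry_mobius \<sigma> None = bdry_mobius \<rho> None"
  obtains \<alpha> \<beta> where "\<alpha> \<noteq> 0" "\<sigma> = \<rho> ** vector [vector [\<alpha>, \<beta>], vector [0, 1 / \<alpha>]]"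
    "\<And>z. z \<in> uhp \<Longrightarrow> mobius \<sigma> z = mobius \<rho> (of_real (\<alpha>\<^sup>2) * z + of_real (\<alpha> * \<beta>))"
proof -
  define U where "U = matrix_inv \<rho> ** \<sigma>"
  have detU: "det U = 1" using assms by (simp add: U_def det_mul det_matrix_inv)
  have "bdry_mobius U None = None"
    unfolding U_def bdry_mobius_mult[OF assms(1)] assms(3) by (rule bdry_mobius_inverse[OF assms(2)])
  hence U21: "U$2$1 = 0" by (simp only: bdry_mobius_None_iff)
  hence U22: "U$1$1 * U$2$2 = 1" using detU by (simp add: det_2)
  hence nz: "U$1$1 \<noteq> 0" by auto
  have U: "U = vector [vector [U$1$1, U$1$2], vector [0, 1 / U$1$1]]"
    using U21 U22 nz by (simp add: mat2_eq_iff vector_2 field_simps)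
  have \<sigma>: "\<sigma> = \<rho> ** U" unfolding U_def using assms(2) by (simp add: matrix_inv_cancel)
  have "mobius U z = of_real ((U$1$1)\<^sup>2) * z + of_real (U$1$1 * U$1$2)" for z
    using nz by (subst U) (simp add: mobius_def vector_2 field_simps power2_eq_square)
  hence "mobius \<sigma> z = mobius \<rho> (of_real ((U$1$1)\<^sup>2) * z + of_real (U$1$1 * U$1$2))" if "z \<in> uhp" for z
    unfolding \<sigma> using mobius_mult[OF detU that, of \<rho>] by simp
  thus ?thesis using that[of "U$1$1" "U$1$2"] nz \<sigma> U by metis
qed

section \<open>Integral matrices and the cusps of the modular group\<close>

lemma carrier_SL2Z: "A \<in> carrier SL2Z \<longleftrightarrow> det A = 1 \<and> (\<forall>i j. A$i$j \<in> \<int>)"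
  by (simp add: SL2Z_def)

lemma SL2Z_simps [simp]: "A \<otimes>\<^bsub>SL2Z\<^esub> B = A ** B" "\<one>\<^bsub>SL2Z\<^esub> = mat 1"
  by (simp_all add: SL2Z_def)

lemma SL2Z_det: "A \<in> carrier SL2Z \<Longrightarrow> det A = 1" and SL2Z_entry: "A \<in> carrier SL2Z \<Longrightarrow> A$i$j \<in> \<int>"
  by (simp_all add: carrier_SL2Z)

lemma SL2Z_inv:
  assumes "A \<in> carrier SL2Z"
  shows "matrix_inv A \<in> carrier SL2Z" "inv\<^bsub>SL2Z\<^esub> A = matrix_inv A"
proof -
  show 1: "matrix_inv A \<in> carrier SL2Z"
    using assms by (auto simp: carrier_SL2Z det_matrix_inv forall_2 matrix_inv_entries)
  show "inv\<^bsub>SL2Z\<^esub> A = matrix_inv A"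
    by (rule group.inv_equality[OF SL2Z_group])
       (use assms 1 in \<open>simp_all add: matrix_inv_cancel SL2Z_det\<close>)
qed

lemma cusp_eq_SL2Z_image:
  assumes "\<aa> \<in> cusps"
  obtains \<rho> where "\<rho> \<in> carrier SL2Z" "bdry_mobius \<rho> None = \<aa>"
proof (cases \<aa>)
  case None
  have "mat 1 \<in> carrier SL2Z" using SL2Z_group group.is_monoid monoid.one_closed by fastforce
  thus ?thesis by (metis None bdry_mobius_one that)
next
  case (Some x)
  hence "x \<in> \<rat>" using assms by (auto simp: cusps_def)
  then obtain p q :: int where pq: "q > 0" "coprime p q" "x = of_int p / of_int q"
    by (rule Rats_cases')
  obtain u v where uv: "u * p + v * q = 1"
    using bezout_int[of p q] pq(2) by auto
  define \<rho> :: "real^2^2" where "\<rho> = vector [vector [of_int p, - of_int v], vector [of_int q, of_int u]]"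
  have "det \<rho> = of_int (u * p + v * q)" by (simp add: \<rho>_def det_2 vector_2)
  hence "\<rho> \<in> carrier SL2Z" using uv by (simp add: carrier_SL2Z forall_2 \<rho>_def vector_2)
  moreover have "bdry_mobius \<rho> None = \<aa>" using pq Some by (simp add: \<rho>_def vector_2)
  ultimately show ?thesis using that by blast
qed

lemma SL2Z_cusps:
  assumes "A \<in> carrier SL2Z" "\<aa> \<in> cusps"
  shows "bdry_mobius A \<aa> \<in> cusps"
proof -
  have "A$i$j \<in> \<rat>" for i j using SL2Z_entry[OF assms(1)] Ints_subset_Rats by blast
  thus ?thesis using assms(2) by (cases \<aa>) (auto simp: cusps_def)
qed

section \<open>Lattice sums\<close>

lemma sum_shifted_powr_bound:
  fixes s :: real
  assumes "s > 1"
  shows "\<exists>K\<ge>0. \<forall>t (D::int set). finite D \<longrightarrow> (\<Sum>d\<in>D. max 1 \<bar>t + of_int d\<bar> powr (- s)) \<le> K"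
proof -
  \<comment> \<open>Each term is compared with g at the integer part of |t + d|. These integer parts
    are distinct among the nonnegative t + d and among the negative ones, so twice the sum of g is a
    bound, uniform in the shift t.\<close>
  define g where "g = (\<lambda>n::nat. max 1 (real n) powr (- s))"
  have "summable (\<lambda>n. real n powr (- s))" using assms by (simp add: summable_real_powr_iff)
  hence "summable g"
    by (rule summable_comparison_test_ev[rotated])
       (auto simp: g_def intro!: eventually_mono[OF eventually_ge_at_top[of 1]])
  hence gsum: "sum g N \<le> suminf g" if "finite N" for N
    using that by (intro sum_le_suminf) (auto simp: g_def)
  have part: "(\<Sum>d\<in>D. max 1 \<bar>t d\<bar> powr (- s)) \<le> suminf g"
    if D: "finite D" "\<And>d. d \<in> D \<Longrightarrow> t d \<ge> 0" "inj_on (\<lambda>d. nat \<lfloor>t d\<rfloor>) D" for t :: "int \<Rightarrow> real" and D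
  proof -
    have "(\<Sum>d\<in>D. max 1 \<bar>t d\<bar> powr (- s)) \<le> (\<Sum>d\<in>D. g (nat \<lfloor>t d\<rfloor>))"
    proof (rule sum_mono)
      fix d assume "d \<in> D"
      hence "real (nat \<lfloor>t d\<rfloor>) \<le> \<bar>t d\<bar>" using D(2)[of d] by simp
      thus "max 1 \<bar>t d\<bar> powr (- s) \<le> g (nat \<lfloor>t d\<rfloor>)"
        unfolding g_def using assms by (intro powr_mono2') auto
    qed
    also have "\<dots> = sum g ((\<lambda>d. nat \<lfloor>t d\<rfloor>) ` D)" using D(3) by (simp add: sum.reindex)
    also have "\<dots> \<le> suminf g" using D(1) by (intro gsum) auto
    finally show ?thesis .
  qed
  have "(\<Sum>d\<in>D. max 1 \<bar>t + of_int d\<bar> powr (- s)) \<le> 2 * suminf g" if D: "finite D" for t and D :: "int set"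
  proof -
    have "(\<Sum>d\<in>{d\<in>D. t + of_int d \<ge> 0}. max 1 \<bar>t + of_int d\<bar> powr (- s)) \<le> suminf g"
    proof (rule part)
      show "inj_on (\<lambda>d. nat \<lfloor>t + of_int d\<rfloor>) {d\<in>D. t + of_int d \<ge> 0}"
      proof (rule inj_onI)
        fix d e assume de: "d \<in> {d\<in>D. t + of_int d \<ge> 0}" "e \<in> {d\<in>D. t + of_int d \<ge> 0}"
          "nat \<lfloor>t + of_int d\<rfloor> = nat \<lfloor>t + of_int e\<rfloor>"
        have "0 \<le> \<lfloor>t + of_int d\<rfloor>" "0 \<le> \<lfloor>t + of_int e\<rfloor>"
          using de(1,2) by (simp_all only: zero_le_floor mem_Collect_eq)
        hence "\<lfloor>t + of_int d\<rfloor> = \<lfloor>t + of_int e\<rfloor>" using de(3) by (simp only: eq_nat_nat_iff)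
        thus "d = e" by simp
      qed
    qed (use D in auto)
    moreover have "(\<Sum>d\<in>{d\<in>D. \<not> t + of_int d \<ge> 0}. max 1 \<bar>- (t + of_int d)\<bar> powr (- s)) \<le> suminf g"
    proof (rule part)
      show "inj_on (\<lambda>d. nat \<lfloor>- (t + of_int d)\<rfloor>) {d\<in>D. \<not> t + of_int d \<ge> 0}"
      proof (rule inj_onI)
        fix d e assume de: "d \<in> {d\<in>D. \<not> t + of_int d \<ge> 0}" "e \<in> {d\<in>D. \<not> t + of_int d \<ge> 0}"
          "nat \<lfloor>- (t + of_int d)\<rfloor> = nat \<lfloor>- (t + of_int e)\<rfloor>"
        have "0 \<le> \<lfloor>- (t + of_int d)\<rfloor>" "0 \<le> \<lfloor>- (t + of_int e)\<rfloor>"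
          unfolding zero_le_floor using de(1,2) by auto
        hence "\<lfloor>- (t + of_int d)\<rfloor> = \<lfloor>- (t + of_int e)\<rfloor>" using de(3) by (simp only: eq_nat_nat_iff)
        hence "\<lfloor>- t - of_int d\<rfloor> = \<lfloor>- t - of_int e\<rfloor>" by simp
        thus "d = e" by (simp only: floor_diff_of_int)
      qed
    qed (use D in auto)
    moreover have "(\<Sum>d\<in>D. max 1 \<bar>t + of_int d\<bar> powr (- s)) =
        (\<Sum>d\<in>{d\<in>D. t + of_int d \<ge> 0}. max 1 \<bar>t + of_int d\<bar> powr (- s)) +
        (\<Sum>d\<in>{d\<in>D. \<not> t + of_int d \<ge> 0}. max 1 \<bar>- (t + of_int d)\<bar> powr (- s))"
      unfolding abs_minus_cancel using D by (subst sum.union_disjoint[symmetric]) (auto intro!: sum.cong)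
    ultimately show ?thesis by linarith
  qed
  moreover have "suminf g \<ge> 0" using gsum[of "{}"] by simp
  ultimately show ?thesis by (intro exI[of _ "2 * suminf g"]) auto
qed

text \<open>The exponent \<open>k\<close> is split as \<open>(3k/4 - 1/2) + (k/4 + 1/2)\<close>: the second part exceeds \<open>1\<close> and makes the
  sum over \<open>d\<close> converge, the first part exceeds \<open>k/2\<close> and gives the decay in \<open>y\<close>.\<close>

lemma lattice_sum_bound:
  fixes k :: real
  assumes k: "k > 2"
  shows "\<exists>K\<ge>0. \<forall>z\<in>uhp. \<forall>F::(int \<times> int) set. finite F \<longrightarrow> (\<forall>q\<in>F. fst q \<noteq> 0) \<longrightarrow>
      (\<Sum>q\<in>F. norm (of_int (fst q) * z + of_int (snd q)) powr (- k))
        \<le> K * min 1 (Im z) powr (- (k/4 + 1/2)) * Im z powr (- (3*k/4 - 1/2))"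
proof -
  define s1 where "s1 = k/4 + 1/2" define s2 where "s2 = 3*k/4 - 1/2"
  have s: "s1 > 1" "s2 > 1" "k = s1 + s2" using k by (simp_all add: s1_def s2_def)
  obtain K1 where K1: "K1 \<ge> 0" "\<And>t (D::int set). finite D \<Longrightarrow> (\<Sum>d\<in>D. max 1 \<bar>t + of_int d\<bar> powr (- s1)) \<le> K1"
    using sum_shifted_powr_bound[OF s(1)] by blast
  obtain K2 where K2: "K2 \<ge> 0" "\<And>t (D::int set). finite D \<Longrightarrow> (\<Sum>d\<in>D. max 1 \<bar>t + of_int d\<bar> powr (- s2)) \<le> K2"
    using sum_shifted_powr_bound[OF s(2)] by blast
  have "(\<Sum>q\<in>F. norm (of_int (fst q) * z + of_int (snd q)) powr (- k))
        \<le> (K1 * K2) * min 1 (Im z) powr (- s1) * Im z powr (- s2)"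
    if z: "z \<in> uhp" and F: "finite F" "\<forall>q\<in>F. fst q \<noteq> 0" for z and F :: "(int \<times> int) set"
  proof -
    define y where "y = Im z" define m where "m = min 1 y"
    have y: "y > 0" using z by (simp add: y_def uhp_def)
    have m: "m > 0" "m \<le> 1" "m \<le> y" using y by (auto simp: m_def)
    define h where "h = (\<lambda>c d::int. (max 1 \<bar>0 + of_int c\<bar> powr (- s2) * y powr (- s2)) *
        (m powr (- s1) * max 1 \<bar>of_int c * Re z + of_int d\<bar> powr (- s1)))"
    have le: "norm (of_int c * z + of_int d) powr (- k) \<le> h c d" if c: "c \<noteq> 0" for c d :: int
    proof -
      let ?n = "norm (of_int c * z + of_int d)"
      have "1 \<le> \<bar>c\<bar>" using c by linarith
      hence c1: "1 \<le> \<bar>real_of_int c\<bar>" by linarith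
      have n1: "?n \<ge> \<bar>of_int c\<bar> * y" using abs_Im_le_cmod[of "of_int c * z + of_int d"] y by (simp add: y_def abs_mult)
      have n2: "?n \<ge> \<bar>of_int c * Re z + of_int d\<bar>" using abs_Re_le_cmod[of "of_int c * z + of_int d"] by simp
      have cy: "y \<le> \<bar>of_int c\<bar> * y" using c1 y by simp
      \<comment> \<open>The modulus dominates both y (as c is nonzero) and |c Re z + d|; the factor
        m = min 1 y merges the two into one bound that is summable in d.\<close>
      have n3: "m * max 1 \<bar>of_int c * Re z + of_int d\<bar> \<le> ?n"
      proof (cases "1 \<le> \<bar>of_int c * Re z + of_int d\<bar>")
        case True
        hence "m * max 1 \<bar>of_int c * Re z + of_int d\<bar> \<le> 1 * \<bar>of_int c * Re z + of_int d\<bar>"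
          using m by (intro mult_mono) auto
        thus ?thesis using n2 by simp
      next
        case False
        hence "max 1 \<bar>of_int c * Re z + of_int d\<bar> = 1" by simp
        hence "m * max 1 \<bar>of_int c * Re z + of_int d\<bar> = m" by simp
        thus ?thesis using m n1 cy by linarith
      qed
      have "?n powr (- k) = ?n powr (- s2) * ?n powr (- s1)" unfolding s(3) by (simp add: algebra_simps flip: powr_add)
      also have "\<dots> \<le> (\<bar>of_int c\<bar> * y) powr (- s2) * (m * max 1 \<bar>of_int c * Re z + of_int d\<bar>) powr (- s1)"
        using n1 n3 s y m c1 cy by (intro mult_mono powr_mono2') auto
      also have "\<dots> = h c d" using c1 y m by (simp add: h_def powr_mult max_def)
      finally show ?thesis .
    qed
    define A where "A = fst ` F" define D where "D = snd ` F"
    have fin: "finite A" "finite D" using F by (auto simp: A_def D_def)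
    have "(\<Sum>q\<in>F. norm (of_int (fst q) * z + of_int (snd q)) powr (- k)) \<le> (\<Sum>q\<in>F. h (fst q) (snd q))"
      using F le by (intro sum_mono) auto
    \<comment> \<open>Enlarging F to a rectangle turns the sum into an iterated one: the inner d-sum
      is bounded independently of c, and the c-sum remains.\<close>
    also have "\<dots> \<le> (\<Sum>q\<in>A \<times> D. h (fst q) (snd q))"
      using fin m y by (intro sum_mono2) (auto simp: A_def D_def h_def rev_image_eqI)
    also have "\<dots> = (\<Sum>c\<in>A. \<Sum>d\<in>D. h c d)" by (simp add: sum.cartesian_product split_def)
    also have "\<dots> = (\<Sum>c\<in>A. max 1 \<bar>0 + of_int c\<bar> powr (- s2) * (y powr (- s2) * m powr (- s1) * 
        (\<Sum>d\<in>D. max 1 \<bar>of_int c * Re z + of_int d\<bar> powr (- s1))))"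
      unfolding h_def by (simp add: sum_distrib_left mult_ac)
    also have "\<dots> \<le> (\<Sum>c\<in>A. max 1 \<bar>0 + of_int c\<bar> powr (- s2) * (y powr (- s2) * m powr (- s1) * K1))"
      using fin K1(2) by (intro sum_mono mult_left_mono) auto
    also have "\<dots> = (\<Sum>c\<in>A. max 1 \<bar>0 + of_int c\<bar> powr (- s2)) * (y powr (- s2) * m powr (- s1) * K1)"
      by (simp only: sum_distrib_right)
    also have "\<dots> \<le> K2 * (y powr (- s2) * m powr (- s1) * K1)"
      by (rule mult_right_mono[OF K2(2)[OF fin(1)]]) (use K1(1) in auto)
    finally show ?thesis by (simp add: y_def m_def mult_ac)
  qed
  thus ?thesis unfolding s1_def s2_def using K1(1) K2(1) by (intro exI[of _ "K1 * K2"]) auto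
qed

text \<open>The rows (0, d) add a sum that does not depend on z; this is the summand 1 in the
  bound.\<close>

lemma lattice_sum_bound_full:
  fixes k :: real
  assumes k: "k > 2"
  shows "\<exists>K\<ge>0. \<forall>z\<in>uhp. \<forall>F::(int \<times> int) set. finite F \<longrightarrow>
      (\<Sum>q\<in>F. norm (of_int (fst q) * z + of_int (snd q)) powr (- k))
        \<le> K * (1 + min 1 (Im z) powr (- (k/4 + 1/2)) * Im z powr (- (3*k/4 - 1/2)))"
proof -
  obtain K where K: "K \<ge> 0" "\<And>z (F::(int \<times> int) set). z \<in> uhp \<Longrightarrow> finite F \<Longrightarrow> (\<forall>q\<in>F. fst q \<noteq> 0) \<Longrightarrow>
      (\<Sum>q\<in>F. norm (of_int (fst q) * z + of_int (snd q)) powr (- k))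
        \<le> K * min 1 (Im z) powr (- (k/4 + 1/2)) * Im z powr (- (3*k/4 - 1/2))"
    using lattice_sum_bound[OF k] by blast
  have k1: "k > 1" using k by simp
  obtain K1 where K1: "K1 \<ge> 0" "\<And>t (D::int set). finite D \<Longrightarrow> (\<Sum>d\<in>D. max 1 \<bar>t + of_int d\<bar> powr (- k)) \<le> K1"
    using sum_shifted_powr_bound[OF k1] by blast
  have "(\<Sum>q\<in>F. norm (of_int (fst q) * z + of_int (snd q)) powr (- k))
        \<le> (K + K1) * (1 + min 1 (Im z) powr (- (k/4 + 1/2)) * Im z powr (- (3*k/4 - 1/2)))"
    if z: "z \<in> uhp" and F: "finite F" for z and F :: "(int \<times> int) set"
  proof -
    let ?h = "\<lambda>q :: int \<times> int. norm (of_int (fst q) * z + of_int (snd q)) powr (- k)"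
    let ?X = "min 1 (Im z) powr (- (k/4 + 1/2)) * Im z powr (- (3*k/4 - 1/2))"
    have "sum ?h F = sum ?h {q\<in>F. fst q \<noteq> 0} + sum ?h {q\<in>F. fst q = 0}"
      using F by (subst sum.union_disjoint[symmetric]) (auto intro!: sum.cong)
    also have "sum ?h {q\<in>F. fst q \<noteq> 0} \<le> K * ?X"
      unfolding mult.assoc[symmetric] by (rule K(2)[OF z]) (use F in auto)
    also have "sum ?h {q\<in>F. fst q = 0} = sum (\<lambda>d. \<bar>of_int d\<bar> powr (- k)) (snd ` {q\<in>F. fst q = 0})"
      by (subst sum.reindex) (auto simp: inj_on_def prod_eq_iff)
    also have "\<dots> \<le> sum (\<lambda>d. max 1 \<bar>0 + of_int d\<bar> powr (- k)) (snd ` {q\<in>F. fst q = 0})"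
    proof (rule sum_mono)
      fix d :: int
      show "\<bar>of_int d\<bar> powr (- k) \<le> max 1 \<bar>0 + of_int d\<bar> powr (- k)"
      \<comment> \<open>For d = 0 the left side is \<open>0 powr (- k)\<close>, which is 0; so the
        row (0, 0) does no harm.\<close>
      proof (cases "d = 0")
        case False
        hence "1 \<le> \<bar>d\<bar>" by linarith
        hence "1 \<le> \<bar>real_of_int d\<bar>" by linarith
        thus ?thesis by (simp add: max_def)
      qed simp
    qed
    also have "\<dots> \<le> K1" using F by (intro K1(2)) auto
    finally have "sum ?h F \<le> K * ?X + K1" by simp
    also have "\<dots> \<le> (K + K1) * (1 + ?X)" using K(1) K1(1) by (simp add: algebra_simps)
    finally show ?thesis .
  qed
  thus ?thesis using K(1) K1(1) by (intro exI[of _ "K + K1"]) auto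
qed

section \<open>Convergence of Eisenstein series\<close>

text \<open>\<open>\<rho>\<close> is an integral matrix with \<open>\<rho> \<infinity> = \<aa>\<close>; up to a real factor, the bottom rows of \<open>\<sigma>\<^sup>-\<^sup>1 A\<close>
  are then those of \<open>\<rho>\<^sup>-\<^sup>1 A\<close>, hence integral.  The weight \<open>k = \<kappa> + 2 s\<close> governs convergence.\<close>

locale eisenstein_setup =
  fixes \<Gamma> :: "(real^2^2) set" and \<nu> :: "real^2^2 \<Rightarrow> complex" and \<kappa> s k :: real
    and \<aa> :: "real option" and \<sigma> \<rho> :: "real^2^2"
  assumes sub: "subgroup \<Gamma> SL2Z" and ms: "multiplier_system \<Gamma> \<nu> \<kappa>"
    and scal: "scaling_matrix \<Gamma> \<aa> \<sigma>" and sing: "singular_cusp \<Gamma> \<nu> \<kappa> \<aa> \<sigma>"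
    and k: "k = \<kappa> + 2 * s" "k > 2"
    and \<rho>: "\<rho> \<in> carrier SL2Z" "bdry_mobius \<rho> None = \<aa>"
begin

abbreviation "S \<equiv> matrix_inv \<sigma>"
abbreviation "\<Gamma>\<^sub>0 \<equiv> cusp_stabilizer \<Gamma> \<aa>"
abbreviation "cosets \<equiv> rcosets\<^bsub>SL2Z\<lparr>carrier := \<Gamma>\<rparr>\<^esub> \<Gamma>\<^sub>0"
abbreviation "rep K \<equiv> (SOME A. A \<in> K)"
definition coset where "coset A = (\<lambda>D. D ** A) ` \<Gamma>\<^sub>0"
abbreviation "etrm z A \<equiv> eisenstein_term \<nu> \<kappa> \<sigma> (of_real s) z A"

lemma \<Gamma>_SL2Z: "A \<in> \<Gamma> \<Longrightarrow> A \<in> carrier SL2Z"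
  using sub subgroup.subset by blast

lemma \<Gamma>_det: "A \<in> \<Gamma> \<Longrightarrow> det A = 1"
  using \<Gamma>_SL2Z SL2Z_det by blast

lemma \<Gamma>_closed: "A \<in> \<Gamma> \<Longrightarrow> B \<in> \<Gamma> \<Longrightarrow> A ** B \<in> \<Gamma>" "mat 1 \<in> \<Gamma>" "A \<in> \<Gamma> \<Longrightarrow> matrix_inv A \<in> \<Gamma>"
  using subgroup.m_closed[OF sub] subgroup.one_closed[OF sub] subgroup.m_inv_closed[OF sub] SL2Z_inv(2) \<Gamma>_SL2Z
  by (auto simp: SL2Z_simps)

lemma \<sigma>_det: "det \<sigma> = 1" and \<sigma>_cusp: "bdry_mobius \<sigma> None = \<aa>"
  using scal by (auto simp: scaling_matrix_def SL2R_def)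

lemma S_det: "det S = 1" using det_matrix_inv[OF \<sigma>_det] .

lemma stab_closed:
  "D \<in> \<Gamma>\<^sub>0 \<Longrightarrow> E \<in> \<Gamma>\<^sub>0 \<Longrightarrow> D ** E \<in> \<Gamma>\<^sub>0" "mat 1 \<in> \<Gamma>\<^sub>0" "D \<in> \<Gamma>\<^sub>0 \<Longrightarrow> matrix_inv D \<in> \<Gamma>\<^sub>0"
  using bdry_mobius_inverse(1)[OF \<Gamma>_det, of D \<aa>]
  by (auto simp: cusp_stabilizer_def \<Gamma>_closed bdry_mobius_mult[OF \<Gamma>_det] bdry_mobius_one)

lemma stab_\<Gamma>: "D \<in> \<Gamma>\<^sub>0 \<Longrightarrow> D \<in> \<Gamma>" by (simp add: cusp_stabilizer_def)

lemma cosets_eq: "cosets = coset ` \<Gamma>"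
  by (auto simp: RCOSETS_def r_coset_def coset_def SL2Z_def)

lemma coset_self: "A \<in> coset A"
  unfolding coset_def using stab_closed(2) by (metis imageI matrix_mul_lid)

lemma coset_cong:
  assumes "B \<in> coset A"
  shows "coset B = coset A"
proof -
  obtain D where D: "D \<in> \<Gamma>\<^sub>0" "B = D ** A" using assms by (auto simp: coset_def)
  have d: "det D = 1" using D stab_\<Gamma> \<Gamma>_det by blast
  have "E ** A \<in> coset B" if "E \<in> \<Gamma>\<^sub>0" for E
  proof -
    have "E ** A = (E ** matrix_inv D) ** B"
      unfolding D(2) by (simp add: matrix_mul_assoc matrix_inv_cancel[OF d])
    thus ?thesis unfolding coset_def using that D stab_closed by blast
  qed
  moreover have "E ** B \<in> coset A" if "E \<in> \<Gamma>\<^sub>0" for E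
    unfolding D(2) coset_def using that D stab_closed by (auto simp: matrix_mul_assoc)
  ultimately show ?thesis unfolding coset_def[of A] coset_def[of B] by (auto simp: coset_def)
qed

lemma coset_eq_iff:
  assumes "A \<in> \<Gamma>" "B \<in> \<Gamma>"
  shows "coset A = coset B \<longleftrightarrow> bdry_mobius (A ** matrix_inv B) \<aa> = \<aa>"
proof
  assume "coset A = coset B"
  hence "A \<in> coset B" using coset_self by blast
  then obtain D where "D \<in> \<Gamma>\<^sub>0" "A = D ** B" by (auto simp: coset_def)
  thus "bdry_mobius (A ** matrix_inv B) \<aa> = \<aa>"
    using \<Gamma>_det[OF assms(2)] by (simp add: matrix_inv_cancel cusp_stabilizer_def)
next
  assume *: "bdry_mobius (A ** matrix_inv B) \<aa> = \<aa>"
  have "A = (A ** matrix_inv B) ** B" using \<Gamma>_det[OF assms(2)] by (simp add: matrix_inv_cancel)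
  hence "A \<in> coset B" using * assms \<Gamma>_closed unfolding coset_def cusp_stabilizer_def by blast
  thus "coset A = coset B" by (rule coset_cong)
qed

lemma rep:
  assumes "K \<in> cosets"
  shows "rep K \<in> \<Gamma>" "coset (rep K) = K" "rep K \<in> K"
proof -
  obtain A where A: "A \<in> \<Gamma>" "K = coset A" using assms cosets_eq by auto
  show 1: "rep K \<in> K" using A coset_self by (metis someI)
  thus "coset (rep K) = K" using A coset_cong by blast
  show "rep K \<in> \<Gamma>" using 1 A stab_\<Gamma> \<Gamma>_closed by (auto simp: coset_def)
qed

lemma etrm_rep:
  assumes "A \<in> \<Gamma>" "z \<in> uhp"
  shows "etrm z (rep (coset A)) = etrm z A"
proof -
  have K: "coset A \<in> cosets" using assms cosets_eq by auto
  obtain D where D: "D \<in> \<Gamma>\<^sub>0" "rep (coset A) = D ** A" using rep(3)[OF K] by (auto simp: coset_def)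
  have "\<Gamma> \<subseteq> SL2R" using \<Gamma>_det by (auto simp: SL2R_def)
  thus ?thesis unfolding D(2)
    by (rule eisenstein_term_coset[OF _ ms scal sing D(1) assms(1) _ assms(2)]) (use D assms stab_\<Gamma> \<Gamma>_closed in auto)
qed

lemma norm_\<nu>: "A \<in> \<Gamma> \<Longrightarrow> norm (\<nu> A) = 1"
  using ms by (simp add: multiplier_system_def)

lemma norm_etrm:
  assumes "A \<in> \<Gamma>" "z \<in> uhp"
  shows "norm (etrm z A) = norm (automorphy (S ** A) z) powr (- k)"
proof -
  have nz: "automorphy (S ** A) z \<noteq> 0"
    using automorphy_nonzero[of "S ** A" z] assms \<Gamma>_det S_det by (simp add: det_mul)
  have "norm (of_real (norm (automorphy (S ** A) z)) powr (- 2 * of_real s) :: complex) = norm (automorphy (S ** A) z) powr (- 2 * s)"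
    using norm_powr_real_powr[of "of_real (norm (automorphy (S ** A) z))" "of_real (- 2 * s)"] nz by simp
  moreover have "norm (automorphy (S ** A) z powr (- of_real \<kappa>)) = norm (automorphy (S ** A) z) powr (- \<kappa>)"
    using norm_powr_real_powr'[of "- of_real \<kappa>" "automorphy (S ** A) z"] by simp
  ultimately show ?thesis
    unfolding eisenstein_term_def norm_mult complex_mod_cnj norm_\<nu>[OF assms(1)]
      norm_wcocycle[OF S_det \<Gamma>_det[OF assms(1)]]
    by (simp add: k(1) flip: powr_add)
qed

lemma row_factor:
  obtains r where "r \<noteq> 0" "\<And>(B::real^2^2) j. (S ** B) $ 2 $ j = r * (matrix_inv \<rho> ** B) $ 2 $ j"
proof -
  have "bdry_mobius \<sigma> None = bdry_mobius \<rho> None" using \<sigma>_cusp \<rho> by simp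
  then obtain \<alpha> \<beta> where ab: "\<alpha> \<noteq> 0" "\<sigma> = \<rho> ** vector [vector [\<alpha>, \<beta>], vector [0, 1 / \<alpha>]]"
    by (rule same_cusp_matrix[OF \<sigma>_det SL2Z_det[OF \<rho>(1)]])
  define U :: "real^2^2" where "U = vector [vector [\<alpha>, \<beta>], vector [0, 1 / \<alpha>]]"
  have U: "det U = 1" "U$2$1 = 0" "U$1$1 = \<alpha>" using ab by (simp_all add: U_def det_2 vector_2)
  have "S = matrix_inv U ** matrix_inv \<rho>"
    using ab(2) matrix_inv_mult[OF SL2Z_det[OF \<rho>(1)] U(1)] by (simp add: U_def)
  hence "(S ** B) $ 2 $ j = \<alpha> * (matrix_inv \<rho> ** B) $ 2 $ j" for B :: "real^2^2" and j
    using U by (simp add: matrix_mul_assoc[symmetric] mat2_mult[of "matrix_inv U"] matrix_inv_entries)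
  thus ?thesis using that ab by blast
qed

text \<open>The extra matrix \<rho>' moves the cusp \<rho>' \<infinity> to infinity, so that the
  behaviour of the series at any cusp is read off from these integral rows at large height.\<close>

definition row where
  "row \<rho>' K = (\<lfloor>(matrix_inv \<rho> ** rep K ** \<rho>') $ 2 $ 1\<rfloor>, \<lfloor>(matrix_inv \<rho> ** rep K ** \<rho>') $ 2 $ 2\<rfloor>)"

lemma row_SL2Z:
  assumes "K \<in> cosets" "\<rho>' \<in> carrier SL2Z"
  shows "matrix_inv \<rho> ** rep K ** \<rho>' \<in> carrier SL2Z"
    "of_int (fst (row \<rho>' K)) = (matrix_inv \<rho> ** rep K ** \<rho>') $ 2 $ 1"
    "of_int (snd (row \<rho>' K)) = (matrix_inv \<rho> ** rep K ** \<rho>') $ 2 $ 2"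
proof -
  show 1: "matrix_inv \<rho> ** rep K ** \<rho>' \<in> carrier SL2Z"
    by (intro SL2Z_mult_closed SL2Z_inv(1) \<rho>(1) assms(2) \<Gamma>_SL2Z[OF rep(1)[OF assms(1)]])
  show "of_int (fst (row \<rho>' K)) = (matrix_inv \<rho> ** rep K ** \<rho>') $ 2 $ 1"
    "of_int (snd (row \<rho>' K)) = (matrix_inv \<rho> ** rep K ** \<rho>') $ 2 $ 2"
    using SL2Z_entry[OF 1] unfolding row_def by (auto elim: Ints_cases)
qed

text \<open>Two matrices with equal bottom rows send the same point w to infinity, so both
  representatives send \<rho>' w to \<aa>, which puts them in one coset. Sums over cosets are thus
  dominated by sums over lattice points.\<close>

lemma row_inj:
  assumes \<rho>': "\<rho>' \<in> carrier SL2Z"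
  shows "inj_on (row \<rho>') cosets"
proof (rule inj_onI)
  fix K L assume K: "K \<in> cosets" and L: "L \<in> cosets" and eq: "row \<rho>' K = row \<rho>' L"
  define X where "X = matrix_inv \<rho> ** rep K ** \<rho>'" define Y where "Y = matrix_inv \<rho> ** rep L ** \<rho>'"
  have dets: "det X = 1" "det Y = 1" "det \<rho> = 1" "det \<rho>' = 1" "det (rep K) = 1" "det (rep L) = 1"
    using SL2Z_det[OF row_SL2Z(1)[OF K \<rho>']] SL2Z_det[OF row_SL2Z(1)[OF L \<rho>']] SL2Z_det[OF \<rho>(1)] SL2Z_det[OF \<rho>']
      \<Gamma>_det[OF rep(1)[OF K]] \<Gamma>_det[OF rep(1)[OF L]] unfolding X_def Y_def by blast+
  have "X$2$1 = Y$2$1" "X$2$2 = Y$2$2"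
    using row_SL2Z(2,3)[OF K \<rho>'] row_SL2Z(2,3)[OF L \<rho>'] eq by (simp_all add: X_def Y_def)
  hence "(X ** matrix_inv Y) $ 2 $ 1 = 0"
    using dets by (simp add: mat2_mult matrix_inv_entries)
  hence XY: "bdry_mobius (X ** matrix_inv Y) None = None" by (simp only: bdry_mobius_None_iff)
  define w where "w = bdry_mobius (matrix_inv Y) None"
  have Xw: "bdry_mobius X w = None"
    using XY unfolding w_def bdry_mobius_mult[OF det_matrix_inv[OF dets(2)]] .
  have Yw: "bdry_mobius Y w = None" unfolding w_def by (rule bdry_mobius_inverse(2)[OF dets(2)])
  have fixed: "bdry_mobius (rep J) (bdry_mobius \<rho>' w) = \<aa>"
    if "bdry_mobius (matrix_inv \<rho> ** rep J ** \<rho>') w = None" "det (rep J) = 1" for J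
  proof -
    have "bdry_mobius (matrix_inv \<rho>) (bdry_mobius (rep J) (bdry_mobius \<rho>' w)) = None"
      using that(1) unfolding bdry_mobius_mult[OF dets(4)] bdry_mobius_mult[OF that(2)] .
    thus ?thesis using bdry_mobius_inverse(2)[OF dets(3)] \<rho>(2) by metis
  qed
  have "bdry_mobius (rep K) (bdry_mobius \<rho>' w) = \<aa>" "bdry_mobius (rep L) (bdry_mobius \<rho>' w) = \<aa>"
    using fixed Xw Yw dets by (auto simp: X_def Y_def)
  hence "bdry_mobius (rep K ** matrix_inv (rep L)) \<aa> = \<aa>"
    using bdry_mobius_inverse(1)[OF dets(6)] bdry_mobius_mult[OF det_matrix_inv[OF dets(6)]] by metis
  hence "coset (rep K) = coset (rep L)" using coset_eq_iff rep(1) K L by blast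
  thus "K = L" using rep(2) K L by simp
qed

text \<open>Rows with first entry 0 give the terms that do not decay at the cusp \<rho>'
  \<infinity>; they belong to the cosets that carry this cusp to \<aa>.\<close>

lemma fst_row_eq_0_iff:
  assumes "K \<in> cosets" "\<rho>' \<in> carrier SL2Z"
  shows "fst (row \<rho>' K) = 0 \<longleftrightarrow> bdry_mobius (rep K) (bdry_mobius \<rho>' None) = \<aa>"
proof -
  have d: "det \<rho> = 1" "det \<rho>' = 1" "det (rep K) = 1" using \<rho> assms rep(1) \<Gamma>_det SL2Z_det by auto
  have "fst (row \<rho>' K) = 0 \<longleftrightarrow> bdry_mobius (matrix_inv \<rho> ** rep K ** \<rho>') None = None"
    unfolding bdry_mobius_None_iff row_SL2Z(2)[OF assms, symmetric] by simp
  also have "\<dots> \<longleftrightarrow> bdry_mobius (matrix_inv \<rho>) (bdry_mobius (rep K) (bdry_mobius \<rho>' None)) = None"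
    using d by (simp only: bdry_mobius_mult)
  also have "\<dots> \<longleftrightarrow> bdry_mobius (rep K) (bdry_mobius \<rho>' None) = \<aa>"
    using bdry_mobius_inverse[OF d(1)] \<rho>(2) by metis
  finally show ?thesis .
qed

lemma norm_automorphy_row:
  assumes "\<rho>' \<in> carrier SL2Z"
  obtains L where "L > 0" "\<And>K z. K \<in> cosets \<Longrightarrow> norm (automorphy (S ** rep K ** \<rho>') z) powr (- k)
     = L * norm (of_int (fst (row \<rho>' K)) * z + of_int (snd (row \<rho>' K))) powr (- k)"
proof -
  obtain r where l: "r \<noteq> 0" "\<And>(B::real^2^2) j. (S ** B) $ 2 $ j = r * (matrix_inv \<rho> ** B) $ 2 $ j"
    using row_factor by blast
  have "norm (automorphy (S ** rep K ** \<rho>') z) powr (- k)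
     = \<bar>r\<bar> powr (- k) * norm (of_int (fst (row \<rho>' K)) * z + of_int (snd (row \<rho>' K))) powr (- k)"
    if K: "K \<in> cosets" for K z
  proof -
    have "(of_int (fst (row \<rho>' K)) :: complex) = of_real ((matrix_inv \<rho> ** rep K ** \<rho>') $ 2 $ 1)"
      "(of_int (snd (row \<rho>' K)) :: complex) = of_real ((matrix_inv \<rho> ** rep K ** \<rho>') $ 2 $ 2)"
      using row_SL2Z(2,3)[OF K assms] by (metis of_real_of_int_eq)+
    hence "automorphy (S ** rep K ** \<rho>') z = of_real r * (of_int (fst (row \<rho>' K)) * z + of_int (snd (row \<rho>' K)))"
      unfolding automorphy_def matrix_mul_assoc[symmetric] l(2) by (simp add: algebra_simps)
    thus ?thesis by (simp add: norm_mult powr_mult)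
  qed
  thus ?thesis using that[of "\<bar>r\<bar> powr (- k)"] l(1) by simp
qed

lemma summable_automorphy:
  assumes \<rho>': "\<rho>' \<in> carrier SL2Z"
  shows "\<exists>C\<ge>0. \<forall>z\<in>uhp. (\<lambda>K. norm (automorphy (S ** rep K ** \<rho>') z) powr (- k)) summable_on cosets \<and>
      (\<Sum>\<^sub>\<infinity>K\<in>cosets. norm (automorphy (S ** rep K ** \<rho>') z) powr (- k)) \<le>
        C * (1 + min 1 (Im z) powr (- (k/4 + 1/2)) * Im z powr (- (3*k/4 - 1/2)))"
proof -
  obtain L where L: "L > 0" "\<And>K z. K \<in> cosets \<Longrightarrow> norm (automorphy (S ** rep K ** \<rho>') z) powr (- k)
     = L * norm (of_int (fst (row \<rho>' K)) * z + of_int (snd (row \<rho>' K))) powr (- k)"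
    using norm_automorphy_row[OF \<rho>'] by blast
  obtain B where B: "B \<ge> 0" "\<And>z (F::(int \<times> int) set). z \<in> uhp \<Longrightarrow> finite F \<Longrightarrow>
      (\<Sum>q\<in>F. norm (of_int (fst q) * z + of_int (snd q)) powr (- k))
        \<le> B * (1 + min 1 (Im z) powr (- (k/4 + 1/2)) * Im z powr (- (3*k/4 - 1/2)))"
    using lattice_sum_bound_full[OF k(2)] by blast
  have fin: "(\<Sum>K\<in>G. norm (automorphy (S ** rep K ** \<rho>') z) powr (- k)) \<le>
        L * B * (1 + min 1 (Im z) powr (- (k/4 + 1/2)) * Im z powr (- (3*k/4 - 1/2)))"
    if z: "z \<in> uhp" and G: "finite G" "G \<subseteq> cosets" for z G
  proof -
    have "(\<Sum>K\<in>G. norm (automorphy (S ** rep K ** \<rho>') z) powr (- k)) =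
        L * (\<Sum>K\<in>G. norm (of_int (fst (row \<rho>' K)) * z + of_int (snd (row \<rho>' K))) powr (- k))"
      using G L(2) by (simp add: sum_distrib_left subset_eq)
    also have "(\<Sum>K\<in>G. norm (of_int (fst (row \<rho>' K)) * z + of_int (snd (row \<rho>' K))) powr (- k)) =
        (\<Sum>q\<in>row \<rho>' ` G. norm (of_int (fst q) * z + of_int (snd q)) powr (- k))"
      using inj_on_subset[OF row_inj[OF \<rho>'] G(2)] by (simp add: sum.reindex)
    also have "L * \<dots> \<le> L * (B * (1 + min 1 (Im z) powr (- (k/4 + 1/2)) * Im z powr (- (3*k/4 - 1/2))))"
      using L(1) G by (intro mult_left_mono B(2) z) auto
    finally show ?thesis by (simp add: mult.assoc)
  qed
  have sm: "(\<lambda>K. norm (automorphy (S ** rep K ** \<rho>') z) powr (- k)) summable_on cosets" if "z \<in> uhp" for z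
    using fin[OF that] by (intro nonneg_bdd_above_summable_on bdd_aboveI2) auto
  show ?thesis
    by (intro exI[of _ "L * B"] conjI ballI sm infsum_le_finite_sums[OF sm] fin) (use L B in auto)
qed

text \<open>Only rows with nonzero first entry occur, so the lattice bound without a constant
  summand applies; its exponent exceeds k/2, the growth of the invariant factor.\<close>

lemma cusp_tail_bound:
  assumes \<rho>': "\<rho>' \<in> carrier SL2Z"
  shows "\<exists>C\<ge>0. \<forall>z\<in>uhp. Im z \<ge> 1 \<longrightarrow>
      (\<Sum>\<^sub>\<infinity>K\<in>{K\<in>cosets. bdry_mobius (rep K) (bdry_mobius \<rho>' None) \<noteq> \<aa>}. norm (automorphy (S ** rep K ** \<rho>') z) powr (- k)) \<le>
        C * Im z powr (- (3*k/4 - 1/2))"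
proof -
  obtain L where L: "L > 0" "\<And>K z. K \<in> cosets \<Longrightarrow> norm (automorphy (S ** rep K ** \<rho>') z) powr (- k)
     = L * norm (of_int (fst (row \<rho>' K)) * z + of_int (snd (row \<rho>' K))) powr (- k)"
    using norm_automorphy_row[OF \<rho>'] by blast
  obtain B where B: "B \<ge> 0" "\<And>z (F::(int \<times> int) set). z \<in> uhp \<Longrightarrow> finite F \<Longrightarrow> (\<forall>q\<in>F. fst q \<noteq> 0) \<Longrightarrow>
      (\<Sum>q\<in>F. norm (of_int (fst q) * z + of_int (snd q)) powr (- k))
        \<le> B * min 1 (Im z) powr (- (k/4 + 1/2)) * Im z powr (- (3*k/4 - 1/2))"
    using lattice_sum_bound[OF k(2)] by blast
  define \<T> where "\<T> = {K\<in>cosets. bdry_mobius (rep K) (bdry_mobius \<rho>' None) \<noteq> \<aa>}"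
  have fin: "(\<Sum>K\<in>G. norm (automorphy (S ** rep K ** \<rho>') z) powr (- k)) \<le> L * B * Im z powr (- (3*k/4 - 1/2))"
    if z: "z \<in> uhp" "Im z \<ge> 1" and G: "finite G" "G \<subseteq> \<T>" for z G
  proof -
    have Gc: "G \<subseteq> cosets" using G by (auto simp: \<T>_def)
    have "(\<Sum>K\<in>G. norm (automorphy (S ** rep K ** \<rho>') z) powr (- k)) =
        L * (\<Sum>K\<in>G. norm (of_int (fst (row \<rho>' K)) * z + of_int (snd (row \<rho>' K))) powr (- k))"
      using Gc L(2) by (simp add: sum_distrib_left subset_eq)
    also have "(\<Sum>K\<in>G. norm (of_int (fst (row \<rho>' K)) * z + of_int (snd (row \<rho>' K))) powr (- k)) =
        (\<Sum>q\<in>row \<rho>' ` G. norm (of_int (fst q) * z + of_int (snd q)) powr (- k))"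
      using inj_on_subset[OF row_inj[OF \<rho>'] Gc] by (simp add: sum.reindex)
    also have "L * \<dots> \<le> L * (B * min 1 (Im z) powr (- (k/4 + 1/2)) * Im z powr (- (3*k/4 - 1/2)))"
      using L(1) G fst_row_eq_0_iff[OF _ \<rho>'] by (intro mult_left_mono B(2) z) (auto simp: \<T>_def)
    also have "min 1 (Im z) = 1" using z by simp
    finally show ?thesis by (simp add: mult.assoc)
  qed
  have sm: "(\<lambda>K. norm (automorphy (S ** rep K ** \<rho>') z) powr (- k)) summable_on \<T>" if "z \<in> uhp" for z
    using summable_automorphy[OF \<rho>'] that by (auto intro: summable_on_subset_banach simp: \<T>_def)
  show ?thesis
    unfolding \<T>_def[symmetric]
    by (intro exI[of _ "L * B"] conjI ballI impI infsum_le_finite_sums[OF sm] fin) (use L B in auto)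
qed

lemma norm_etrm_mobius:
  assumes "K \<in> cosets" "det \<rho>' = 1" "z \<in> uhp"
  shows "Im (mobius \<rho>' z) powr (k / 2) * norm (etrm (mobius \<rho>' z) (rep K)) =
    Im z powr (k / 2) * norm (automorphy (S ** rep K ** \<rho>') z) powr (- k)"
proof -
  have "norm (automorphy \<rho>' z) powr (- k) * norm (automorphy (S ** rep K) (mobius \<rho>' z)) powr (- k) =
     norm (automorphy (S ** rep K ** \<rho>') z) powr (- k)"
    unfolding automorphy_mult[OF assms(2,3)] by (simp add: norm_mult powr_mult mult.commute)
  thus ?thesis
    unfolding norm_etrm[OF rep(1)[OF assms(1)] mobius_uhp[OF assms(2,3)]] Im_mobius_powr[OF assms(2,3)]
    by (simp add: mult.assoc)
qed

lemma etrm_summable: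
  assumes "z \<in> uhp"
  shows "(\<lambda>K. norm (etrm z (rep K))) summable_on cosets" "(\<lambda>K. etrm z (rep K)) summable_on cosets"
proof -
  have "mat 1 \<in> carrier SL2Z" using \<Gamma>_closed(2) \<Gamma>_SL2Z by blast
  from summable_automorphy[OF this] assms
  have "(\<lambda>K. norm (automorphy (S ** rep K) z) powr (- k)) summable_on cosets" by (simp add: matrix_mul_rid) blast
  moreover have "norm (etrm z (rep K)) = norm (automorphy (S ** rep K) z) powr (- k)" if "K \<in> cosets" for K
    using norm_etrm rep(1) that assms by blast
  ultimately show 1: "(\<lambda>K. norm (etrm z (rep K))) summable_on cosets" by (simp cong: summable_on_cong)
  thus "(\<lambda>K. etrm z (rep K)) summable_on cosets" by (rule abs_summable_summable)
qed

abbreviation "E \<equiv> eisenstein \<kappa> \<Gamma> \<nu> \<aa> \<sigma> (of_real s)"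

lemma E_eq: "z \<in> uhp \<Longrightarrow> E z = (\<Sum>\<^sub>\<infinity>K\<in>cosets. etrm z (rep K))"
  by (simp add: eisenstein_def)

lemma eisenstein_cusp_growth:
  assumes \<rho>': "\<rho>' \<in> carrier SL2Z"
  shows "\<exists>C. \<forall>z\<in>uhp. Im z \<ge> 1 \<longrightarrow> Im (mobius \<rho>' z) powr (k / 2) * norm (E (mobius \<rho>' z)) \<le> C * Im z powr (k / 2)"
proof -
  obtain C where C: "C \<ge> 0" "\<And>z. z \<in> uhp \<Longrightarrow> (\<lambda>K. norm (automorphy (S ** rep K ** \<rho>') z) powr (- k)) summable_on cosets"
    "\<And>z. z \<in> uhp \<Longrightarrow> (\<Sum>\<^sub>\<infinity>K\<in>cosets. norm (automorphy (S ** rep K ** \<rho>') z) powr (- k)) \<le>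
        C * (1 + min 1 (Im z) powr (- (k/4 + 1/2)) * Im z powr (- (3*k/4 - 1/2)))"
    using summable_automorphy[OF \<rho>'] by blast
  have "Im (mobius \<rho>' z) powr (k / 2) * norm (E (mobius \<rho>' z)) \<le> 2 * C * Im z powr (k / 2)"
    if z: "z \<in> uhp" "Im z \<ge> 1" for z
  proof -
    have d: "det \<rho>' = 1" using \<rho>' SL2Z_det by blast
    have m: "mobius \<rho>' z \<in> uhp" by (rule mobius_uhp[OF d z(1)])
    have "norm (E (mobius \<rho>' z)) \<le> (\<Sum>\<^sub>\<infinity>K\<in>cosets. norm (etrm (mobius \<rho>' z) (rep K)))"
      unfolding E_eq[OF m] by (rule norm_infsum_bound[OF etrm_summable(1)[OF m]])
    hence "Im (mobius \<rho>' z) powr (k / 2) * norm (E (mobius \<rho>' z)) \<le>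
        Im (mobius \<rho>' z) powr (k / 2) * (\<Sum>\<^sub>\<infinity>K\<in>cosets. norm (etrm (mobius \<rho>' z) (rep K)))"
      by (intro mult_left_mono) auto
    also have "\<dots> = (\<Sum>\<^sub>\<infinity>K\<in>cosets. Im z powr (k / 2) * norm (automorphy (S ** rep K ** \<rho>') z) powr (- k))"
      using norm_etrm_mobius[OF _ d z(1)] by (simp add: infsum_cmult_right'[symmetric] cong: infsum_cong)
    also have "\<dots> = Im z powr (k / 2) * (\<Sum>\<^sub>\<infinity>K\<in>cosets. norm (automorphy (S ** rep K ** \<rho>') z) powr (- k))"
      by (rule infsum_cmult_right')
    also have "\<dots> \<le> Im z powr (k / 2) * (C * (1 + min 1 (Im z) powr (- (k/4 + 1/2)) * Im z powr (- (3*k/4 - 1/2))))"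
      by (intro mult_left_mono C(3) z) auto
    also have "\<dots> \<le> Im z powr (k / 2) * (C * (1 + 1 * 1))"
    proof -
      have "Im z powr (- (3*k/4 - 1/2)) \<le> 1 powr (- (3*k/4 - 1/2))" using z k(2) by (intro powr_mono2') auto
      thus ?thesis using z C(1) by (intro mult_left_mono add_left_mono mult_mono) auto
    qed
    finally show ?thesis by (simp add: mult_ac)
  qed
  thus ?thesis by blast
qed

text \<open>The exponent is k/2 - (3k/4 - 1/2), which is negative for k > 2: once the terms that
  carry the cusp to \<aa> are removed, the series is negligible there.\<close>

lemma eisenstein_cusp_asymp:
  assumes \<rho>': "\<rho>' \<in> carrier SL2Z"
  shows "\<exists>C. \<forall>z\<in>uhp. Im z \<ge> 1 \<longrightarrow> Im (mobius \<rho>' z) powr (k / 2) * norm (E (mobius \<rho>' z)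
      - (\<Sum>K\<in>{K\<in>cosets. bdry_mobius (rep K) (bdry_mobius \<rho>' None) = \<aa>}. etrm (mobius \<rho>' z) (rep K)))
    \<le> C * Im z powr (- (k/4 - 1/2))"
proof -
  define \<T> where "\<T> = {K\<in>cosets. bdry_mobius (rep K) (bdry_mobius \<rho>' None) \<noteq> \<aa>}"
  define \<T>0 where "\<T>0 = {K\<in>cosets. bdry_mobius (rep K) (bdry_mobius \<rho>' None) = \<aa>}"
  have d: "det \<rho>' = 1" using \<rho>' SL2Z_det by blast
  \<comment> \<open>There is at most one such coset: two elements that carry the cusp to \<aa>
    differ on the left by an element of the stabilizer.\<close>
  have "finite \<T>0"
  proof -
    have "K = L" if K: "K \<in> \<T>0" and L: "L \<in> \<T>0" for K L
    proof -
      have c: "K \<in> cosets" "L \<in> cosets" using K L by (auto simp: \<T>0_def)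
      have dd: "det (rep L) = 1" "det (rep K) = 1" using rep(1) c \<Gamma>_det by auto
      have "bdry_mobius (matrix_inv (rep L)) \<aa> = bdry_mobius \<rho>' None"
        using L bdry_mobius_inverse(1)[OF dd(1)] unfolding \<T>0_def by (metis (mono_tags, lifting) mem_Collect_eq)
      hence "bdry_mobius (rep K ** matrix_inv (rep L)) \<aa> = \<aa>"
        using K dd by (simp add: \<T>0_def bdry_mobius_mult det_matrix_inv del: bdry_mobius.simps)
      hence "coset (rep K) = coset (rep L)" using coset_eq_iff rep(1) c by blast
      thus ?thesis using rep(2) c by simp
    qed
    hence "\<T>0 \<subseteq> {K}" if "K \<in> \<T>0" for K using that by blast
    thus ?thesis by (metis ex_in_conv finite.emptyI finite_insert finite_subset)
  qed
  obtain C where C: "C \<ge> 0" "\<And>z. z \<in> uhp \<Longrightarrow> Im z \<ge> 1 \<Longrightarrow>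
      (\<Sum>\<^sub>\<infinity>K\<in>\<T>. norm (automorphy (S ** rep K ** \<rho>') z) powr (- k)) \<le> C * Im z powr (- (3*k/4 - 1/2))"
    using cusp_tail_bound[OF \<rho>'] unfolding \<T>_def by blast
  have "Im (mobius \<rho>' z) powr (k / 2) * norm (E (mobius \<rho>' z) - (\<Sum>K\<in>\<T>0. etrm (mobius \<rho>' z) (rep K))) \<le>
      C * Im z powr (- (k/4 - 1/2))"
    if z: "z \<in> uhp" "Im z \<ge> 1" for z
  proof -
    have m: "mobius \<rho>' z \<in> uhp" by (rule mobius_uhp[OF d z(1)])
    have part: "cosets = \<T>0 \<union> \<T>" "\<T>0 \<inter> \<T> = {}" by (auto simp: \<T>_def \<T>0_def)
    have sT: "(\<lambda>K. etrm (mobius \<rho>' z) (rep K)) summable_on \<T>" "(\<lambda>K. norm (etrm (mobius \<rho>' z) (rep K))) summable_on \<T>"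
      using etrm_summable[OF m] part by (auto intro: summable_on_subset_banach)
    have "E (mobius \<rho>' z) = infsum (\<lambda>K. etrm (mobius \<rho>' z) (rep K)) (\<T>0 \<union> \<T>)"
      unfolding E_eq[OF m] part(1)[symmetric] ..
    also have "\<dots> = (\<Sum>K\<in>\<T>0. etrm (mobius \<rho>' z) (rep K)) + (\<Sum>\<^sub>\<infinity>K\<in>\<T>. etrm (mobius \<rho>' z) (rep K))"
      using \<open>finite \<T>0\<close> part sT by (subst infsum_Un_disjoint) auto
    finally have "norm (E (mobius \<rho>' z) - (\<Sum>K\<in>\<T>0. etrm (mobius \<rho>' z) (rep K))) \<le>
        (\<Sum>\<^sub>\<infinity>K\<in>\<T>. norm (etrm (mobius \<rho>' z) (rep K)))"
      using norm_infsum_bound[OF sT(2)] by simp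
    hence "Im (mobius \<rho>' z) powr (k / 2) * norm (E (mobius \<rho>' z) - (\<Sum>K\<in>\<T>0. etrm (mobius \<rho>' z) (rep K))) \<le>
        Im (mobius \<rho>' z) powr (k / 2) * (\<Sum>\<^sub>\<infinity>K\<in>\<T>. norm (etrm (mobius \<rho>' z) (rep K)))"
      by (intro mult_left_mono) auto
    also have "\<dots> = (\<Sum>\<^sub>\<infinity>K\<in>\<T>. Im z powr (k / 2) * norm (automorphy (S ** rep K ** \<rho>') z) powr (- k))"
      using norm_etrm_mobius[OF _ d z(1)] part by (simp add: infsum_cmult_right'[symmetric] cong: infsum_cong)
    also have "\<dots> = Im z powr (k / 2) * (\<Sum>\<^sub>\<infinity>K\<in>\<T>. norm (automorphy (S ** rep K ** \<rho>') z) powr (- k))"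
      by (rule infsum_cmult_right')
    also have "\<dots> \<le> Im z powr (k / 2) * (C * Im z powr (- (3*k/4 - 1/2)))"
      by (intro mult_left_mono C(2) z) auto
    also have "\<dots> = C * Im z powr (k / 2 + (- (3*k/4 - 1/2)))" by (simp only: powr_add mult_ac)
    also have "k / 2 + (- (3*k/4 - 1/2)) = - (k/4 - 1/2)" by simp
    finally show ?thesis .
  qed
  thus ?thesis unfolding \<T>0_def by blast
qed

text \<open>Up to an absolute value the inverse of a term is \<open>F\<close>, which can be written
  with a product of two principal powers instead of the power of a product. In this form the
  multiplier relation for B A splits off a factor that depends on A alone.\<close>

lemma etrm_mobius:
  assumes A: "A \<in> \<Gamma>" and B: "B \<in> \<Gamma>" and z: "z \<in> uhp"
  shows "etrm (mobius A z) B = \<nu> A * automorphy A z powr of_real \<kappa> * of_real (norm (automorphy A z)) powr (2 * of_real s)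
    * etrm z (B ** A)"
proof -
  have dets: "det A = 1" "det B = 1" "det (B ** A) = 1" using A B \<Gamma>_det \<Gamma>_closed by auto
  have Az: "mobius A z \<in> uhp" by (rule mobius_uhp[OF dets(1) z])
  define F where "F = (\<lambda>C w. \<nu> C * wcocycle \<kappa> S C * automorphy (S ** C) w powr of_real \<kappa>)"
  have F: "F C w = \<nu> C * (automorphy S (mobius C w) powr of_real \<kappa> * automorphy C w powr of_real \<kappa>)"
    if "C \<in> \<Gamma>" "w \<in> uhp" for C w
    unfolding F_def wcocycle_powr[OF S_det \<Gamma>_det[OF that(1)] that(2), symmetric] by (simp add: mult.assoc)
  have e: "etrm w C = inverse (F C w) * of_real (norm (automorphy (S ** C) w)) powr (- 2 * of_real s)" if "C \<in> \<Gamma>" for C w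
  proof -
    have "cnj (\<nu> C) = inverse (\<nu> C)" "cnj (wcocycle \<kappa> S C) = inverse (wcocycle \<kappa> S C)"
      using norm_\<nu>[OF that] norm_wcocycle[OF S_det \<Gamma>_det[OF that]]
      by (simp_all add: inverse_eq_divide complex_div_cnj[of 1])
    thus ?thesis by (simp add: eisenstein_term_def F_def powr_minus)
  qed
  have "\<nu> (B ** A) = \<nu> B * \<nu> A * wcocycle \<kappa> B A" using ms A B by (simp add: multiplier_system_def)
  moreover have "wcocycle \<kappa> B A * automorphy (B ** A) z powr of_real \<kappa>
      = automorphy B (mobius A z) powr of_real \<kappa> * automorphy A z powr of_real \<kappa>"
    by (rule wcocycle_powr[OF dets(2,1) z])
  ultimately have FBA: "F (B ** A) z = F B (mobius A z) * (\<nu> A * automorphy A z powr of_real \<kappa>)"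
    unfolding F[OF \<Gamma>_closed(1)[OF B A] z] F[OF B Az] mobius_mult[OF dets(1) z] 
    by (simp add: mult_ac)
  have nzA: "automorphy A z \<noteq> 0" by (rule automorphy_nonzero[OF dets(1) z])
  have nz: "\<nu> A \<noteq> 0" "automorphy A z powr of_real \<kappa> \<noteq> 0" using norm_\<nu>[OF A] nzA by auto
  define u where "u = norm (automorphy A z)" define v where "v = norm (automorphy (S ** B) (mobius A z))"
  have uv: "u > 0" "v > 0"
    using nzA automorphy_nonzero[of "S ** B" "mobius A z"] Az dets S_det by (simp_all add: u_def v_def det_mul)
  have "norm (automorphy (S ** (B ** A)) z) = v * u"
    by (simp add: matrix_mul_assoc automorphy_mult[OF dets(1) z] norm_mult u_def v_def)
  moreover have "(of_real (v * u) :: complex) powr (- 2 * of_real s) = of_real v powr (- 2 * of_real s) * of_real u powr (- 2 * of_real s)"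
    using uv by (simp add: powr_times_real)
  moreover have "(of_real u :: complex) powr (2 * of_real s) * of_real u powr (- 2 * of_real s) = 1"
    using uv by (simp flip: powr_add)
  ultimately show ?thesis
    unfolding e[OF B] e[OF \<Gamma>_closed(1)[OF B A]] FBA u_def[symmetric] v_def[symmetric]
    using nz by (simp add: field_simps)
qed

lemma E_transform:
  assumes A: "A \<in> \<Gamma>" and z: "z \<in> uhp"
  shows "E (mobius A z) = \<nu> A * automorphy A z powr of_real \<kappa> * of_real (norm (automorphy A z)) powr (2 * of_real s) * E z"
proof -
  have Az: "mobius A z \<in> uhp" by (rule mobius_uhp[OF \<Gamma>_det[OF A] z])
  define c where "c = \<nu> A * automorphy A z powr of_real \<kappa> * of_real (norm (automorphy A z)) powr (2 * of_real s)"
  \<comment> \<open>Right multiplication by A permutes the cosets; it need not respect the chosen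
    representatives, but the terms do not depend on them.\<close>
  define g where "g = (\<lambda>K. coset (rep K ** A))"
  have g_coset: "g (coset B) = coset (B ** A)" if "B \<in> \<Gamma>" for B
  proof -
    have "coset B \<in> cosets" using that cosets_eq by auto
    then obtain D where D: "D \<in> \<Gamma>\<^sub>0" "rep (coset B) = D ** B" using rep(3) by (auto simp: coset_def)
    have "D ** B ** A \<in> coset (B ** A)" unfolding coset_def using D by (auto simp: matrix_mul_assoc)
    thus ?thesis unfolding g_def D(2) by (rule coset_cong)
  qed
  have bij: "bij_betw g cosets cosets"
  proof (rule bij_betwI[where g = "\<lambda>K. coset (rep K ** matrix_inv A)"])
    have h: "coset (rep (coset B) ** matrix_inv A) = coset (B ** matrix_inv A)" if "B \<in> \<Gamma>" for B
    proof -
      have "coset B \<in> cosets" using that cosets_eq by auto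
      then obtain D where D: "D \<in> \<Gamma>\<^sub>0" "rep (coset B) = D ** B" using rep(3) by (auto simp: coset_def)
      have "D ** B ** matrix_inv A \<in> coset (B ** matrix_inv A)" unfolding coset_def using D by (auto simp: matrix_mul_assoc)
      thus ?thesis unfolding D(2) by (rule coset_cong)
    qed
    show "g \<in> cosets \<rightarrow> cosets" "(\<lambda>K. coset (rep K ** matrix_inv A)) \<in> cosets \<rightarrow> cosets"
      using rep(1) A \<Gamma>_closed by (auto simp: g_def cosets_eq)
    fix K assume K: "K \<in> cosets"
    have r: "rep K \<in> \<Gamma>" by (rule rep(1)[OF K])
    show "coset (rep (g K) ** matrix_inv A) = K"
      unfolding g_def h[OF \<Gamma>_closed(1)[OF r A]] by (simp add: matrix_inv_cancel[OF \<Gamma>_det[OF A]] rep(2)[OF K])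
    show "g (coset (rep K ** matrix_inv A)) = K"
      unfolding g_coset[OF \<Gamma>_closed(1)[OF r \<Gamma>_closed(3)[OF A]]]
      by (simp add: matrix_inv_cancel[OF \<Gamma>_det[OF A]] rep(2)[OF K])
  qed
  have "E (mobius A z) = (\<Sum>\<^sub>\<infinity>K\<in>cosets. c * etrm z (rep (g K)))"
    unfolding E_eq[OF Az]
  proof (rule infsum_cong)
    fix K assume K: "K \<in> cosets"
    have r: "rep K \<in> \<Gamma>" by (rule rep(1)[OF K])
    show "etrm (mobius A z) (rep K) = c * etrm z (rep (g K))"
      unfolding g_def etrm_rep[OF \<Gamma>_closed(1)[OF r A] z] etrm_mobius[OF A r z] c_def ..
  qed
  also have "\<dots> = c * (\<Sum>\<^sub>\<infinity>K\<in>cosets. etrm z (rep (g K)))" by (rule infsum_cmult_right')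
  also have "(\<Sum>\<^sub>\<infinity>K\<in>cosets. etrm z (rep (g K))) = (\<Sum>\<^sub>\<infinity>K\<in>cosets. etrm z (rep K))"
    by (rule infsum_reindex_bij_betw[OF bij])
  finally show ?thesis by (simp add: c_def E_eq[OF z])
qed

end

section \<open>Mock Eisenstein series are harmonic\<close>

lemma smooth_on_cong:
  assumes "open S" "smooth_on S g" "\<And>z. z \<in> S \<Longrightarrow> f z = g z"
  shows "smooth_on S f"
proof (rule smooth_on_coinduct[where P = "\<lambda>f. \<exists>g. smooth_on S g \<and> (\<forall>z\<in>S. f z = g z)", OF assms(1)])
  show "\<exists>g. smooth_on S g \<and> (\<forall>z\<in>S. f z = g z)" using assms by blast
  fix f assume "\<exists>g. smooth_on S g \<and> (\<forall>z\<in>S. f z = g z)"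
  then obtain g where g: "smooth_on S g" "\<And>z. z \<in> S \<Longrightarrow> f z = g z" by blast
  have "(f has_derivative frechet_derivative g (at z)) (at z)" if "z \<in> S" for z
    by (rule has_derivative_transform_within_open[OF smooth_onD(1)[OF g(1) that] assms(1) that]) (simp add: g(2))
  moreover have "\<exists>h. (\<exists>ga. smooth_on S ga \<and> (\<forall>z\<in>S. h z = ga z)) \<and> (\<forall>z\<in>S. frechet_derivative g (at z) v = h z)" for v
    by (intro exI[of _ "\<lambda>z. frechet_derivative g (at z) v"] conjI) (auto intro!: smooth_onD(2)[OF g(1)])
  ultimately show "\<exists>D. \<forall>z\<in>S. (f has_derivative D z) (at z) \<and>
       (\<forall>v. \<exists>g. (\<exists>ga. smooth_on S ga \<and> (\<forall>z\<in>S. g z = ga z)) \<and> (\<forall>z\<in>S. D z v = g z))"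
    by (intro exI[of _ "\<lambda>z. frechet_derivative g (at z)"] ballI conjI allI) simp_all
qed

lemma xi_bar_lincomb:
  assumes "smooth_on uhp f" "smooth_on uhp g" "z \<in> uhp"
  shows "xi_bar \<kappa> (cfun_scale c f + g) z = c * xi_bar \<kappa> f z + xi_bar \<kappa> g z"
proof -
  have "(f has_derivative (\<lambda>h. d_dz f z * h + d_dzbar f z * cnj h)) (at z)"
    "(g has_derivative (\<lambda>h. d_dz g z * h + d_dzbar g z * cnj h)) (at z)"
    using smooth_onD(1)[OF assms(1,3)] smooth_onD(1)[OF assms(2,3)]
    by (auto intro!: has_derivative_Wirtinger simp: differentiable_def)
  hence "((\<lambda>z. c * f z + g z) has_derivative (\<lambda>h. c * (d_dz f z * h + d_dzbar f z * cnj h) + (d_dz g z * h + d_dzbar g z * cnj h))) (at z)"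
    by (intro has_derivative_add has_derivative_mult_right)
  moreover have "(\<lambda>h. c * (d_dz f z * h + d_dzbar f z * cnj h) + (d_dz g z * h + d_dzbar g z * cnj h))
     = (\<lambda>h. (c * d_dz f z + d_dz g z) * h + (c * d_dzbar f z + d_dzbar g z) * cnj h)"
    by (simp add: fun_eq_iff algebra_simps)
  ultimately have "(cfun_scale c f + g has_derivative (\<lambda>h. (c * d_dz f z + d_dz g z) * h + (c * d_dzbar f z + d_dzbar g z) * cnj h)) (at z)"
    by (simp add: cfun_scale_def plus_fun_def)
  from Wirtinger_eqs(2)[OF this] show ?thesis by (simp add: xi_bar_def algebra_simps)
qed

text \<open>Moduli of real powers obey the law of exponents whatever the branch, so the invariant
  norm of f at \<rho> z is that of its slash transform at z.\<close>

lemma slash_norm: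
  assumes "det \<rho> = 1" "z \<in> uhp"
  shows "Im z powr (\<kappa> / 2) * norm (automorphy \<rho> z powr (- of_real \<kappa>) * f (mobius \<rho> z)) =
    Im (mobius \<rho> z) powr (\<kappa> / 2) * norm (f (mobius \<rho> z))"
proof -
  have "norm (automorphy \<rho> z powr (- of_real \<kappa>)) = norm (automorphy \<rho> z) powr (- \<kappa>)"
    using norm_powr_real_powr'[of "- of_real \<kappa>" "automorphy \<rho> z"] by simp
  thus ?thesis unfolding Im_mobius_powr[OF assms] by (simp add: norm_mult)
qed

text \<open>The definition of growth quantifies over all real matrices that carry infinity to the
  cusp. They differ from \<rho> by a map z to \<alpha>^2 z + \<alpha> \<beta>, so a bound on the
  invariant norm for one \<rho> suffices.\<close>

lemma polynomial_growth_atI: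
  assumes \<rho>: "det \<rho> = 1" "bdry_mobius \<rho> None = \<aa>"
    and bd: "\<And>z. z \<in> uhp \<Longrightarrow> Im z \<ge> 1 \<Longrightarrow> Im (mobius \<rho> z) powr (\<kappa> / 2) * norm (f (mobius \<rho> z)) \<le> C * Im z powr e"
  shows "polynomial_growth_at \<kappa> f \<aa>"
  unfolding polynomial_growth_at_def
proof (intro ballI impI)
  fix \<sigma> assume \<sigma>: "\<sigma> \<in> SL2R" "bdry_mobius \<sigma> None = \<aa>"
  hence d: "det \<sigma> = 1" by (simp add: SL2R_def)
  obtain \<alpha> \<beta> where ab: "\<alpha> \<noteq> 0" "\<And>z. z \<in> uhp \<Longrightarrow> mobius \<sigma> z = mobius \<rho> (of_real (\<alpha>\<^sup>2) * z + of_real (\<alpha> * \<beta>))"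
    using same_cusp_matrix[OF d \<rho>(1)] \<sigma>(2) \<rho>(2) by metis
  have "norm (automorphy \<sigma> z powr (- of_real \<kappa>) * f (mobius \<sigma> z)) \<le> C * (\<alpha>\<^sup>2) powr e * Im z powr (e - \<kappa> / 2)"
    if z: "z \<in> uhp" "Im z \<ge> 1 / \<alpha>\<^sup>2" for z
  proof -
    define w where "w = of_real (\<alpha>\<^sup>2) * z + of_real (\<alpha> * \<beta>)"
    have y: "Im z > 0" using z by (simp add: uhp_def)
    have mw: "mobius \<sigma> z = mobius \<rho> w" unfolding w_def by (rule ab(2)[OF z(1)])
    have Imw: "Im w = \<alpha>\<^sup>2 * Im z" by (simp add: w_def)
    have w: "w \<in> uhp" "Im w \<ge> 1" using y ab(1) z(2) by (simp_all add: uhp_def Imw field_simps)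
    have "Im z powr (\<kappa> / 2) * norm (automorphy \<sigma> z powr (- of_real \<kappa>) * f (mobius \<sigma> z)) \<le> C * (\<alpha>\<^sup>2 * Im z) powr e"
      unfolding slash_norm[OF d z(1)] unfolding mw using bd[OF w] unfolding Imw .
    hence "Im z powr (- (\<kappa> / 2)) * (Im z powr (\<kappa> / 2) * norm (automorphy \<sigma> z powr (- of_real \<kappa>) * f (mobius \<sigma> z))) \<le>
        Im z powr (- (\<kappa> / 2)) * (C * (\<alpha>\<^sup>2 * Im z) powr e)"
      by (rule mult_left_mono) simp
    moreover have "Im z powr (- (\<kappa> / 2)) * (Im z powr (\<kappa> / 2) * x) = x" for x
      using y by (simp add: mult.assoc[symmetric] flip: powr_add)
    moreover have "Im z powr (- (\<kappa> / 2)) * (C * (\<alpha>\<^sup>2 * Im z) powr e) = C * (\<alpha>\<^sup>2) powr e * Im z powr (e - \<kappa> / 2)"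
    proof -
      have p1: "(\<alpha>\<^sup>2 * Im z) powr e = (\<alpha>\<^sup>2) powr e * Im z powr e" by (rule powr_mult)
      have p2: "Im z powr (e - \<kappa> / 2) = Im z powr (- (\<kappa> / 2)) * Im z powr e" by (simp flip: powr_add)
      show ?thesis unfolding p1 p2 by (simp only: mult_ac)
    qed
    ultimately show ?thesis by simp
  qed
  thus "\<exists>a C Y. \<forall>z\<in>uhp. Im z \<ge> Y \<longrightarrow> norm (automorphy \<sigma> z powr (- of_real \<kappa>) * f (mobius \<sigma> z)) \<le> C * Im z powr a"
    by blast
qed

section \<open>Linear structure of the space of harmonic forms\<close>

lemma H_sharp_lincomb:
  assumes f: "f \<in> H_sharp \<kappa> \<Gamma> \<nu>" and g: "g \<in> H_sharp \<kappa> \<Gamma> \<nu>"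
  shows "cfun_scale c f + g \<in> H_sharp \<kappa> \<Gamma> \<nu>"
proof -
  have sm: "smooth_on uhp f" "smooth_on uhp g" using f g by (auto simp: H_sharp_def)
  have "(\<lambda>z. cnj (c * xi_bar \<kappa> f z + xi_bar \<kappa> g z)) holomorphic_on uhp"
    using f g weight_laplacian_zero_iff[OF sm(1)] weight_laplacian_zero_iff[OF sm(2)]
    by (auto simp: H_sharp_def intro!: holomorphic_intros)
  hence "(\<lambda>z. cnj (xi_bar \<kappa> (cfun_scale c f + g) z)) holomorphic_on uhp"
    by (rule holomorphic_transform) (simp add: xi_bar_lincomb[OF sm])
  hence 1: "\<forall>z\<in>uhp. weight_laplacian \<kappa> (cfun_scale c f + g) z = 0"
    using weight_laplacian_zero_iff[OF smooth_on_lincomb[OF open_uhp sm]] by blast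
  have 2: "polynomial_growth_at \<kappa> (cfun_scale c f + g) \<aa>" if \<aa>: "\<aa> \<in> cusps" for \<aa>
    unfolding polynomial_growth_at_def
  proof (intro ballI impI)
    fix \<sigma> assume \<sigma>: "\<sigma> \<in> SL2R" "bdry_mobius \<sigma> None = \<aa>"
    have "polynomial_growth_at \<kappa> f \<aa>" "polynomial_growth_at \<kappa> g \<aa>" using f g \<aa> by (auto simp: H_sharp_def)
    then obtain a1 C1 Y1 a2 C2 Y2 where
      b1: "\<And>z. z \<in> uhp \<Longrightarrow> Im z \<ge> Y1 \<Longrightarrow> norm (automorphy \<sigma> z powr (- of_real \<kappa>) * f (mobius \<sigma> z)) \<le> C1 * Im z powr a1" and
      b2: "\<And>z. z \<in> uhp \<Longrightarrow> Im z \<ge> Y2 \<Longrightarrow> norm (automorphy \<sigma> z powr (- of_real \<kappa>) * g (mobius \<sigma> z)) \<le> C2 * Im z powr a2"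
      using \<sigma> unfolding polynomial_growth_at_def by metis
    have "norm (automorphy \<sigma> z powr (- of_real \<kappa>) * (cfun_scale c f + g) (mobius \<sigma> z)) \<le>
        (norm c * \<bar>C1\<bar> + \<bar>C2\<bar>) * Im z powr (max a1 a2)"
      if z: "z \<in> uhp" "Im z \<ge> max 1 (max Y1 Y2)" for z
    proof -
      let ?j = "automorphy \<sigma> z powr (- of_real \<kappa>)"
      have p: "Im z powr a1 \<le> Im z powr (max a1 a2)" "Im z powr a2 \<le> Im z powr (max a1 a2)"
        using z by (auto intro!: powr_mono)
      have "norm (?j * (cfun_scale c f + g) (mobius \<sigma> z)) =
          norm (c * (?j * f (mobius \<sigma> z)) + ?j * g (mobius \<sigma> z))"
        by (simp add: cfun_scale_def algebra_simps)
      also have "\<dots> \<le> norm c * norm (?j * f (mobius \<sigma> z)) + norm (?j * g (mobius \<sigma> z))"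
        by (rule order_trans[OF norm_triangle_ineq]) (simp add: norm_mult)
      also have "\<dots> \<le> norm c * (\<bar>C1\<bar> * Im z powr (max a1 a2)) + \<bar>C2\<bar> * Im z powr (max a1 a2)"
      proof (intro add_mono mult_left_mono)
        show "norm (?j * f (mobius \<sigma> z)) \<le> \<bar>C1\<bar> * Im z powr (max a1 a2)"
          by (rule order_trans[OF b1 mult_mono]) (use z p in auto)
        show "norm (?j * g (mobius \<sigma> z)) \<le> \<bar>C2\<bar> * Im z powr (max a1 a2)"
          by (rule order_trans[OF b2 mult_mono]) (use z p in auto)
      qed auto
      finally show ?thesis by (simp add: algebra_simps)
    qed
    thus "\<exists>a C Y. \<forall>z\<in>uhp. Im z \<ge> Y \<longrightarrow>
        norm (automorphy \<sigma> z powr (- of_real \<kappa>) * (cfun_scale c f + g) (mobius \<sigma> z)) \<le> C * Im z powr a" by blast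
  qed
  show ?thesis
    unfolding H_sharp_def using f g 1 2 smooth_on_lincomb[OF open_uhp sm]
    by (auto simp: H_sharp_def cfun_scale_def algebra_simps)
qed

lemma H_sharp_zero: "0 \<in> H_sharp \<kappa> \<Gamma> \<nu>"
proof -
  have sm: "smooth_on uhp (0 :: complex \<Rightarrow> complex)"
    by (rule smooth_on_span[OF open_uhp cfun.span_zero, of "{}"]) auto
  have "((0 :: complex \<Rightarrow> complex) has_derivative (\<lambda>h. 0 * h + 0 * cnj h)) (at z)" for z
    by (simp add: zero_fun_def)
  hence "d_dzbar 0 z = 0" for z by (rule Wirtinger_eqs)
  hence "(\<lambda>z. cnj (xi_bar \<kappa> 0 z)) holomorphic_on uhp" by (simp add: xi_bar_def)
  hence 1: "\<forall>z\<in>uhp. weight_laplacian \<kappa> 0 z = 0" using weight_laplacian_zero_iff[OF sm] by blast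
  have "polynomial_growth_at \<kappa> 0 \<aa>" for \<aa>
    unfolding polynomial_growth_at_def by (auto intro!: exI[of _ 0])
  thus ?thesis using sm 1 by (auto simp: H_sharp_def)
qed

lemma H_sharp_subspace: "cfun.subspace (H_sharp \<kappa> \<Gamma> \<nu>)"
proof (rule cfun.subspaceI)
  fix f g assume fg: "f \<in> H_sharp \<kappa> \<Gamma> \<nu>" "g \<in> H_sharp \<kappa> \<Gamma> \<nu>"
  show "f + g \<in> H_sharp \<kappa> \<Gamma> \<nu>" using H_sharp_lincomb[OF fg, of 1] by simp
next
  fix c f assume f: "f \<in> H_sharp \<kappa> \<Gamma> \<nu>"
  show "cfun_scale c f \<in> H_sharp \<kappa> \<Gamma> \<nu>" using H_sharp_lincomb[OF f H_sharp_zero, of c] by simp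
qed (rule H_sharp_zero)

section \<open>Termwise differentiation of the mock Eisenstein series\<close>

locale mock_setup = eisenstein_setup \<Gamma> \<nu> "2 - k" "k - 1" k \<aa> \<sigma> \<rho>
  for \<Gamma> :: "(real^2^2) set" and \<nu> :: "real^2^2 \<Rightarrow> complex" and k :: real and \<aa> :: "real option" and \<sigma> \<rho> :: "real^2^2"
begin

definition "phase K = cnj (\<nu> (rep K)) * cnj (wcocycle (2 - k) S (rep K))"
definition "jc K = (S ** rep K) $ 2 $ 1"
definition "jf K z = automorphy (S ** rep K) z"

text \<open>Up to constants and powers of \<open>y\<close>, the derivatives of all orders of the terms of the series are
  \<open>c\<^bsup>p+q-1\<^esup> j\<^bsup>-p\<^esup> \<close> times the conjugate of \<open>j\<^bsup>1-k-q\<^esup>\<close>; the series itself has \<open>p = 1\<close>, \<open>q = 0\<close>.\<close>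

definition "gt p q K z = phase K * of_real (jc K ^ (p + q - 1)) * inverse (jf K z) ^ p
    * cnj (jf K z powr of_real (1 - k - real q))"

definition "G p q z = (\<Sum>\<^sub>\<infinity>K\<in>cosets. gt p q K z)"

lemma det_rep: "K \<in> cosets \<Longrightarrow> det (S ** rep K) = 1"
  using rep(1) \<Gamma>_det S_det by (simp add: det_mul)

lemma jf_nz: "K \<in> cosets \<Longrightarrow> z \<in> uhp \<Longrightarrow> jf K z \<noteq> 0"
  unfolding jf_def by (rule automorphy_nonzero[OF det_rep])

lemma norm_phase: "K \<in> cosets \<Longrightarrow> norm (phase K) = 1"
  using norm_\<nu>[OF rep(1)] norm_wcocycle[OF S_det \<Gamma>_det[OF rep(1)]] by (simp add: phase_def norm_mult)

lemma jf_eq: "jf K z = of_real (jc K) * z + of_real ((S ** rep K) $ 2 $ 2)"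
  by (simp add: jf_def jc_def automorphy_def)

text \<open>On the principal branch j^(k-2) |j|^(-2(k-1)) is 1/j times the conjugate of j^(1-k),
  because 2 Re log j is the sum of log j and its conjugate. The term thus splits into a holomorphic
  and an antiholomorphic factor.\<close>

lemma etrm_gt:
  assumes "K \<in> cosets" "z \<in> uhp"
  shows "etrm z (rep K) = gt 1 0 K z"
proof -
  define j where "j = jf K z"
  have j: "j \<noteq> 0" using jf_nz[OF assms] by (simp add: j_def)
  define L where "L = Ln j"
  have eL: "exp L = j" using j by (simp add: L_def)
  have "of_real (norm j) = exp (of_real (Re L) :: complex)" 
    using j by (simp add: L_def Re_Ln exp_of_real)
  hence nj: "(of_real (norm j) :: complex) powr (- 2 * of_real (k - 1)) = exp (- 2 * of_real (k - 1) * of_real (Re L))"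
    using j by (simp add: powr_def Ln_of_real L_def Re_Ln)
  have "j powr (- of_real (2 - k)) * (of_real (norm j) :: complex) powr (- 2 * of_real (k - 1))
      = exp (- of_real (2 - k) * L + - 2 * of_real (k - 1) * of_real (Re L))"
    unfolding nj exp_add using j by (simp add: powr_def L_def)
  also have "2 * of_real (Re L) = L + cnj L" by (simp add: complex_eq_iff)
  hence "- of_real (2 - k) * L + - 2 * of_real (k - 1) * of_real (Re L) = - of_real (2 - k) * L - of_real (k - 1) * (L + cnj L)"
    by (metis (no_types, lifting) add_uminus_conv_diff mult.assoc mult.left_commute mult_minus_left)
  also have "\<dots> = - L + cnj (of_real (1 - k) * L)" by (simp add: algebra_simps)
  also have "exp \<dots> = inverse j * cnj (j powr of_real (1 - k))"
    using j unfolding exp_add exp_minus eL by (simp add: powr_def L_def exp_cnj)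
  finally show ?thesis
    by (simp add: eisenstein_term_def gt_def phase_def jf_def j_def mult.assoc)
qed

lemma gt_has_derivative:
  assumes K: "K \<in> cosets" and z: "z \<in> uhp" and pq: "p + q \<ge> 1"
  shows "(gt p q K has_derivative (\<lambda>h. - of_nat p * gt (p + 1) q K z * h
      + of_real (1 - k - real q) * gt p (q + 1) K z * cnj h)) (at z)"
\<comment> \<open>If c = 0 then j is a constant, possibly a negative real on the branch cut; the
  term is constant, and the claimed derivatives vanish through the factor c^(p+q). The condition p +
  q \<ge> 1 lets the exponent p + q - 1 rise to p + q without truncation at 0.\<close>
proof (cases "jc K = 0")
  case True
  have j: "jf K = (\<lambda>z. jf K 0)" by (simp add: fun_eq_iff jf_eq True)
  have "gt p q K w = gt p q K 0" for w using fun_cong[OF j, of w] by (simp add: gt_def)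
  moreover have "gt (p + 1) q K z = 0" "gt p (q + 1) K z = 0" using pq True by (auto simp: gt_def)
  ultimately show ?thesis by (metis (no_types, lifting) add_0 has_derivative_const has_derivative_transform UNIV_I mult_eq_0_iff ext)
next
  case False
  define c where "c = jc K" define r where "r = 1 - k - real q" define j where "j = jf K z"
  have jnz: "j \<noteq> 0" using jf_nz[OF K z] by (simp add: j_def)
  have "Im j \<noteq> 0" using False z by (simp add: j_def jf_eq uhp_def)
  hence jnp: "j \<notin> \<real>\<^sub>\<le>\<^sub>0" by (auto simp: complex_nonpos_Reals_iff)
  have dj: "(jf K has_field_derivative of_real c) (at z)"
    unfolding jf_eq[abs_def] c_def by (auto intro!: derivative_eq_intros)
  have d1: "((\<lambda>z. inverse (jf K z) ^ p) has_field_derivative - of_nat p * of_real c * inverse j ^ (p + 1)) (at z)"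
  proof -
    have "((\<lambda>z. inverse (jf K z)) has_field_derivative - (inverse j * of_real c * inverse j)) (at z)"
      using DERIV_inverse'[OF dj] jnz by (simp add: j_def)
    from DERIV_power[OF this, of p] show ?thesis
      by (rule DERIV_cong) (cases p, auto simp: j_def algebra_simps)
  qed
  have d2: "((\<lambda>z. jf K z powr of_real r) has_field_derivative of_real r * j powr (of_real r - 1) * of_real c) (at z)"
    using DERIV_chain2[OF has_field_derivative_powr[OF jnp, unfolded j_def] dj] by (simp add: j_def)
  have D1: "((\<lambda>z. inverse (jf K z) ^ p) has_derivative (\<lambda>h. (- of_nat p * of_real c * inverse j ^ (p + 1)) * h)) (at z)"
    by (rule d1[unfolded has_field_derivative_def])
  have D2: "((\<lambda>z. cnj (jf K z powr of_real r)) has_derivative (\<lambda>h. cnj ((of_real r * j powr (of_real r - 1) * of_real c) * h))) (at z)"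
    using d2 by (intro has_derivative_cnj) (simp add: has_field_derivative_def)
  have cp: "(of_real (c ^ (p + q)) :: complex) = of_real c * of_real (c ^ (p + q - 1))"
    using pq by (cases "p + q") auto
  have r1: "of_real (1 - k - real (q + 1)) = (of_real r - 1 :: complex)" by (simp add: r_def)
  have "((\<lambda>z. phase K * of_real (c ^ (p + q - 1)) * (inverse (jf K z) ^ p * cnj (jf K z powr of_real r))) has_derivative
     (\<lambda>h. phase K * of_real (c ^ (p + q - 1)) * (inverse (jf K z) ^ p * cnj ((of_real r * j powr (of_real r - 1) * of_real c) * h)
       + (- of_nat p * of_real c * inverse j ^ (p + 1)) * h * cnj (jf K z powr of_real r)))) (at z)"
    by (intro has_derivative_mult_right has_derivative_mult D1 D2)
  moreover have "gt p q K = (\<lambda>z. phase K * of_real (c ^ (p + q - 1)) * (inverse (jf K z) ^ p * cnj (jf K z powr of_real r)))"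
    by (simp add: fun_eq_iff gt_def c_def r_def)
  moreover have "(\<lambda>h. phase K * of_real (c ^ (p + q - 1)) * (inverse (jf K z) ^ p * cnj ((of_real r * j powr (of_real r - 1) * of_real c) * h)
       + (- of_nat p * of_real c * inverse j ^ (p + 1)) * h * cnj (jf K z powr of_real r)))
     = (\<lambda>h. - of_nat p * gt (p + 1) q K z * h + of_real (1 - k - real q) * gt p (q + 1) K z * cnj h)"
  proof
    fix h
    have g1: "gt (p + 1) q K z = phase K * (of_real c * of_real (c ^ (p + q - 1))) * inverse j ^ (p + 1) * cnj (j powr of_real r)"
      unfolding gt_def c_def[symmetric] r_def[symmetric] j_def[symmetric] cp[symmetric] by simp
    have g2: "gt p (q + 1) K z = phase K * (of_real c * of_real (c ^ (p + q - 1))) * inverse j ^ p * cnj (j powr (of_real r - 1))"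
      unfolding gt_def c_def[symmetric] r1 j_def[symmetric] cp[symmetric] by simp
    show "phase K * of_real (c ^ (p + q - 1)) * (inverse (jf K z) ^ p * cnj ((of_real r * j powr (of_real r - 1) * of_real c) * h)
       + (- of_nat p * of_real c * inverse j ^ (p + 1)) * h * cnj (jf K z powr of_real r))
     = - of_nat p * gt (p + 1) q K z * h + of_real (1 - k - real q) * gt p (q + 1) K z * cnj h"
      unfolding g1 g2 j_def[symmetric] r_def[symmetric]
      by (simp only: complex_cnj_mult complex_cnj_complex_of_real) (simp only: algebra_simps)
  qed
  ultimately show ?thesis by simp
qed

text \<open>By |c| Im z \<le> |j| each derivative costs at most a factor 2 / Im z0, and on the disc
  |j(z)| \<ge> |j(z0)|/2. So the terms of all orders are dominated near z0 by the summable terms at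
  z0, which is what termwise differentiation needs.\<close>

lemma norm_gt_le:
  assumes K: "K \<in> cosets" and z0: "z0 \<in> uhp" and z: "dist z z0 \<le> Im z0 / 2" and pq: "p + q = Suc n"
  shows "norm (gt p q K z) \<le> (2 / Im z0) ^ n * 2 powr k * norm (etrm z0 (rep K))"
proof -
  have y0: "Im z0 > 0" using z0 by (simp add: uhp_def)
  have "\<bar>Im z - Im z0\<bar> \<le> Im z0 / 2" using z abs_Im_le_cmod[of "z - z0"] by (simp add: dist_norm)
  hence Imz: "Im z \<ge> Im z0 / 2" by linarith
  hence zu: "z \<in> uhp" using y0 by (simp add: uhp_def)
  define m where "m = norm (jf K z)" define m0 where "m0 = norm (jf K z0)"
  have m: "m > 0" "m0 > 0" using jf_nz[OF K zu] jf_nz[OF K z0] by (simp_all add: m_def m0_def)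
  have c0: "\<bar>jc K\<bar> * Im z0 \<le> m0" and c1: "\<bar>jc K\<bar> * Im z \<le> m"
    using abs_Im_le_cmod[of "jf K z0"] abs_Im_le_cmod[of "jf K z"] y0 Imz by (simp_all add: m_def m0_def jf_eq abs_mult)
  have "norm (jf K z0 - jf K z) = \<bar>jc K\<bar> * dist z z0"
  proof -
    have "jf K z0 - jf K z = of_real (jc K) * (z0 - z)" by (simp add: jf_eq algebra_simps)
    thus ?thesis by (simp add: norm_mult dist_norm norm_minus_commute)
  qed
  also have "\<dots> \<le> \<bar>jc K\<bar> * (Im z0 / 2)" using z by (intro mult_left_mono) auto
  also have "\<dots> \<le> m0 / 2" using c0 by simp
  finally have mm: "m \<ge> m0 / 2" using norm_triangle_ineq2[of "jf K z0" "jf K z"] by (simp add: m_def m0_def)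
  have "norm (gt p q K z) = \<bar>jc K\<bar> ^ n * inverse m ^ p * m powr (1 - k - real q)"
    unfolding gt_def norm_mult norm_phase[OF K] complex_mod_cnj
    using norm_powr_real_powr'[of "of_real (1 - k - real q)" "jf K z"] pq
    by (simp add: m_def norm_power norm_inverse power_abs)
  also have "inverse m ^ p = m powr (- real p)"
    using m by (simp add: powr_minus powr_realpow power_inverse)
  also have "\<bar>jc K\<bar> ^ n * m powr (- real p) * m powr (1 - k - real q) = \<bar>jc K\<bar> ^ n * m powr (- real n + - k)"
  proof -
    have "- real p + (1 - k - real q) = - real n + - k" using pq by linarith
    thus ?thesis by (metis mult.assoc powr_add)
  qed
  also have "\<dots> = (\<bar>jc K\<bar> / m) ^ n * m powr (- k)"
    unfolding powr_add using m by (simp add: powr_minus powr_realpow power_divide field_simps)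
  also have "\<dots> \<le> (2 / Im z0) ^ n * (m0 / 2) powr (- k)"
  proof (intro mult_mono power_mono)
    have "\<bar>jc K\<bar> * (Im z0 / 2) \<le> \<bar>jc K\<bar> * Im z" using Imz by (intro mult_left_mono) auto
    hence "\<bar>jc K\<bar> * (Im z0 / 2) \<le> m" using c1 by linarith
    thus "\<bar>jc K\<bar> / m \<le> 2 / Im z0" using m y0 by (simp add: field_simps)
    show "m powr (- k) \<le> (m0 / 2) powr (- k)" using mm m k(2) by (intro powr_mono2') auto
  qed (use y0 m in auto)
  also have "(m0 / 2) powr (- k) = 2 powr k * norm (etrm z0 (rep K))"
    using m unfolding norm_etrm[OF rep(1)[OF K] z0] jf_def[symmetric] m0_def[symmetric]
    by (simp add: powr_divide powr_minus field_simps)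
  finally show ?thesis by (simp add: mult.assoc)
qed

lemma gt_summable:
  assumes "z \<in> uhp" "p + q \<ge> 1"
  shows "(\<lambda>K. gt p q K z) summable_on cosets"
proof -
  obtain n where n: "p + q = Suc n" using assms(2) by (cases "p + q") auto
  have "dist z z \<le> Im z / 2" using assms by (simp add: uhp_def)
  from abs_summable_summable[OF Infinite_Sum.abs_summable_on_comparison_test'[OF
        summable_on_cmult_right[OF etrm_summable(1)[OF assms(1)]] norm_gt_le[OF _ assms(1) this n]]]
  show ?thesis .
qed

lemma G_has_derivative:
  assumes z: "z \<in> uhp" and pq: "p + q \<ge> 1"
  shows "(G p q has_derivative (\<lambda>h. - of_nat p * G (p + 1) q z * h
      + of_real (1 - k - real q) * G p (q + 1) z * cnj h)) (at z)"
proof -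
  obtain n where n: "p + q = Suc n" using pq by (cases "p + q") auto
  have y: "Im z > 0" using z by (simp add: uhp_def)
  define U where "U = ball z (Im z / 2)"
  have U: "w \<in> uhp" "dist w z \<le> Im z / 2" if "w \<in> U" for w
  proof -
    show d: "dist w z \<le> Im z / 2" using that by (simp add: U_def dist_commute)
    have "\<bar>Im w - Im z\<bar> \<le> Im z / 2" using d abs_Im_le_cmod[of "w - z"] by (simp add: dist_norm)
    hence "Im w > 0" using y by linarith
    thus "w \<in> uhp" by (simp add: uhp_def)
  qed
  \<comment> \<open>The bound refers to the centre z while the derivatives range over the disc; p
    and |1 - k - q| are the coefficients of the two parts of the derivative.\<close>
  define b where "b = (\<lambda>K. (real p + \<bar>1 - k - real q\<bar>) * ((2 / Im z) ^ Suc n * 2 powr k * norm (etrm z (rep K))))"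
  have "((\<lambda>z. \<Sum>\<^sub>\<infinity>K\<in>cosets. gt p q K z) has_derivative (\<lambda>h. \<Sum>\<^sub>\<infinity>K\<in>cosets.
      - of_nat p * gt (p + 1) q K z * h + of_real (1 - k - real q) * gt p (q + 1) K z * cnj h)) (at z)"
  proof (rule has_derivative_infsum[where S = U and b = b])
    show "open U" "convex U" "z \<in> U" using y by (auto simp: U_def)
    show "b K \<ge> 0" for K unfolding b_def using y by (intro mult_nonneg_nonneg) auto
    show "b summable_on cosets" unfolding b_def by (intro summable_on_cmult_right etrm_summable z)
    fix w assume w: "w \<in> U"
    show "(\<lambda>K. gt p q K w) summable_on cosets" by (rule gt_summable[OF U(1)[OF w] pq])
    fix K assume K: "K \<in> cosets"
    show "(gt p q K has_derivative (\<lambda>h. - of_nat p * gt (p + 1) q K w * h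
      + of_real (1 - k - real q) * gt p (q + 1) K w * cnj h)) (at w)"
      by (rule gt_has_derivative[OF K U(1)[OF w] pq])
    fix h
    let ?B = "(2 / Im z) ^ Suc n * 2 powr k * norm (etrm z (rep K))"
    have 1: "norm (gt (p + 1) q K w) \<le> ?B" "norm (gt p (q + 1) K w) \<le> ?B"
      by (rule norm_gt_le[OF K z U(2)[OF w]], use n in simp)+
    have "norm (- of_nat p * gt (p + 1) q K w * h + of_real (1 - k - real q) * gt p (q + 1) K w * cnj h) \<le>
       real p * norm (gt (p + 1) q K w) * norm h + \<bar>1 - k - real q\<bar> * norm (gt p (q + 1) K w) * norm h"
      by (rule order_trans[OF norm_triangle_ineq]) (simp add: norm_mult flip: of_real_diff)
    also have "\<dots> \<le> real p * ?B * norm h + \<bar>1 - k - real q\<bar> * ?B * norm h"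
      using 1 by (intro add_mono mult_right_mono mult_left_mono) auto
    also have "\<dots> = b K * norm h" unfolding b_def by (simp only: distrib_right)
    finally show "norm (- of_nat p * gt (p + 1) q K w * h + of_real (1 - k - real q) * gt p (q + 1) K w * cnj h) \<le> b K * norm h" .
  qed
  moreover have "(\<Sum>\<^sub>\<infinity>K\<in>cosets. - of_nat p * gt (p + 1) q K z * h + of_real (1 - k - real q) * gt p (q + 1) K z * cnj h)
     = - of_nat p * G (p + 1) q z * h + of_real (1 - k - real q) * G p (q + 1) z * cnj h" for h
  proof -
    have s: "(\<lambda>K. a * gt p' q' K z * b) summable_on cosets" "(\<Sum>\<^sub>\<infinity>K\<in>cosets. a * gt p' q' K z * b) = a * G p' q' z * b"
      if "p' + q' \<ge> 1" for p' q' a b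
      using gt_summable[OF z that] by (auto intro!: summable_on_cmult_left summable_on_cmult_right
          simp: infsum_cmult_left' infsum_cmult_right' G_def)
    have 1: "1 \<le> p + 1 + q" "1 \<le> p + (q + 1)" by auto
    show ?thesis unfolding infsum_add[OF s(1)[OF 1(1)] s(1)[OF 1(2)]] s(2)[OF 1(1)] s(2)[OF 1(2)] ..
  qed
  ultimately show ?thesis by (simp add: G_def[abs_def])
qed

lemma mock_eq: "z \<in> uhp \<Longrightarrow> mock_eisenstein k \<Gamma> \<nu> \<aa> \<sigma> z = of_real (1 / (k - 1)) * (of_real (Im z powr (k - 1)) * G 1 0 z)"
  unfolding mock_eisenstein_def E_eq G_def using etrm_gt by (simp cong: infsum_cong)

text \<open>The functions y^r \<open>G p q\<close> with p + q \<ge> 1 are stable under derivatives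
  up to linear combination: differentiating y^r lowers r, and differentiating \<open>G p q\<close>
  raises p or q.\<close>

lemma mock_smooth: "smooth_on uhp (mock_eisenstein k \<Gamma> \<nu> \<aa> \<sigma>)"
proof (rule smooth_on_cong[OF open_uhp])
  define B where "B = {f. \<exists>r p q. p + q \<ge> 1 \<and> f = (\<lambda>z. of_real (Im z powr r) * G p q z)}"
  have inB: "(\<lambda>z. c * (of_real (Im z powr r) * G p q z)) \<in> cfun.span B" if "p + q \<ge> 1" for c r p q
    using cfun.span_scale[OF cfun.span_base[of "\<lambda>z. of_real (Im z powr r) * G p q z" B], of c] that
    by (auto simp: B_def cfun_scale_def)
  show "smooth_on uhp (\<lambda>z. of_real (1 / (k - 1)) * (of_real (Im z powr (k - 1)) * G 1 0 z))"
  proof (rule smooth_on_span[OF open_uhp inB])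
    fix b assume "b \<in> B"
    then obtain r p q where b: "p + q \<ge> 1" "b = (\<lambda>z. of_real (Im z powr r) * G p q z)" by (auto simp: B_def)
    define D where "D = (\<lambda>z h. of_real (Im z powr r) * (- of_nat p * G (p + 1) q z * h + of_real (1 - k - real q) * G p (q + 1) z * cnj h)
       + of_real (r * Im z powr (r - 1) * Im h) * G p q z)"
    have "(b has_derivative D z) (at z)" if "z \<in> uhp" for z
      unfolding b(2) D_def using that b(1)
      by (intro has_derivative_mult has_derivative_Im_powr G_has_derivative) (auto simp: uhp_def)
    moreover have "\<exists>g. g \<in> cfun.span B \<and> (\<forall>z\<in>uhp. D z v = g z)" for v
    proof (intro exI conjI ballI)
      show "(\<lambda>z. (- of_nat p * v) * (of_real (Im z powr r) * G (p + 1) q z)) + 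
         ((\<lambda>z. (of_real (1 - k - real q) * cnj v) * (of_real (Im z powr r) * G p (q + 1) z)) +
          (\<lambda>z. of_real (r * Im v) * (of_real (Im z powr (r - 1)) * G p q z))) \<in> cfun.span B"
        using b(1) by (intro cfun.span_add inB) auto
    qed (simp add: D_def algebra_simps)
    ultimately show "\<exists>D. \<forall>z\<in>uhp. (b has_derivative D z) (at z) \<and> (\<forall>v. \<exists>g. g \<in> cfun.span B \<and> (\<forall>z\<in>uhp. D z v = g z))"
      by blast
  qed simp
qed (rule mock_eq)

text \<open>\<open>G 0 1\<close> sums the phases times the conjugates of j^(-k), so it is the
  conjugate of the weight k Eisenstein series for the conjugate multiplier. The factor y^(k-1) is
  what makes the two contributions to the derivative combine into it.\<close>

lemma mock_xi_bar:
  assumes z: "z \<in> uhp"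
  shows "xi_bar (2 - k) (mock_eisenstein k \<Gamma> \<nu> \<aa> \<sigma>) z = \<i> / 2 * G 0 1 z"
proof -
  have y: "Im z > 0" using z by (simp add: uhp_def)
  define f where "f = (\<lambda>z. of_real (1 / (k - 1)) * (of_real (Im z powr (k - 1)) * G 1 0 z))"
  have Im_eq: "of_real (Im h) = (- \<i> / 2) * (h - cnj h)" for h :: complex
    by (simp add: complex_eq_iff)
  have k1: "of_real (k - 1) \<noteq> (0 :: complex)" using k(2) by (simp del: of_real_diff)
  define a where "a = (of_real (Im z powr (k - 1)) :: complex)"
  define b where "b = (of_real (Im z powr (k - 2)) :: complex)"
  have ab: "a = of_real (Im z) * b"
  proof -
    have "Im z powr (1 + (k - 2)) = Im z * Im z powr (k - 2)" using y by (simp only: powr_add) simp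
    thus ?thesis by (simp add: a_def b_def flip: of_real_mult)
  qed
  have "(f has_derivative (\<lambda>h. of_real (1 / (k - 1)) * (a * (- G 2 0 z * h + of_real (1 - k) * G 1 1 z * cnj h)
     + of_real ((k - 1) * Im z powr (k - 2) * Im h) * G 1 0 z))) (at z)"
    unfolding f_def a_def
    using has_derivative_mult[OF has_derivative_Im_powr[OF y, of "k - 1"] G_has_derivative[OF z, of 1 0]]
    by (intro has_derivative_mult_right) (simp add: numeral_2_eq_2)
  moreover have "of_real (1 / (k - 1)) * (a * (- G 2 0 z * h + of_real (1 - k) * G 1 1 z * cnj h)
     + of_real ((k - 1) * Im z powr (k - 2) * Im h) * G 1 0 z) = 
      (- of_real (1 / (k - 1)) * a * G 2 0 z - \<i> / 2 * b * G 1 0 z) * h + (\<i> / 2 * b * G 1 0 z - a * G 1 1 z) * cnj h" for h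
  proof -
    have e1: "of_real (1 / (k - 1)) * of_real (1 - k) = (- 1 :: complex)"
      using k(2) by (simp flip: of_real_mult of_real_minus) (simp add: field_simps)
    have e2: "of_real (1 / (k - 1)) * of_real ((k - 1) * Im z powr (k - 2) * Im h) = b * of_real (Im h)"
      unfolding b_def of_real_mult[symmetric] by (rule arg_cong[where f = of_real]) (use k(2) in simp)
    have alg: "x * (a * (- g2 * h + w * g1 * h') + T * g0) = - x * a * g2 * h + (x * w) * a * g1 * h' + (x * T) * g0"
      for x w T g2 g1 g0 h' :: complex
      by (simp add: algebra_simps)
    show ?thesis unfolding alg e1 e2 Im_eq[of h] by (simp add: field_simps)
  qed
  ultimately have "(f has_derivative (\<lambda>h. (- of_real (1 / (k - 1)) * a * G 2 0 z - \<i> / 2 * b * G 1 0 z) * h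
     + (\<i> / 2 * b * G 1 0 z - a * G 1 1 z) * cnj h)) (at z)" by simp
  hence "(mock_eisenstein k \<Gamma> \<nu> \<aa> \<sigma> has_derivative (\<lambda>h. (- of_real (1 / (k - 1)) * a * G 2 0 z - \<i> / 2 * b * G 1 0 z) * h
     + (\<i> / 2 * b * G 1 0 z - a * G 1 1 z) * cnj h)) (at z)"
    by (rule has_derivative_transform_within_open[OF _ open_uhp z]) (simp add: f_def mock_eq)
  from Wirtinger_eqs(2)[OF this]
  have "d_dzbar (mock_eisenstein k \<Gamma> \<nu> \<aa> \<sigma>) z = b * (\<i> / 2 * G 1 0 z + (- of_real (Im z)) * G 1 1 z)"
    unfolding ab by (simp add: algebra_simps)
  also have "\<i> / 2 * G 1 0 z + (- of_real (Im z)) * G 1 1 z = (\<Sum>\<^sub>\<infinity>K\<in>cosets. \<i> / 2 * gt 1 0 K z + (- of_real (Im z)) * gt 1 1 K z)"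
    unfolding G_def infsum_cmult_right'[symmetric]
    by (rule infsum_add[symmetric]; (intro summable_on_cmult_right gt_summable z, simp))
  also have "\<dots> = (\<Sum>\<^sub>\<infinity>K\<in>cosets. \<i> / 2 * gt 0 1 K z)"
  proof (rule infsum_cong)
    fix K assume K: "K \<in> cosets"
    define j where "j = jf K z" define c where "c = jc K" define e where "e = cnj (j powr of_real (- k))"
    have j: "j \<noteq> 0" using jf_nz[OF K z] by (simp add: j_def)
    have "j powr of_real (1 - k) = j * j powr of_real (- k)"
    proof -
      have "j powr (1 + of_real (- k)) = j * j powr of_real (- k)" using j by (simp only: powr_add) simp
      thus ?thesis by simp
    qed
    hence p: "cnj (j powr of_real (1 - k)) = cnj j * e" by (simp add: e_def)
    have q: "cnj (j powr of_real (1 - k - 1)) = e" by (simp add: e_def)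
    \<comment> \<open>j minus its conjugate is 2i c y, so the contributions from y^(k-1) and from
      the conjugate of j^(1-k) merge into a multiple of j and cancel the denominator.\<close>
    have jj: "\<i> / 2 * cnj j - of_real (Im z) * of_real c = \<i> / 2 * j"
      by (simp add: j_def c_def jf_eq complex_eq_iff)
    have g: "gt 1 0 K z = phase K * inverse j * (cnj j * e)" "gt 1 1 K z = phase K * of_real c * inverse j * e"
      "gt 0 1 K z = phase K * e"
      using p q by (simp_all add: gt_def j_def c_def)
    have "\<i> / 2 * gt 1 0 K z + (- of_real (Im z)) * gt 1 1 K z =
        phase K * e * inverse j * (\<i> / 2 * cnj j - of_real (Im z) * of_real c)"
      unfolding g by (simp add: algebra_simps)
    also have "\<dots> = \<i> / 2 * gt 0 1 K z" unfolding jj g using j by simp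
    finally show "\<i> / 2 * gt 1 0 K z + (- of_real (Im z)) * gt 1 1 K z = \<i> / 2 * gt 0 1 K z" .
  qed
  also have "\<dots> = \<i> / 2 * G 0 1 z" unfolding G_def by (rule infsum_cmult_right')
  finally have d: "d_dzbar (mock_eisenstein k \<Gamma> \<nu> \<aa> \<sigma>) z = b * (\<i> / 2 * G 0 1 z)" .
  have "of_real (Im z powr (2 - k)) * b = (1 :: complex)"
    using y by (simp add: b_def flip: of_real_mult powr_add)
  thus ?thesis unfolding xi_bar_def d by (simp add: mult.assoc[symmetric])
qed

text \<open>In the derivative of \<open>G 0 1\<close> the holomorphic part carries the factor p = 0,
  so this series is antiholomorphic.\<close>

lemma mock_laplacian: "\<forall>z\<in>uhp. weight_laplacian (2 - k) (mock_eisenstein k \<Gamma> \<nu> \<aa> \<sigma>) z = 0"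
  unfolding weight_laplacian_zero_iff[OF mock_smooth]
proof (rule holomorphic_onI, rule field_differentiable_at_within)
  fix z assume z: "z \<in> uhp"
  define c where "c = of_real (1 - k - 1) * G 0 2 z"
  have "(G 0 1 has_derivative (\<lambda>h. c * cnj h)) (at z)"
    using G_has_derivative[OF z, of 0 1] by (simp add: c_def numeral_2_eq_2)
  hence "((\<lambda>z. cnj (\<i> / 2 * G 0 1 z)) has_derivative (\<lambda>h. cnj (\<i> / 2 * (c * cnj h)))) (at z)"
    by (intro has_derivative_cnj has_derivative_mult_right)
  moreover have "(\<lambda>h. cnj (\<i> / 2 * (c * cnj h))) = (*) (cnj (\<i> / 2 * c))" by (simp add: fun_eq_iff)
  ultimately have "((\<lambda>z. cnj (\<i> / 2 * G 0 1 z)) has_field_derivative (cnj (\<i> / 2 * c))) (at z)"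
    unfolding has_field_derivative_def by (simp only:)
  hence "((\<lambda>z. cnj (xi_bar (2 - k) (mock_eisenstein k \<Gamma> \<nu> \<aa> \<sigma>) z)) has_field_derivative (cnj (\<i> / 2 * c))) (at z)"
    by (rule has_field_derivative_transform_within_open[OF _ open_uhp z]) (simp add: mock_xi_bar)
  thus "(\<lambda>z. cnj (xi_bar (2 - k) (mock_eisenstein k \<Gamma> \<nu> \<aa> \<sigma>) z)) field_differentiable at z"
    by (auto simp: field_differentiable_def)
qed

lemma mock_inv_norm:
  assumes "z \<in> uhp"
  shows "Im z powr ((2 - k) / 2) * norm (mock_eisenstein k \<Gamma> \<nu> \<aa> \<sigma> z) = Im z powr (k / 2) * norm (E z) / (k - 1)"
proof -
  have "norm (of_real (Im z powr (k - 1) / (k - 1)) :: complex) = Im z powr (k - 1) / (k - 1)"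
    unfolding norm_of_real using k(2) by simp
  moreover have "Im z powr ((2 - k) / 2) * Im z powr (k - 1) = Im z powr (k / 2)"
    by (simp add: field_simps flip: powr_add)
  ultimately show ?thesis unfolding mock_eisenstein_def norm_mult by (simp add: field_simps)
qed

lemma mock_in_H_sharp: "mock_eisenstein k \<Gamma> \<nu> \<aa> \<sigma> \<in> H_sharp (2 - k) \<Gamma> \<nu>"
proof -
  let ?f = "mock_eisenstein k \<Gamma> \<nu> \<aa> \<sigma>"
  have zero: "?f z = 0" if "z \<notin> uhp" for z using that by (simp add: mock_eisenstein_def eisenstein_def)
  have tr: "?f (mobius A z) = \<nu> A * automorphy A z powr of_real (2 - k) * ?f z" if A: "A \<in> \<Gamma>" and z: "z \<in> uhp" for A z
  proof -
    define n where "n = norm (automorphy A z)"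
    have n: "n > 0" using automorphy_nonzero[OF \<Gamma>_det[OF A] z] by (simp add: n_def)
    have "(of_real n :: complex) powr (2 * of_real (k - 1)) = of_real (n powr (2 * (k - 1)))"
      using n powr_of_real[of n "2 * (k - 1)"] by simp
    \<comment> \<open>The factor |j|^(2(k-1)) in the transformation of E cancels against the one
      from y^(k-1), which leaves pure weight 2 - k.\<close>
    hence "of_real (Im (mobius A z) powr (k - 1)) * (of_real n :: complex) powr (2 * of_real (k - 1)) =
        of_real (Im z powr (k - 1) * (n powr (- 2 * (k - 1)) * n powr (2 * (k - 1))))"
      unfolding Im_mobius_powr[OF \<Gamma>_det[OF A] z] n_def by (simp add: mult.assoc)
    also have "n powr (- 2 * (k - 1)) * n powr (2 * (k - 1)) = 1" using n by (simp flip: powr_add)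
    finally have e: "of_real (Im (mobius A z) powr (k - 1)) * (of_real n :: complex) powr (2 * of_real (k - 1)) = of_real (Im z powr (k - 1))"
      by simp
    have "?f (mobius A z) = 1 / of_real (k - 1) * (of_real (Im (mobius A z) powr (k - 1)) * of_real n powr (2 * of_real (k - 1))) *
        (\<nu> A * automorphy A z powr of_real (2 - k) * E z)"
      unfolding mock_eisenstein_def E_transform[OF A z] n_def[symmetric] by (simp add: mult_ac)
    thus ?thesis unfolding e mock_eisenstein_def by (simp add: mult_ac)
  qed
  have gr: "polynomial_growth_at (2 - k) ?f \<bb>" if b: "\<bb> \<in> cusps" for \<bb>
  proof -
    obtain \<rho>' where \<rho>': "\<rho>' \<in> carrier SL2Z" "bdry_mobius \<rho>' None = \<bb>" using cusp_eq_SL2Z_image[OF b] by blast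
    obtain C where C: "\<And>z. z \<in> uhp \<Longrightarrow> Im z \<ge> 1 \<Longrightarrow> Im (mobius \<rho>' z) powr (k / 2) * norm (E (mobius \<rho>' z)) \<le> C * Im z powr (k / 2)"
      using eisenstein_cusp_growth[OF \<rho>'(1)] by blast
    show ?thesis
    proof (rule polynomial_growth_atI[OF SL2Z_det[OF \<rho>'(1)] \<rho>'(2)])
      fix z assume z: "z \<in> uhp" "1 \<le> Im z"
      show "Im (mobius \<rho>' z) powr ((2 - k) / 2) * norm (?f (mobius \<rho>' z)) \<le> (C / (k - 1)) * Im z powr (k / 2)"
        unfolding mock_inv_norm[OF mobius_uhp[OF SL2Z_det[OF \<rho>'(1)] z(1)]]
        using divide_right_mono[OF C[OF z], of "k - 1"] k(2) by simp
    qed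
  qed
  show ?thesis using zero mock_smooth tr mock_laplacian gr by (auto simp: H_sharp_def)
qed

end

section \<open>Reduction theory and behaviour at the cusps\<close>

lemma mobius_translation: "mobius (translation n) z = z + of_int n"
  and automorphy_translation: "automorphy (translation n) z = 1"
  and det_translation: "det (translation n) = 1"
  by (simp_all add: mobius_def automorphy_def translation_def vector_2 det_2)

text \<open>Minimizing |j(A, z)| maximizes Im (A z). After a translation into |Re w| \<le> 1/2,
  comparison of the minimum with the matrix followed by z to -1/z gives |w| \<ge> 1. This would give
  Im w \<ge> sqrt(3)/2; the weaker 1/2 still leaves a region that is compact when cut off
  above.\<close>

lemma SL2Z_reduction:
  assumes z: "z \<in> uhp"
  obtains A where "A \<in> carrier SL2Z" "\<bar>Re (mobius A z)\<bar> \<le> 1 / 2" "Im (mobius A z) \<ge> 1 / 2"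
proof -
  have y: "Im z > 0" using z by (simp add: uhp_def)
  \<comment> \<open>Only values up to 1, the value at the identity, are collected: then the bottom
    rows are bounded and a minimum exists.\<close>
  define N where "N = {norm (automorphy A z) | A. A \<in> carrier SL2Z \<and> norm (automorphy A z) \<le> 1}"
  have one: "mat 1 \<in> carrier SL2Z" using SL2Z_group group.is_monoid monoid.one_closed by fastforce
  have "finite N"
  proof -
    define M where "M = \<lceil>max (1 / Im z) (1 + norm z / Im z)\<rceil>"
    have "N \<subseteq> (\<lambda>(c, d). norm (of_int c * z + of_int d)) ` ({-M..M} \<times> {-M..M})"
    proof
      fix v assume "v \<in> N"
      then obtain A where A: "A \<in> carrier SL2Z" "norm (automorphy A z) \<le> 1" "v = norm (automorphy A z)"
        by (auto simp: N_def)
      obtain c d :: int where cd: "A$2$1 = of_int c" "A$2$2 = of_int d" 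
        using SL2Z_entry[OF A(1)] by (metis Ints_cases)
      have a: "automorphy A z = of_int c * z + of_int d" by (simp add: automorphy_def cd)
      have "\<bar>of_int c\<bar> * Im z \<le> 1"
        using abs_Im_le_cmod[of "automorphy A z"] A(2) y by (simp add: a abs_mult)
      hence c1: "\<bar>real_of_int c\<bar> \<le> 1 / Im z" using y by (simp add: field_simps)
      have "\<bar>real_of_int d\<bar> = norm (automorphy A z - of_int c * z)" by (simp add: a)
      also have "\<dots> \<le> norm (automorphy A z) + norm (of_int c * z)" by (rule norm_triangle_ineq4)
      also have "norm (of_int c * z) = \<bar>of_int c\<bar> * norm z" by (simp add: norm_mult)
      also have "\<dots> \<le> 1 / Im z * norm z" by (rule mult_right_mono[OF c1]) simp
      finally have d1: "\<bar>real_of_int d\<bar> \<le> 1 + norm z / Im z" using A(2) by simp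
      have "\<bar>real_of_int c\<bar> \<le> of_int M" "\<bar>real_of_int d\<bar> \<le> of_int M"
        using c1 d1 le_of_int_ceiling[of "max (1 / Im z) (1 + norm z / Im z)"] unfolding M_def by linarith+
      hence "(c, d) \<in> {-M..M} \<times> {-M..M}" by (auto simp: abs_le_iff)
      thus "v \<in> (\<lambda>(c, d). norm (of_int c * z + of_int d)) ` ({-M..M} \<times> {-M..M})"
        using A(3) a by (intro image_eqI[of _ _ "(c, d)"]) auto
    qed
    thus ?thesis by (rule finite_subset) auto
  qed
  moreover have "1 \<in> N"
    using one by (auto simp: N_def automorphy_one intro!: exI[of _ "mat 1"])
  ultimately obtain A where A: "A \<in> carrier SL2Z" "norm (automorphy A z) \<le> 1" "\<And>v. v \<in> N \<Longrightarrow> norm (automorphy A z) \<le> v"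
    using Min_in[of N] Min_le[of N] unfolding N_def by fastforce
  have least: "norm (automorphy A z) \<le> norm (automorphy B z)" if "B \<in> carrier SL2Z" for B
    using A(2,3) that by (cases "norm (automorphy B z) \<le> 1") (auto simp: N_def)
  define n where "n = round (Re (mobius A z))"
  define B where "B = translation (- n) ** A"
  define w where "w = mobius A z - of_int n"
  have dA: "det A = 1" using A SL2Z_det by blast
  have T: "translation (- n) \<in> carrier SL2Z"
    by (simp add: carrier_SL2Z translation_def det_2 vector_2 forall_2)
  have B: "B \<in> carrier SL2Z" unfolding B_def by (rule SL2Z_mult_closed[OF T A(1)])
  have wB: "mobius B z = w"
    unfolding B_def mobius_mult[OF dA z] by (simp add: mobius_translation w_def)
  have aB: "automorphy B z = automorphy A z"
    by (simp add: B_def automorphy_mult[OF dA z] automorphy_translation)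
  define J :: "real^2^2" where "J = vector [vector [0, -1], vector [1, 0]]"
  have J: "J \<in> carrier SL2Z" by (simp add: J_def carrier_SL2Z det_2 vector_2 forall_2)
  have "automorphy J w = w" by (simp add: automorphy_def J_def vector_2)
  hence "automorphy (J ** B) z = w * automorphy A z"
    by (simp add: automorphy_mult[OF SL2Z_det[OF B] z] wB aB)
  hence "norm (automorphy A z) \<le> norm w * norm (automorphy A z)"
    using least[OF SL2Z_mult_closed[OF J B]] by (simp add: norm_mult)
  hence "norm w \<ge> 1" using automorphy_nonzero[OF dA z] by simp
  hence "1 \<le> (norm w)\<^sup>2" by (simp add: power2_eq_square mult_ge1_I)
  hence "1 \<le> (Re w)\<^sup>2 + (Im w)\<^sup>2" by (simp add: cmod_power2)
  moreover have re: "\<bar>Re w\<bar> \<le> 1 / 2"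
    using of_int_round_abs_le[of "Re (mobius A z)"] by (simp add: w_def n_def abs_minus_commute)
  hence "(Re w)\<^sup>2 \<le> (1/2)\<^sup>2" by (metis abs_le_square_iff abs_of_nonneg divide_nonneg_nonneg zero_le_numeral zero_le_one)
  ultimately have "(1/2)\<^sup>2 \<le> (Im w)\<^sup>2" by (simp add: power2_eq_square)
  moreover have "Im w > 0" using mobius_uhp[OF SL2Z_det[OF B] z] wB by (simp add: uhp_def)
  ultimately have "1/2 \<le> Im w" using power2_le_imp_le[of "1/2" "Im w"] by simp
  thus ?thesis using that[OF B] re wB by simp
qed

lemma finite_index_cosets:
  assumes "finite_index_subgroup \<Gamma>"
  obtains P where "finite P" "P \<subseteq> carrier SL2Z" "\<And>A. A \<in> carrier SL2Z \<Longrightarrow> \<exists>\<gamma>\<in>\<Gamma>. \<exists>\<rho>\<in>P. A = \<gamma> ** \<rho>"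
proof -
  have sub: "subgroup \<Gamma> SL2Z" and fin: "finite (rcosets\<^bsub>SL2Z\<^esub> \<Gamma>)"
    using assms by (auto simp: finite_index_subgroup_def)
  have \<Gamma>: "\<Gamma> \<subseteq> carrier SL2Z" using sub by (rule subgroup.subset)
  define P where "P = (\<lambda>K. SOME A. A \<in> K) ` (rcosets\<^bsub>SL2Z\<^esub> \<Gamma>)"
  have some: "(SOME B. B \<in> \<Gamma> #>\<^bsub>SL2Z\<^esub> A) \<in> \<Gamma> #>\<^bsub>SL2Z\<^esub> A" if "A \<in> carrier SL2Z" for A
    using group.rcos_self[OF SL2Z_group that sub] by (rule someI)
  have cos: "\<Gamma> #>\<^bsub>SL2Z\<^esub> A = (\<lambda>\<gamma>. \<gamma> ** A) ` \<Gamma>" for A by (auto simp: r_coset_def)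
  show ?thesis
  proof (rule that[of P])
    show "finite P" using fin by (simp add: P_def)
    show "P \<subseteq> carrier SL2Z"
    proof
      fix B assume "B \<in> P"
      then obtain A where A: "A \<in> carrier SL2Z" "B = (SOME B. B \<in> \<Gamma> #>\<^bsub>SL2Z\<^esub> A)"
        by (auto simp: P_def RCOSETS_def)
      thus "B \<in> carrier SL2Z" using some[OF A(1)] \<Gamma> SL2Z_mult_closed unfolding cos by fastforce
    qed
    fix A assume A: "A \<in> carrier SL2Z"
    define \<rho> where "\<rho> = (SOME B. B \<in> \<Gamma> #>\<^bsub>SL2Z\<^esub> A)"
    have "\<rho> \<in> P" unfolding P_def \<rho>_def using A by (auto simp: RCOSETS_def)
    obtain \<gamma> where \<gamma>: "\<gamma> \<in> \<Gamma>" "\<rho> = \<gamma> ** A" using some[OF A] unfolding cos \<rho>_def by auto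
    have d: "\<gamma> \<in> carrier SL2Z" using \<gamma> \<Gamma> by blast
    have "matrix_inv \<gamma> \<in> \<Gamma>" using subgroup.m_inv_closed[OF sub \<gamma>(1)] SL2Z_inv(2)[OF d] by simp
    moreover have "A = matrix_inv \<gamma> ** \<rho>" unfolding \<gamma>(2) by (simp add: matrix_inv_cancel SL2Z_det[OF d])
    ultimately show "\<exists>\<gamma>\<in>\<Gamma>. \<exists>\<rho>\<in>P. A = \<gamma> ** \<rho>" using \<open>\<rho> \<in> P\<close> by blast
  qed
qed

text \<open>By reduction every point is equivalent under \<Gamma> to some \<rho> w, where \<rho> is
  one of finitely many coset representatives and w lies in |Re w| \<le> 1/2, Im w \<ge> 1/2. High
  up, \<phi> does not exceed its value at a point z1 where it is positive; the remaining rectangles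
  are compact.\<close>

lemma invariant_max_attained:
  fixes \<phi> :: "complex \<Rightarrow> real"
  assumes fi: "finite_index_subgroup \<Gamma>" and cont: "continuous_on uhp \<phi>"
    and inv: "\<And>A z. A \<in> \<Gamma> \<Longrightarrow> z \<in> uhp \<Longrightarrow> \<phi> (mobius A z) = \<phi> z" and nonneg: "\<And>z. \<phi> z \<ge> 0"
    and lim: "\<And>\<rho> \<eta>. \<rho> \<in> carrier SL2Z \<Longrightarrow> \<eta> > 0 \<Longrightarrow> \<exists>Y. \<forall>z\<in>uhp. Im z \<ge> Y \<longrightarrow> \<phi> (mobius \<rho> z) \<le> \<eta>"
  shows "\<exists>z0\<in>uhp. \<forall>z\<in>uhp. \<phi> z \<le> \<phi> z0"
proof (cases "\<exists>z1\<in>uhp. \<phi> z1 > 0")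
  case False
  hence "\<phi> z = 0" if "z \<in> uhp" for z using nonneg[of z] that by force
  moreover have "\<i> \<in> uhp" by (simp add: uhp_def)
  ultimately show ?thesis by (intro bexI[of _ \<i>]) auto
next
  case True
  then obtain z1 where z1: "z1 \<in> uhp" "\<phi> z1 > 0" by blast
  obtain P where P: "finite P" "P \<subseteq> carrier SL2Z" "\<And>A. A \<in> carrier SL2Z \<Longrightarrow> \<exists>\<gamma>\<in>\<Gamma>. \<exists>\<rho>\<in>P. A = \<gamma> ** \<rho>"
    using finite_index_cosets[OF fi] by blast
  have "\<forall>\<rho>\<in>P. \<exists>Y. \<forall>z\<in>uhp. Im z \<ge> Y \<longrightarrow> \<phi> (mobius \<rho> z) \<le> \<phi> z1" using lim[OF _ z1(2)] P(2) by blast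
  then obtain Yf where Yf: "\<And>\<rho> z. \<rho> \<in> P \<Longrightarrow> z \<in> uhp \<Longrightarrow> Im z \<ge> Yf \<rho> \<Longrightarrow> \<phi> (mobius \<rho> z) \<le> \<phi> z1"
    by metis
  define Y where "Y = Max (insert 0 (Yf ` P))"
  have Y: "Yf \<rho> \<le> Y" if "\<rho> \<in> P" for \<rho> unfolding Y_def using P(1) that by (intro Max_ge) auto
  define D where "D = cbox (Complex (- 1/2) (1/2)) (Complex (1/2) Y)"
  have D: "w \<in> D \<longleftrightarrow> \<bar>Re w\<bar> \<le> 1/2 \<and> 1/2 \<le> Im w \<and> Im w \<le> Y" for w
    by (auto simp: D_def in_cbox_complex_iff)
  have Du: "D \<subseteq> uhp" by (auto simp: D uhp_def)
  define C where "C = insert z1 (\<Union>\<rho>\<in>P. mobius \<rho> ` D)"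
  have dP: "det \<rho> = 1" if "\<rho> \<in> P" for \<rho> using P(2) SL2Z_det that by blast
  have "compact C" unfolding C_def
    using P(1) by (intro compact_insert compact_UN compact_continuous_image
        continuous_on_subset[OF continuous_on_mobius[OF dP] Du]) (auto simp: D_def)
  moreover have Cu: "C \<subseteq> uhp" unfolding C_def using z1 Du mobius_uhp[OF dP] by blast
  ultimately obtain z0 where z0: "z0 \<in> C" "\<And>z. z \<in> C \<Longrightarrow> \<phi> z \<le> \<phi> z0"
    using continuous_attains_sup[of C \<phi>] continuous_on_subset[OF cont Cu] unfolding C_def by blast
  show ?thesis
  proof (intro bexI[of _ z0] ballI)
    show "z0 \<in> uhp" using z0 Cu by blast
    fix z assume z: "z \<in> uhp"
    obtain A where A: "A \<in> carrier SL2Z" "\<bar>Re (mobius A z)\<bar> \<le> 1/2" "Im (mobius A z) \<ge> 1/2"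
      using SL2Z_reduction[OF z] by blast
    define w where "w = mobius A z"
    have w: "w \<in> uhp" unfolding w_def by (rule mobius_uhp[OF SL2Z_det[OF A(1)] z])
    obtain \<gamma> \<rho> where g: "\<gamma> \<in> \<Gamma>" "\<rho> \<in> P" "matrix_inv A = \<gamma> ** \<rho>" using P(3)[OF SL2Z_inv(1)[OF A(1)]] by blast
    have "z = mobius (matrix_inv A) w" unfolding w_def by (simp add: mobius_inverse[OF SL2Z_det[OF A(1)] z])
    also have "\<dots> = mobius \<gamma> (mobius \<rho> w)" unfolding g(3) by (rule mobius_mult[OF dP[OF g(2)] w])
    finally have "\<phi> z = \<phi> (mobius \<rho> w)" using inv[OF g(1) mobius_uhp[OF dP[OF g(2)] w]] by simp
    also have "\<dots> \<le> \<phi> z0"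
    proof (cases "Im w \<ge> Y")
      case True
      hence "\<phi> (mobius \<rho> w) \<le> \<phi> z1" using Yf[OF g(2) w] Y[OF g(2)] by simp
      also have "\<dots> \<le> \<phi> z0" by (rule z0(2)) (simp add: C_def)
      finally show ?thesis .
    next
      case False
      hence "w \<in> D" using A by (simp add: D w_def)
      hence "mobius \<rho> w \<in> C" using g(2) by (auto simp: C_def)
      thus ?thesis by (rule z0(2))
    qed
    finally show "\<phi> z \<le> \<phi> z0" .
  qed
qed

section \<open>Slash transforms at a cusp\<close>

lemma holomorphic_Ln_automorphy:
  assumes "det A = 1"
  shows "(\<lambda>z. Ln (automorphy A z)) holomorphic_on uhp"
proof (cases "A$2$1 = 0")
  case True
  then show ?thesis by (simp add: automorphy_def)
next
  case False
  then have "automorphy A z \<notin> \<real>\<^sub>\<le>\<^sub>0" if "z \<in> uhp" for z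
    using that by (auto simp: complex_nonpos_Reals_iff automorphy_def uhp_def)
  moreover have "automorphy A holomorphic_on uhp"
    unfolding automorphy_def[abs_def] by (intro holomorphic_intros)
  ultimately show ?thesis by (intro holomorphic_intros) auto
qed

lemma holomorphic_automorphy_powr:
  assumes "det A = 1"
  shows "(\<lambda>z. automorphy A z powr c) holomorphic_on uhp"
proof -
  have "(\<lambda>z. exp (c * Ln (automorphy A z))) holomorphic_on uhp"
    by (intro holomorphic_intros holomorphic_Ln_automorphy assms)
  thus ?thesis
    by (rule holomorphic_transform) (use automorphy_nonzero[OF assms] in \<open>auto simp: powr_def\<close>)
qed

lemma mobius_has_field_derivative:
  assumes "det A = 1" "z \<in> uhp"
  shows "(mobius A has_field_derivative inverse (automorphy A z) ^ 2) (at z)"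
proof -
  have nz: "of_real (A$2$1) * z + of_real (A$2$2) \<noteq> 0"
    using automorphy_nonzero[OF assms] by (simp add: automorphy_def)
  have "of_real (A$1$1) * of_real (A$2$2) - of_real (A$1$2) * of_real (A$2$1) = (1 :: complex)"
    using assms(1) by (simp add: det_2 flip: of_real_mult of_real_diff)
  hence "of_real (A$1$1) * (of_real (A$2$1) * z + of_real (A$2$2)) - (of_real (A$1$1) * z + of_real (A$1$2)) * of_real (A$2$1) = (1 :: complex)"
    by (simp add: algebra_simps)
  thus ?thesis unfolding mobius_def[abs_def] automorphy_def
    using nz by (auto intro!: derivative_eq_intros simp: field_simps power2_eq_square)
qed

text \<open>Makes the quotient of (-j)^\<kappa> by j^\<kappa> a constant on the half plane, despite
  the branch cut. This is needed because the conjugated stabilizer consists of translations only up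
  to sign.\<close>

lemma wcocycle_minus_one:
  assumes "det S = 1" "w \<in> uhp"
  shows "wcocycle \<kappa> (- mat 1) S * (- automorphy S w) powr of_real \<kappa> = (- 1) powr of_real \<kappa> * automorphy S w powr of_real \<kappa>"
proof -
  have "(- mat 1) ** S = - S" by (simp add: mat2_minus_mult)
  thus ?thesis
    using wcocycle_powr[of "- mat 1" S w \<kappa>] assms
    by (simp add: det_minus_2 automorphy_minus automorphy_one)
qed

locale cusp_setup =
  fixes \<Gamma> :: "(real^2^2) set" and \<nu> :: "real^2^2 \<Rightarrow> complex" and \<kappa> :: real
    and \<aa> :: "real option" and \<sigma> :: "real^2^2"
  assumes sub: "subgroup \<Gamma> SL2Z" and ms: "multiplier_system \<Gamma> \<nu> \<kappa>"
    and scal: "scaling_matrix \<Gamma> \<aa> \<sigma>"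
begin

lemma \<Gamma>_det: "A \<in> \<Gamma> \<Longrightarrow> det A = 1"
  using sub subgroup.subset SL2Z_det by blast

lemma \<sigma>_det: "det \<sigma> = 1" and \<sigma>_cusp: "bdry_mobius \<sigma> None = \<aa>"
  using scal by (auto simp: scaling_matrix_def SL2R_def)

abbreviation "S \<equiv> matrix_inv \<sigma>"

lemma S_det: "det S = 1" using det_matrix_inv[OF \<sigma>_det] .

text \<open>Quotient of the two sides of the condition in \<open>singular_cusp\<close>. On the
  stabilizer it is a unimodular constant, by which the slash transform of a form changes under the
  translation belonging to A.\<close>

definition "ratio A w = \<nu> A * wcocycle \<kappa> S A * automorphy (S ** A) w powr of_real \<kappa> / automorphy S w powr of_real \<kappa>"

lemma nz_S: "w \<in> uhp \<Longrightarrow> automorphy S w powr of_real \<kappa> \<noteq> 0"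
  using automorphy_nonzero[OF S_det] by simp

lemma singular_iff_ratio:
  "singular_cusp \<Gamma> \<nu> \<kappa> \<aa> \<sigma> \<longleftrightarrow> (\<forall>A\<in>cusp_stabilizer \<Gamma> \<aa>. \<forall>w\<in>uhp. ratio A w = 1)"
  using nz_S by (auto simp: singular_cusp_def ratio_def divide_eq_1_iff)

lemma automorphy_translation_mult:
  "automorphy (translation n ** B) w = automorphy B w" "automorphy (- translation n ** B) w = - automorphy B w"
  by (simp_all add: automorphy_def translation_def mat2_mult vector_2)

lemma ratio_const:
  assumes A: "A \<in> cusp_stabilizer \<Gamma> \<aa>"
  obtains e where "norm e = 1" "\<And>w. w \<in> uhp \<Longrightarrow> ratio A w = e"
proof -
  have A\<Gamma>: "A \<in> \<Gamma>" using A by (simp add: cusp_stabilizer_def)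
  have n1: "norm (\<nu> A * wcocycle \<kappa> S A) = 1"
    using ms A\<Gamma> norm_wcocycle[OF S_det \<Gamma>_det[OF A\<Gamma>]] by (simp add: norm_mult multiplier_system_def)
  obtain n where "S ** A = translation n ** S \<or> S ** A = - translation n ** S"
    using scaled_stabilizer[OF scal A] by metis
  thus ?thesis
  proof
    assume 1: "S ** A = translation n ** S"
    show ?thesis
      by (rule that[OF n1]) (use nz_S in \<open>simp add: ratio_def 1 automorphy_translation_mult\<close>)
  next
    assume 1: "S ** A = - translation n ** S"
    define e where "e = (- 1) powr of_real \<kappa> / wcocycle \<kappa> (- mat 1) S"
    have nw: "norm (wcocycle \<kappa> (- mat 1) S) = 1"
      by (rule norm_wcocycle) (simp_all add: det_minus_2 S_det)
    hence w0: "wcocycle \<kappa> (- mat 1) S \<noteq> 0" by auto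
    have "norm ((- 1 :: complex) powr of_real \<kappa>) = 1"
      using norm_powr_real_powr'[of "of_real \<kappa>" "- 1"] by simp
    hence ne: "norm (\<nu> A * wcocycle \<kappa> S A * e) = 1" using n1 nw by (simp add: norm_mult norm_divide e_def)
    show ?thesis
    proof (rule that[OF ne])
      fix w assume w: "w \<in> uhp"
      have "(- automorphy S w) powr of_real \<kappa> = e * automorphy S w powr of_real \<kappa>"
        using wcocycle_minus_one[OF S_det w, of \<kappa>] w0 by (simp add: e_def field_simps)
      thus "ratio A w = \<nu> A * wcocycle \<kappa> S A * e"
        using nz_S[OF w] by (simp add: ratio_def 1 automorphy_translation_mult)
    qed
  qed
qed

definition slash where "slash f z = automorphy \<sigma> z powr (- of_real \<kappa>) * f (mobius \<sigma> z)"

lemma slash_shift: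
  assumes f: "\<And>A z. A \<in> \<Gamma> \<Longrightarrow> z \<in> uhp \<Longrightarrow> f (mobius A z) = \<nu> A * automorphy A z powr of_real \<kappa> * f z"
    and A: "A \<in> cusp_stabilizer \<Gamma> \<aa>" and n: "S ** A = translation n ** S \<or> S ** A = - translation n ** S"
    and z: "z \<in> uhp"
  shows "slash f (z + of_int n) = ratio A (mobius \<sigma> z) * slash f z"
proof -
  have A\<Gamma>: "A \<in> \<Gamma>" using A by (simp add: cusp_stabilizer_def)
  define w0 where "w0 = wcocycle \<kappa> S \<sigma>"
  have "norm w0 = 1" unfolding w0_def by (rule norm_wcocycle[OF S_det \<sigma>_det])
  hence w0: "w0 \<noteq> 0" by auto
  \<comment> \<open>j(S, \<sigma> u) j(\<sigma>, u) = 1, but the principal powers multiply only to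
    the constant w0. This trades the power of j(\<sigma>, u) for one of j(S, \<sigma> u), on which
    the cocycle relation with A can act.\<close>
  have sl: "slash f u = automorphy S (mobius \<sigma> u) powr of_real \<kappa> * f (mobius \<sigma> u) / w0" if u: "u \<in> uhp" for u
  proof -
    have "w0 = automorphy S (mobius \<sigma> u) powr of_real \<kappa> * automorphy \<sigma> u powr of_real \<kappa>"
      using wcocycle_powr[OF S_det \<sigma>_det u, of \<kappa>] by (simp add: w0_def matrix_inv_cancel[OF \<sigma>_det] automorphy_one)
    moreover have "automorphy \<sigma> u powr of_real \<kappa> \<noteq> 0" using automorphy_nonzero[OF \<sigma>_det u] by simp
    ultimately show ?thesis using w0 unfolding slash_def by (simp add: powr_minus field_simps)
  qed
  define w where "w = mobius \<sigma> z"
  have w: "w \<in> uhp" unfolding w_def by (rule mobius_uhp[OF \<sigma>_det z])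
  have zn: "z + of_int n \<in> uhp" using z by (simp add: uhp_def)
  have "mobius \<sigma> (z + of_int n) = mobius A w"
  proof -
    have 1: "A ** \<sigma> = \<sigma> ** ((S ** A) ** \<sigma>)"
      by (simp add: matrix_mul_assoc[symmetric] matrix_inv_cancel(1)[OF \<sigma>_det])
    have "(translation n ** S) ** \<sigma> = translation n" "(- translation n ** S) ** \<sigma> = - translation n"
      by (rule matrix_inv_cancel(4)[OF \<sigma>_det])+
    hence "A ** \<sigma> = \<sigma> ** translation n \<or> A ** \<sigma> = - (\<sigma> ** translation n)"
      using n unfolding 1 mat2_minus_mult(2)[symmetric] by metis
    hence "mobius (A ** \<sigma>) z = mobius (\<sigma> ** translation n) z" by (auto simp: mobius_minus)
    moreover have "mobius (translation n) z = z + of_int n" by (rule mobius_translation)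
    ultimately show ?thesis using mobius_mult[OF \<sigma>_det z, of A] mobius_mult[OF det_translation z, of \<sigma> n] by (simp add: w_def)
  qed
  hence "slash f (z + of_int n) = (automorphy S (mobius A w) powr of_real \<kappa> * automorphy A w powr of_real \<kappa>) * \<nu> A * f w / w0"
    using sl[OF zn] f[OF A\<Gamma> w] by (simp add: mult_ac)
  also have "automorphy S (mobius A w) powr of_real \<kappa> * automorphy A w powr of_real \<kappa> = wcocycle \<kappa> S A * automorphy (S ** A) w powr of_real \<kappa>"
    by (rule wcocycle_powr[OF S_det \<Gamma>_det[OF A\<Gamma>] w, symmetric])
  finally show ?thesis
    unfolding sl[OF z] w_def[symmetric] ratio_def using nz_S[OF w] by simp
qed

text \<open>The conjugate of \<open>xi_bar\<close> intertwines slash actions: applied to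
  \<open>slash f\<close> it gives the holomorphic function belonging to f, slashed in weight 2 -
  \<kappa>, which is again holomorphic.\<close>

lemma slash_regularity:
  assumes f: "smooth_on uhp f" and lap: "\<forall>z\<in>uhp. weight_laplacian \<kappa> f z = 0"
  obtains F' where "\<And>z. z \<in> uhp \<Longrightarrow> (slash f has_derivative F' z) (at z)"
    "\<And>v. continuous_on uhp (\<lambda>z. F' z v)" "(\<lambda>z. cnj (xi_bar \<kappa> (slash f) z)) holomorphic_on uhp"
proof -
  define g where "g = (\<lambda>z. automorphy \<sigma> z powr (- of_real \<kappa>))"
  define j where "j = (\<lambda>z. automorphy \<sigma> z)"
  define h where "h = (\<lambda>z. cnj (xi_bar \<kappa> f z))"
  have jnz: "j z \<noteq> 0" if "z \<in> uhp" for z unfolding j_def by (rule automorphy_nonzero[OF \<sigma>_det that])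
  have m: "mobius \<sigma> z \<in> uhp" if "z \<in> uhp" for z by (rule mobius_uhp[OF \<sigma>_det that])
  have g_hol: "g holomorphic_on uhp" unfolding g_def by (rule holomorphic_automorphy_powr[OF \<sigma>_det])
  have j_hol: "j holomorphic_on uhp" unfolding j_def automorphy_def by (intro holomorphic_intros)
  have m_hol: "mobius \<sigma> holomorphic_on uhp"
    by (rule holomorphic_onI, rule field_differentiable_at_within, unfold field_differentiable_def)
       (blast intro: mobius_has_field_derivative[OF \<sigma>_det])
  have h_hol: "h holomorphic_on uhp" unfolding h_def using weight_laplacian_zero_iff[OF f] lap by blast
  have W: "(f has_derivative (\<lambda>v. d_dz f w * v + d_dzbar f w * cnj v)) (at w)" if "w \<in> uhp" for w
    using smooth_onD(1)[OF f that] by (intro has_derivative_Wirtinger) (auto simp: differentiable_def)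
  have cf: "continuous_on uhp (\<lambda>z. frechet_derivative f (at z) v)" for v
    by (rule smooth_onD(3)[OF smooth_onD(2)[OF f]])
  have cW: "continuous_on uhp (d_dz f)" "continuous_on uhp (d_dzbar f)"
    unfolding d_dz_def[abs_def] d_dzbar_def[abs_def]
    by (auto intro!: continuous_intros cf)
  define a where "a = (\<lambda>z. deriv g z * f (mobius \<sigma> z) + g z * d_dz f (mobius \<sigma> z) * inverse (j z) ^ 2)"
  define b where "b = (\<lambda>z. g z * d_dzbar f (mobius \<sigma> z) * cnj (inverse (j z) ^ 2))"
  have D: "(slash f has_derivative (\<lambda>v. a z * v + b z * cnj v)) (at z)" if z: "z \<in> uhp" for z
  proof -
    have dg: "(g has_derivative (\<lambda>v. deriv g z * v)) (at z)"
      using holomorphic_derivI[OF g_hol open_uhp z] by (simp add: has_field_derivative_def)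
    have dm: "(mobius \<sigma> has_derivative (\<lambda>v. inverse (j z) ^ 2 * v)) (at z)"
      using mobius_has_field_derivative[OF \<sigma>_det z] by (simp add: has_field_derivative_def j_def)
    have df: "((\<lambda>z. f (mobius \<sigma> z)) has_derivative (\<lambda>v. d_dz f (mobius \<sigma> z) * (inverse (j z) ^ 2 * v)
        + d_dzbar f (mobius \<sigma> z) * cnj (inverse (j z) ^ 2 * v))) (at z)"
      by (rule has_derivative_compose[OF dm W[OF m[OF z]]])
    have "(slash f has_derivative (\<lambda>v. g z * (d_dz f (mobius \<sigma> z) * (inverse (j z) ^ 2 * v)
        + d_dzbar f (mobius \<sigma> z) * cnj (inverse (j z) ^ 2 * v)) + deriv g z * v * f (mobius \<sigma> z))) (at z)"
      using has_derivative_mult[OF dg df] unfolding slash_def[abs_def] g_def .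
    moreover have "(\<lambda>v. g z * (d_dz f (mobius \<sigma> z) * (inverse (j z) ^ 2 * v)
        + d_dzbar f (mobius \<sigma> z) * cnj (inverse (j z) ^ 2 * v)) + deriv g z * v * f (mobius \<sigma> z))
       = (\<lambda>v. a z * v + b z * cnj v)"
      by (simp add: fun_eq_iff a_def b_def algebra_simps)
    ultimately show ?thesis by simp
  qed
  have cm: "continuous_on uhp (mobius \<sigma>)" by (rule continuous_on_mobius[OF \<sigma>_det])
  have comp: "continuous_on uhp (\<lambda>z. \<phi> (mobius \<sigma> z))" if "continuous_on uhp \<phi>" for \<phi> :: "complex \<Rightarrow> complex"
    by (rule continuous_on_compose2[OF that cm]) (use m in auto)
  have cg: "continuous_on uhp g" "continuous_on uhp (deriv g)" "continuous_on uhp j"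
    using g_hol j_hol holomorphic_deriv[OF g_hol open_uhp] by (auto intro: holomorphic_on_imp_continuous_on)
  have c: "continuous_on uhp (\<lambda>z. a z * v + b z * cnj v)" for v
    unfolding a_def b_def
    by (intro continuous_intros comp cg cW smooth_onD(3)[OF f]) (use jnz in auto)
  have H: "cnj (xi_bar \<kappa> (slash f) z) = h (mobius \<sigma> z) * automorphy \<sigma> z powr of_real \<kappa> * inverse (j z) ^ 2" if z: "z \<in> uhp" for z
  proof -
    have jz: "j z \<noteq> 0" by (rule jnz[OF z])
    define L where "L = Ln (j z)"
    have "norm (j z) powr (2 * \<kappa>) = exp (2 * \<kappa> * Re L)" using jz by (simp add: powr_def L_def Re_Ln)
    hence nj: "of_real (norm (j z) powr (2 * \<kappa>)) = exp (of_real (2 * \<kappa> * Re L) :: complex)" by (simp only: exp_of_real)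
    \<comment> \<open>|j|^(2\<kappa>) times the conjugate of j^(-\<kappa>) is j^\<kappa>; together
      with the derivative j^(-2) of the action of \<sigma> this is the factor of weight 2 -
      \<kappa>.\<close>
    have e: "of_real (norm (j z) powr (2 * \<kappa>)) * cnj (g z) = automorphy \<sigma> z powr of_real \<kappa>"
    proof -
      have "cnj (g z) = exp (- of_real \<kappa> * cnj L)"
        using jz by (simp add: g_def powr_def L_def j_def exp_cnj)
      hence "of_real (norm (j z) powr (2 * \<kappa>)) * cnj (g z) = exp (of_real (2 * \<kappa> * Re L) + - of_real \<kappa> * cnj L)"
        unfolding nj by (simp only: exp_add)
      also have "of_real (2 * \<kappa> * Re L) + - of_real \<kappa> * cnj L = of_real \<kappa> * L"
        by (simp add: complex_eq_iff)
      finally show ?thesis using jz by (simp add: powr_def L_def j_def)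
    qed
    have y: "Im z powr \<kappa> = Im (mobius \<sigma> z) powr \<kappa> * norm (j z) powr (2 * \<kappa>)"
      unfolding Im_mobius_powr[OF \<sigma>_det z] j_def[symmetric] using jz by (simp add: mult.assoc flip: powr_add)
    have "cnj (xi_bar \<kappa> (slash f) z) = of_real (Im z powr \<kappa>) * cnj (b z)"
      unfolding xi_bar_def Wirtinger_eqs(2)[OF D[OF z]] by simp
    also have "\<dots> = (of_real (Im (mobius \<sigma> z) powr \<kappa>) * cnj (d_dzbar f (mobius \<sigma> z))) *
        (of_real (norm (j z) powr (2 * \<kappa>)) * cnj (g z)) * inverse (j z) ^ 2"
      unfolding y b_def by (simp add: mult_ac)
    finally show ?thesis unfolding e h_def xi_bar_def by simp
  qed
  have "(\<lambda>z. h (mobius \<sigma> z) * automorphy \<sigma> z powr of_real \<kappa> * inverse (j z) ^ 2) holomorphic_on uhp"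
    using holomorphic_on_compose_gen[OF m_hol h_hol] m jnz
    by (intro holomorphic_intros holomorphic_automorphy_powr[OF \<sigma>_det] j_hol) (auto simp: o_def)
  hence "(\<lambda>z. cnj (xi_bar \<kappa> (slash f) z)) holomorphic_on uhp"
    by (rule holomorphic_transform) (simp add: H)
  thus ?thesis using that[OF D c] by blast
qed

lemma cusp_behaviour:
  assumes f: "f \<in> H_sharp \<kappa> \<Gamma> \<nu>" and \<aa>: "\<aa> \<in> cusps" and \<kappa>: "\<kappa> < 0"
  shows "\<exists>C. (\<not> singular_cusp \<Gamma> \<nu> \<kappa> \<aa> \<sigma> \<longrightarrow> C = 0) \<and> (\<forall>\<eta>>0. \<exists>Y. \<forall>z\<in>uhp. Im z \<ge> Y \<longrightarrow>
            Im z powr (\<kappa> / 2) * norm (slash f z - C * of_real (Im z powr (1 - \<kappa>))) \<le> \<eta>)"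
proof -
  have tr: "\<And>A z. A \<in> \<Gamma> \<Longrightarrow> z \<in> uhp \<Longrightarrow> f (mobius A z) = \<nu> A * automorphy A z powr of_real \<kappa> * f z"
    and sm: "smooth_on uhp f" and lap: "\<forall>z\<in>uhp. weight_laplacian \<kappa> f z = 0" and gr: "polynomial_growth_at \<kappa> f \<aa>"
    using f \<aa> by (auto simp: H_sharp_def)
  obtain F' where F': "\<And>z. z \<in> uhp \<Longrightarrow> (slash f has_derivative F' z) (at z)"
    "\<And>v. continuous_on uhp (\<lambda>z. F' z v)" "(\<lambda>z. cnj (xi_bar \<kappa> (slash f) z)) holomorphic_on uhp"
    using slash_regularity[OF sm lap] by blast
  have "translation 1 \<in> (\<lambda>A. S ** A ** \<sigma>) ` (cusp_stabilizer \<Gamma> \<aa> \<union> uminus ` cusp_stabilizer \<Gamma> \<aa>)"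
    using scal unfolding scaling_matrix_def by blast
  then obtain A where A: "A \<in> cusp_stabilizer \<Gamma> \<aa>" "S ** A ** \<sigma> = translation 1 \<or> S ** (- A) ** \<sigma> = translation 1"
    by auto
  have SA: "S ** A = translation 1 ** S \<or> S ** A = - translation 1 ** S"
  proof -
    have "S ** A = (S ** A ** \<sigma>) ** S" by (simp add: matrix_inv_cancel[OF \<sigma>_det])
    moreover have "S ** A = - ((S ** (- A) ** \<sigma>) ** S)" by (simp add: matrix_inv_cancel[OF \<sigma>_det] mat2_minus_mult)
    ultimately show ?thesis using A(2) by (metis mat2_minus_mult(1))
  qed
  have sh: "slash f (z + of_int 1) = ratio A (mobius \<sigma> z) * slash f z" if "z \<in> uhp" for z
    by (rule slash_shift[OF _ A(1) SA that]) (rule tr)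
  obtain e where e: "norm e = 1" "\<And>w. w \<in> uhp \<Longrightarrow> ratio A w = e" using ratio_const[OF A(1)] by blast
  have per: "slash f (z + 1) = e * slash f z" if "z \<in> uhp" for z
    using sh[OF that] e(2)[OF mobius_uhp[OF \<sigma>_det that]] by simp
  have \<sigma>_SL2R: "\<sigma> \<in> SL2R" using \<sigma>_det by (simp add: SL2R_def)
  obtain a C Y where g: "\<And>z. z \<in> uhp \<Longrightarrow> Im z \<ge> Y \<Longrightarrow> norm (slash f z) \<le> C * Im z powr a"
    using bspec[OF gr[unfolded polynomial_growth_at_def] \<sigma>_SL2R] \<sigma>_cusp unfolding slash_def by blast
  have g': "norm (slash f z) \<le> C * Im z powr a" if "Im z \<ge> max 1 Y" for z
    using g[of z] that by (simp add: uhp_def)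
  define k where "k = 2 - \<kappa>"
  have k: "k > 2" "2 - k = \<kappa>" "k - 1 = 1 - \<kappa>" using \<kappa> by (auto simp: k_def)
  have Y1: "max 1 Y > 0" by simp
  have "\<exists>C. (e \<noteq> 1 \<longrightarrow> C = 0) \<and> (\<forall>\<eta>>0. \<exists>Y. \<forall>z\<in>uhp. Im z \<ge> Y \<longrightarrow>
            Im z powr ((2 - k) / 2) * norm (slash f z - C * of_real (Im z powr (k - 1))) \<le> \<eta>)"
  proof (rule cusp_expansion[where F = "slash f" and F' = F' and \<epsilon> = e and Y = "max 1 Y" and B = C and a = a])
    show "(\<lambda>z. cnj (xi_bar (2 - k) (slash f) z)) holomorphic_on uhp" using F'(3) by (simp only: k(2))
  qed (use k(1) F'(1,2) per e(1) Y1 g' in blast)+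
  hence "\<exists>C. (e \<noteq> 1 \<longrightarrow> C = 0) \<and> (\<forall>\<eta>>0. \<exists>Y. \<forall>z\<in>uhp. Im z \<ge> Y \<longrightarrow>
            Im z powr (\<kappa> / 2) * norm (slash f z - C * of_real (Im z powr (1 - \<kappa>))) \<le> \<eta>)"
    by (simp only: k(2,3))
  then obtain C where C: "e \<noteq> 1 \<longrightarrow> C = 0" "\<forall>\<eta>>0. \<exists>Y. \<forall>z\<in>uhp. Im z \<ge> Y \<longrightarrow>
            Im z powr (\<kappa> / 2) * norm (slash f z - C * of_real (Im z powr (1 - \<kappa>))) \<le> \<eta>" by blast
  show ?thesis
  \<comment> \<open>Singularity is a condition on the whole stabilizer, while e belongs to a single
    element A. If e = 1 and some B violates the condition, the slash transform is both invariant
    under a translation by n and multiplied by a constant other than 1, so it vanishes.\<close>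
  proof (cases "e = 1 \<and> \<not> singular_cusp \<Gamma> \<nu> \<kappa> \<aa> \<sigma>")
    case False
    have "C = 0" if "\<not> singular_cusp \<Gamma> \<nu> \<kappa> \<aa> \<sigma>" using False that C(1) by blast
    thus ?thesis using C(2) by blast
  next
    case True
    then obtain B w where B: "B \<in> cusp_stabilizer \<Gamma> \<aa>" "w \<in> uhp" "ratio B w \<noteq> 1"
      unfolding singular_iff_ratio by blast
    obtain n where n: "S ** B = translation n ** S \<or> S ** B = - translation n ** S"
      using scaled_stabilizer[OF scal B(1)] by metis
    obtain e' where e': "norm e' = 1" "\<And>w. w \<in> uhp \<Longrightarrow> ratio B w = e'" using ratio_const[OF B(1)] by blast
    have zero: "slash f z = 0" if z: "z \<in> uhp" for z
    proof -
      have "slash f (z + of_int n) = slash f z"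
      proof (induction n rule: int_induct[where k = 0])
        case (step1 i)
        have "z + of_int i \<in> uhp" using z by (simp add: uhp_def)
        thus ?case using per[of "z + of_int i"] step1 True by (simp add: add.assoc)
      next
        case (step2 i)
        have "z + of_int (i - 1) \<in> uhp" using z by (simp add: uhp_def)
        thus ?case using per[of "z + of_int (i - 1)"] step2 True by (simp add: add.assoc)
      qed simp
      moreover have "slash f (z + of_int n) = ratio B (mobius \<sigma> z) * slash f z"
        by (rule slash_shift[OF _ B(1) n z]) (rule tr)
      hence "slash f (z + of_int n) = e' * slash f z"
        using e'(2)[OF mobius_uhp[OF \<sigma>_det z]] by simp
      moreover have "e' \<noteq> 1" using B e' by auto
      ultimately show ?thesis by simp
    qed
    show ?thesis by (rule exI[of _ 0]) (auto simp: zero)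
  qed
qed

end

section \<open>The mock Eisenstein series span\<close>

text \<open>The remainder is measured by the invariant norm \<open>y\<^bsup>\<kappa>/2\<^esup> |h|\<close>: a form with leading coefficient \<open>0\<close> at all
  cusps then attains the maximum of this norm.\<close>

definition cusp_asymp :: "real \<Rightarrow> real \<Rightarrow> real^2^2 \<Rightarrow> (complex \<Rightarrow> complex) \<Rightarrow> complex \<Rightarrow> bool" where
  "cusp_asymp \<kappa> e \<tau> h c \<longleftrightarrow> (\<forall>\<eta>>0. \<exists>Y. \<forall>z\<in>uhp. Im z \<ge> Y \<longrightarrow>
     Im z powr (\<kappa> / 2) * norm (automorphy \<tau> z powr (- of_real \<kappa>) * h (mobius \<tau> z) - c * of_real (Im z powr e)) \<le> \<eta>)"

lemma cusp_asympD:
  assumes "cusp_asymp \<kappa> e \<tau> h c" "\<eta> > 0"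
  obtains Y where "\<And>z. z \<in> uhp \<Longrightarrow> Im z \<ge> Y \<Longrightarrow>
     Im z powr (\<kappa> / 2) * norm (automorphy \<tau> z powr (- of_real \<kappa>) * h (mobius \<tau> z) - c * of_real (Im z powr e)) \<le> \<eta>"
  using assms unfolding cusp_asymp_def by blast

lemma cusp_asymp_zero: "cusp_asymp \<kappa> e \<tau> 0 0"
  by (auto simp: cusp_asymp_def)

lemma cusp_asymp_lincomb:
  assumes h: "cusp_asymp \<kappa> e \<tau> h c" and h': "cusp_asymp \<kappa> e \<tau> h' c'"
  shows "cusp_asymp \<kappa> e \<tau> (cfun_scale x h + h') (x * c + c')"
  unfolding cusp_asymp_def
proof (intro allI impI)
  fix \<eta> :: real assume \<eta>: "\<eta> > 0"
  define \<eta>' where "\<eta>' = \<eta> / (norm x + 1)"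
  have n: "norm x + 1 > 0" using norm_ge_zero[of x] by linarith
  have \<eta>': "\<eta>' > 0" unfolding \<eta>'_def using \<eta> n by (rule divide_pos_pos)
  obtain Y1 where Y1: "\<And>z. z \<in> uhp \<Longrightarrow> Im z \<ge> Y1 \<Longrightarrow>
     Im z powr (\<kappa> / 2) * norm (automorphy \<tau> z powr (- of_real \<kappa>) * h (mobius \<tau> z) - c * of_real (Im z powr e)) \<le> \<eta>'"
    using cusp_asympD[OF h \<eta>'] by blast
  obtain Y2 where Y2: "\<And>z. z \<in> uhp \<Longrightarrow> Im z \<ge> Y2 \<Longrightarrow>
     Im z powr (\<kappa> / 2) * norm (automorphy \<tau> z powr (- of_real \<kappa>) * h' (mobius \<tau> z) - c' * of_real (Im z powr e)) \<le> \<eta>'"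
    using cusp_asympD[OF h' \<eta>'] by blast
  have "Im z powr (\<kappa> / 2) * norm (automorphy \<tau> z powr (- of_real \<kappa>) * (cfun_scale x h + h') (mobius \<tau> z) - (x * c + c') * of_real (Im z powr e)) \<le> \<eta>"
    if z: "z \<in> uhp" "Im z \<ge> max Y1 Y2" for z
  proof -
    define A where "A = automorphy \<tau> z powr (- of_real \<kappa>) * h (mobius \<tau> z) - c * of_real (Im z powr e)"
    define B where "B = automorphy \<tau> z powr (- of_real \<kappa>) * h' (mobius \<tau> z) - c' * of_real (Im z powr e)"
    have 1: "Im z powr (\<kappa> / 2) * norm A \<le> \<eta>'" "Im z powr (\<kappa> / 2) * norm B \<le> \<eta>'"
      using Y1[of z] Y2[of z] z by (auto simp: A_def B_def)
    have "automorphy \<tau> z powr (- of_real \<kappa>) * (cfun_scale x h + h') (mobius \<tau> z) - (x * c + c') * of_real (Im z powr e) = x * A + B"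
      by (simp add: A_def B_def cfun_scale_def algebra_simps)
    also have "norm (x * A + B) \<le> norm x * norm A + norm B"
      by (rule order_trans[OF norm_triangle_ineq]) (simp add: norm_mult)
    finally have "Im z powr (\<kappa> / 2) * norm (automorphy \<tau> z powr (- of_real \<kappa>) * (cfun_scale x h + h') (mobius \<tau> z) - (x * c + c') * of_real (Im z powr e))
        \<le> Im z powr (\<kappa> / 2) * (norm x * norm A + norm B)" by (rule mult_left_mono) simp
    also have "\<dots> = norm x * (Im z powr (\<kappa> / 2) * norm A) + Im z powr (\<kappa> / 2) * norm B" by (simp add: algebra_simps)
    also have "\<dots> \<le> norm x * \<eta>' + \<eta>'" using 1 by (intro add_mono mult_left_mono) auto
    also have "\<dots> = \<eta>' * (norm x + 1)" by (simp add: algebra_simps)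
    also have "\<dots> = \<eta>" using n by (simp add: \<eta>'_def)
    finally show ?thesis .
  qed
  thus "\<exists>Y. \<forall>z\<in>uhp. Im z \<ge> Y \<longrightarrow>
     Im z powr (\<kappa> / 2) * norm (automorphy \<tau> z powr (- of_real \<kappa>) * (cfun_scale x h + h') (mobius \<tau> z) - (x * c + c') * of_real (Im z powr e)) \<le> \<eta>"
    by blast
qed

lemma cusp_asymp_sum:
  assumes "finite I" "\<And>i. i \<in> I \<Longrightarrow> cusp_asymp \<kappa> e \<tau> (h i) (c i)"
  shows "cusp_asymp \<kappa> e \<tau> (\<Sum>i\<in>I. cfun_scale (x i) (h i)) (\<Sum>i\<in>I. x i * c i)"
  using assms by (induction I rule: finite_induct) (auto intro: cusp_asymp_zero cusp_asymp_lincomb)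

lemma cusp_asymp_zero_unique:
  assumes "cusp_asymp \<kappa> e \<tau> 0 c" "\<kappa> / 2 + e > 0"
  shows "c = 0"
proof (rule ccontr)
  assume c: "c \<noteq> 0"
  hence "norm c / 2 > 0" by simp
  from cusp_asympD[OF assms(1) this] obtain Y where Y: "\<And>z. z \<in> uhp \<Longrightarrow> Im z \<ge> Y \<Longrightarrow>
     Im z powr (\<kappa> / 2) * norm (automorphy \<tau> z powr (- of_real \<kappa>) * (0 :: complex \<Rightarrow> complex) (mobius \<tau> z) - c * of_real (Im z powr e)) \<le> norm c / 2"
    by blast
  define y where "y = max 1 Y"
  have "Im (of_real y * \<i>) powr (\<kappa> / 2) * norm (- (c * of_real (Im (of_real y * \<i>) powr e))) \<le> norm c / 2"
    using Y[of "of_real y * \<i>"] by (simp add: uhp_def y_def)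
  hence "norm c * (y powr (\<kappa> / 2) * y powr e) \<le> norm c / 2" by (simp add: norm_mult mult_ac)
  hence "norm c * y powr (\<kappa> / 2 + e) \<le> norm c / 2" by (simp only: powr_add)
  moreover have "1 \<le> y powr (\<kappa> / 2 + e)" using assms(2) by (intro ge_one_powr_ge_zero) (auto simp: y_def)
  hence "norm c * 1 \<le> norm c * y powr (\<kappa> / 2 + e)" by (rule mult_left_mono) simp
  ultimately show False using c by simp
qed

text \<open>The matrix of leading coefficients is diagonal with nonzero entries. The parameters are
  (2 - k, k - 1) for the mock series and (k, 0) for the series of weight k; in both cases \<kappa>/2
  + e = k/2 is positive, so a nonzero leading term cannot be negligible.\<close>

lemma cusp_asymp_independent:
  fixes \<phi> :: "'a \<Rightarrow> complex \<Rightarrow> complex"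
  assumes I: "finite I" and pos: "\<kappa> / 2 + e > 0"
    and self: "\<And>a. a \<in> I \<Longrightarrow> \<exists>u. u \<noteq> 0 \<and> cusp_asymp \<kappa> e (\<sigma> a) (\<phi> a) u"
    and other: "\<And>a b. a \<in> I \<Longrightarrow> b \<in> I \<Longrightarrow> a \<noteq> b \<Longrightarrow> cusp_asymp \<kappa> e (\<sigma> b) (\<phi> a) 0"
  shows "inj_on \<phi> I" "cfun.independent (\<phi> ` I)"
proof -
  show inj: "inj_on \<phi> I"
  proof (rule inj_onI, rule ccontr)
    fix a b assume ab: "a \<in> I" "b \<in> I" "\<phi> a = \<phi> b" "a \<noteq> b"
    obtain u where u: "u \<noteq> 0" "cusp_asymp \<kappa> e (\<sigma> b) (\<phi> b) u" using self[OF ab(2)] by blast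
    have "cusp_asymp \<kappa> e (\<sigma> b) (cfun_scale (- 1) (\<phi> b) + \<phi> a) (- 1 * u + 0)"
      by (rule cusp_asymp_lincomb[OF u(2) other[OF ab(1,2,4)]])
    moreover have "cfun_scale (- 1) (\<phi> b) + \<phi> a = 0" by (simp add: ab(3) cfun_scale_def fun_eq_iff)
    ultimately show False using cusp_asymp_zero_unique[OF _ pos] u(1) by fastforce
  qed
  show "cfun.independent (\<phi> ` I)"
  proof
    assume "cfun.dependent (\<phi> ` I)"
    then obtain u a where u: "a \<in> I" "u (\<phi> a) \<noteq> 0" "(\<Sum>v\<in>\<phi> ` I. cfun_scale (u v) v) = 0"
      using I by (auto simp: cfun.dependent_finite)
    obtain v where v: "v \<noteq> 0" "cusp_asymp \<kappa> e (\<sigma> a) (\<phi> a) v" using self[OF u(1)] by blast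
    have "cusp_asymp \<kappa> e (\<sigma> a) (\<Sum>b\<in>I. cfun_scale (u (\<phi> b)) (\<phi> b)) (\<Sum>b\<in>I. u (\<phi> b) * (if b = a then v else 0))"
      using other u(1) v(2) by (intro cusp_asymp_sum I) auto
    moreover have "(\<Sum>b\<in>I. cfun_scale (u (\<phi> b)) (\<phi> b)) = 0" using u(3) by (simp add: sum.reindex[OF inj])
    moreover have "(\<Sum>b\<in>I. u (\<phi> b) * (if b = a then v else 0)) = u (\<phi> a) * v"
      using I u(1) by (simp add: if_distrib[of "\<lambda>x. _ * x"] sum.delta cong: if_cong)
    ultimately have "cusp_asymp \<kappa> e (\<sigma> a) 0 (u (\<phi> a) * v)" by simp
    from cusp_asymp_zero_unique[OF this pos] show False using u(2) v(1) by simp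
  qed
qed

section \<open>Leading coefficients of Eisenstein series\<close>

context eisenstein_setup
begin

text \<open>For s = k - 1 this is k - 1 times the mock Eisenstein series, for s = 0 the holomorphic
  one. The factor y^s makes it transform with pure weight \<kappa>.\<close>

definition "M z = of_real (Im z powr s) * E z"

text \<open>Transfer of \<open>eisenstein_cusp_asymp\<close> from an integral matrix to a real one
  with the same cusp, as scaling matrices require.\<close>

lemma eisenstein_tail:
  assumes \<rho>': "\<rho>' \<in> carrier SL2Z" and \<tau>: "det \<tau> = 1" "bdry_mobius \<tau> None = bdry_mobius \<rho>' None" and \<eta>: "\<eta> > 0"
  shows "\<exists>Y. \<forall>z\<in>uhp. Im z \<ge> Y \<longrightarrow> Im (mobius \<tau> z) powr (k / 2) * norm (E (mobius \<tau> z)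
      - (\<Sum>K\<in>{K\<in>cosets. bdry_mobius (rep K) (bdry_mobius \<rho>' None) = \<aa>}. etrm (mobius \<tau> z) (rep K))) \<le> \<eta>"
proof -
  obtain C where C: "\<And>z. z \<in> uhp \<Longrightarrow> Im z \<ge> 1 \<Longrightarrow> Im (mobius \<rho>' z) powr (k / 2) * norm (E (mobius \<rho>' z)
      - (\<Sum>K\<in>{K\<in>cosets. bdry_mobius (rep K) (bdry_mobius \<rho>' None) = \<aa>}. etrm (mobius \<rho>' z) (rep K)))
    \<le> C * Im z powr (- (k/4 - 1/2))" using eisenstein_cusp_asymp[OF \<rho>'] by blast
  obtain \<alpha> \<beta> where ab: "\<alpha> \<noteq> 0" "\<And>z. z \<in> uhp \<Longrightarrow> mobius \<tau> z = mobius \<rho>' (of_real (\<alpha>\<^sup>2) * z + of_real (\<alpha> * \<beta>))"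
    using same_cusp_matrix[OF \<tau>(1) SL2Z_det[OF \<rho>'] \<tau>(2)] by metis
  have "((\<lambda>y. C * y powr (- (k/4 - 1/2))) \<longlongrightarrow> 0) at_top"
    using k(2) by (intro tendsto_mult_right_zero tendsto_neg_powr filterlim_ident) auto
  hence "\<forall>\<^sub>F y in at_top. C * y powr (- (k/4 - 1/2)) < \<eta>" using \<eta> by (rule order_tendstoD(2))
  then obtain Y where Y: "\<And>y. y \<ge> Y \<Longrightarrow> C * y powr (- (k/4 - 1/2)) < \<eta>"
    by (auto simp: eventually_at_top_linorder)
  show ?thesis
  proof (intro exI[of _ "max 1 Y / \<alpha>\<^sup>2"] ballI impI)
    fix z assume z: "z \<in> uhp" "Im z \<ge> max 1 Y / \<alpha>\<^sup>2"
    define w where "w = of_real (\<alpha>\<^sup>2) * z + of_real (\<alpha> * \<beta>)"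
    have mw: "mobius \<tau> z = mobius \<rho>' w" unfolding w_def by (rule ab(2)[OF z(1)])
    have "Im w = \<alpha>\<^sup>2 * Im z" by (simp add: w_def)
    moreover have "max 1 Y \<le> \<alpha>\<^sup>2 * Im z"
      using z(2) pos_divide_le_eq[of "\<alpha>\<^sup>2" "max 1 Y" "Im z"] ab(1) by (simp add: mult.commute)
    ultimately have Imw: "Im w \<ge> 1" "Im w \<ge> Y" by auto
    hence "w \<in> uhp" by (simp add: uhp_def)
    from C[OF this Imw(1)] Y[OF Imw(2)]
    show "Im (mobius \<tau> z) powr (k / 2) * norm (E (mobius \<tau> z)
      - (\<Sum>K\<in>{K\<in>cosets. bdry_mobius (rep K) (bdry_mobius \<rho>' None) = \<aa>}. etrm (mobius \<tau> z) (rep K))) \<le> \<eta>"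
      unfolding mw by linarith
  qed
qed

lemma slash_M_norm:
  assumes "det \<tau> = 1" "z \<in> uhp"
  shows "Im z powr (\<kappa> / 2) * norm (automorphy \<tau> z powr (- of_real \<kappa>) * (of_real (Im (mobius \<tau> z) powr s) * x))
    = Im (mobius \<tau> z) powr (k / 2) * norm x"
proof -
  have "Im (mobius \<tau> z) powr (\<kappa> / 2) * Im (mobius \<tau> z) powr s = Im (mobius \<tau> z) powr (k / 2)"
    by (simp add: k(1) field_simps flip: powr_add)
  thus ?thesis
    using slash_norm[OF assms, of \<kappa> "\<lambda>_. of_real (Im (mobius \<tau> z) powr s) * x"]
    by (simp add: norm_mult mult.assoc[symmetric])
qed

text \<open>No coset carries \<bb> to \<aa>, so the whole series is tail.\<close>

lemma M_asymp_other:
  assumes \<bb>: "\<bb> \<in> cusps" and \<tau>: "det \<tau> = 1" "bdry_mobius \<tau> None = \<bb>" and ne: "\<And>A. A \<in> \<Gamma> \<Longrightarrow> bdry_mobius A \<bb> \<noteq> \<aa>"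
  shows "cusp_asymp \<kappa> s \<tau> M 0"
  unfolding cusp_asymp_def
proof (intro allI impI)
  fix \<eta> :: real assume "\<eta> > 0"
  obtain \<rho>' where \<rho>': "\<rho>' \<in> carrier SL2Z" "bdry_mobius \<rho>' None = \<bb>" using cusp_eq_SL2Z_image[OF \<bb>] by blast
  have empty: "{K\<in>cosets. bdry_mobius (rep K) (bdry_mobius \<rho>' None) = \<aa>} = {}" using ne rep(1) \<rho>'(2) by blast
  obtain Y where Y: "\<And>z. z \<in> uhp \<Longrightarrow> Im z \<ge> Y \<Longrightarrow> Im (mobius \<tau> z) powr (k / 2) * norm (E (mobius \<tau> z)) \<le> \<eta>"
    using eisenstein_tail[OF \<rho>'(1) \<tau>(1) _ \<open>\<eta> > 0\<close>] \<tau>(2) \<rho>'(2) unfolding empty by auto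
  show "\<exists>Y. \<forall>z\<in>uhp. Im z \<ge> Y \<longrightarrow> Im z powr (\<kappa> / 2) * norm (automorphy \<tau> z powr (- of_real \<kappa>) * M (mobius \<tau> z) - 0 * of_real (Im z powr s)) \<le> \<eta>"
    using Y slash_M_norm[OF \<tau>(1)] by (auto simp: M_def)
qed

text \<open>Only the coset of the identity fixes \<aa>, and since j(S, \<sigma> z) j(\<sigma>, z) =
  1 its term turns into a unimodular multiple of y^s.\<close>

lemma M_asymp_self: "\<exists>u. u \<noteq> 0 \<and> cusp_asymp \<kappa> s \<sigma> M u"
proof -
  define w0 where "w0 = wcocycle \<kappa> S \<sigma>"
  define C1 where "C1 = cnj (\<nu> (mat 1)) * cnj (wcocycle \<kappa> S (mat 1))"
  define u where "u = C1 / w0"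
  have d1: "det (mat 1 :: real^2^2) = 1" by simp
  have "norm w0 = 1" unfolding w0_def by (rule norm_wcocycle[OF S_det \<sigma>_det])
  moreover have "norm C1 = 1"
    using norm_\<nu>[OF \<Gamma>_closed(2)] norm_wcocycle[OF S_det d1] by (simp add: C1_def norm_mult)
  ultimately have w0: "w0 \<noteq> 0" and u: "u \<noteq> 0" by (auto simp: u_def)
  have T0: "{K\<in>cosets. bdry_mobius (rep K) (bdry_mobius \<rho> None) = \<aa>} = {coset (mat 1)}"
  proof -
    have "matrix_inv (mat 1 :: real^2^2) = mat 1" by (rule matrix_inv_unique) simp_all
    hence iff: "coset A = coset (mat 1) \<longleftrightarrow> bdry_mobius A \<aa> = \<aa>" if "A \<in> \<Gamma>" for A
      using coset_eq_iff[OF that \<Gamma>_closed(2)] by simp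
    have "coset (mat 1) \<in> cosets" using \<Gamma>_closed(2) cosets_eq by blast
    thus ?thesis using iff[OF rep(1)] rep(2) \<rho>(2) by auto
  qed
  have main: "automorphy \<sigma> z powr (- of_real \<kappa>) * (of_real (Im (mobius \<sigma> z) powr s) * etrm (mobius \<sigma> z) (mat 1)) = u * of_real (Im z powr s)"
    if z: "z \<in> uhp" for z
  proof -
    define j where "j = automorphy \<sigma> z" define J where "J = automorphy S (mobius \<sigma> z)"
    have m: "mobius \<sigma> z \<in> uhp" by (rule mobius_uhp[OF \<sigma>_det z])
    have Jj: "J * j = 1"
      using automorphy_mult[OF \<sigma>_det z, of S] by (simp add: J_def j_def matrix_inv_cancel[OF \<sigma>_det] automorphy_one)
    have j0: "norm j > 0" using Jj by auto
    have nJ: "norm J = 1 / norm j" using Jj j0 by (metis norm_mult norm_one nonzero_eq_divide_eq less_irrefl)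
    have w: "w0 = J powr of_real \<kappa> * j powr of_real \<kappa>"
      using wcocycle_powr[OF S_det \<sigma>_det z, of \<kappa>] by (simp add: w0_def J_def j_def matrix_inv_cancel[OF \<sigma>_det] automorphy_one)
    have nz: "j powr of_real \<kappa> \<noteq> 0" "J powr of_real \<kappa> \<noteq> 0" using Jj by auto
    have p: "j powr (- of_real \<kappa>) * J powr (- of_real \<kappa>) = 1 / w0"
      unfolding w powr_minus using nz by (simp add: field_simps)
    have "(of_real (norm J) :: complex) powr (- 2 * of_real s) = of_real (norm J powr (- 2 * s))"
      using powr_of_real[of "norm J" "- 2 * s"] by simp
    also have "norm J powr (- 2 * s) = norm j powr (2 * s)"
      unfolding nJ using j0 by (simp add: powr_divide powr_minus)
    finally have q: "of_real (Im (mobius \<sigma> z) powr s) * (of_real (norm J) :: complex) powr (- 2 * of_real s) = of_real (Im z powr s)"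
      unfolding Im_mobius_powr[OF \<sigma>_det z] j_def[symmetric] using j0
      by (simp add: mult.assoc flip: of_real_mult powr_add)
    have "etrm (mobius \<sigma> z) (mat 1) = C1 * J powr (- of_real \<kappa>) * of_real (norm J) powr (- 2 * of_real s)"
      by (simp add: eisenstein_term_def C1_def J_def)
    hence "automorphy \<sigma> z powr (- of_real \<kappa>) * (of_real (Im (mobius \<sigma> z) powr s) * etrm (mobius \<sigma> z) (mat 1)) =
       C1 * (j powr (- of_real \<kappa>) * J powr (- of_real \<kappa>)) * (of_real (Im (mobius \<sigma> z) powr s) * of_real (norm J) powr (- 2 * of_real s))"
      by (simp add: j_def mult_ac)
    thus ?thesis unfolding p q u_def by simp
  qed
  have "cusp_asymp \<kappa> s \<sigma> M u"
    unfolding cusp_asymp_def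
  proof (intro allI impI)
    fix \<eta> :: real assume \<eta>: "\<eta> > 0"
    have b: "bdry_mobius \<sigma> None = bdry_mobius \<rho> None" using \<sigma>_cusp \<rho>(2) by simp
    have "\<exists>Y. \<forall>z\<in>uhp. Im z \<ge> Y \<longrightarrow> Im (mobius \<sigma> z) powr (k / 2) * norm (E (mobius \<sigma> z)
      - etrm (mobius \<sigma> z) (rep (coset (mat 1)))) \<le> \<eta>"
      using eisenstein_tail[OF \<rho>(1) \<sigma>_det b \<eta>] unfolding T0 by simp
    then obtain Y where Y: "\<And>z. z \<in> uhp \<Longrightarrow> Im z \<ge> Y \<Longrightarrow> Im (mobius \<sigma> z) powr (k / 2) * norm (E (mobius \<sigma> z)
      - etrm (mobius \<sigma> z) (rep (coset (mat 1)))) \<le> \<eta>" by blast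
    show "\<exists>Y. \<forall>z\<in>uhp. Im z \<ge> Y \<longrightarrow> Im z powr (\<kappa> / 2) * norm (automorphy \<sigma> z powr (- of_real \<kappa>) * M (mobius \<sigma> z) - u * of_real (Im z powr s)) \<le> \<eta>"
    proof (intro exI[of _ Y] ballI impI)
      fix z assume z: "z \<in> uhp" "Im z \<ge> Y"
      have "automorphy \<sigma> z powr (- of_real \<kappa>) * M (mobius \<sigma> z) - u * of_real (Im z powr s) =
         automorphy \<sigma> z powr (- of_real \<kappa>) * (of_real (Im (mobius \<sigma> z) powr s) * (E (mobius \<sigma> z) - etrm (mobius \<sigma> z) (mat 1)))"
        unfolding main[OF z(1), symmetric] M_def by (simp add: algebra_simps)
      thus "Im z powr (\<kappa> / 2) * norm (automorphy \<sigma> z powr (- of_real \<kappa>) * M (mobius \<sigma> z) - u * of_real (Im z powr s)) \<le> \<eta>"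
        using Y[OF z] slash_M_norm[OF \<sigma>_det z(1)] etrm_rep[OF \<Gamma>_closed(2) mobius_uhp[OF \<sigma>_det z(1)]] by simp
    qed
  qed
  thus ?thesis using u by blast
qed

end

lemma mock_eisenstein_asymp:
  assumes "subgroup \<Gamma> SL2Z" "multiplier_system \<Gamma> \<nu> (2 - k)" "scaling_matrix \<Gamma> \<aa> \<sigma>"
    "singular_cusp \<Gamma> \<nu> (2 - k) \<aa> \<sigma>" "k > 2" "\<aa> \<in> cusps"
  shows "mock_eisenstein k \<Gamma> \<nu> \<aa> \<sigma> \<in> H_sharp (2 - k) \<Gamma> \<nu>"
    "\<exists>u. u \<noteq> 0 \<and> cusp_asymp (2 - k) (k - 1) \<sigma> (mock_eisenstein k \<Gamma> \<nu> \<aa> \<sigma>) u"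
    "\<And>\<tau> \<bb>. \<bb> \<in> cusps \<Longrightarrow> det \<tau> = 1 \<Longrightarrow> bdry_mobius \<tau> None = \<bb> \<Longrightarrow> (\<And>A. A \<in> \<Gamma> \<Longrightarrow> bdry_mobius A \<bb> \<noteq> \<aa>) \<Longrightarrow>
       cusp_asymp (2 - k) (k - 1) \<tau> (mock_eisenstein k \<Gamma> \<nu> \<aa> \<sigma>) 0"
proof -
  obtain \<rho> where \<rho>: "\<rho> \<in> carrier SL2Z" "bdry_mobius \<rho> None = \<aa>" using cusp_eq_SL2Z_image[OF assms(6)] by blast
  interpret mock_setup \<Gamma> \<nu> k \<aa> \<sigma> \<rho>
    by (intro mock_setup.intro eisenstein_setup.intro) (use assms \<rho> in \<open>simp_all del: bdry_mobius.simps\<close>)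
  show "mock_eisenstein k \<Gamma> \<nu> \<aa> \<sigma> \<in> H_sharp (2 - k) \<Gamma> \<nu>" by (rule mock_in_H_sharp)
  have eq: "mock_eisenstein k \<Gamma> \<nu> \<aa> \<sigma> = cfun_scale (of_real (1 / (k - 1))) M + 0"
    by (simp add: fun_eq_iff mock_eisenstein_def cfun_scale_def M_def)
  have k1: "of_real (1 / (k - 1)) \<noteq> (0 :: complex)" unfolding of_real_eq_0_iff using k(2) by simp
  obtain u where u: "u \<noteq> 0" "cusp_asymp (2 - k) (k - 1) \<sigma> M u" using M_asymp_self by blast
  have "cusp_asymp (2 - k) (k - 1) \<sigma> (mock_eisenstein k \<Gamma> \<nu> \<aa> \<sigma>) (of_real (1 / (k - 1)) * u + 0)"
    unfolding eq by (rule cusp_asymp_lincomb[OF u(2) cusp_asymp_zero])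
  thus "\<exists>u. u \<noteq> 0 \<and> cusp_asymp (2 - k) (k - 1) \<sigma> (mock_eisenstein k \<Gamma> \<nu> \<aa> \<sigma>) u"
    using u(1) k1 by (metis add.right_neutral mult_eq_0_iff)
  fix \<tau> \<bb> assume b: "\<bb> \<in> cusps" "det \<tau> = 1" "bdry_mobius \<tau> None = \<bb>" "\<And>A. A \<in> \<Gamma> \<Longrightarrow> bdry_mobius A \<bb> \<noteq> \<aa>"
  have "cusp_asymp (2 - k) (k - 1) \<tau> (mock_eisenstein k \<Gamma> \<nu> \<aa> \<sigma>) (of_real (1 / (k - 1)) * 0 + 0)"
    unfolding eq by (rule cusp_asymp_lincomb[OF M_asymp_other[OF b] cusp_asymp_zero])
  thus "cusp_asymp (2 - k) (k - 1) \<tau> (mock_eisenstein k \<Gamma> \<nu> \<aa> \<sigma>) 0" by simp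
qed

lemma holomorphic_eisenstein_asymp:
  assumes "subgroup \<Gamma> SL2Z" "multiplier_system \<Gamma> \<mu> k" "scaling_matrix \<Gamma> \<aa> \<sigma>"
    "singular_cusp \<Gamma> \<mu> k \<aa> \<sigma>" "k > 2" "\<aa> \<in> cusps"
  shows "\<exists>u. u \<noteq> 0 \<and> cusp_asymp k 0 \<sigma> (eisenstein k \<Gamma> \<mu> \<aa> \<sigma> 0) u"
    "\<And>\<tau> \<bb>. \<bb> \<in> cusps \<Longrightarrow> det \<tau> = 1 \<Longrightarrow> bdry_mobius \<tau> None = \<bb> \<Longrightarrow> (\<And>A. A \<in> \<Gamma> \<Longrightarrow> bdry_mobius A \<bb> \<noteq> \<aa>) \<Longrightarrow>
       cusp_asymp k 0 \<tau> (eisenstein k \<Gamma> \<mu> \<aa> \<sigma> 0) 0"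
proof -
  obtain \<rho> where \<rho>: "\<rho> \<in> carrier SL2Z" "bdry_mobius \<rho> None = \<aa>" using cusp_eq_SL2Z_image[OF assms(6)] by blast
  interpret eisenstein_setup \<Gamma> \<mu> k 0 k \<aa> \<sigma> \<rho>
    by (intro eisenstein_setup.intro) (use assms \<rho> in \<open>simp_all del: bdry_mobius.simps\<close>)
  have eq: "M = eisenstein k \<Gamma> \<mu> \<aa> \<sigma> 0"
    by (auto simp: fun_eq_iff M_def eisenstein_def uhp_def)
  show "\<exists>u. u \<noteq> 0 \<and> cusp_asymp k 0 \<sigma> (eisenstein k \<Gamma> \<mu> \<aa> \<sigma> 0) u"
    using M_asymp_self unfolding eq .
  show "cusp_asymp k 0 \<tau> (eisenstein k \<Gamma> \<mu> \<aa> \<sigma> 0) 0"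
    if "\<bb> \<in> cusps" "det \<tau> = 1" "bdry_mobius \<tau> None = \<bb>" "\<And>A. A \<in> \<Gamma> \<Longrightarrow> bdry_mobius A \<bb> \<noteq> \<aa>" for \<tau> \<bb>
    using M_asymp_other[OF that] unfolding eq .
qed

section \<open>Cancelling the leading coefficients\<close>

lemma finite_cusp_representatives:
  assumes fi: "finite_index_subgroup \<Gamma>" and R: "cusp_representatives \<Gamma> R"
  shows "finite R"
proof -
  have sub: "subgroup \<Gamma> SL2Z" using fi by (simp add: finite_index_subgroup_def)
  obtain P where P: "finite P" "P \<subseteq> carrier SL2Z" "\<And>A. A \<in> carrier SL2Z \<Longrightarrow> \<exists>\<gamma>\<in>\<Gamma>. \<exists>\<rho>\<in>P. A = \<gamma> ** \<rho>"
    using finite_index_cosets[OF fi] by blast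
  \<comment> \<open>Each representative is recovered from the image of infinity under one of the
    finitely many coset representatives of \<Gamma> in the modular group.\<close>
  have "R \<subseteq> (\<lambda>\<rho>. THE \<bb>. \<bb> \<in> R \<and> (\<exists>A\<in>\<Gamma>. bdry_mobius A \<bb> = bdry_mobius \<rho> None)) ` P"
  proof
    fix \<aa> assume a: "\<aa> \<in> R"
    have ac: "\<aa> \<in> cusps" using R a by (auto simp: cusp_representatives_def)
    obtain A where A: "A \<in> carrier SL2Z" "bdry_mobius A None = \<aa>" using cusp_eq_SL2Z_image[OF ac] by blast
    obtain \<gamma> \<rho> where g: "\<gamma> \<in> \<Gamma>" "\<rho> \<in> P" "A = \<gamma> ** \<rho>" using P(3)[OF A(1)] by blast
    have gS: "\<gamma> \<in> carrier SL2Z" and rS: "\<rho> \<in> carrier SL2Z" using g P(2) subgroup.subset[OF sub] by auto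
    have "None \<in> cusps" by (simp add: cusps_def)
    hence rc: "bdry_mobius \<rho> None \<in> cusps" using SL2Z_cusps[OF rS] by blast
    have "matrix_inv \<gamma> \<in> \<Gamma>" using subgroup.m_inv_closed[OF sub g(1)] SL2Z_inv(2)[OF gS] by simp
    moreover have "bdry_mobius (matrix_inv \<gamma>) \<aa> = bdry_mobius \<rho> None"
      unfolding A(2)[symmetric] g(3) bdry_mobius_mult[OF SL2Z_det[OF rS]] by (rule bdry_mobius_inverse(1)[OF SL2Z_det[OF gS]])
    ultimately have "\<aa> \<in> R \<and> (\<exists>A\<in>\<Gamma>. bdry_mobius A \<aa> = bdry_mobius \<rho> None)" using a by blast
    moreover have "\<exists>!\<bb>. \<bb> \<in> R \<and> (\<exists>A\<in>\<Gamma>. bdry_mobius A \<bb> = bdry_mobius \<rho> None)"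
      using R rc unfolding cusp_representatives_def by blast
    ultimately have "(THE \<bb>. \<bb> \<in> R \<and> (\<exists>A\<in>\<Gamma>. bdry_mobius A \<bb> = bdry_mobius \<rho> None)) = \<aa>" by (rule the1_equality[rotated])
    thus "\<aa> \<in> (\<lambda>\<rho>. THE \<bb>. \<bb> \<in> R \<and> (\<exists>A\<in>\<Gamma>. bdry_mobius A \<bb> = bdry_mobius \<rho> None)) ` P" using g(2) by blast
  qed
  thus ?thesis by (rule finite_subset) (use P(1) in simp)
qed

lemma cusp_representatives_inequivalent:
  assumes sub: "subgroup \<Gamma> SL2Z" and R: "cusp_representatives \<Gamma> R" and ab: "\<aa> \<in> R" "\<bb> \<in> R" "\<aa> \<noteq> \<bb>" and A: "A \<in> \<Gamma>"
  shows "bdry_mobius A \<bb> \<noteq> \<aa>"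
proof
  assume "bdry_mobius A \<bb> = \<aa>"
  moreover have "mat 1 \<in> \<Gamma>" using subgroup.one_closed[OF sub] by simp
  moreover have "bdry_mobius (mat 1) \<aa> = \<aa>" by (rule bdry_mobius_one)
  moreover have "\<aa> \<in> cusps" using R ab by (auto simp: cusp_representatives_def)
  ultimately show False using R ab A unfolding cusp_representatives_def by blast
qed

lemma H_sharp_vanish:
  assumes fi: "finite_index_subgroup \<Gamma>" and ms: "multiplier_system \<Gamma> \<nu> \<kappa>" and \<kappa>: "\<kappa> < 0"
    and R: "cusp_representatives \<Gamma> R" and scal: "\<And>\<aa>. \<aa> \<in> R \<Longrightarrow> scaling_matrix \<Gamma> \<aa> (\<sigma> \<aa>)"
    and g: "g \<in> H_sharp \<kappa> \<Gamma> \<nu>" and lim: "\<And>\<aa>. \<aa> \<in> R \<Longrightarrow> cusp_asymp \<kappa> e (\<sigma> \<aa>) g 0"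
  shows "g = 0"
proof -
  have sub: "subgroup \<Gamma> SL2Z" using fi by (simp add: finite_index_subgroup_def)
  have \<Gamma>S: "\<And>A. A \<in> \<Gamma> \<Longrightarrow> A \<in> carrier SL2Z" using subgroup.subset[OF sub] by blast
  have sm: "smooth_on uhp g" and lap: "\<And>z. z \<in> uhp \<Longrightarrow> weight_laplacian \<kappa> g z = 0"
    and tr: "\<And>A z. A \<in> \<Gamma> \<Longrightarrow> z \<in> uhp \<Longrightarrow> g (mobius A z) = \<nu> A * automorphy A z powr of_real \<kappa> * g z"
    and off: "\<And>z. z \<notin> uhp \<Longrightarrow> g z = 0"
    using g by (auto simp: H_sharp_def)
  define \<phi> where "\<phi> = (\<lambda>z. Im z powr (\<kappa> / 2) * norm (g z))"
  have inv: "\<phi> (mobius A z) = \<phi> z" if A: "A \<in> \<Gamma>" and z: "z \<in> uhp" for A z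
  proof -
    have d: "det A = 1" using \<Gamma>S[OF A] SL2Z_det by blast
    have eq: "automorphy A z powr (- of_real \<kappa>) * g (mobius A z) = \<nu> A * g z"
      using automorphy_nonzero[OF d z] by (simp add: powr_minus tr[OF A z])
    have "norm (\<nu> A) = 1" using ms A by (simp add: multiplier_system_def)
    thus ?thesis
      using slash_norm[OF d z, of \<kappa> g] unfolding \<phi>_def eq by (simp only: norm_mult mult_1_left)
  qed
  have cont: "continuous_on uhp \<phi>"
    unfolding \<phi>_def by (intro continuous_intros smooth_onD(3)[OF sm]) (auto simp: uhp_def)
  have "\<exists>Y. \<forall>z\<in>uhp. Im z \<ge> Y \<longrightarrow> \<phi> (mobius \<rho> z) \<le> \<eta>" if \<rho>: "\<rho> \<in> carrier SL2Z" and \<eta>: "\<eta> > 0" for \<rho> \<eta>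
  proof -
    have "None \<in> cusps" by (simp add: cusps_def)
    hence "bdry_mobius \<rho> None \<in> cusps" using SL2Z_cusps[OF \<rho>] by blast
    then obtain \<bb> \<gamma> where b: "\<bb> \<in> R" "\<gamma> \<in> \<Gamma>" "bdry_mobius \<gamma> \<bb> = bdry_mobius \<rho> None"
      using R unfolding cusp_representatives_def by blast
    have d: "det \<gamma> = 1" "det \<rho> = 1" "det (\<sigma> \<bb>) = 1" "bdry_mobius (\<sigma> \<bb>) None = \<bb>"
      using \<Gamma>S[OF b(2)] \<rho> SL2Z_det scal[OF b(1)] by (auto simp: scaling_matrix_def SL2R_def)
    \<comment> \<open>Decay is given only at the cusps in R. Since \<gamma> \<bb> = \<rho>
      \<infinity>, the matrix \<tau> leads to \<bb> itself, where it differs from \<sigma> \<bb> by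
      an affine map, and \<phi> takes the same value at \<tau> z and at \<rho> z.\<close>
    define \<tau> where "\<tau> = matrix_inv \<gamma> ** \<rho>"
    have \<tau>d: "det \<tau> = 1" using d by (simp add: \<tau>_def det_mul det_matrix_inv)
    have "bdry_mobius \<tau> None = bdry_mobius (\<sigma> \<bb>) None"
      unfolding \<tau>_def bdry_mobius_mult[OF d(2)] b(3)[symmetric] d(4) by (rule bdry_mobius_inverse(1)[OF d(1)])
    then obtain \<alpha> \<beta> where ab: "\<alpha> \<noteq> 0" "\<And>z. z \<in> uhp \<Longrightarrow> mobius \<tau> z = mobius (\<sigma> \<bb>) (of_real (\<alpha>\<^sup>2) * z + of_real (\<alpha> * \<beta>))"
      using same_cusp_matrix[OF \<tau>d d(3)] by metis
    obtain Y where Y: "\<And>z. z \<in> uhp \<Longrightarrow> Im z \<ge> Y \<Longrightarrow> Im z powr (\<kappa> / 2) *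
        norm (automorphy (\<sigma> \<bb>) z powr (- of_real \<kappa>) * g (mobius (\<sigma> \<bb>) z) - 0 * of_real (Im z powr e)) \<le> \<eta>"
      using cusp_asympD[OF lim[OF b(1)] \<eta>] by blast
    show ?thesis
    proof (intro exI[of _ "Y / \<alpha>\<^sup>2"] ballI impI)
      fix z assume z: "z \<in> uhp" "Im z \<ge> Y / \<alpha>\<^sup>2"
      define w where "w = of_real (\<alpha>\<^sup>2) * z + of_real (\<alpha> * \<beta>)"
      have Imw: "Im w = \<alpha>\<^sup>2 * Im z" by (simp add: w_def)
      have w: "w \<in> uhp" using z(1) ab(1) by (simp add: uhp_def Imw)
      have "Y \<le> \<alpha>\<^sup>2 * Im z" using z(2) pos_divide_le_eq[of "\<alpha>\<^sup>2" Y "Im z"] ab(1) by (simp add: mult.commute)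
      hence "\<phi> (mobius (\<sigma> \<bb>) w) \<le> \<eta>" using Y[OF w] slash_norm[OF d(3) w, of \<kappa> g] by (simp add: Imw \<phi>_def)
      moreover have "mobius (\<sigma> \<bb>) w = mobius \<tau> z" unfolding w_def by (rule ab(2)[OF z(1), symmetric])
      moreover have "\<phi> (mobius \<tau> z) = \<phi> (mobius \<rho> z)"
        using inv[OF b(2) mobius_uhp[OF \<tau>d z(1)]] mobius_mult[OF \<tau>d z(1), of \<gamma>]
        by (simp add: \<tau>_def matrix_inv_cancel[OF d(1)])
      ultimately show "\<phi> (mobius \<rho> z) \<le> \<eta>" by simp
    qed
  qed
  then obtain z0 where z0: "z0 \<in> uhp" "\<And>z. z \<in> uhp \<Longrightarrow> \<phi> z \<le> \<phi> z0"
    using invariant_max_attained[OF fi cont inv] unfolding \<phi>_def by fastforce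
  have sq: "Im z powr \<kappa> * (norm (g z))\<^sup>2 = (\<phi> z)\<^sup>2" for z
    by (simp add: \<phi>_def power_mult_distrib power2_eq_square flip: powr_add)
  have "g z0 = 0"
  proof (rule maximum_principle[OF \<kappa> sm lap[OF z0(1)] z0(1)])
    fix z assume z: "z \<in> uhp"
    show "Im z powr \<kappa> * (norm (g z))\<^sup>2 \<le> Im z0 powr \<kappa> * (norm (g z0))\<^sup>2"
      unfolding sq using z0(2)[OF z] by (intro power_mono) (auto simp: \<phi>_def)
  qed
  hence "\<phi> z0 = 0" by (simp add: \<phi>_def)
  have "g z = 0" for z
  proof (cases "z \<in> uhp")
    case True
    hence "Im z powr (\<kappa> / 2) * norm (g z) \<le> 0" using z0(2)[OF True] \<open>\<phi> z0 = 0\<close> unfolding \<phi>_def by linarith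
    moreover have "Im z powr (\<kappa> / 2) > 0" using True by (simp add: uhp_def)
    ultimately show ?thesis by (simp add: mult_le_0_iff)
  qed (rule off)
  thus ?thesis by (simp add: fun_eq_iff)
qed

lemma H_sharp_eq_span:
  assumes fi: "finite_index_subgroup \<Gamma>" and ms: "multiplier_system \<Gamma> \<nu> (2 - k)" and k: "k > 2"
    and R: "cusp_representatives \<Gamma> R" and scal: "\<And>\<aa>. \<aa> \<in> cusps \<Longrightarrow> scaling_matrix \<Gamma> \<aa> (\<sigma> \<aa>)"
  defines "I \<equiv> {\<aa> \<in> R. singular_cusp \<Gamma> \<nu> (2 - k) \<aa> (\<sigma> \<aa>)}"
  defines "\<phi> \<equiv> (\<lambda>\<aa>. mock_eisenstein k \<Gamma> \<nu> \<aa> (\<sigma> \<aa>))"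
  shows "H_sharp (2 - k) \<Gamma> \<nu> = cfun.span (\<phi> ` I)" "inj_on \<phi> I" "cfun.independent (\<phi> ` I)"
proof -
  have sub: "subgroup \<Gamma> SL2Z" using fi by (simp add: finite_index_subgroup_def)
  have Rc: "R \<subseteq> cusps" using R by (simp add: cusp_representatives_def)
  have fI: "finite I" using finite_cusp_representatives[OF fi R] by (simp add: I_def)
  have I: "\<aa> \<in> cusps" "\<aa> \<in> R" "singular_cusp \<Gamma> \<nu> (2 - k) \<aa> (\<sigma> \<aa>)" if "\<aa> \<in> I" for \<aa>
    using that Rc by (auto simp: I_def)
  have d: "det (\<sigma> \<bb>) = 1" "bdry_mobius (\<sigma> \<bb>) None = \<bb>" if "\<bb> \<in> R" for \<bb>
    using scal[of \<bb>] that Rc by (auto simp: scaling_matrix_def SL2R_def)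
  have H: "\<phi> \<aa> \<in> H_sharp (2 - k) \<Gamma> \<nu>" if "\<aa> \<in> I" for \<aa>
    unfolding \<phi>_def using mock_eisenstein_asymp(1)[OF sub ms scal[OF I(1)[OF that]] I(3)[OF that] k I(1)[OF that]] .
  have self: "\<exists>u. u \<noteq> 0 \<and> cusp_asymp (2 - k) (k - 1) (\<sigma> \<aa>) (\<phi> \<aa>) u" if "\<aa> \<in> I" for \<aa>
    unfolding \<phi>_def using mock_eisenstein_asymp(2)[OF sub ms scal[OF I(1)[OF that]] I(3)[OF that] k I(1)[OF that]] .
  have other: "cusp_asymp (2 - k) (k - 1) (\<sigma> \<bb>) (\<phi> \<aa>) 0" if "\<aa> \<in> I" "\<bb> \<in> R" "\<aa> \<noteq> \<bb>" for \<aa> \<bb>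
    unfolding \<phi>_def
    by (rule mock_eisenstein_asymp(3)[OF sub ms scal[OF I(1)[OF that(1)]] I(3)[OF that(1)] k I(1)[OF that(1)] _ d[OF that(2)]])
       (use that Rc cusp_representatives_inequivalent[OF sub R I(2)[OF that(1)] that(2,3)] in auto)
  have pos: "(2 - k) / 2 + (k - 1) > 0" using k by (simp add: field_simps)
  show "inj_on \<phi> I" by (rule cusp_asymp_independent(1)[OF fI pos self]) (use other I(2) in blast)+
  show "cfun.independent (\<phi> ` I)" by (rule cusp_asymp_independent(2)[OF fI pos self]) (use other I(2) in blast)+
  show "H_sharp (2 - k) \<Gamma> \<nu> = cfun.span (\<phi> ` I)"
  proof
    show "cfun.span (\<phi> ` I) \<subseteq> H_sharp (2 - k) \<Gamma> \<nu>"
      by (rule cfun.span_minimal[OF _ H_sharp_subspace]) (use H in blast)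
    show "H_sharp (2 - k) \<Gamma> \<nu> \<subseteq> cfun.span (\<phi> ` I)"
    proof
      fix f assume f: "f \<in> H_sharp (2 - k) \<Gamma> \<nu>"
      have "\<exists>C. (\<bb> \<notin> I \<longrightarrow> C = 0) \<and> cusp_asymp (2 - k) (k - 1) (\<sigma> \<bb>) f C" if b: "\<bb> \<in> R" for \<bb>
      proof -
        have bc: "\<bb> \<in> cusps" using b Rc by blast
        interpret cusp_setup \<Gamma> \<nu> "2 - k" \<bb> "\<sigma> \<bb>" by (rule cusp_setup.intro[OF sub ms scal[OF bc]])
        have "2 - k < 0" using k by simp
        from cusp_behaviour[OF f bc this] b show ?thesis
          by (auto simp: cusp_asymp_def slash_def I_def)
      qed
      then obtain C where C: "\<And>\<bb>. \<bb> \<in> R \<Longrightarrow> \<bb> \<notin> I \<Longrightarrow> C \<bb> = 0"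
        "\<And>\<bb>. \<bb> \<in> R \<Longrightarrow> cusp_asymp (2 - k) (k - 1) (\<sigma> \<bb>) f (C \<bb>)" by metis
      obtain u where u: "\<And>\<aa>. \<aa> \<in> I \<Longrightarrow> u \<aa> \<noteq> 0" "\<And>\<aa>. \<aa> \<in> I \<Longrightarrow> cusp_asymp (2 - k) (k - 1) (\<sigma> \<aa>) (\<phi> \<aa>) (u \<aa>)"
        using self by metis
      \<comment> \<open>u is the leading coefficient of each mock series at its own cusp, so q has
        the same leading coefficient as f at every singular cusp in R; at the other cusps in R both
        are 0.\<close>
      define q where "q = (\<Sum>\<aa>\<in>I. cfun_scale (C \<aa> / u \<aa>) (\<phi> \<aa>))"
      have q: "q \<in> cfun.span (\<phi> ` I)"
        unfolding q_def by (intro cfun.span_sum cfun.span_scale cfun.span_base) auto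
      have qH: "q \<in> H_sharp (2 - k) \<Gamma> \<nu>" 
        using q cfun.span_minimal[OF _ H_sharp_subspace, of "\<phi> ` I"] H by blast
      have "cfun_scale (- 1) q + f = 0"
      proof (rule H_sharp_vanish[OF fi ms _ R _ H_sharp_lincomb[OF qH f], where e = "k - 1"])
        show "2 - k < 0" using k by simp
        show "scaling_matrix \<Gamma> \<aa> (\<sigma> \<aa>)" if "\<aa> \<in> R" for \<aa> using scal that Rc by blast
        fix \<bb> assume b: "\<bb> \<in> R"
        have "cusp_asymp (2 - k) (k - 1) (\<sigma> \<bb>) q (\<Sum>\<aa>\<in>I. C \<aa> / u \<aa> * (if \<aa> = \<bb> then u \<bb> else 0))"
          unfolding q_def using u(2) other b by (intro cusp_asymp_sum fI) auto
        moreover have "(\<Sum>\<aa>\<in>I. C \<aa> / u \<aa> * (if \<aa> = \<bb> then u \<bb> else 0)) = C \<bb>"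
        proof (cases "\<bb> \<in> I")
          case True
          have "(\<Sum>\<aa>\<in>I. C \<aa> / u \<aa> * (if \<aa> = \<bb> then u \<bb> else 0)) = (\<Sum>\<aa>\<in>I. if \<aa> = \<bb> then C \<bb> / u \<bb> * u \<bb> else 0)"
            by (intro sum.cong) auto
          thus ?thesis using True fI u(1)[OF True] by simp
        next
          case False
          hence "(\<Sum>\<aa>\<in>I. C \<aa> / u \<aa> * (if \<aa> = \<bb> then u \<bb> else 0)) = 0" by (intro sum.neutral) auto
          thus ?thesis using C(1)[OF b False] by simp
        qed
        ultimately have "cusp_asymp (2 - k) (k - 1) (\<sigma> \<bb>) q (C \<bb>)" by simp
        from cusp_asymp_lincomb[OF this C(2)[OF b], of "- 1"]
        show "cusp_asymp (2 - k) (k - 1) (\<sigma> \<bb>) (cfun_scale (- 1) q + f) 0" by simp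
      qed
      hence "f = q" by (auto simp: cfun_scale_def fun_eq_iff)
      thus "f \<in> cfun.span (\<phi> ` I)" using q by simp
    qed
  qed
qed

section \<open>Equivalent cusps and dual weights\<close>

lemma SL2Z_subgroup:
  assumes "subgroup \<Gamma> SL2Z"
  shows "A \<in> \<Gamma> \<Longrightarrow> A \<in> carrier SL2Z" "A \<in> \<Gamma> \<Longrightarrow> det A = 1" "mat 1 \<in> \<Gamma>"
    "A \<in> \<Gamma> \<Longrightarrow> B \<in> \<Gamma> \<Longrightarrow> A ** B \<in> \<Gamma>" "A \<in> \<Gamma> \<Longrightarrow> matrix_inv A \<in> \<Gamma>"
proof -
  show 1: "A \<in> carrier SL2Z" if "A \<in> \<Gamma>" for A using subgroup.subset[OF assms] that by blast
  show "A \<in> \<Gamma> \<Longrightarrow> det A = 1" using 1 SL2Z_det by blast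
  show "mat 1 \<in> \<Gamma>" using subgroup.one_closed[OF assms] by simp
  show "A \<in> \<Gamma> \<Longrightarrow> B \<in> \<Gamma> \<Longrightarrow> A ** B \<in> \<Gamma>" using subgroup.m_closed[OF assms, of A B] by simp
  show "matrix_inv A \<in> \<Gamma>" if "A \<in> \<Gamma>" using subgroup.m_inv_closed[OF assms that] SL2Z_inv(2)[OF 1[OF that]] by simp
qed

lemma norm_one_cnj: "norm (u :: complex) = 1 \<Longrightarrow> cnj u = 1 / u"
proof -
  assume "norm u = 1"
  moreover have "u * cnj u = of_real ((norm u)\<^sup>2)" by (rule complex_norm_square[symmetric])
  ultimately have "cnj u * u = 1" "u \<noteq> 0" by (auto simp: mult.commute)
  thus ?thesis by (simp add: nonzero_eq_divide_eq)
qed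

text \<open>The cocycles of weights \<kappa> and 2 - \<kappa> multiply to that of weight 2, which is
  1 because squares of automorphy factors multiply; and the cocycle is unimodular.\<close>

lemma wcocycle_dual:
  assumes d: "det A = 1" "det B = 1"
  shows "wcocycle (2 - \<kappa>) A B = cnj (wcocycle \<kappa> A B)"
proof -
  have i: "\<i> \<in> uhp" by (simp add: uhp_def)
  have n: "norm (wcocycle \<kappa> A B) = 1" by (rule norm_wcocycle[OF d])
  define a b c where "a = automorphy A (mobius B \<i>)" "b = automorphy B \<i>" "c = automorphy (A ** B) \<i>"
  have nz: "a \<noteq> 0" "b \<noteq> 0" "c \<noteq> 0"
    using automorphy_nonzero[OF d(1) mobius_uhp[OF d(2) i]] automorphy_nonzero[OF d(2) i] automorphy_nonzero[OF _ i, of "A ** B"] d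
    by (simp_all add: a_b_c_def det_mul)
  have cab: "c = a * b" unfolding a_b_c_def by (rule automorphy_mult[OF d(2) i])
  have p: "x powr of_real (2 - \<kappa>) = x\<^sup>2 / x powr of_real \<kappa>" if "x \<noteq> 0" for x :: complex
    using that by (simp add: powr_diff)
  have "wcocycle (2 - \<kappa>) A B * wcocycle \<kappa> A B = 1"
    using nz unfolding wcocycle_def a_b_c_def[symmetric] powr_minus p[OF nz(1)] p[OF nz(2)] p[OF nz(3)]
    by (simp add: cab power_mult_distrib field_simps)
  moreover have w0: "wcocycle \<kappa> A B \<noteq> 0" using n by auto
  moreover have "cnj (wcocycle \<kappa> A B) * wcocycle \<kappa> A B = 1" unfolding norm_one_cnj[OF n] using w0 by simp
  ultimately show ?thesis by (metis mult_right_cancel)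
qed

lemma multiplier_dual:
  assumes sub: "subgroup \<Gamma> SL2Z" and ms: "multiplier_system \<Gamma> \<nu> \<kappa>"
  shows "multiplier_system \<Gamma> (\<lambda>A. cnj (\<nu> A)) (2 - \<kappa>)"
  unfolding multiplier_system_def
proof (intro conjI ballI impI)
  show "norm (cnj (\<nu> A)) = 1" if "A \<in> \<Gamma>" for A using ms that by (simp add: multiplier_system_def)
  show "cnj (\<nu> (A ** B)) = cnj (\<nu> A) * cnj (\<nu> B) * wcocycle (2 - \<kappa>) A B" if "A \<in> \<Gamma>" "B \<in> \<Gamma>" for A B
  proof -
    have d: "det A = 1" "det B = 1" using SL2Z_subgroup(2)[OF sub] that by auto
    have "\<nu> (A ** B) = \<nu> A * \<nu> B * wcocycle \<kappa> A B" using ms that by (simp add: multiplier_system_def)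
    thus ?thesis by (simp add: wcocycle_dual[OF d])
  qed
  assume "- mat 1 \<in> \<Gamma>"
  hence "\<nu> (- mat 1) = exp (- of_real pi * \<i> * of_real \<kappa>)" using ms by (simp add: multiplier_system_def)
  hence "cnj (\<nu> (- mat 1)) = exp (of_real pi * \<i> * of_real \<kappa>)" by (simp add: exp_cnj)
  also have "\<dots> = exp (of_real pi * \<i> * of_real \<kappa> - 2 * of_real pi * \<i>)" by (simp add: exp_diff)
  also have "of_real pi * \<i> * of_real \<kappa> - 2 * of_real pi * \<i> = - of_real pi * \<i> * of_real (2 - \<kappa>)"
    by (simp add: algebra_simps)
  finally show "cnj (\<nu> (- mat 1)) = exp (- of_real pi * \<i> * of_real (2 - \<kappa>))" .
qed

text \<open>For A in the stabilizer, S A is a translation times S up to sign, so both automorphy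
  factors have the same square. Dividing this square by the condition in weight \<kappa> gives the
  one in weight 2 - \<kappa>. Applied to the conjugate multiplier, the lemma supplies its own
  converse.\<close>

lemma singular_dual:
  assumes sub: "subgroup \<Gamma> SL2Z" and ms: "multiplier_system \<Gamma> \<nu> \<kappa>"
    and scal: "scaling_matrix \<Gamma> \<aa> \<sigma>" and sing: "singular_cusp \<Gamma> \<nu> \<kappa> \<aa> \<sigma>"
  shows "singular_cusp \<Gamma> (\<lambda>A. cnj (\<nu> A)) (2 - \<kappa>) \<aa> \<sigma>"
  unfolding singular_cusp_def
proof (intro ballI)
  fix A z assume A: "A \<in> cusp_stabilizer \<Gamma> \<aa>" and z: "z \<in> uhp"
  define S where "S = matrix_inv \<sigma>"
  have A\<Gamma>: "A \<in> \<Gamma>" using A by (simp add: cusp_stabilizer_def)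
  have d: "det S = 1" "det A = 1" "det (S ** A) = 1"
    using scal SL2Z_subgroup(2)[OF sub A\<Gamma>] by (auto simp: S_def scaling_matrix_def SL2R_def det_matrix_inv det_mul)
  have nz: "automorphy S z \<noteq> 0" "automorphy (S ** A) z \<noteq> 0" using automorphy_nonzero z d by blast+
  have sq: "(automorphy (S ** A) z)\<^sup>2 = (automorphy S z)\<^sup>2"
  proof -
    obtain n where "S ** A = translation n ** S \<or> S ** A = - translation n ** S"
      using scaled_stabilizer[OF scal A] unfolding S_def by metis
    thus ?thesis using cusp_setup.automorphy_translation_mult[OF cusp_setup.intro[OF sub ms scal]] by auto
  qed
  define u where "u = \<nu> A * wcocycle \<kappa> S A"
  have n: "norm (\<nu> A) = 1" "norm (wcocycle \<kappa> S A) = 1"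
    using ms A\<Gamma> norm_wcocycle[OF d(1,2)] by (auto simp: multiplier_system_def)
  have u0: "norm u = 1" by (simp add: u_def n norm_mult)
  have u: "u * automorphy (S ** A) z powr of_real \<kappa> = automorphy S z powr of_real \<kappa>"
    using sing A z by (simp add: singular_cusp_def u_def S_def)
  have p: "x powr of_real (2 - \<kappa>) = x\<^sup>2 / x powr of_real \<kappa>" if "x \<noteq> 0" for x :: complex
    using that by (simp add: powr_diff)
  have "cnj (\<nu> A) * wcocycle (2 - \<kappa>) S A = 1 / u" unfolding wcocycle_dual[OF d(1,2)] using norm_one_cnj[OF u0] by (simp add: u_def)
  hence "cnj (\<nu> A) * wcocycle (2 - \<kappa>) S A * automorphy (S ** A) z powr of_real (2 - \<kappa>)
      = (automorphy S z)\<^sup>2 / (u * automorphy (S ** A) z powr of_real \<kappa>)"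
    unfolding p[OF nz(2)] sq by simp
  also have "\<dots> = automorphy S z powr of_real (2 - \<kappa>)" unfolding u p[OF nz(1)] ..
  finally show "cnj (\<nu> A) * wcocycle (2 - \<kappa>) (matrix_inv \<sigma>) A * automorphy (matrix_inv \<sigma> ** A) z powr of_real (2 - \<kappa>)
      = automorphy (matrix_inv \<sigma>) z powr of_real (2 - \<kappa>)" unfolding S_def .
qed

section \<open>Eisenstein series at equivalent cusps\<close>

lemma cusp_stabilizer_translate:
  assumes sub: "subgroup \<Gamma> SL2Z" and \<gamma>: "\<gamma> \<in> \<Gamma>"
  shows "cusp_stabilizer \<Gamma> (bdry_mobius \<gamma> \<aa>) = (\<lambda>A. \<gamma> ** A ** matrix_inv \<gamma>) ` cusp_stabilizer \<Gamma> \<aa>"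
proof -
  note G = SL2Z_subgroup[OF sub]
  have d: "det \<gamma> = 1" by (rule G(2)[OF \<gamma>])
  show ?thesis
  proof (intro equalityI subsetI)
    fix A assume "A \<in> cusp_stabilizer \<Gamma> (bdry_mobius \<gamma> \<aa>)"
    hence A: "A \<in> \<Gamma>" "bdry_mobius A (bdry_mobius \<gamma> \<aa>) = bdry_mobius \<gamma> \<aa>"
      unfolding cusp_stabilizer_def by blast+
    have "bdry_mobius (matrix_inv \<gamma> ** (A ** \<gamma>)) \<aa> = bdry_mobius (matrix_inv \<gamma>) (bdry_mobius A (bdry_mobius \<gamma> \<aa>))"
      using bdry_mobius_mult[of "A ** \<gamma>"] bdry_mobius_mult[OF d] G(2)[OF A(1)] d by (simp add: det_mul del: bdry_mobius.simps)
    hence "matrix_inv \<gamma> ** (A ** \<gamma>) \<in> cusp_stabilizer \<Gamma> \<aa>"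
      unfolding A(2) bdry_mobius_inverse(1)[OF d] cusp_stabilizer_def using A(1) \<gamma> G(4,5) by blast
    moreover have "A = \<gamma> ** (matrix_inv \<gamma> ** (A ** \<gamma>)) ** matrix_inv \<gamma>" by (simp add: matrix_inv_cancel[OF d])
    ultimately show "A \<in> (\<lambda>A. \<gamma> ** A ** matrix_inv \<gamma>) ` cusp_stabilizer \<Gamma> \<aa>" by blast
  next
    fix B assume "B \<in> (\<lambda>A. \<gamma> ** A ** matrix_inv \<gamma>) ` cusp_stabilizer \<Gamma> \<aa>"
    then obtain A where A: "A \<in> \<Gamma>" "bdry_mobius A \<aa> = \<aa>" "B = \<gamma> ** A ** matrix_inv \<gamma>"
      unfolding cusp_stabilizer_def by blast
    have "bdry_mobius B (bdry_mobius \<gamma> \<aa>) = bdry_mobius (B ** \<gamma>) \<aa>" by (rule bdry_mobius_mult[OF d, symmetric])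
    also have "B ** \<gamma> = \<gamma> ** A" unfolding A(3) by (simp add: matrix_inv_cancel[OF d])
    also have "bdry_mobius (\<gamma> ** A) \<aa> = bdry_mobius \<gamma> \<aa>" using bdry_mobius_mult[OF G(2)[OF A(1)]] A(2) by simp
    finally show "B \<in> cusp_stabilizer \<Gamma> (bdry_mobius \<gamma> \<aa>)"
      unfolding cusp_stabilizer_def using A(1,3) \<gamma> G(4,5) by blast
  qed
qed

lemma scaling_matrix_translate:
  assumes sub: "subgroup \<Gamma> SL2Z" and scal: "scaling_matrix \<Gamma> \<aa> \<sigma>" and \<gamma>: "\<gamma> \<in> \<Gamma>"
  shows "scaling_matrix \<Gamma> (bdry_mobius \<gamma> \<aa>) (\<gamma> ** \<sigma>)"
proof -
  have d: "det \<gamma> = 1" "det \<sigma> = 1" "bdry_mobius \<sigma> None = \<aa>"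
    using SL2Z_subgroup(2)[OF sub \<gamma>] scal by (auto simp: scaling_matrix_def SL2R_def)
  let ?Z = "cusp_stabilizer \<Gamma> \<aa>"
  have 1: "matrix_inv (\<gamma> ** \<sigma>) ** (\<gamma> ** A ** matrix_inv \<gamma>) ** (\<gamma> ** \<sigma>) = matrix_inv \<sigma> ** A ** \<sigma>" for A
    by (simp add: matrix_inv_mult d matrix_mul_assoc[symmetric] matrix_inv_cancel(2)[OF d(1)])
  have "(\<lambda>A. matrix_inv (\<gamma> ** \<sigma>) ** A ** (\<gamma> ** \<sigma>)) `
      (cusp_stabilizer \<Gamma> (bdry_mobius \<gamma> \<aa>) \<union> uminus ` cusp_stabilizer \<Gamma> (bdry_mobius \<gamma> \<aa>))
    = (\<lambda>A. matrix_inv \<sigma> ** A ** \<sigma>) ` (?Z \<union> uminus ` ?Z)"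
    unfolding cusp_stabilizer_translate[OF sub \<gamma>] by (simp add: image_Un image_image mat2_minus_mult 1)
  moreover have "bdry_mobius (\<gamma> ** \<sigma>) None = bdry_mobius \<gamma> \<aa>" unfolding bdry_mobius_mult[OF d(2)] d(3) ..
  ultimately show ?thesis using scal d unfolding scaling_matrix_def SL2R_def by (simp add: det_mul del: bdry_mobius.simps)
qed

text \<open>By symmetry \<open>1/\<alpha>\<^sup>2\<close> is an integer too, which forces \<open>\<alpha> = \<plusminus>1\<close>.\<close>

lemma scaling_matrix_width_Ints:
  assumes \<sigma>: "scaling_matrix \<Gamma> \<aa> \<sigma>" and \<tau>: "scaling_matrix \<Gamma> \<aa> \<tau>"
    and \<alpha>: "\<alpha> \<noteq> 0" "\<tau> = \<sigma> ** vector [vector [\<alpha>, \<beta>], vector [0, 1 / \<alpha>]]"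
  shows "\<alpha>\<^sup>2 \<in> \<int>"
proof -
  define U :: "real^2^2" where "U = vector [vector [\<alpha>, \<beta>], vector [0, 1 / \<alpha>]]"
  have U: "det U = 1" "U$1$1 = \<alpha>" "U$1$2 = \<beta>" "U$2$1 = 0" "U$2$2 = 1 / \<alpha>" using \<alpha> by (simp_all add: U_def det_2 vector_2)
  have d: "det \<sigma> = 1" "det \<tau> = 1" using \<sigma> \<tau> by (auto simp: scaling_matrix_def SL2R_def)
  have "translation 1 \<in> (\<lambda>A. matrix_inv \<tau> ** A ** \<tau>) ` (cusp_stabilizer \<Gamma> \<aa> \<union> uminus ` cusp_stabilizer \<Gamma> \<aa>)"
    using \<tau> unfolding scaling_matrix_def by blast
  then obtain A where A: "A \<in> cusp_stabilizer \<Gamma> \<aa> \<union> uminus ` cusp_stabilizer \<Gamma> \<aa>" "translation 1 = matrix_inv \<tau> ** A ** \<tau>"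
    by blast
  have "\<tau> ** translation 1 ** matrix_inv \<tau> = A"
    unfolding A(2) by (simp add: matrix_mul_assoc[symmetric] matrix_inv_cancel[OF d(2)]) 
  hence "matrix_inv \<sigma> ** A ** \<sigma> = matrix_inv \<sigma> ** (\<sigma> ** U ** translation 1 ** matrix_inv (\<sigma> ** U)) ** \<sigma>"
    using \<alpha>(2) by (simp add: U_def)
  also have "\<dots> = U ** translation 1 ** matrix_inv U"
    by (simp add: matrix_inv_mult d U(1) matrix_mul_assoc[symmetric] matrix_inv_cancel[OF d(1)])
  finally have e: "matrix_inv \<sigma> ** A ** \<sigma> = U ** translation 1 ** matrix_inv U" .
  have "matrix_inv \<sigma> ** A ** \<sigma> \<in> range translation \<union> uminus ` range translation"
    using \<sigma> A(1) unfolding scaling_matrix_def by blast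
  then obtain n where "matrix_inv \<sigma> ** A ** \<sigma> = translation n \<or> matrix_inv \<sigma> ** A ** \<sigma> = - translation n" by blast
  moreover have "(U ** translation 1 ** matrix_inv U) $ 1 $ 1 = 1" "(U ** translation 1 ** matrix_inv U) $ 1 $ 2 = \<alpha>\<^sup>2"
    using \<alpha>(1) by (simp_all add: mat2_mult matrix_inv_entries[OF U(1)] U translation_def vector_2 power2_eq_square algebra_simps)
  ultimately have "\<alpha>\<^sup>2 = of_int n" unfolding e by (auto simp: translation_def vector_2)
  thus ?thesis by simp
qed

text \<open>The Eisenstein space is formed with an arbitrary scaling matrix at each cusp. That two
  choices agree in their automorphy factors up to sign makes series at equivalent cusps
  comparable.\<close>

lemma scaling_matrix_automorphy:
  assumes \<sigma>: "scaling_matrix \<Gamma> \<aa> \<sigma>" and \<tau>: "scaling_matrix \<Gamma> \<aa> \<tau>"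
  shows "(\<forall>w. automorphy (matrix_inv \<tau>) w = automorphy (matrix_inv \<sigma>) w) \<or>
         (\<forall>w. automorphy (matrix_inv \<tau>) w = - automorphy (matrix_inv \<sigma>) w)"
proof -
  have d: "det \<sigma> = 1" "det \<tau> = 1" "bdry_mobius \<tau> None = bdry_mobius \<sigma> None"
    using \<sigma> \<tau> unfolding scaling_matrix_def SL2R_def by auto
  obtain \<alpha> \<beta> where \<alpha>: "\<alpha> \<noteq> 0" "\<tau> = \<sigma> ** vector [vector [\<alpha>, \<beta>], vector [0, 1 / \<alpha>]]"
    by (rule same_cusp_matrix[OF d(2,1,3)])
  define U :: "real^2^2" where "U = vector [vector [\<alpha>, \<beta>], vector [0, 1 / \<alpha>]]"
  have U: "det U = 1" "U$1$1 = \<alpha>" "U$1$2 = \<beta>" "U$2$1 = 0" "U$2$2 = 1 / \<alpha>" using \<alpha>(1) by (simp_all add: U_def det_2 vector_2)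
  have \<tau>U: "\<tau> = \<sigma> ** U" using \<alpha>(2) by (simp add: U_def)
  have "matrix_inv U = vector [vector [1 / \<alpha>, - \<beta>], vector [0, 1 / (1 / \<alpha>)]]"
    by (simp add: mat2_eq_iff matrix_inv_entries[OF U(1)] U vector_2)
  hence "\<sigma> = \<tau> ** vector [vector [1 / \<alpha>, - \<beta>], vector [0, 1 / (1 / \<alpha>)]]"
    using matrix_inv_cancel(3)[OF U(1), of \<sigma>] by (simp add: \<tau>U)
  hence "(1 / \<alpha>)\<^sup>2 \<in> \<int>" using \<alpha>(1) scaling_matrix_width_Ints[OF \<tau> \<sigma>, of "1 / \<alpha>" "- \<beta>"] by simp
  then obtain m where m: "(1 / \<alpha>)\<^sup>2 = of_int m" by (auto elim: Ints_cases)
  obtain n where n: "\<alpha>\<^sup>2 = of_int n" using scaling_matrix_width_Ints[OF \<sigma> \<tau> \<alpha>] by (auto elim: Ints_cases)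
  have "of_int (n * m) = \<alpha>\<^sup>2 * (1 / \<alpha>)\<^sup>2" by (simp only: n m of_int_mult)
  also have "\<dots> = 1" using \<alpha>(1) by (simp add: field_simps)
  finally have nm: "n * m = 1" by (simp only: of_int_eq_1_iff)
  have "of_int n > (0 :: real)" using \<alpha>(1) n by (metis zero_less_power2)
  hence "n = 1" using nm by (auto simp: zmult_eq_1_iff)
  hence "\<alpha> = 1 \<or> \<alpha> = - 1" using n by (simp add: power2_eq_1_iff)
  moreover have "automorphy (matrix_inv \<tau>) w = of_real \<alpha> * automorphy (matrix_inv \<sigma>) w" for w
    unfolding \<tau>U matrix_inv_mult[OF d(1) U(1)] automorphy_def
    by (simp add: mat2_mult matrix_inv_entries[OF U(1)] U algebra_simps)
  ultimately show ?thesis by auto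
qed

lemma eisenstein_term_eq:
  assumes ms: "multiplier_system \<Gamma> \<nu> \<kappa>" and A: "A \<in> \<Gamma>" "det A = 1" and \<sigma>: "det \<sigma> = 1" and z: "z \<in> uhp"
  shows "eisenstein_term \<nu> \<kappa> \<sigma> 0 z A =
    1 / (\<nu> A * (automorphy (matrix_inv \<sigma>) (mobius A z) powr of_real \<kappa> * automorphy A z powr of_real \<kappa>))"
proof -
  define S where "S = matrix_inv \<sigma>"
  have S: "det S = 1" unfolding S_def by (rule det_matrix_inv[OF \<sigma>])
  have nz: "automorphy (S ** A) z \<noteq> 0" using S A z by (intro automorphy_nonzero) (auto simp: det_mul)
  have n: "norm (\<nu> A) = 1" "norm (wcocycle \<kappa> S A) = 1"
    using ms A norm_wcocycle[OF S A(2)] by (auto simp: multiplier_system_def)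
  show ?thesis
    using nz unfolding eisenstein_term_def S_def[symmetric] norm_one_cnj[OF n(1)] norm_one_cnj[OF n(2)]
      wcocycle_powr[OF S A(2) z, symmetric] powr_minus by (simp add: divide_simps)
qed

text \<open>\<open>eisenstein_space\<close> runs over all singular cusps, the basis only over
  inequivalent ones. Left multiplication by \<gamma> carries the cosets of the stabilizer of \<aa>
  to those of \<bb> and changes all terms by one constant.\<close>

lemma eisenstein_equivalent_cusp:
  assumes sub: "subgroup \<Gamma> SL2Z" and ms: "multiplier_system \<Gamma> \<nu> k" and k: "k > 2" and ac: "\<aa> \<in> cusps"
    and \<gamma>: "\<gamma> \<in> \<Gamma>" and scal: "scaling_matrix \<Gamma> \<aa> \<sigma>" and b: "\<bb> = bdry_mobius \<gamma> \<aa>"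
    and scal': "scaling_matrix \<Gamma> \<bb> \<sigma>'" and sing': "singular_cusp \<Gamma> \<nu> k \<bb> \<sigma>'"
  shows "singular_cusp \<Gamma> \<nu> k \<aa> \<sigma>"
    "\<exists>c. eisenstein k \<Gamma> \<nu> \<bb> \<sigma>' 0 = cfun_scale c (eisenstein k \<Gamma> \<nu> \<aa> \<sigma> 0)"
proof -
  note G = SL2Z_subgroup[OF sub]
  define S S' where "S = matrix_inv \<sigma>" "S' = matrix_inv \<sigma>'"
  have d: "det \<gamma> = 1" "det \<sigma> = 1" "det \<sigma>' = 1" "det S = 1" "det S' = 1"
    using G(2)[OF \<gamma>] scal scal' by (auto simp: S_S'_def scaling_matrix_def SL2R_def det_matrix_inv)
  \<comment> \<open>Up to sign, \<sigma>' and \<gamma> \<sigma> have the same automorphy factor; a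
    minus sign costs the constant provided by \<open>wcocycle_minus_one\<close>.\<close>
  obtain c0 where c0: "c0 \<noteq> 0" "\<And>w. w \<in> uhp \<Longrightarrow> automorphy (S' ** \<gamma>) w powr of_real k = c0 * automorphy S w powr of_real k"
  proof -
    have e: "automorphy (S ** matrix_inv \<gamma>) (mobius \<gamma> w) * automorphy \<gamma> w = automorphy S w" if "w \<in> uhp" for w
      unfolding automorphy_mult[OF d(1) that, symmetric] by (simp add: matrix_inv_cancel[OF d(1)])
    have m: "matrix_inv (\<gamma> ** \<sigma>) = S ** matrix_inv \<gamma>" by (simp add: matrix_inv_mult d S_S'_def)
    have st: "scaling_matrix \<Gamma> \<bb> (\<gamma> ** \<sigma>)" unfolding b by (rule scaling_matrix_translate[OF sub scal \<gamma>])
    from scaling_matrix_automorphy[OF st scal'] show ?thesis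
    proof
      assume "\<forall>w. automorphy (matrix_inv \<sigma>') w = automorphy (matrix_inv (\<gamma> ** \<sigma>)) w"
      hence "automorphy (S' ** \<gamma>) w = automorphy S w" if "w \<in> uhp" for w
        using e[OF that] unfolding m automorphy_mult[OF d(1) that] S_S'_def by simp
      thus ?thesis using that[of 1] by simp
    next
      assume "\<forall>w. automorphy (matrix_inv \<sigma>') w = - automorphy (matrix_inv (\<gamma> ** \<sigma>)) w"
      hence e': "automorphy (S' ** \<gamma>) w = - automorphy S w" if "w \<in> uhp" for w
        using e[OF that] unfolding m automorphy_mult[OF d(1) that] S_S'_def by simp
      have n: "norm (wcocycle k (- mat 1) S) = 1"
        by (rule norm_wcocycle[OF _ d(4)]) (simp add: det_minus_2)
      hence "wcocycle k (- mat 1) S \<noteq> 0" by auto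
      thus ?thesis using wcocycle_minus_one[OF d(4), of _ k]
        by (intro that[of "(- 1) powr of_real k / wcocycle k (- mat 1) S"]) (simp_all add: e' field_simps)
    qed
  qed
  define c where "c = \<nu> \<gamma> * wcocycle k S' \<gamma> * c0"
  have "norm (\<nu> \<gamma>) = 1" "norm (wcocycle k S' \<gamma>) = 1"
    using ms \<gamma> norm_wcocycle[OF d(5,1)] by (auto simp: multiplier_system_def)
  hence c: "c \<noteq> 0" using c0(1) by (auto simp: c_def)
  let ?t = "eisenstein_term \<nu> k \<sigma> 0" and ?t' = "eisenstein_term \<nu> k \<sigma>' 0"
  have t: "?t' z (\<gamma> ** B) = 1 / c * ?t z B" if B: "B \<in> \<Gamma>" and z: "z \<in> uhp" for B z
  proof -
    have dB: "det B = 1" "det (\<gamma> ** B) = 1" using G(2) G(4)[OF \<gamma> B] B by auto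
    have Bz: "mobius B z \<in> uhp" by (rule mobius_uhp[OF dB(1) z])
    have 1: "\<nu> (\<gamma> ** B) = \<nu> \<gamma> * \<nu> B * wcocycle k \<gamma> B" using ms \<gamma> B by (simp add: multiplier_system_def)
    have "\<nu> (\<gamma> ** B) * (automorphy S' (mobius (\<gamma> ** B) z) powr of_real k * automorphy (\<gamma> ** B) z powr of_real k)
      = \<nu> \<gamma> * \<nu> B * automorphy S' (mobius \<gamma> (mobius B z)) powr of_real k * (wcocycle k \<gamma> B * automorphy (\<gamma> ** B) z powr of_real k)"
      unfolding 1 mobius_mult[OF dB(1) z] by (simp only: mult_ac)
    also have "\<dots> = \<nu> \<gamma> * \<nu> B * (automorphy S' (mobius \<gamma> (mobius B z)) powr of_real k * automorphy \<gamma> (mobius B z) powr of_real k)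
        * automorphy B z powr of_real k"
      unfolding wcocycle_powr[OF d(1) dB(1) z] by (simp only: mult_ac)
    also have "\<dots> = c * (\<nu> B * (automorphy S (mobius B z) powr of_real k * automorphy B z powr of_real k))"
      unfolding wcocycle_powr[OF d(5,1) Bz, symmetric] c0(2)[OF Bz] c_def by (simp only: mult_ac)
    finally show ?thesis
      using eisenstein_term_eq[OF ms G(4)[OF \<gamma> B] dB(2) d(3) z] eisenstein_term_eq[OF ms B dB(1) d(2) z]
      unfolding S_S'_def by simp
  qed
  have SL: "\<Gamma> \<subseteq> SL2R" using G(2) by (auto simp: SL2R_def)
  have \<nu>1: "\<nu> (mat 1) = 1"
  proof -
    have "wcocycle k (mat 1) (mat 1) = 1" by (simp add: wcocycle_def automorphy_one)
    hence "\<nu> (mat 1) = \<nu> (mat 1) * \<nu> (mat 1)" and "norm (\<nu> (mat 1)) = 1"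
      using ms G(3) unfolding multiplier_system_def by (metis matrix_mul_lid mult.right_neutral, blast)
    thus ?thesis by (metis mult_cancel_left2 norm_zero zero_neq_one)
  qed
  \<comment> \<open>Conjugation by \<gamma> moves A into the stabilizer of \<bb>, where terms are
    constant on cosets. Carried back by \<open>t\<close>, the term at A equals the term at the
    identity, which is the condition at \<aa>.\<close>
  show sing: "singular_cusp \<Gamma> \<nu> k \<aa> \<sigma>"
    unfolding singular_cusp_def
  proof (intro ballI)
    fix A z assume A: "A \<in> cusp_stabilizer \<Gamma> \<aa>" and z: "z \<in> uhp"
    have A\<Gamma>: "A \<in> \<Gamma>" using A by (simp add: cusp_stabilizer_def)
    have dA: "det A = 1" by (rule G(2)[OF A\<Gamma>])
    define D where "D = \<gamma> ** A ** matrix_inv \<gamma>"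
    have D: "D \<in> cusp_stabilizer \<Gamma> \<bb>" unfolding b cusp_stabilizer_translate[OF sub \<gamma>] D_def using A by blast
    have D\<gamma>: "D ** \<gamma> = \<gamma> ** A" by (simp add: D_def matrix_inv_cancel[OF d(1)])
    have "1 / c * ?t z A = ?t' z (D ** \<gamma>)" unfolding D\<gamma> by (rule t[OF A\<Gamma> z, symmetric])
    also have "\<dots> = ?t' z (\<gamma> ** mat 1)" unfolding matrix_mul_rid
      by (rule eisenstein_term_coset[OF SL ms scal' sing' D \<gamma> _ z]) (simp add: D\<gamma> G(4)[OF \<gamma> A\<Gamma>])
    also have "\<dots> = 1 / c * ?t z (mat 1)" by (rule t[OF G(3) z])
    finally have "?t z A = ?t z (mat 1)" using c by simp
    hence "\<nu> A * (automorphy S (mobius A z) powr of_real k * automorphy A z powr of_real k) = automorphy S z powr of_real k"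
      unfolding eisenstein_term_eq[OF ms A\<Gamma> dA d(2) z] eisenstein_term_eq[OF ms G(3) G(2)[OF G(3)] d(2) z] S_S'_def
      by (simp add: \<nu>1 automorphy_one mobius_one)
    thus "\<nu> A * wcocycle k (matrix_inv \<sigma>) A * automorphy (matrix_inv \<sigma> ** A) z powr of_real k = automorphy (matrix_inv \<sigma>) z powr of_real k"
      using wcocycle_powr[OF d(4) dA z, of k] unfolding S_S'_def by (simp only: mult.assoc)
  qed
  obtain \<rho> where \<rho>: "\<rho> \<in> carrier SL2Z" "bdry_mobius \<rho> None = \<aa>" using cusp_eq_SL2Z_image[OF ac] by blast
  have \<rho>': "\<gamma> ** \<rho> \<in> carrier SL2Z" "bdry_mobius (\<gamma> ** \<rho>) None = \<bb>"
    unfolding bdry_mobius_mult[OF SL2Z_det[OF \<rho>(1)]] \<rho>(2) b using SL2Z_mult_closed[OF G(1)[OF \<gamma>] \<rho>(1)] by auto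
  have k0: "k = k + 2 * 0" by simp
  interpret X: eisenstein_setup \<Gamma> \<nu> k 0 k \<aa> \<sigma> \<rho>
    by (rule eisenstein_setup.intro[OF sub ms scal sing k0 k \<rho>])
  interpret Y: eisenstein_setup \<Gamma> \<nu> k 0 k \<bb> \<sigma>' "\<gamma> ** \<rho>"
    by (rule eisenstein_setup.intro[OF sub ms scal' sing' k0 k \<rho>'])
  have ceq: "Y.coset (\<gamma> ** A) = Y.coset (\<gamma> ** B) \<longleftrightarrow> X.coset A = X.coset B" if AB: "A \<in> \<Gamma>" "B \<in> \<Gamma>" for A B
  proof -
    define D where "D = A ** matrix_inv B"
    have DG: "D \<in> \<Gamma>" unfolding D_def using AB G(4,5) by blast
    have "\<gamma> ** A ** matrix_inv (\<gamma> ** B) = \<gamma> ** D ** matrix_inv \<gamma>"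
      by (simp add: D_def matrix_inv_mult d(1) G(2)[OF AB(2)] matrix_mul_assoc)
    hence "bdry_mobius (\<gamma> ** A ** matrix_inv (\<gamma> ** B)) \<bb> = bdry_mobius (\<gamma> ** D ** matrix_inv \<gamma> ** \<gamma>) \<aa>"
      unfolding b bdry_mobius_mult[OF d(1)] by simp
    also have "\<gamma> ** D ** matrix_inv \<gamma> ** \<gamma> = \<gamma> ** D" by (simp add: matrix_inv_cancel[OF d(1)])
    finally have "bdry_mobius (\<gamma> ** A ** matrix_inv (\<gamma> ** B)) \<bb> = bdry_mobius \<gamma> (bdry_mobius D \<aa>)"
      unfolding bdry_mobius_mult[OF G(2)[OF DG]] .
    moreover have "bdry_mobius \<gamma> x = \<bb> \<longleftrightarrow> x = \<aa>" for x
      unfolding b by (metis bdry_mobius_inverse(1)[OF d(1)])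
    ultimately show ?thesis
      unfolding Y.coset_eq_iff[OF G(4)[OF \<gamma> AB(1)] G(4)[OF \<gamma> AB(2)]] X.coset_eq_iff[OF AB] D_def by simp
  qed
  have bij: "bij_betw (\<lambda>K. Y.coset (\<gamma> ** X.rep K)) X.cosets Y.cosets"
  proof (rule bij_betw_imageI)
    show "inj_on (\<lambda>K. Y.coset (\<gamma> ** X.rep K)) X.cosets"
      using ceq X.rep by (intro inj_onI) metis
    show "(\<lambda>K. Y.coset (\<gamma> ** X.rep K)) ` X.cosets = Y.cosets"
    proof (intro equalityI subsetI)
      fix K' assume "K' \<in> (\<lambda>K. Y.coset (\<gamma> ** X.rep K)) ` X.cosets"
      thus "K' \<in> Y.cosets" unfolding Y.cosets_eq using X.rep(1) G(4)[OF \<gamma>] by blast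
    next
      fix K' assume "K' \<in> Y.cosets"
      then obtain A where A: "A \<in> \<Gamma>" "K' = Y.coset A" unfolding Y.cosets_eq by blast
      define B where "B = matrix_inv \<gamma> ** A"
      have B: "B \<in> \<Gamma>" "A = \<gamma> ** B" using A(1) \<gamma> G(4,5) by (auto simp: B_def matrix_inv_cancel[OF d(1)])
      have K: "X.coset B \<in> X.cosets" unfolding X.cosets_eq using B(1) by blast
      have "Y.coset (\<gamma> ** X.rep (X.coset B)) = K'"
        unfolding A(2) B(2) ceq[OF X.rep(1)[OF K] B(1)] by (rule X.rep(2)[OF K])
      thus "K' \<in> (\<lambda>K. Y.coset (\<gamma> ** X.rep K)) ` X.cosets" using K by blast
    qed
  qed
  have "eisenstein k \<Gamma> \<nu> \<bb> \<sigma>' 0 z = 1 / c * eisenstein k \<Gamma> \<nu> \<aa> \<sigma> 0 z" for z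
  proof (cases "z \<in> uhp")
    case True
    have "(\<Sum>\<^sub>\<infinity>K\<in>Y.cosets. ?t' z (Y.rep K)) = (\<Sum>\<^sub>\<infinity>K\<in>X.cosets. ?t' z (Y.rep (Y.coset (\<gamma> ** X.rep K))))"
      by (rule infsum_reindex_bij_betw[OF bij, symmetric])
    also have "\<dots> = (\<Sum>\<^sub>\<infinity>K\<in>X.cosets. 1 / c * ?t z (X.rep K))"
    proof (rule infsum_cong)
      fix K assume K: "K \<in> X.cosets"
      have "?t' z (Y.rep (Y.coset (\<gamma> ** X.rep K))) = ?t' z (\<gamma> ** X.rep K)"
        using Y.etrm_rep[OF G(4)[OF \<gamma> X.rep(1)[OF K]] True] by simp
      thus "?t' z (Y.rep (Y.coset (\<gamma> ** X.rep K))) = 1 / c * ?t z (X.rep K)" using t[OF X.rep(1)[OF K] True] by simp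
    qed
    also have "\<dots> = 1 / c * (\<Sum>\<^sub>\<infinity>K\<in>X.cosets. ?t z (X.rep K))" by (rule infsum_cmult_right')
    finally show ?thesis using True by (simp add: eisenstein_def)
  qed (simp add: eisenstein_def)
  thus "\<exists>c. eisenstein k \<Gamma> \<nu> \<bb> \<sigma>' 0 = cfun_scale c (eisenstein k \<Gamma> \<nu> \<aa> \<sigma> 0)"
    unfolding cfun_scale_def fun_eq_iff by blast
qed

lemma eisenstein_space_eq_span:
  assumes fi: "finite_index_subgroup \<Gamma>" and ms: "multiplier_system \<Gamma> \<mu> k" and k: "k > 2"
    and R: "cusp_representatives \<Gamma> R" and scal: "\<And>\<aa>. \<aa> \<in> cusps \<Longrightarrow> scaling_matrix \<Gamma> \<aa> (\<sigma> \<aa>)"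
  defines "I \<equiv> {\<aa> \<in> R. singular_cusp \<Gamma> \<mu> k \<aa> (\<sigma> \<aa>)}"
  defines "\<phi> \<equiv> (\<lambda>\<aa>. eisenstein k \<Gamma> \<mu> \<aa> (\<sigma> \<aa>) 0)"
  shows "eisenstein_space k \<Gamma> \<mu> \<sigma> = cfun.span (\<phi> ` I)" "inj_on \<phi> I" "cfun.independent (\<phi> ` I)"
proof -
  have sub: "subgroup \<Gamma> SL2Z" using fi by (simp add: finite_index_subgroup_def)
  have Rc: "R \<subseteq> cusps" using R by (simp add: cusp_representatives_def)
  have fI: "finite I" using finite_cusp_representatives[OF fi R] by (simp add: I_def)
  have I: "\<aa> \<in> cusps" "\<aa> \<in> R" "singular_cusp \<Gamma> \<mu> k \<aa> (\<sigma> \<aa>)" if "\<aa> \<in> I" for \<aa>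
    using that Rc by (auto simp: I_def)
  have d: "det (\<sigma> \<bb>) = 1" "bdry_mobius (\<sigma> \<bb>) None = \<bb>" if "\<bb> \<in> R" for \<bb>
    using scal[of \<bb>] that Rc by (auto simp: scaling_matrix_def SL2R_def)
  have self: "\<exists>u. u \<noteq> 0 \<and> cusp_asymp k 0 (\<sigma> \<aa>) (\<phi> \<aa>) u" if "\<aa> \<in> I" for \<aa>
    unfolding \<phi>_def using holomorphic_eisenstein_asymp(1)[OF sub ms scal[OF I(1)[OF that]] I(3)[OF that] k I(1)[OF that]] .
  have other: "cusp_asymp k 0 (\<sigma> \<bb>) (\<phi> \<aa>) 0" if "\<aa> \<in> I" "\<bb> \<in> R" "\<aa> \<noteq> \<bb>" for \<aa> \<bb>
    unfolding \<phi>_def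
    by (rule holomorphic_eisenstein_asymp(2)[OF sub ms scal[OF I(1)[OF that(1)]] I(3)[OF that(1)] k I(1)[OF that(1)] _ d[OF that(2)]])
       (use that Rc cusp_representatives_inequivalent[OF sub R I(2)[OF that(1)] that(2,3)] in auto)
  have pos: "k / 2 + 0 > 0" using k by simp
  show "inj_on \<phi> I" by (rule cusp_asymp_independent(1)[OF fI pos self]) (use other I(2) in blast)+
  show "cfun.independent (\<phi> ` I)" by (rule cusp_asymp_independent(2)[OF fI pos self]) (use other I(2) in blast)+
  show "eisenstein_space k \<Gamma> \<mu> \<sigma> = cfun.span (\<phi> ` I)"
    unfolding eisenstein_space_def
  proof (rule antisym)
    show "cfun.span (\<phi> ` I) \<subseteq> cfun.span {eisenstein k \<Gamma> \<mu> \<aa> (\<sigma> \<aa>) 0 |\<aa>. \<aa> \<in> cusps \<and> singular_cusp \<Gamma> \<mu> k \<aa> (\<sigma> \<aa>)}"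
      by (rule cfun.span_mono) (use I in \<open>auto simp: \<phi>_def\<close>)
    have "eisenstein k \<Gamma> \<mu> \<bb> (\<sigma> \<bb>) 0 \<in> cfun.span (\<phi> ` I)" if b: "\<bb> \<in> cusps" "singular_cusp \<Gamma> \<mu> k \<bb> (\<sigma> \<bb>)" for \<bb>
    proof -
      obtain \<aa> \<gamma> where a: "\<aa> \<in> R" "\<gamma> \<in> \<Gamma>" "bdry_mobius \<gamma> \<aa> = \<bb>"
        using R b(1) unfolding cusp_representatives_def by blast
      have ac: "\<aa> \<in> cusps" using a(1) Rc by blast
      note eq = eisenstein_equivalent_cusp[OF sub ms k ac a(2) scal[OF ac] a(3)[symmetric] scal[OF b(1)] b(2)]
      have "\<aa> \<in> I" using a(1) eq(1) by (simp add: I_def)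
      hence "eisenstein k \<Gamma> \<mu> \<aa> (\<sigma> \<aa>) 0 \<in> cfun.span (\<phi> ` I)" unfolding \<phi>_def by (intro cfun.span_base) blast
      thus ?thesis using eq(2) cfun.span_scale by metis
    qed
    thus "cfun.span {eisenstein k \<Gamma> \<mu> \<aa> (\<sigma> \<aa>) 0 |\<aa>. \<aa> \<in> cusps \<and> singular_cusp \<Gamma> \<mu> k \<aa> (\<sigma> \<aa>)} \<subseteq> cfun.span (\<phi> ` I)"
      by (intro cfun.span_minimal cfun.subspace_span) blast
  qed
qed

lemma isomorphic_spans:
  assumes \<phi>: "inj_on \<phi> I" "cfun.independent (\<phi> ` I)" and \<psi>: "inj_on \<psi> I" "cfun.independent (\<psi> ` I)"
  shows "isomorphic_subspaces (cfun.span (\<phi> ` I)) (cfun.span (\<psi> ` I))"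
proof -
  interpret p: vector_space_pair cfun_scale cfun_scale ..
  obtain T where T: "Vector_Spaces.linear cfun_scale cfun_scale T" "\<And>f. f \<in> \<phi> ` I \<Longrightarrow> T f = \<psi> (the_inv_into I \<phi> f)"
    using p.linear_independent_extend[OF \<phi>(2), of "\<lambda>f. \<psi> (the_inv_into I \<phi> f)"] by blast
  have T\<phi>: "T (\<phi> a) = \<psi> a" if "a \<in> I" for a using T(2)[of "\<phi> a"] that the_inv_into_f_f[OF \<phi>(1) that] by simp
  have im: "T ` \<phi> ` I = \<psi> ` I" using T\<phi> by force
  have "inj_on T (\<phi> ` I)" using T\<phi> \<psi>(1) by (auto simp: inj_on_def)
  hence "inj_on T (cfun.span (\<phi> ` I))"
    using p.linear_inj_on_span_independent_image[OF T(1), of "\<phi> ` I"] \<psi>(2) im by simp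
  moreover have "T ` cfun.span (\<phi> ` I) = cfun.span (\<psi> ` I)"
    using p.linear_span_image[OF T(1), of "\<phi> ` I"] im by simp
  ultimately show ?thesis
    unfolding isomorphic_subspaces_def bij_betw_def
    using p.linear_add[OF T(1)] p.linear_scale[OF T(1)] by blast
qed

lemma H_sharp_isomorphic_eisenstein_space:
  assumes fi: "finite_index_subgroup \<Gamma>" and ms: "multiplier_system \<Gamma> \<nu> (2 - k)" and k: "k > 2"
    and R: "cusp_representatives \<Gamma> R" and scal: "\<And>\<aa>. \<aa> \<in> cusps \<Longrightarrow> scaling_matrix \<Gamma> \<aa> (\<sigma> \<aa>)"
  shows "isomorphic_subspaces (H_sharp (2 - k) \<Gamma> \<nu>) (eisenstein_space k \<Gamma> (\<lambda>A. cnj (\<nu> A)) \<sigma>)"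
proof -
  have sub: "subgroup \<Gamma> SL2Z" using fi by (simp add: finite_index_subgroup_def)
  have md: "multiplier_system \<Gamma> (\<lambda>A. cnj (\<nu> A)) k" using multiplier_dual[OF sub ms] by simp
  have Rc: "R \<subseteq> cusps" using R by (simp add: cusp_representatives_def)
  have "singular_cusp \<Gamma> \<nu> (2 - k) \<aa> (\<sigma> \<aa>) \<longleftrightarrow> singular_cusp \<Gamma> (\<lambda>A. cnj (\<nu> A)) k \<aa> (\<sigma> \<aa>)" if "\<aa> \<in> R" for \<aa>
    using singular_dual[OF sub ms scal[of \<aa>]] singular_dual[OF sub md scal[of \<aa>]] that Rc by auto
  hence I: "{\<aa> \<in> R. singular_cusp \<Gamma> \<nu> (2 - k) \<aa> (\<sigma> \<aa>)} = {\<aa> \<in> R. singular_cusp \<Gamma> (\<lambda>A. cnj (\<nu> A)) k \<aa> (\<sigma> \<aa>)}"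
    by blast
  let ?I = "{\<aa> \<in> R. singular_cusp \<Gamma> \<nu> (2 - k) \<aa> (\<sigma> \<aa>)}"
  let ?\<phi> = "\<lambda>\<aa>. mock_eisenstein k \<Gamma> \<nu> \<aa> (\<sigma> \<aa>)" and ?\<psi> = "\<lambda>\<aa>. eisenstein k \<Gamma> (\<lambda>A. cnj (\<nu> A)) \<aa> (\<sigma> \<aa>) 0"
  have H: "H_sharp (2 - k) \<Gamma> \<nu> = cfun.span (?\<phi> ` ?I)" "inj_on ?\<phi> ?I" "cfun.independent (?\<phi> ` ?I)"
    by (rule H_sharp_eq_span[OF fi ms k R]; rule scal; assumption)+
  have E: "eisenstein_space k \<Gamma> (\<lambda>A. cnj (\<nu> A)) \<sigma> = cfun.span (?\<psi> ` ?I)" "inj_on ?\<psi> ?I" "cfun.independent (?\<psi> ` ?I)"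
    unfolding I by (rule eisenstein_space_eq_span[OF fi md k R]; rule scal; assumption)+
  show ?thesis unfolding H(1) E(1) by (rule isomorphic_spans[OF H(2,3) E(2,3)])
qed

section \<open>Dirichlet characters and conductors\<close>

text \<open>Take b = a + M D, where D is the product of the primes of N that do not divide a: a
  prime of N divides exactly one of a and D, and one that divides a does not divide M.\<close>

lemma coprime_lift:
  fixes a M N :: int
  assumes "coprime a M" "N \<noteq> 0"
  obtains b where "[b = a] (mod M)" "coprime b N"
proof -
  define D where "D = (\<Prod>p | p \<in> prime_factors N \<and> \<not> p dvd a. p)"
  have "coprime (a + M * D) N"
  proof (rule ccontr)
    assume "\<not> coprime (a + M * D) N"
    hence "gcd (a + M * D) N \<noteq> 0" "\<not> is_unit (gcd (a + M * D) N)" using assms(2) by (auto simp: coprime_iff_gcd_eq_1)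
    then obtain p where "prime p" "p dvd gcd (a + M * D) N" using prime_divisor_exists by blast
    hence p: "prime p" "p dvd a + M * D" "p dvd N" by auto
    have pD: "p dvd D \<longleftrightarrow> \<not> p dvd a"
    proof
      assume "p dvd D"
      then obtain q where q: "q \<in> prime_factors N" "\<not> q dvd a" "p dvd q"
        unfolding D_def using p(1) by (auto simp: prime_dvd_prod_iff)
      thus "\<not> p dvd a" using primes_dvd_imp_eq[of p q] p(1) by auto
    next
      assume "\<not> p dvd a"
      thus "p dvd D" unfolding D_def using p assms(2) by (intro dvd_prodI) (auto simp: prime_factors_dvd)
    qed
    show False
    proof (cases "p dvd a")
      case True
      hence "p dvd M * D" using p(2) by (simp add: dvd_add_right_iff)
      hence "p dvd M" using p(1) pD True by (auto simp: prime_dvd_mult_iff)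
      thus False using assms(1) True p(1) by (meson coprime_common_divisor not_prime_unit)
    next
      case False
      hence "p dvd M * D" using pD by simp
      thus False using False p(2) by (simp add: dvd_add_left_iff)
    qed
  qed
  moreover have "[a + M * D = a] (mod M)" by (simp add: cong_def)
  ultimately show ?thesis using that by blast
qed

lemma cong_gcd_solution:
  fixes a M1 M2 :: int
  assumes "[a = 1] (mod gcd M1 M2)"
  obtains b where "[b = 1] (mod M1)" "[b = a] (mod M2)"
proof -
  obtain j where j: "a - 1 = gcd M1 M2 * j" using assms by (auto simp: cong_iff_dvd_diff elim: dvdE)
  obtain u v where uv: "u * M1 + v * M2 = gcd M1 M2" using bezout_int by blast
  have "1 + M1 * (u * j) = a - M2 * (v * j)" using j unfolding uv[symmetric] by (simp add: algebra_simps)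
  moreover have "[1 + M1 * (u * j) = 1] (mod M1)" "[a - M2 * (v * j) = a] (mod M2)" by (simp_all add: cong_iff_dvd_diff)
  ultimately show ?thesis using that by metis
qed

lemma dirichlet_character_cong:
  assumes \<psi>: "dirichlet_character N \<psi>" and ab: "[a = b] (mod int N)"
  shows "\<psi> a = \<psi> b"
proof -
  have per: "\<psi> (c + int N * int n) = \<psi> c" for c n
  proof (induction n)
    case (Suc n)
    have "\<psi> (c + int N * int (Suc n)) = \<psi> ((c + int N * int n) + int N)" by (simp add: algebra_simps)
    also have "\<dots> = \<psi> (c + int N * int n)" using \<psi> unfolding dirichlet_character_def by blast
    finally show ?case using Suc by simp
  qed simp
  obtain j where j: "b = a + int N * j" using ab cong_iff_lin by blast
  show ?thesis
  proof (cases "j \<ge> 0")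
    case True
    thus ?thesis using per[of a "nat j"] j by simp
  next
    case False
    hence "a = b + int N * int (nat (- j))" using j by simp
    thus ?thesis using per[of b "nat (- j)"] by simp
  qed
qed

lemma dirichlet_character_mult: "dirichlet_character N \<psi> \<Longrightarrow> \<psi> (a * b) = \<psi> a * \<psi> b"
  by (simp add: dirichlet_character_def)

lemma dirichlet_character_nonzero: "dirichlet_character N \<psi> \<Longrightarrow> \<psi> a \<noteq> 0 \<longleftrightarrow> coprime a (int N)"
  by (simp add: dirichlet_character_def)

lemma dirichlet_character_one:
  assumes "dirichlet_character N \<psi>"
  shows "\<psi> 1 = 1"
  using dirichlet_character_mult[OF assms, of 1 1] dirichlet_character_nonzero[OF assms, of 1] by simp

text \<open>The powers of a value lie in the finite image of one period, so the value is a root of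
  unity.\<close>

lemma dirichlet_character_norm:
  assumes \<psi>: "dirichlet_character N \<psi>" and a: "coprime a (int N)"
  shows "norm (\<psi> a) = 1"
proof -
  have N: "N > 0" using \<psi> by (simp add: dirichlet_character_def)
  have nz: "\<psi> a \<noteq> 0" using dirichlet_character_nonzero[OF \<psi>] a by simp
  have pow: "\<psi> (a ^ n) = \<psi> a ^ n" for n
    by (induction n) (simp_all add: dirichlet_character_one[OF \<psi>] dirichlet_character_mult[OF \<psi>])
  have "\<psi> a ^ n \<in> \<psi> ` {0..<int N}" for n
  proof -
    have "\<psi> (a ^ n) = \<psi> (a ^ n mod int N)" by (rule dirichlet_character_cong[OF \<psi>]) (simp add: cong_def)
    thus ?thesis using N by (auto simp: pow)
  qed
  hence "range (\<lambda>n. \<psi> a ^ n) \<subseteq> \<psi> ` {0..<int N}" by blast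
  hence "finite (range (\<lambda>n. \<psi> a ^ n))" by (rule finite_subset) simp
  hence "\<not> inj (\<lambda>n. \<psi> a ^ n)" using finite_imageD infinite_UNIV_nat by blast
  then obtain n m where "n < m" "\<psi> a ^ n = \<psi> a ^ m" unfolding inj_def by (metis linorder_neqE_nat)
  moreover from this have "\<psi> a ^ m = \<psi> a ^ n * \<psi> a ^ (m - n)" unfolding power_add[symmetric] by simp
  ultimately have "\<psi> a ^ (m - n) = 1" "m - n > 0" using nz by auto
  hence "norm (\<psi> a) ^ (m - n) = 1 ^ (m - n)" unfolding norm_power[symmetric] by simp
  from power_eq_imp_eq_base[OF this norm_ge_zero zero_le_one \<open>m - n > 0\<close>] show ?thesis .
qed

lemma dirichlet_character_cnj:
  "dirichlet_character N \<psi> \<Longrightarrow> dirichlet_character N (\<lambda>a. cnj (\<psi> a))"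
  by (simp add: dirichlet_character_def)

text \<open>For M dividing N this says that \<psi> is induced from a character modulo M
  (\<open>trivial_mod_induced\<close>). Both the conductor and the singularity of a cusp can be
  expressed in this form.\<close>

definition trivial_mod :: "nat \<Rightarrow> (int \<Rightarrow> complex) \<Rightarrow> int \<Rightarrow> bool" where
  "trivial_mod N \<psi> M \<longleftrightarrow> (\<forall>a. coprime a (int N) \<longrightarrow> [a = 1] (mod M) \<longrightarrow> \<psi> a = 1)"

lemma trivial_modD:
  assumes \<psi>: "dirichlet_character N \<psi>" and M: "trivial_mod N \<psi> M" and N: "M dvd int N"
    and ab: "coprime a (int N)" "coprime b (int N)" "[a = b] (mod M)"
  shows "\<psi> a = \<psi> b"
proof -
  obtain x where x: "[b * x = 1] (mod int N)" using cong_solve_coprime_int[OF ab(2)] by blast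
  have x1: "\<psi> (b * x) = 1" using dirichlet_character_cong[OF \<psi> x] dirichlet_character_one[OF \<psi>] by simp
  hence "coprime x (int N)"
    using dirichlet_character_mult[OF \<psi>, of b x] dirichlet_character_nonzero[OF \<psi>, of x] by auto
  moreover have "[a * x = 1] (mod M)"
    using cong_trans[OF cong_scalar_right[OF ab(3)] cong_dvd_modulus[OF x N]] .
  ultimately have "\<psi> (a * x) = 1" using M ab(1) by (simp add: trivial_mod_def)
  hence "\<psi> a * \<psi> x = \<psi> b * \<psi> x" "\<psi> x \<noteq> 0" using x1 by (auto simp: dirichlet_character_mult[OF \<psi>])
  thus ?thesis by simp
qed

lemma trivial_mod_dvd: "trivial_mod N \<psi> M \<Longrightarrow> M dvd M' \<Longrightarrow> trivial_mod N \<psi> M'"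
  unfolding trivial_mod_def using cong_dvd_modulus by blast

text \<open>For a congruent to 1 modulo the gcd there is b congruent to 1 modulo M1 and to a modulo
  M2, and b lifts to a number prime to N; its character value is both 1 and \<psi> a.\<close>

lemma trivial_mod_gcd:
  assumes \<psi>: "dirichlet_character N \<psi>" and M: "trivial_mod N \<psi> M1" "trivial_mod N \<psi> M2" "M1 dvd int N" "M2 dvd int N"
  shows "trivial_mod N \<psi> (gcd M1 M2)"
  unfolding trivial_mod_def
proof (intro allI impI)
  fix a assume a: "coprime a (int N)" "[a = 1] (mod gcd M1 M2)"
  have N: "int N \<noteq> 0" using \<psi> by (simp add: dirichlet_character_def)
  obtain b where b: "[b = 1] (mod M1)" "[b = a] (mod M2)" using cong_gcd_solution[OF a(2)] by blast
  have "coprime b M1" using b(1) by (metis cong_imp_coprime cong_sym coprime_1_left)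
  moreover have "coprime a M2" using a(1) M(4) by (meson coprime_divisors dvd_refl)
  hence "coprime b M2" using b(2) by (metis cong_imp_coprime cong_sym)
  ultimately have "coprime b (M1 * M2)" by simp
  then obtain b' where b': "[b' = b] (mod (M1 * M2))" "coprime b' (int N)" using coprime_lift[OF _ N] by blast
  have "[b' = 1] (mod M1)" "[b' = a] (mod M2)"
    using cong_trans[OF cong_dvd_modulus[OF b'(1)]] b by auto
  hence "\<psi> b' = 1" "\<psi> b' = \<psi> a"
    using M(1) b'(2) trivial_modD[OF \<psi> M(2,4) b'(2) a(1)] by (auto simp: trivial_mod_def)
  thus "\<psi> a = 1" by simp
qed

text \<open>The character modulo M is evaluated at a lift prime to N; triviality modulo M makes the
  value independent of the lift.\<close>

lemma trivial_mod_induced: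
  assumes \<psi>: "dirichlet_character N \<psi>" and M: "trivial_mod N \<psi> (int M)" "M dvd N"
  obtains \<theta> where "dirichlet_character M \<theta>" "\<And>a. coprime a (int N) \<Longrightarrow> \<psi> a = \<theta> a"
proof -
  have N: "int N \<noteq> 0" "N > 0" using \<psi> by (auto simp: dirichlet_character_def)
  have MN: "int M dvd int N" and M0: "M > 0" using M(2) N by (auto intro: Nat.gr0I)
  define l where "l = (\<lambda>a. SOME b. [b = a] (mod int M) \<and> coprime b (int N))"
  have l: "[l a = a] (mod int M)" "coprime (l a) (int N)" if "coprime a (int M)" for a
  proof -
    have "\<exists>b. [b = a] (mod int M) \<and> coprime b (int N)" using coprime_lift[OF that N(1)] by blast
    from someI_ex[OF this] show "[l a = a] (mod int M)" "coprime (l a) (int N)" unfolding l_def by auto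
  qed
  define \<theta> where "\<theta> = (\<lambda>a. if coprime a (int M) then \<psi> (l a) else 0)"
  note eq = trivial_modD[OF \<psi> M(1) MN]
  have "dirichlet_character M \<theta>"
    unfolding dirichlet_character_def
  proof (intro conjI allI)
    show "M > 0" by (rule M0)
    show "\<theta> (a + int M) = \<theta> a" for a
    proof (cases "coprime a (int M)")
      case True
      hence c: "coprime (a + int M) (int M)" by (simp add: coprime_iff_gcd_eq_1)
      have "[l (a + int M) = l a] (mod int M)"
        using cong_trans[OF l(1)[OF c] cong_trans[OF _ cong_sym[OF l(1)[OF True]]]] by (simp add: cong_def)
      thus ?thesis using eq[OF l(2)[OF c] l(2)[OF True]] c True by (simp add: \<theta>_def)
    qed (simp add: \<theta>_def coprime_iff_gcd_eq_1)
    show "\<theta> (a * b) = \<theta> a * \<theta> b" for a b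
    proof (cases "coprime a (int M) \<and> coprime b (int M)")
      case True
      hence c: "coprime a (int M)" "coprime b (int M)" "coprime (a * b) (int M)" by auto
      have "[l (a * b) = l a * l b] (mod int M)"
        using cong_trans[OF l(1)[OF c(3)] cong_sym[OF cong_mult[OF l(1)[OF c(1)] l(1)[OF c(2)]]]] .
      hence "\<psi> (l (a * b)) = \<psi> (l a * l b)" using l(2) c by (intro eq) auto
      thus ?thesis using c by (simp add: \<theta>_def dirichlet_character_mult[OF \<psi>])
    qed (auto simp: \<theta>_def)
    show "\<theta> a \<noteq> 0 \<longleftrightarrow> coprime a (int M)" for a
      using dirichlet_character_nonzero[OF \<psi>] l(2) by (auto simp: \<theta>_def)
  qed
  moreover have "\<psi> a = \<theta> a" if a: "coprime a (int N)" for a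
  proof -
    have c: "coprime a (int M)" using a MN by (meson coprime_divisors dvd_refl)
    show ?thesis using eq[OF a l(2)[OF c] cong_sym[OF l(1)[OF c]]] c by (simp add: \<theta>_def)
  qed
  ultimately show ?thesis using that by blast
qed

text \<open>The moduli from which \<psi> is induced are closed under gcd, so the least of them
  divides all the others.\<close>

lemma conductor_dvd_iff:
  assumes \<psi>: "dirichlet_character N \<psi>" and M: "M dvd N"
  shows "conductor N \<psi> dvd M \<longleftrightarrow> trivial_mod N \<psi> (int M)"
proof -
  let ?P = "\<lambda>M. M dvd N \<and> (\<exists>\<theta>. dirichlet_character M \<theta> \<and> (\<forall>a. coprime a (int N) \<longrightarrow> \<psi> a = \<theta> a))"
  define m where "m = conductor N \<psi>"
  have N: "N > 0" using \<psi> by (simp add: dirichlet_character_def)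
  have "?P N" using \<psi> by (intro conjI exI[of _ \<psi>]) auto
  hence Pm: "?P m" unfolding m_def conductor_def by (rule LeastI)
  have triv: "trivial_mod N \<psi> (int m)"
  proof -
    obtain \<theta> where \<theta>: "dirichlet_character m \<theta>" "\<And>a. coprime a (int N) \<Longrightarrow> \<psi> a = \<theta> a" using Pm by blast
    show ?thesis unfolding trivial_mod_def
      using \<theta>(2) dirichlet_character_cong[OF \<theta>(1), of _ 1] dirichlet_character_one[OF \<theta>(1)] by simp
  qed
  have "m dvd M" if t: "trivial_mod N \<psi> (int M)"
  proof -
    have "trivial_mod N \<psi> (gcd (int m) (int M))"
      by (rule trivial_mod_gcd[OF \<psi> triv t]) (use Pm M in auto)
    hence t': "trivial_mod N \<psi> (int (gcd m M))" by simp
    have "gcd m M dvd N" using M by (rule dvd_trans[rotated]) simp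
    hence "?P (gcd m M)" using trivial_mod_induced[OF \<psi> t'] by metis
    hence "m \<le> gcd m M" unfolding m_def conductor_def by (rule Least_le)
    moreover have "m > 0" using Pm N by (auto intro: Nat.gr0I)
    ultimately have "gcd m M = m" by (intro antisym gcd_le1_nat) auto
    thus ?thesis by (metis gcd_dvd2)
  qed
  thus ?thesis using triv trivial_mod_dvd[of N \<psi> "int m" "int M"] unfolding m_def[symmetric] by auto
qed

lemma card_units_mod:
  assumes "g > 0"
  shows "card {u \<in> {0..<int g}. coprime u (int g)} = totient g"
proof -
  let ?U = "{u \<in> {0..<int g}. coprime u (int g)}"
  have "bij_betw (\<lambda>n. int n mod int g) (totatives g) ?U"
  proof (rule bij_betwI')
    fix n m assume nm: "n \<in> totatives g" "m \<in> totatives g"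
    show "int n mod int g = int m mod int g \<longleftrightarrow> n = m"
    proof
      assume "int n mod int g = int m mod int g"
      hence "n mod g = m mod g" by (simp flip: zmod_int)
      moreover have "n mod g = (if n = g then 0 else n)" "m mod g = (if m = g then 0 else m)" "0 < n" "0 < m"
        using nm by (auto simp: totatives_def)
      ultimately show "n = m" by (simp split: if_splits)
    qed simp
  next
    show "int n mod int g \<in> ?U" if "n \<in> totatives g" for n
      using assms that by (auto simp: totatives_def)
  next
    fix u assume u: "u \<in> ?U"
    show "\<exists>n\<in>totatives g. u = int n mod int g"
    \<comment> \<open>\<open>totatives\<close> uses the residues 1, ..., g instead of 0, ..., g - 1;
      the difference matters only for g = 1.\<close>
    proof (cases "u = 0")
      case True
      hence "g = 1" using u by simp
      thus ?thesis using True by (intro bexI[of _ 1]) (auto simp: totatives_def)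
    next
      case False
      moreover have "coprime (int (nat u)) (int g)" using u by simp
      ultimately have "nat u \<in> totatives g" using u unfolding coprime_int_iff by (auto simp: totatives_def)
      thus ?thesis using u by (intro bexI[of _ "nat u"]) auto
    qed
  qed
  from bij_betw_same_card[OF this] show ?thesis by (simp only: totient_def)
qed

section \<open>The cusps of \<open>\<Gamma>\<^sub>0(N)\<close>\<close>

definition int_matrix :: "int \<Rightarrow> int \<Rightarrow> int \<Rightarrow> int \<Rightarrow> real^2^2" where
  "int_matrix a b c d = vector [vector [of_int a, of_int b], vector [of_int c, of_int d]]"

lemma int_matrix_entries [simp]:
  "int_matrix a b c d $ 1 $ 1 = of_int a" "int_matrix a b c d $ 1 $ 2 = of_int b"
  "int_matrix a b c d $ 2 $ 1 = of_int c" "int_matrix a b c d $ 2 $ 2 = of_int d"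
  by (simp_all add: int_matrix_def vector_2)

lemma int_matrix_mult:
  "int_matrix a b c d ** int_matrix a' b' c' d' = int_matrix (a*a' + b*c') (a*b' + b*d') (c*a' + d*c') (c*b' + d*d')"
  by (simp add: mat2_eq_iff mat2_mult)

lemma int_matrix_minus: "- int_matrix a b c d = int_matrix (- a) (- b) (- c) (- d)"
  by (simp add: mat2_eq_iff)

lemma int_matrix_SL2Z: "int_matrix a b c d \<in> carrier SL2Z \<longleftrightarrow> a * d - b * c = 1"
proof -
  have "det (int_matrix a b c d) = of_int (a * d - b * c)" by (simp add: det_2)
  thus ?thesis by (simp add: carrier_SL2Z forall_2 del: of_int_diff of_int_mult)
qed

lemma SL2Z_int_matrix:
  assumes "A \<in> carrier SL2Z"
  obtains a b c d where "A = int_matrix a b c d" "a * d - b * c = 1"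
proof -
  have "A = int_matrix \<lfloor>A$1$1\<rfloor> \<lfloor>A$1$2\<rfloor> \<lfloor>A$2$1\<rfloor> \<lfloor>A$2$2\<rfloor>"
    using SL2Z_entry[OF assms] by (simp add: mat2_eq_iff)
  thus ?thesis using that assms int_matrix_SL2Z by metis
qed

lemma matrix_inv_int_matrix:
  assumes "a * d - b * c = 1"
  shows "matrix_inv (int_matrix a b c d) = int_matrix d (- b) (- c) a"
  using matrix_inv_entries[OF SL2Z_det[of "int_matrix a b c d"]] assms by (simp add: mat2_eq_iff int_matrix_SL2Z)

lemma translation_int_matrix: "translation t = int_matrix 1 t 0 1"
  by (simp add: translation_def int_matrix_def)

lemma Gamma0_int_matrix: "int_matrix a b c d \<in> Gamma0 N \<longleftrightarrow> a * d - b * c = 1 \<and> int N dvd c"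
  by (simp add: Gamma0_def int_matrix_SL2Z)

lemma minus_Gamma0: "- A \<in> Gamma0 N \<longleftrightarrow> A \<in> Gamma0 N"
proof -
  have "- A \<in> Gamma0 N" if A: "A \<in> Gamma0 N" for A
  proof -
    have "A \<in> carrier SL2Z" using A by (simp add: Gamma0_def)
    then obtain a b c d where "A = int_matrix a b c d" by (metis SL2Z_int_matrix)
    thus ?thesis using A by (simp add: int_matrix_minus Gamma0_int_matrix)
  qed
  from this[of A] this[of "- A"] show ?thesis by auto
qed

lemma subgroup_Gamma0: "subgroup (Gamma0 N) SL2Z"
proof (rule group.subgroupI[OF SL2Z_group])
  show "Gamma0 N \<subseteq> carrier SL2Z" by (auto simp: Gamma0_def)
  have "int_matrix 1 0 0 1 \<in> Gamma0 N" by (simp add: Gamma0_int_matrix)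
  thus "Gamma0 N \<noteq> {}" by blast
  have obt: "\<exists>a b c d. A = int_matrix a b c d \<and> a * d - b * c = 1 \<and> int N dvd c" if A: "A \<in> Gamma0 N" for A
  proof -
    have "A \<in> carrier SL2Z" using A by (simp add: Gamma0_def)
    then obtain a b c d where "A = int_matrix a b c d" "a * d - b * c = 1" by (metis SL2Z_int_matrix)
    thus ?thesis using A by (auto simp: Gamma0_int_matrix)
  qed
  show "inv\<^bsub>SL2Z\<^esub> A \<in> Gamma0 N" if A: "A \<in> Gamma0 N" for A
  proof -
    obtain a b c d where A': "A = int_matrix a b c d" "a * d - b * c = 1" "int N dvd c" using obt[OF A] by blast
    have "inv\<^bsub>SL2Z\<^esub> A = int_matrix d (- b) (- c) a"
      using SL2Z_inv(2)[of A] A'(2) by (simp add: A'(1) int_matrix_SL2Z matrix_inv_int_matrix)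
    thus ?thesis using A' by (simp add: Gamma0_int_matrix mult.commute)
  qed
  show "A \<otimes>\<^bsub>SL2Z\<^esub> B \<in> Gamma0 N" if A: "A \<in> Gamma0 N" and B: "B \<in> Gamma0 N" for A B
  proof -
    obtain a b c d where A': "A = int_matrix a b c d" "a * d - b * c = 1" "int N dvd c" using obt[OF A] by blast
    obtain a' b' c' d' where B': "B = int_matrix a' b' c' d'" "a' * d' - b' * c' = 1" "int N dvd c'" using obt[OF B] by blast
    have "A ** B \<in> carrier SL2Z" using A B by (intro SL2Z_mult_closed) (auto simp: Gamma0_def)
    thus ?thesis using A'(3) B'(3) by (simp add: A'(1) B'(1) int_matrix_mult Gamma0_int_matrix int_matrix_SL2Z)
  qed
qed

text \<open>A coset is determined by the bottom row modulo N: the lower left entry of B times the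
  inverse of A is c' d - d' c.\<close>

lemma finite_index_Gamma0:
  assumes N: "N > 0"
  shows "finite_index_subgroup (Gamma0 N)"
proof -
  let ?r = "\<lambda>A::real^2^2. (\<lfloor>A$2$1\<rfloor> mod int N, \<lfloor>A$2$2\<rfloor> mod int N)"
  have eq: "Gamma0 N #>\<^bsub>SL2Z\<^esub> A = Gamma0 N #>\<^bsub>SL2Z\<^esub> B"
    if A: "A \<in> carrier SL2Z" and B: "B \<in> carrier SL2Z" and r: "?r A = ?r B" for A B
  proof -
    obtain a b c d where A': "A = int_matrix a b c d" "a * d - b * c = 1" using A by (metis SL2Z_int_matrix)
    obtain a' b' c' d' where B': "B = int_matrix a' b' c' d'" "a' * d' - b' * c' = 1" using B by (metis SL2Z_int_matrix)
    have "[c = c'] (mod int N)" "[d = d'] (mod int N)" using r by (auto simp: A'(1) B'(1) cong_def)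
    hence "[c' * d - d' * c = c' * d' - d' * c'] (mod int N)"
      by (intro cong_diff cong_mult cong_refl) auto
    hence "int N dvd c' * d - d' * c" by (simp add: cong_iff_dvd_diff mult.commute)
    hence "B ** matrix_inv A \<in> Gamma0 N"
      using SL2Z_mult_closed[OF B SL2Z_inv(1)[OF A]]
      by (simp add: A'(1) B'(1) matrix_inv_int_matrix[OF A'(2)] int_matrix_mult int_matrix_SL2Z Gamma0_int_matrix)
    moreover have "B = B ** matrix_inv A ** A" by (simp add: matrix_inv_cancel[OF SL2Z_det[OF A]])
    ultimately have "B \<in> Gamma0 N #>\<^bsub>SL2Z\<^esub> A" unfolding r_coset_def SL2Z_simps by blast
    thus ?thesis by (rule group.repr_independence[OF SL2Z_group _ A subgroup_Gamma0])
  qed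
  have "rcosets\<^bsub>SL2Z\<^esub> (Gamma0 N) \<subseteq> (\<lambda>p. Gamma0 N #>\<^bsub>SL2Z\<^esub> (SOME A. A \<in> carrier SL2Z \<and> ?r A = p)) ` ({0..<int N} \<times> {0..<int N})"
  proof
    fix K assume "K \<in> rcosets\<^bsub>SL2Z\<^esub> (Gamma0 N)"
    then obtain A where A: "A \<in> carrier SL2Z" "K = Gamma0 N #>\<^bsub>SL2Z\<^esub> A" unfolding RCOSETS_def by blast
    have "\<exists>B. B \<in> carrier SL2Z \<and> ?r B = ?r A" using A(1) by blast
    from someI_ex[OF this] have "K = Gamma0 N #>\<^bsub>SL2Z\<^esub> (SOME B. B \<in> carrier SL2Z \<and> ?r B = ?r A)"
      unfolding A(2) using A(1) by (intro eq) auto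
    moreover have "?r A \<in> {0..<int N} \<times> {0..<int N}" using N by simp
    ultimately show "K \<in> (\<lambda>p. Gamma0 N #>\<^bsub>SL2Z\<^esub> (SOME A. A \<in> carrier SL2Z \<and> ?r A = p)) ` ({0..<int N} \<times> {0..<int N})" by blast
  qed
  hence "finite (rcosets\<^bsub>SL2Z\<^esub> (Gamma0 N))" by (rule finite_subset) simp
  thus ?thesis using subgroup_Gamma0 by (simp add: finite_index_subgroup_def)
qed

section \<open>Cusp representatives, and characters as multipliers\<close>

lemma cusp_representatives_exist:
  assumes sub: "subgroup \<Gamma> SL2Z"
  obtains R where "cusp_representatives \<Gamma> R"
proof -
  note G = SL2Z_subgroup[OF sub]
  define e where "e \<aa> \<bb> \<longleftrightarrow> (\<exists>A\<in>\<Gamma>. bdry_mobius A \<aa> = \<bb>)" for \<aa> \<bb>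
  have refl: "e \<aa> \<aa>" for \<aa> unfolding e_def using G(3) bdry_mobius_one by blast
  have sym: "e \<bb> \<aa>" if ab: "e \<aa> \<bb>" for \<aa> \<bb>
    using ab G(5) bdry_mobius_inverse(1)[OF G(2)] unfolding e_def by metis
  have trans: "e \<aa> \<cc>" if ab: "e \<aa> \<bb>" "e \<bb> \<cc>" for \<aa> \<bb> \<cc>
    using ab G(4) bdry_mobius_mult[OF G(2)] unfolding e_def by metis
  \<comment> \<open>Equivalent cusps have the same set of candidates, so the choice depends only on
    the class; this gives uniqueness.\<close>
  define f where "f = (\<lambda>\<aa>. SOME \<bb>. \<bb> \<in> cusps \<and> e \<bb> \<aa>)"
  have f: "f \<aa> \<in> cusps" "e (f \<aa>) \<aa>" if "\<aa> \<in> cusps" for \<aa>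
  proof -
    have "\<exists>\<bb>. \<bb> \<in> cusps \<and> e \<bb> \<aa>" using that refl by blast
    from someI_ex[OF this] show "f \<aa> \<in> cusps" "e (f \<aa>) \<aa>" unfolding f_def by auto
  qed
  have fe: "f \<aa> = f \<bb>" if "e \<aa> \<bb>" for \<aa> \<bb>
  proof -
    have "e \<cc> \<aa> \<longleftrightarrow> e \<cc> \<bb>" for \<cc> using that sym trans by blast
    thus ?thesis by (simp add: f_def)
  qed
  have "cusp_representatives \<Gamma> (f ` cusps)"
    unfolding cusp_representatives_def e_def[symmetric]
  proof (intro conjI ballI)
    show "f ` cusps \<subseteq> cusps" using f by blast
    fix \<aa> assume a: "\<aa> \<in> cusps"
    show "\<exists>!\<bb>. \<bb> \<in> f ` cusps \<and> e \<bb> \<aa>"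
    proof (rule ex1I[of _ "f \<aa>"])
      show "f \<aa> \<in> f ` cusps \<and> e (f \<aa>) \<aa>" using a f by blast
      fix \<bb> assume b: "\<bb> \<in> f ` cusps \<and> e \<bb> \<aa>"
      then obtain \<cc> where c: "\<cc> \<in> cusps" "\<bb> = f \<cc>" by blast
      have "e \<cc> \<aa>" using sym[OF f(2)[OF c(1)]] b[unfolded c(2)] trans by blast
      thus "\<bb> = f \<aa>" using fe c(2) by blast
    qed
  qed
  thus ?thesis by (rule that)
qed

lemma complex_powr_of_real_int: "z \<noteq> 0 \<Longrightarrow> z powr of_real (of_int n) = (z :: complex) powi n"
  using complex_powr_of_int[of z n] by simp

lemma wcocycle_of_int:
  assumes d: "det A = 1" "det B = 1"
  shows "wcocycle (of_int n) A B = 1"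
proof -
  have i: "\<i> \<in> uhp" by (simp add: uhp_def)
  define a b where "a = automorphy A (mobius B \<i>)" "b = automorphy B \<i>"
  have nz: "a \<noteq> 0" "b \<noteq> 0"
    using automorphy_nonzero[OF d(1) mobius_uhp[OF d(2) i]] automorphy_nonzero[OF d(2) i] by (simp_all add: a_b_def)
  have "wcocycle (of_int n) A B = a powi n * b powi n * inverse ((a * b) powi n)"
    using nz unfolding wcocycle_def automorphy_mult[OF d(2) i] a_b_def[symmetric] powr_minus
    by (simp only: complex_powr_of_real_int mult_eq_0_iff simp_thms not_False_eq_True)
  also have "\<dots> = 1" unfolding power_int_mult_distrib[symmetric] by (rule right_inverse) (use nz in simp)
  finally show ?thesis .
qed

lemma multiplier_system_character:
  assumes \<psi>: "dirichlet_character N \<psi>" and par: "\<psi> (- 1) = (- 1) ^ m"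
  shows "multiplier_system (Gamma0 N) (character_multiplier \<psi>) (2 - real m)"
  unfolding multiplier_system_def
proof (intro conjI ballI impI)
  have obt: "\<exists>a b c d. A = int_matrix a b c d \<and> a * d - b * c = 1 \<and> int N dvd c" if A: "A \<in> Gamma0 N" for A
  proof -
    have "A \<in> carrier SL2Z" using A by (simp add: Gamma0_def)
    then obtain a b c d where "A = int_matrix a b c d" "a * d - b * c = 1" by (metis SL2Z_int_matrix)
    thus ?thesis using A by (auto simp: Gamma0_int_matrix)
  qed
  show "norm (character_multiplier \<psi> A) = 1" if A: "A \<in> Gamma0 N" for A
  proof -
    obtain a b c d where A': "A = int_matrix a b c d" "a * d - b * c = 1" "int N dvd c" using obt[OF A] by blast
    have "coprime d (int N)"
    proof (rule coprimeI)
      fix e assume "e dvd d" "e dvd int N"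
      hence "e dvd a * d - b * c" using A'(3) by (intro dvd_diff dvd_mult) (auto intro: dvd_trans)
      thus "is_unit e" by (simp add: A'(2))
    qed
    thus ?thesis using dirichlet_character_norm[OF \<psi>] by (simp add: character_multiplier_def A'(1))
  qed
  show "character_multiplier \<psi> (A ** B) = character_multiplier \<psi> A * character_multiplier \<psi> B * wcocycle (2 - real m) A B"
    if A: "A \<in> Gamma0 N" and B: "B \<in> Gamma0 N" for A B
  proof -
    obtain a b c d where A': "A = int_matrix a b c d" "a * d - b * c = 1" "int N dvd c" using obt[OF A] by blast
    obtain a' b' c' d' where B': "B = int_matrix a' b' c' d'" "a' * d' - b' * c' = 1" "int N dvd c'" using obt[OF B] by blast
    have "wcocycle (2 - real m) A B = wcocycle (of_int (2 - int m)) A B" by simp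
    also have "\<dots> = 1" by (rule wcocycle_of_int) (use A B SL2Z_det in \<open>auto simp: Gamma0_def\<close>)
    finally have w: "wcocycle (2 - real m) A B = 1" .
    have "[c * b' + d * d' = d * d'] (mod int N)" using A'(3) by (simp add: cong_iff_dvd_diff)
    hence "\<psi> (c * b' + d * d') = \<psi> d * \<psi> d'"
      using dirichlet_character_cong[OF \<psi>] dirichlet_character_mult[OF \<psi>] by metis
    moreover have "A ** B = int_matrix (a*a' + b*c') (a*b' + b*d') (c*a' + d*c') (c*b' + d*d')"
      unfolding A'(1) B'(1) by (rule int_matrix_mult)
    ultimately show ?thesis unfolding w character_multiplier_def by (simp add: A'(1) B'(1) del: of_int_add of_int_mult)
  qed
  \<comment> \<open>The value prescribed at -I is (-1)^m, which is the parity of the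
    character.\<close>
  have "exp (- of_real pi * \<i> * of_real (2 - real m)) = exp (of_nat m * (of_real pi * \<i>) - 2 * of_real pi * \<i>)"
    by (simp add: algebra_simps)
  also have "\<dots> = exp (of_real pi * \<i>) ^ m" by (simp only: exp_diff exp_two_pi_i exp_of_nat_mult div_by_1)
  also have "\<dots> = (- 1) ^ m" by simp
  moreover have "\<lfloor>- 1 :: real\<rfloor> = - 1" by (intro floor_unique) auto
  ultimately show "character_multiplier \<psi> (- mat 1) = exp (- of_real pi * \<i> * of_real (2 - real m))"
    using par by (simp add: character_multiplier_def mat2_one)
qed

text \<open>Transported to infinity by \<rho> and \<rho>', A becomes an integral matrix of
  determinant 1 that fixes infinity, hence a translation up to sign.\<close>

lemma SL2Z_cusp_map:
  assumes "\<rho> \<in> carrier SL2Z" "\<rho>' \<in> carrier SL2Z" "A \<in> carrier SL2Z"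
  shows "bdry_mobius A (bdry_mobius \<rho> None) = bdry_mobius \<rho>' None \<longleftrightarrow>
    (\<exists>t. A = \<rho>' ** translation t ** matrix_inv \<rho> \<or> A = - (\<rho>' ** translation t ** matrix_inv \<rho>))"
proof -
  have d: "det \<rho> = 1" "det \<rho>' = 1" "det A = 1" using assms SL2Z_det by auto
  define X where "X = matrix_inv \<rho>' ** (A ** \<rho>)"
  have X: "X \<in> carrier SL2Z" unfolding X_def by (intro SL2Z_mult_closed SL2Z_inv(1) assms)
  have A: "A = \<rho>' ** X ** matrix_inv \<rho>" by (simp add: X_def matrix_inv_cancel[OF d(1)] matrix_inv_cancel[OF d(2)])
  have "bdry_mobius A (bdry_mobius \<rho> None) = bdry_mobius \<rho>' (bdry_mobius X None)"
    using bdry_mobius_mult[OF d(1), of A None] bdry_mobius_mult[OF SL2Z_det[OF X], of \<rho>' None]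
    by (simp add: X_def matrix_inv_cancel[OF d(2)] del: bdry_mobius.simps)
  hence "bdry_mobius A (bdry_mobius \<rho> None) = bdry_mobius \<rho>' None \<longleftrightarrow> bdry_mobius X None = None"
    using bdry_mobius_inverse(1)[OF d(2)] by metis
  also have "\<dots> \<longleftrightarrow> X$2$1 = 0" by (rule bdry_mobius_None_iff)
  also have "\<dots> \<longleftrightarrow> (\<exists>t. X = translation t \<or> X = - translation t)"
  proof
    assume 0: "X$2$1 = 0"
    obtain a b c e where X': "X = int_matrix a b c e" "a * e - b * c = 1" using X by (metis SL2Z_int_matrix)
    have "c = 0" "a * e = 1" using 0 X' by auto
    hence "c = 0 \<and> (a = 1 \<and> e = 1 \<or> a = - 1 \<and> e = - 1)" using zmult_eq_1_iff by blast
    thus "\<exists>t. X = translation t \<or> X = - translation t"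
      unfolding X'(1) translation_int_matrix int_matrix_minus by (metis minus_zero add.inverse_inverse)
  qed (auto simp: translation_int_matrix)
  also have "\<dots> \<longleftrightarrow> (\<exists>t. A = \<rho>' ** translation t ** matrix_inv \<rho> \<or> A = - (\<rho>' ** translation t ** matrix_inv \<rho>))"
  proof -
    have "X = Y \<longleftrightarrow> A = \<rho>' ** Y ** matrix_inv \<rho>" for Y
    proof
      assume "A = \<rho>' ** Y ** matrix_inv \<rho>"
      thus "X = Y" unfolding X_def
        by (simp add: matrix_inv_cancel[OF d(1)] matrix_inv_cancel[OF d(2)] matrix_mul_assoc[symmetric])
    qed (simp add: A)
    moreover have "\<rho>' ** (- Y) ** matrix_inv \<rho> = - (\<rho>' ** Y ** matrix_inv \<rho>)" for Y by (simp add: mat2_minus_mult)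
    ultimately show ?thesis by metis
  qed
  finally show ?thesis .
qed

lemma translation_conj_int_matrix:
  assumes "a * d - b * c = 1"
  shows "int_matrix a' b' c' d' ** translation t ** matrix_inv (int_matrix a b c d)
    = int_matrix (a' * d - (a' * t + b') * c) ((a' * t + b') * a - a' * b) (c' * d - (c' * t + d') * c) ((c' * t + d') * a - c' * b)"
  unfolding matrix_inv_int_matrix[OF assms] translation_int_matrix int_matrix_mult by (simp add: algebra_simps)

lemma translation_conj_Gamma0:
  assumes d: "a * d - b * c = 1" "a' * d' - b' * c' = 1"
  shows "int_matrix a' b' c' d' ** translation t ** matrix_inv (int_matrix a b c d) \<in> Gamma0 N
    \<longleftrightarrow> int N dvd c' * d - (c' * t + d') * c"
proof -
  have "int_matrix a' b' c' d' ** translation t ** matrix_inv (int_matrix a b c d) \<in> carrier SL2Z"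
    by (intro SL2Z_mult_closed SL2Z_inv(1)) (use d in \<open>simp_all add: int_matrix_SL2Z translation_int_matrix\<close>)
  thus ?thesis unfolding translation_conj_int_matrix[OF d(1)] Gamma0_int_matrix int_matrix_SL2Z by simp
qed

lemma Gamma0_equivalent_iff:
  assumes d: "a * d - b * c = 1" "a' * d' - b' * c' = 1"
  shows "(\<exists>A\<in>Gamma0 N. bdry_mobius A (bdry_mobius (int_matrix a b c d) None) = bdry_mobius (int_matrix a' b' c' d') None)
    \<longleftrightarrow> (\<exists>t. int N dvd c' * d - (c' * t + d') * c)"
proof -
  let ?M = "int_matrix a b c d" and ?M' = "int_matrix a' b' c' d'"
  have M: "?M \<in> carrier SL2Z" "?M' \<in> carrier SL2Z" using d by (auto simp: int_matrix_SL2Z)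
  have "(\<exists>A\<in>Gamma0 N. bdry_mobius A (bdry_mobius ?M None) = bdry_mobius ?M' None) \<longleftrightarrow>
     (\<exists>A\<in>Gamma0 N. \<exists>t. A = ?M' ** translation t ** matrix_inv ?M \<or> A = - (?M' ** translation t ** matrix_inv ?M))"
    by (intro bex_cong refl SL2Z_cusp_map M) (simp add: Gamma0_def)
  also have "\<dots> \<longleftrightarrow> (\<exists>t. ?M' ** translation t ** matrix_inv ?M \<in> Gamma0 N)"
    using minus_Gamma0 by metis
  finally show ?thesis unfolding translation_conj_Gamma0[OF d] .
qed

lemma gcd_decomposition:
  fixes c N :: int
  assumes "N > 0"
  obtains x n where "c = gcd c N * x" "N = gcd c N * n" "coprime x n" "c div gcd c N = x" "N div gcd c N = n" "n > 0" "gcd c N > 0"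
proof -
  have C: "gcd c N > 0" using assms by simp
  then obtain x n where xn: "c = x * gcd c N" "N = n * gcd c N" "coprime x n" using gcd_coprime_exists[of c N] by auto
  have "n > 0" using xn(2) C assms by (metis zero_less_mult_pos2)
  thus ?thesis using that[of x n] xn C by (metis mult.commute nonzero_mult_div_cancel_left less_irrefl)
qed

text \<open>The expression on the left is the lower left entry of the general matrix that carries \<open>a/c\<close> to \<open>a'/c'\<close>.\<close>

lemma cusp_congruence:
  fixes a b c d a' b' c' d' N :: int
  assumes N: "N > 0" and d: "a * d - b * c = 1" "a' * d' - b' * c' = 1"
  shows "(\<exists>t. N dvd c' * d - (c' * t + d') * c) \<longleftrightarrow>
    gcd c N = gcd c' N \<and> [a * (c div gcd c N) = a' * (c' div gcd c' N)] (mod gcd (gcd c N) (N div gcd c N))"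
proof -
  obtain x n where x: "c = gcd c N * x" "N = gcd c N * n" "coprime x n" "c div gcd c N = x" "N div gcd c N = n" "n > 0" "gcd c N > 0"
    using gcd_decomposition[OF N] by blast
  obtain y n' where y: "c' = gcd c' N * y" "N = gcd c' N * n'" "coprime y n'" "c' div gcd c' N = y" "N div gcd c' N = n'"
    using gcd_decomposition[OF N] by blast
  define C where "C = gcd c N"
  define g where "g = gcd C n"
  have cop: "coprime d c" "coprime d' c'"
    using d by (metis coprimeI dvd_diff dvd_mult dvd_mult2)+
  have inv: "[a * d = 1] (mod g)" "gcd c' N = C \<Longrightarrow> [a' * d' = 1] (mod g)"
  proof -
    have gC: "g dvd C" by (simp add: g_def)
    have e: "a * d - 1 = b * c" "a' * d' - 1 = b' * c'" using d by auto
    have "C dvd c" by (simp add: C_def)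
    thus "[a * d = 1] (mod g)" unfolding cong_iff_dvd_diff e by (intro dvd_mult dvd_trans[OF gC])
    assume "gcd c' N = C"
    hence "C dvd c'" by (metis gcd_dvd1)
    thus "[a' * d' = 1] (mod g)" unfolding cong_iff_dvd_diff e by (intro dvd_mult dvd_trans[OF gC])
  qed
  \<comment> \<open>a and d are inverse to each other modulo g, and so are a' and d'; multiplying by
    a a' or by d d' therefore passes between the two congruences.\<close>
  have key: "[y * d = x * d'] (mod g) \<longleftrightarrow> [a * x = a' * y] (mod g)" if "gcd c' N = C"
  proof
    note i = inv(1) inv(2)[OF that]
    assume "[y * d = x * d'] (mod g)"
    hence "[(y * d) * (a * a') = (x * d') * (a * a')] (mod g)" by (rule cong_scalar_right)
    moreover have "[(y * d) * (a * a') = 1 * (a' * y)] (mod g)"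
      using cong_scalar_right[OF i(1), of "a' * y"] by (simp add: mult_ac)
    moreover have "[(x * d') * (a * a') = 1 * (a * x)] (mod g)"
      using cong_scalar_right[OF i(2), of "a * x"] by (simp add: mult_ac)
    ultimately show "[a * x = a' * y] (mod g)" by (metis cong_sym cong_trans mult_1)
  next
    note i = inv(1) inv(2)[OF that]
    assume "[a * x = a' * y] (mod g)"
    hence "[(a * x) * (d * d') = (a' * y) * (d * d')] (mod g)" by (rule cong_scalar_right)
    moreover have "[(a * x) * (d * d') = 1 * (x * d')] (mod g)"
      using cong_scalar_right[OF i(1), of "x * d'"] by (simp add: mult_ac)
    moreover have "[(a' * y) * (d * d') = 1 * (y * d)] (mod g)"
      using cong_scalar_right[OF i(2), of "y * d"] by (simp add: mult_ac)
    ultimately show "[y * d = x * d'] (mod g)" by (metis cong_sym cong_trans mult_1)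
  qed
  have fac: "c' * d - (c' * t + d') * c = C * (y * d - x * d' - C * x * y * t)" if "gcd c' N = C" for t
  proof -
    have "c = C * x" "c' = C * y" using x(1) y(1) that by (simp_all add: C_def)
    thus ?thesis by (simp add: algebra_simps)
  qed
  have div: "N dvd C * e \<longleftrightarrow> n dvd e" for e
  proof -
    have "C * n dvd C * e \<longleftrightarrow> n dvd e" using x(7) unfolding C_def[symmetric] by simp
    moreover have "N = C * n" using x(2) unfolding C_def .
    ultimately show ?thesis by simp
  qed
  show ?thesis
  proof
    assume "\<exists>t. N dvd c' * d - (c' * t + d') * c"
    then obtain t where t: "N dvd c' * d - (c' * t + d') * c" by blast
    have "gcd c N dvd c'"
    proof -
      have "gcd c N dvd c' * d - (c' * t + d') * c" using t by (rule dvd_trans[rotated]) simp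
      hence "gcd c N dvd c' * d" by (metis dvd_diff_left_iff dvd_mult gcd_dvd1)
      moreover have "coprime (gcd c N) d" using cop(1) by (metis coprime_commute coprime_divisors dvd_refl gcd_dvd1)
      ultimately show ?thesis by (simp add: coprime_dvd_mult_left_iff)
    qed
    moreover have "gcd c' N dvd c"
    proof -
      have "gcd c' N dvd c' * d - (c' * t + d') * c" using t by (rule dvd_trans[rotated]) simp
      also have "c' * d - (c' * t + d') * c = c' * (d - t * c) - d' * c" by (simp add: algebra_simps)
      finally have "gcd c' N dvd d' * c" by (metis dvd_diff_right_iff dvd_mult2 gcd_dvd1)
      moreover have "coprime (gcd c' N) d'" using cop(2) by (metis coprime_commute coprime_divisors dvd_refl gcd_dvd1)
      ultimately show ?thesis by (simp add: coprime_dvd_mult_right_iff)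
    qed
    ultimately have eq: "gcd c' N = C" unfolding C_def by (intro zdvd_antisym_nonneg) auto
    have "n dvd y * d - x * d' - C * x * y * t" using t unfolding fac[OF eq] div .
    hence "g dvd y * d - x * d' - C * x * y * t" by (rule dvd_trans[rotated]) (simp add: g_def)
    moreover have "g dvd C * x * y * t" by (simp add: g_def)
    ultimately have "g dvd y * d - x * d'" by (metis dvd_diff_left_iff)
    hence "[a * x = a' * y] (mod g)" using key[OF eq] by (simp add: cong_iff_dvd_diff)
    thus "gcd c N = gcd c' N \<and> [a * (c div gcd c N) = a' * (c' div gcd c' N)] (mod gcd (gcd c N) (N div gcd c N))"
      unfolding x(4,5) y(4) using eq by (simp add: g_def C_def)
  next
    assume asm: "gcd c N = gcd c' N \<and> [a * (c div gcd c N) = a' * (c' div gcd c' N)] (mod gcd (gcd c N) (N div gcd c N))"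
    hence eq: "gcd c' N = C" and "[a * x = a' * y] (mod g)" unfolding x(4,5) y(4) by (auto simp: g_def C_def)
    hence "g dvd y * d - x * d'" using key[OF eq] by (simp add: cong_iff_dvd_diff)
    then obtain e where e: "y * d - x * d' = g * e" by (elim dvdE)
    have "n' = n" using x(5) y(5) eq by (simp add: C_def)
    hence "coprime (x * y) n" using x(3) y(3) by simp
    \<comment> \<open>As x y is prime to n, the coefficient of t has the same gcd with n as C;
      Bezout then solves for t.\<close>
    hence "gcd (C * (x * y)) n = g" unfolding g_def by (simp add: gcd_mult_right_right_cancel gcd_mult_left_right_cancel gcd.commute coprime_commute)
    then obtain u v where uv: "u * (C * (x * y)) + v * n = g" using bezout_int by metis
    have "y * d - x * d' - C * x * y * (u * e) = n * (v * e)" unfolding e uv[symmetric] by (simp add: algebra_simps)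
    hence "n dvd y * d - x * d' - C * x * y * (u * e)" by simp
    thus "\<exists>t. N dvd c' * d - (c' * t + d') * c" unfolding fac[OF eq] div by blast
  qed
qed

text \<open>The stabilizer of \<open>a/c\<close> in \<open>\<Gamma>\<^sub>0(N)\<close> is parametrized by the \<open>t\<close> with \<open>N | c\<^sup>2 t\<close>, up to sign, and
  \<open>1 + a c t\<close> is the lower right entry.\<close>

lemma stabilizer_character_trivial_iff:
  fixes a b c d :: int
  assumes \<psi>: "dirichlet_character N \<psi>" and d: "a * d - b * c = 1"
  defines "C \<equiv> gcd c (int N)"
  defines "g \<equiv> gcd C (int N div C)"
  shows "(\<forall>t. int N dvd c * c * t \<longrightarrow> \<psi> (1 + a * c * t) = 1) \<longleftrightarrow> trivial_mod N \<psi> (int N div g)"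
proof -
  have N: "int N > 0" using \<psi> by (simp add: dirichlet_character_def)
  obtain x n where x: "c = C * x" "int N = C * n" "coprime x n" "int N div C = n" "C > 0"
    using gcd_decomposition[OF N, of c] unfolding C_def by metis
  have g: "g = gcd C n" unfolding g_def x(4) ..
  have g0: "g > 0" using x(5) by (simp add: g)
  obtain r where r: "C = g * r" using g by (metis dvdE gcd_dvd1)
  obtain s where s: "n = g * s" using g by (metis dvdE gcd_dvd2)
  have Ng: "int N = g * (C * s)" "int N div g = C * s" using g0 by (simp_all add: x(2) s)
  show ?thesis
  proof
    assume asm: "\<forall>t. int N dvd c * c * t \<longrightarrow> \<psi> (1 + a * c * t) = 1"
    show "trivial_mod N \<psi> (int N div g)"
      unfolding trivial_mod_def Ng(2)
    proof (intro allI impI)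
      fix e assume e: "coprime e (int N)" "[e = 1] (mod C * s)"
      obtain j where j: "e = 1 + C * s * j" using e(2) by (metis cong_iff_lin cong_sym)
      have "coprime a C"
      proof (rule coprimeI)
        fix p assume p: "p dvd a" "p dvd C"
        hence "p dvd a * d - b * c" using x(1) by (intro dvd_diff) (auto intro: dvd_mult dvd_mult2)
        thus "is_unit p" by (simp add: d)
      qed
      hence "coprime a g" using r by (metis coprime_mult_right_iff)
      moreover have "coprime x g" using x(3) s by (metis coprime_mult_right_iff)
      ultimately have "coprime (a * x) g" by simp
      \<comment> \<open>w inverts a x modulo g; with t = s w j the entry 1 + a c t reproduces e = 1
        + C s j modulo N = g C s.\<close>
      then obtain w where "[a * x * w = 1] (mod g)" using cong_solve_coprime_int by blast
      hence "[a * x * w * j = 1 * j] (mod g)" by (rule cong_scalar_right)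
      hence "g dvd a * x * w * j - j" by (simp add: cong_iff_dvd_diff)
      then obtain q where q: "a * x * w * j - j = g * q" by (elim dvdE)
      define t where "t = s * (w * j)"
      have "c * c * t = int N * (r * x * x * w * j)" unfolding t_def x(1) x(2) s by (simp add: r algebra_simps)
      hence "\<psi> (1 + a * c * t) = 1" using asm by simp
      moreover have "(1 + a * c * t) - e = int N * q"
      proof -
        have "(1 + a * c * t) - e = C * s * (a * x * w * j - j)" unfolding t_def x(1) j by (simp add: algebra_simps)
        thus ?thesis unfolding q Ng(1) by (simp add: algebra_simps)
      qed
      hence "[1 + a * c * t = e] (mod int N)" by (simp add: cong_iff_dvd_diff)
      ultimately show "\<psi> e = 1" using dirichlet_character_cong[OF \<psi>] by metis
    qed
  next
    assume triv: "trivial_mod N \<psi> (int N div g)"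
    show "\<forall>t. int N dvd c * c * t \<longrightarrow> \<psi> (1 + a * c * t) = 1"
    proof (intro allI impI)
      fix t assume t: "int N dvd c * c * t"
      have "coprime (1 + a * c * t) (int N)"
      proof (rule coprimeI)
        fix p assume p: "p dvd 1 + a * c * t" "p dvd int N"
        have "p dvd (1 + a * c * t) * (1 - a * c * t) + a * a * t * (c * c * t)"
          by (rule dvd_add[OF dvd_mult2[OF p(1)] dvd_mult[OF dvd_trans[OF p(2) t]]])
        also have "(1 + a * c * t) * (1 - a * c * t) + a * a * t * (c * c * t) = 1" by (simp add: algebra_simps)
        finally show "is_unit p" .
      qed
      \<comment> \<open>It suffices that N divides g c t. Now C is a combination of c and N, so N
        divides C c t; N also divides n c t, and g is a combination of C and n.\<close>
      moreover have "C * s dvd c * t"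
      proof -
        obtain u v where uv: "u * c + v * int N = C" using bezout_int unfolding C_def by metis
        have "C * (c * t) = u * (c * c * t) + int N * (v * (c * t))" unfolding uv[symmetric] by (simp add: algebra_simps)
        hence 1: "int N dvd C * (c * t)" using t by simp
        have 2: "n * (c * t) = int N * (x * t)" unfolding x(1) x(2) by simp
        obtain u' v' where uv': "u' * C + v' * n = g" using bezout_int unfolding g by metis
        have "g * (c * t) = u' * (C * (c * t)) + v' * (n * (c * t))" unfolding uv'[symmetric] by (simp add: algebra_simps)
        hence "int N dvd g * (c * t)" using 1 unfolding 2 by simp
        thus ?thesis using g0 unfolding Ng(1) by simp
      qed
      hence "[1 + a * c * t = 1] (mod C * s)" by (simp add: cong_iff_dvd_diff mult.assoc)
      ultimately show "\<psi> (1 + a * c * t) = 1" using triv unfolding trivial_mod_def Ng(2) by blast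
    qed
  qed
qed

section \<open>Stabilizers, scaling matrices and singular cusps\<close>

lemma cusp_stabilizer_Gamma0:
  assumes d: "a * d - b * c = 1"
  defines "\<rho> \<equiv> int_matrix a b c d"
  shows "cusp_stabilizer (Gamma0 N) (bdry_mobius \<rho> None) = {A. \<exists>t. int N dvd c * c * t \<and>
    (A = \<rho> ** translation t ** matrix_inv \<rho> \<or> A = - (\<rho> ** translation t ** matrix_inv \<rho>))}"
proof -
  let ?B = "\<lambda>t. \<rho> ** translation t ** matrix_inv \<rho>"
  have \<rho>: "\<rho> \<in> carrier SL2Z" using d by (simp add: \<rho>_def int_matrix_SL2Z)
  have e: "c * d - (c * t + d) * c = - (c * c * t)" for t by (simp add: algebra_simps)
  have B: "?B t \<in> Gamma0 N \<longleftrightarrow> int N dvd c * c * t" for t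
    unfolding \<rho>_def translation_conj_Gamma0[OF d d] e by simp
  have "A \<in> cusp_stabilizer (Gamma0 N) (bdry_mobius \<rho> None) \<longleftrightarrow> A \<in> Gamma0 N \<and> (\<exists>t. A = ?B t \<or> A = - ?B t)" for A
  proof -
    have "A \<in> Gamma0 N \<Longrightarrow> A \<in> carrier SL2Z" by (simp add: Gamma0_def)
    thus ?thesis unfolding cusp_stabilizer_def using SL2Z_cusp_map[OF \<rho> \<rho>, of A] by blast
  qed
  moreover have "A \<in> Gamma0 N \<longleftrightarrow> int N dvd c * c * t" if "A = ?B t \<or> A = - ?B t" for A t
    using that B[of t] minus_Gamma0[of "?B t"] by metis
  ultimately have "A \<in> cusp_stabilizer (Gamma0 N) (bdry_mobius \<rho> None) \<longleftrightarrow>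
    (\<exists>t. int N dvd c * c * t \<and> (A = ?B t \<or> A = - ?B t))" for A by metis
  thus ?thesis by (simp only: set_eq_iff mem_Collect_eq simp_thms)
qed

text \<open>The stabilizer of a/c consists, up to sign, of conjugates of translations by multiples
  of the width h = N / gcd(c^2, N); the diagonal matrix with entries sqrt h and 1 / sqrt h rescales
  the width to 1.\<close>

lemma scaling_matrix_Gamma0_exists:
  assumes N: "N > 0" and a: "\<aa> \<in> cusps"
  shows "\<exists>\<sigma>. scaling_matrix (Gamma0 N) \<aa> \<sigma>"
proof -
  obtain \<rho> where \<rho>: "\<rho> \<in> carrier SL2Z" "bdry_mobius \<rho> None = \<aa>" using cusp_eq_SL2Z_image[OF a] by blast
  obtain a b c d where abcd: "\<rho> = int_matrix a b c d" "a * d - b * c = 1" using \<rho>(1) by (metis SL2Z_int_matrix)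
  have N': "int N > 0" using N by simp
  obtain x h where h: "c * c = gcd (c * c) (int N) * x" "int N = gcd (c * c) (int N) * h" "coprime x h" "h > 0" "gcd (c * c) (int N) > 0"
    using gcd_decomposition[OF N'] by metis
  define q where "q = gcd (c * c) (int N)"
  have width: "int N dvd c * c * t \<longleftrightarrow> h dvd t" for t
  proof -
    have "q > 0" using h(5) unfolding q_def .
    hence "q * h dvd q * (x * t) \<longleftrightarrow> h dvd x * t" by simp
    also have "\<dots> \<longleftrightarrow> h dvd t" using h(3) by (simp add: coprime_dvd_mult_right_iff coprime_commute)
    finally show ?thesis using h(1,2) unfolding q_def[symmetric] by (simp add: mult.assoc)
  qed
  define w where "w = sqrt (of_int h)"
  have w: "w \<noteq> 0" "w * w = of_int h" using h(4) by (simp_all add: w_def)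
  define D :: "real^2^2" where "D = vector [vector [w, 0], vector [0, 1 / w]]"
  have D: "D$1$1 = w" "D$1$2 = 0" "D$2$1 = 0" "D$2$2 = 1 / w" "det D = 1"
    using w(1) by (simp_all add: D_def vector_2 det_2)
  define \<sigma> where "\<sigma> = \<rho> ** D"
  have d\<rho>: "det \<rho> = 1" by (rule SL2Z_det[OF \<rho>(1)])
  let ?B = "\<lambda>t. \<rho> ** translation t ** matrix_inv \<rho>"
  have "matrix_inv D ** translation (h * s) ** D = translation s" for s
  proof -
    have "1 / w * (of_int h * of_int s * (1 / w)) = of_int s" unfolding w(2)[symmetric] using w(1) by (simp add: field_simps)
    thus ?thesis using w(1) by (simp add: mat2_eq_iff mat2_mult matrix_inv_entries[OF D(5)] D translation_def vector_2 mult_ac)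
  qed
  moreover have "matrix_inv \<sigma> ** ?B t ** \<sigma> = matrix_inv D ** translation t ** D" for t
    by (simp add: \<sigma>_def matrix_inv_mult[OF d\<rho> D(5)] matrix_mul_assoc[symmetric] matrix_inv_cancel[OF d\<rho>])
  ultimately have conj: "matrix_inv \<sigma> ** ?B (h * s) ** \<sigma> = translation s"
    "matrix_inv \<sigma> ** (- ?B (h * s)) ** \<sigma> = - translation s" for s
    by (simp_all add: mat2_minus_mult)
  define Z where "Z = cusp_stabilizer (Gamma0 N) \<aa>"
  have Z: "A \<in> Z \<longleftrightarrow> (\<exists>s. A = ?B (h * s) \<or> A = - ?B (h * s))" for A
    unfolding Z_def \<rho>(2)[symmetric] abcd(1) cusp_stabilizer_Gamma0[OF abcd(2)] width by (auto simp: dvd_def)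
  have Z': "Z \<union> uminus ` Z = Z"
  proof -
    have "- A \<in> Z" if "A \<in> Z" for A using that unfolding Z by (metis add.inverse_inverse)
    thus ?thesis by auto
  qed
  have "(\<lambda>A. matrix_inv \<sigma> ** A ** \<sigma>) ` Z = range translation \<union> uminus ` range translation"
  proof (intro equalityI subsetI)
    fix X assume "X \<in> (\<lambda>A. matrix_inv \<sigma> ** A ** \<sigma>) ` Z"
    then obtain A where A: "A \<in> Z" "X = matrix_inv \<sigma> ** A ** \<sigma>" by blast
    from A(1)[unfolded Z] obtain s where "X = matrix_inv \<sigma> ** ?B (h * s) ** \<sigma> \<or> X = matrix_inv \<sigma> ** (- ?B (h * s)) ** \<sigma>" using A(2) by blast
    thus "X \<in> range translation \<union> uminus ` range translation" unfolding conj by blast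
  next
    fix X assume "X \<in> range translation \<union> uminus ` range translation"
    then obtain s where "X = matrix_inv \<sigma> ** ?B (h * s) ** \<sigma> \<or> X = matrix_inv \<sigma> ** (- ?B (h * s)) ** \<sigma>" unfolding conj by blast
    thus "X \<in> (\<lambda>A. matrix_inv \<sigma> ** A ** \<sigma>) ` Z" using Z by blast
  qed
  moreover have "bdry_mobius D None = None" using D by simp
  hence "bdry_mobius \<sigma> None = \<aa>" unfolding \<sigma>_def bdry_mobius_mult[OF D(5)] \<rho>(2)[symmetric] by (rule arg_cong)
  ultimately have "scaling_matrix (Gamma0 N) \<aa> \<sigma>"
    unfolding scaling_matrix_def Z_def[symmetric] Z' by (simp add: SL2R_def \<sigma>_def det_mul d\<rho> D(5) del: bdry_mobius.simps)
  thus ?thesis by blast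
qed

text \<open>In integral weight the cocycle is 1, and passing to the stabilizer element changes the
  automorphy factor of S by a sign at most. That sign contributes (-1)^m through the weight and
  (-1)^m through the character, so only the character value at 1 + a c t remains.\<close>

lemma singular_cusp_Gamma0_iff:
  assumes \<psi>: "dirichlet_character N \<psi>" and par: "\<psi> (- 1) = (- 1) ^ m" and d: "a * d - b * c = 1"
    and scal: "scaling_matrix (Gamma0 N) (bdry_mobius (int_matrix a b c d) None) \<sigma>"
  shows "singular_cusp (Gamma0 N) (character_multiplier \<psi>) (2 - real m) (bdry_mobius (int_matrix a b c d) None) \<sigma>
    \<longleftrightarrow> (\<forall>t. int N dvd c * c * t \<longrightarrow> \<psi> (1 + a * c * t) = 1)"
proof -
  define \<rho> where "\<rho> = int_matrix a b c d"
  define S where "S = matrix_inv \<sigma>"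
  let ?B = "\<lambda>t. \<rho> ** translation t ** matrix_inv \<rho>" and ?\<kappa> = "of_real (2 - real m) :: complex"
  have d\<rho>: "det \<rho> = 1" using SL2Z_det[of \<rho>] d by (simp add: \<rho>_def int_matrix_SL2Z)
  have d\<sigma>: "det \<sigma> = 1" and "bdry_mobius \<sigma> None = bdry_mobius \<rho> None"
    using scal unfolding scaling_matrix_def SL2R_def \<rho>_def by auto
  then obtain \<alpha> \<beta> where \<alpha>: "\<alpha> \<noteq> 0" "\<sigma> = \<rho> ** vector [vector [\<alpha>, \<beta>], vector [0, 1 / \<alpha>]]"
    using same_cusp_matrix[OF _ d\<rho>] by metis
  define U :: "real^2^2" where "U = vector [vector [\<alpha>, \<beta>], vector [0, 1 / \<alpha>]]"
  have U: "det U = 1" "U$1$1 = \<alpha>" "U$2$1 = 0" using \<alpha>(1) by (simp_all add: U_def det_2 vector_2)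
  have dS: "det S = 1" unfolding S_def by (rule det_matrix_inv[OF d\<sigma>])
  have SU: "S = matrix_inv U ** matrix_inv \<rho>" unfolding S_def \<alpha>(2) U_def[symmetric] by (rule matrix_inv_mult[OF d\<rho> U(1)])
  have "S ** ?B t = matrix_inv U ** (translation t ** matrix_inv \<rho>)" for t
    unfolding SU by (simp add: matrix_mul_assoc[symmetric] matrix_inv_cancel[OF d\<rho>])
  hence j: "automorphy (S ** ?B t) z = automorphy S z" for t z
    unfolding SU by (simp add: automorphy_def mat2_mult matrix_inv_entries[OF U(1)] U translation_def vector_2)
  have B22: "?B t $ 2 $ 2 = of_int (1 + a * c * t)" for t
  proof -
    have "(c * t + d) * a - c * b = 1 + a * c * t" using d by (simp add: algebra_simps)
    thus ?thesis unfolding \<rho>_def translation_conj_int_matrix[OF d] by (simp del: of_int_diff of_int_add of_int_mult)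
  qed
  have \<nu>: "character_multiplier \<psi> (?B t) = \<psi> (1 + a * c * t)"
    "character_multiplier \<psi> (- ?B t) = (- 1) ^ m * \<psi> (1 + a * c * t)" for t
  proof -
    show "character_multiplier \<psi> (?B t) = \<psi> (1 + a * c * t)"
      unfolding character_multiplier_def B22 floor_of_int ..
    have "(- ?B t) $ 2 $ 2 = of_int (- 1 * (1 + a * c * t))" using B22[of t] by simp
    hence "character_multiplier \<psi> (- ?B t) = \<psi> (- 1 * (1 + a * c * t))"
      unfolding character_multiplier_def by (simp only: floor_of_int)
    thus "character_multiplier \<psi> (- ?B t) = (- 1) ^ m * \<psi> (1 + a * c * t)"
      unfolding dirichlet_character_mult[OF \<psi>] par .
  qed
  have pw: "(- x) powr ?\<kappa> = (- 1) ^ m * x powr ?\<kappa>" if "x \<noteq> 0" for x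
  proof -
    have \<kappa>: "?\<kappa> = of_real (of_int (2 - int m))" by simp
    have "(- 1 :: complex) powi (2 - int m) = (- 1) ^ m"
      by (subst power_int_diff) (auto simp: field_simps simp flip: power_add)
    thus ?thesis unfolding \<kappa> using that power_int_mult_distrib[of "- 1" x "2 - int m"]
      by (simp only: complex_powr_of_real_int neg_equal_0_iff_equal mult_minus1 not_False_eq_True)
  qed
  have w: "wcocycle (2 - real m) S A = 1" if "det A = 1" for A
    using wcocycle_of_int[OF dS that, of "2 - int m"] by simp
  have dB: "det (?B t) = 1" "det (- ?B t) = 1" for t
    by (simp_all add: det_mul det_matrix_inv d\<rho> det_translation det_minus_2)
  let ?P = "\<lambda>A z. character_multiplier \<psi> A * wcocycle (2 - real m) S A * automorphy (S ** A) z powr ?\<kappa> = automorphy S z powr ?\<kappa>"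
  have P: "?P (?B t) z \<longleftrightarrow> \<psi> (1 + a * c * t) = 1" "?P (- ?B t) z \<longleftrightarrow> \<psi> (1 + a * c * t) = 1" if z: "z \<in> uhp" for t z
  proof -
    have nz: "automorphy S z \<noteq> 0" using automorphy_nonzero[OF dS z] .
    hence nz': "automorphy S z powr ?\<kappa> \<noteq> 0" by simp
    show "?P (?B t) z \<longleftrightarrow> \<psi> (1 + a * c * t) = 1" unfolding w[OF dB(1)] \<nu> j using nz' by simp
    have "automorphy (S ** - ?B t) z = - automorphy S z" using j[of t z] by (simp add: mat2_minus_mult automorphy_minus)
    moreover have "(- 1 :: complex) ^ m * (- 1) ^ m = 1" by (simp flip: power_add)
    hence "(- 1) ^ m * u * 1 * ((- 1) ^ m * v) = u * v" for u v :: complex by (simp add: mult_ac)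
    ultimately show "?P (- ?B t) z \<longleftrightarrow> \<psi> (1 + a * c * t) = 1" unfolding w[OF dB(2)] \<nu> using nz' by (simp only: pw[OF nz] mult_cancel_right1 mult_1_left mult_1_right) simp
  qed
  have i: "\<i> \<in> uhp" by (simp add: uhp_def)
  have "singular_cusp (Gamma0 N) (character_multiplier \<psi>) (2 - real m) (bdry_mobius \<rho> None) \<sigma> \<longleftrightarrow>
     (\<forall>t. int N dvd c * c * t \<longrightarrow> (\<forall>z\<in>uhp. ?P (?B t) z) \<and> (\<forall>z\<in>uhp. ?P (- ?B t) z))"
    unfolding singular_cusp_def S_def[symmetric] \<rho>_def cusp_stabilizer_Gamma0[OF d] by blast
  also have "\<dots> \<longleftrightarrow> (\<forall>t. int N dvd c * c * t \<longrightarrow> \<psi> (1 + a * c * t) = 1)" using P i by blast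
  finally show ?thesis unfolding \<rho>_def .
qed

section \<open>Counting the singular cusps\<close>

lemma conductor_dvd:
  assumes "dirichlet_character N \<psi>"
  shows "conductor N \<psi> dvd N"
  using conductor_dvd_iff[OF assms dvd_refl] dirichlet_character_cong[OF assms, of _ 1] dirichlet_character_one[OF assms]
  by (simp add: trivial_mod_def)

text \<open>With D the conductor, D divides N/g iff g divides N/D. Triviality of a character and of
  its conjugate are the same condition.\<close>

lemma trivial_mod_div_iff:
  assumes \<psi>: "dirichlet_character N \<psi>" and g: "g dvd N"
  shows "trivial_mod N \<psi> (int N div int g) \<longleftrightarrow> g dvd N div conductor N (\<lambda>a. cnj (\<psi> a))"
proof -
  let ?\<psi> = "\<lambda>a. cnj (\<psi> a)"
  define D where "D = conductor N ?\<psi>"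
  note \<psi>' = dirichlet_character_cnj[OF \<psi>]
  have N: "N > 0" using \<psi> by (simp add: dirichlet_character_def)
  have D: "D dvd N" unfolding D_def by (rule conductor_dvd[OF \<psi>'])
  have nz: "D \<noteq> 0" "g \<noteq> 0" using D g N by auto
  have "trivial_mod N \<psi> (int N div int g) \<longleftrightarrow> trivial_mod N ?\<psi> (int (N div g))"
    by (simp add: trivial_mod_def zdiv_int)
  also have "\<dots> \<longleftrightarrow> D dvd N div g" unfolding D_def using g by (intro conductor_dvd_iff[OF \<psi>', symmetric]) (auto elim: dvdE)
  also have "\<dots> \<longleftrightarrow> g dvd N div D"
    using nz D g by (simp add: dvd_div_iff_mult mult.commute)
  finally show ?thesis unfolding D_def .
qed

lemma cusp_unit:
  fixes a b c d N :: int
  assumes d: "a * d - b * c = 1" and N: "N > 0"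
  shows "coprime (a * (c div gcd c N)) (gcd (gcd c N) (N div gcd c N))"
proof -
  obtain x n where x: "coprime x n" "c div gcd c N = x" "N div gcd c N = n" using gcd_decomposition[OF N, of c] by metis
  have "coprime a c"
  proof (rule coprimeI)
    fix p assume "p dvd a" "p dvd c"
    hence "p dvd a * d - b * c" by (intro dvd_diff) (auto intro: dvd_mult dvd_mult2)
    thus "is_unit p" by (simp add: d)
  qed
  hence "coprime a (gcd (gcd c N) n)" by (rule coprime_divisors[OF dvd_refl, rotated]) (meson dvd_trans gcd_dvd1)
  moreover have "coprime x (gcd (gcd c N) n)" using x(1) by (rule coprime_divisors[OF dvd_refl, rotated]) simp
  ultimately show ?thesis unfolding x(2,3) by simp
qed

text \<open>The cusp is a/C, with a lifted from u to be prime to C; Bezout completes the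
  matrix.\<close>

lemma cusp_with_invariants:
  fixes C N u :: int
  assumes C: "C dvd N" "C > 0" and u: "coprime u (gcd C (N div C))"
  obtains a b c d where "a * d - b * c = 1" "gcd c N = C" "[a * (c div gcd c N) = u] (mod gcd C (N div C))"
proof -
  obtain a where a: "[a = u] (mod gcd C (N div C))" "coprime a C" using coprime_lift[OF u, of C] C(2) by auto
  obtain p q where "p * a + q * C = gcd a C" using bezout_int by blast
  hence "a * p - (- q) * C = 1" using a(2) by (simp add: coprime_iff_gcd_eq_1 mult.commute)
  moreover have "gcd C N = C" using C by (simp add: gcd_proj1_iff)
  moreover from this have "[a * (C div gcd C N) = u] (mod gcd C (N div C))" using a(1) C(2) by simp
  ultimately show ?thesis by (rule that)
qed

lemma dim_H_sharp_Gamma0: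
  assumes m: "m \<ge> 3" and \<psi>: "dirichlet_character N \<psi>" and par: "\<psi> (- 1) = (- 1) ^ m"
  shows "cfun.dim (H_sharp (2 - real m) (Gamma0 N) (character_multiplier \<psi>)) =
    (\<Sum>C | C dvd N \<and> gcd C (N div C) dvd N div conductor N (\<lambda>a. cnj (\<psi> a)). totient (gcd C (N div C)))"
proof -
  have N: "N > 0" "int N > 0" using \<psi> by (auto simp: dirichlet_character_def)
  obtain R where R: "cusp_representatives (Gamma0 N) R" using cusp_representatives_exist[OF subgroup_Gamma0] by blast
  have Rc: "R \<subseteq> cusps" using R by (simp add: cusp_representatives_def)
  obtain \<sigma> where \<sigma>: "\<And>\<aa>. \<aa> \<in> cusps \<Longrightarrow> scaling_matrix (Gamma0 N) \<aa> (\<sigma> \<aa>)"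
    using scaling_matrix_Gamma0_exists[OF N(1)] by metis
  have "\<exists>a b c d. a * d - b * c = 1 \<and> bdry_mobius (int_matrix a b c d) None = \<aa>" if "\<aa> \<in> cusps" for \<aa>
    using cusp_eq_SL2Z_image[OF that] SL2Z_int_matrix by metis
  then obtain a b c d where M: "\<And>\<aa>. \<aa> \<in> cusps \<Longrightarrow> a \<aa> * d \<aa> - b \<aa> * c \<aa> = 1"
    "\<And>\<aa>. \<aa> \<in> cusps \<Longrightarrow> bdry_mobius (int_matrix (a \<aa>) (b \<aa>) (c \<aa>) (d \<aa>)) None = \<aa>" by metis
  let ?\<nu> = "character_multiplier \<psi>" and ?D = "conductor N (\<lambda>a. cnj (\<psi> a))"
  define I where "I = {\<aa> \<in> R. singular_cusp (Gamma0 N) ?\<nu> (2 - real m) \<aa> (\<sigma> \<aa>)}"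
  define \<phi> where "\<phi> = (\<lambda>\<aa>. mock_eisenstein (real m) (Gamma0 N) ?\<nu> \<aa> (\<sigma> \<aa>))"
  have H: "H_sharp (2 - real m) (Gamma0 N) ?\<nu> = cfun.span (\<phi> ` I)" "inj_on \<phi> I" "cfun.independent (\<phi> ` I)"
    unfolding \<phi>_def I_def
    by (rule H_sharp_eq_span[OF finite_index_Gamma0[OF N(1)] multiplier_system_character[OF \<psi> par] _ R],
        use m in simp, rule \<sigma>, assumption)+
  define g where "g = (\<lambda>C. gcd C (N div C))"
  define cc where "cc = (\<lambda>\<aa>. nat (gcd (c \<aa>) (int N)))"
  define u where "u = (\<lambda>\<aa>. (a \<aa> * (c \<aa> div gcd (c \<aa>) (int N))) mod int (g (cc \<aa>)))"
  have ccN: "int (cc \<aa>) = gcd (c \<aa>) (int N)" for \<aa> by (simp add: cc_def)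
  have ccdvd: "cc \<aa> dvd N" for \<aa> by (metis ccN gcd_dvd2 int_dvd_int_iff)
  have gN: "g C dvd N" "g C > 0" if "C dvd N" for C using that N by (auto simp: g_def intro: dvd_trans Nat.gr0I)
  have gi: "int (g C) = gcd (int C) (int N div int C)" for C by (simp add: g_def zdiv_int[symmetric])
  have gc: "int (g (cc \<aa>)) = gcd (gcd (c \<aa>) (int N)) (int N div gcd (c \<aa>) (int N))" for \<aa>
    unfolding gi ccN ..
  have sing: "singular_cusp (Gamma0 N) ?\<nu> (2 - real m) \<aa> (\<sigma> \<aa>) \<longleftrightarrow> g (cc \<aa>) dvd N div ?D" if a: "\<aa> \<in> cusps" for \<aa>
  proof -
    have "singular_cusp (Gamma0 N) ?\<nu> (2 - real m) \<aa> (\<sigma> \<aa>) \<longleftrightarrow>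
       (\<forall>t. int N dvd c \<aa> * c \<aa> * t \<longrightarrow> \<psi> (1 + a \<aa> * c \<aa> * t) = 1)"
      using singular_cusp_Gamma0_iff[OF \<psi> par M(1)[OF a], of "\<sigma> \<aa>"] \<sigma>[OF a] unfolding M(2)[OF a] by blast
    also have "\<dots> \<longleftrightarrow> trivial_mod N \<psi> (int N div int (g (cc \<aa>)))"
      unfolding gc by (rule stabilizer_character_trivial_iff[OF \<psi> M(1)[OF a]])
    also have "\<dots> \<longleftrightarrow> g (cc \<aa>) dvd N div ?D" by (rule trivial_mod_div_iff[OF \<psi> gN(1)[OF ccdvd]])
    finally show ?thesis .
  qed
  have equiv: "(\<exists>A\<in>Gamma0 N. bdry_mobius A \<aa> = bdry_mobius (int_matrix a' b' c' d') None) \<longleftrightarrow>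
      gcd (c \<aa>) (int N) = gcd c' (int N) \<and> [a \<aa> * (c \<aa> div gcd (c \<aa>) (int N)) = a' * (c' div gcd c' (int N))] (mod int (g (cc \<aa>)))"
    if a: "\<aa> \<in> cusps" and d: "a' * d' - b' * c' = 1" for \<aa> a' b' c' d'
    using Gamma0_equivalent_iff[OF M(1)[OF a] d, of N] cusp_congruence[OF N(2) M(1)[OF a] d]
    unfolding M(2)[OF a] gc by blast
  \<comment> \<open>A singular cusp is encoded by C = gcd(c, N) and the residue of a c/C modulo
    gcd(C, N/C). The singularity condition depends on C alone, so every fibre is a full group of
    units.\<close>
  let ?T = "SIGMA C:{C. C dvd N \<and> g C dvd N div ?D}. {u \<in> {0..<int (g C)}. coprime u (int (g C))}"
  have bij: "bij_betw (\<lambda>\<aa>. (cc \<aa>, u \<aa>)) I ?T"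
  proof (rule bij_betw_imageI)
    show "inj_on (\<lambda>\<aa>. (cc \<aa>, u \<aa>)) I"
    proof (rule inj_onI, rule ccontr)
      fix \<aa> \<bb> assume ab: "\<aa> \<in> I" "\<bb> \<in> I" "(cc \<aa>, u \<aa>) = (cc \<bb>, u \<bb>)" "\<aa> \<noteq> \<bb>"
      hence c: "\<aa> \<in> R" "\<bb> \<in> R" "\<aa> \<in> cusps" "\<bb> \<in> cusps" using Rc by (auto simp: I_def)
      have "cc \<bb> = cc \<aa>" "u \<bb> = u \<aa>" using ab(3) by auto
      hence "gcd (c \<bb>) (int N) = gcd (c \<aa>) (int N)" "[a \<bb> * (c \<bb> div gcd (c \<bb>) (int N)) = a \<aa> * (c \<aa> div gcd (c \<aa>) (int N))] (mod int (g (cc \<bb>)))"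
        using ccN[of \<aa>] ccN[of \<bb>] by (auto simp: u_def cong_def)
      then obtain A where "A \<in> Gamma0 N" "bdry_mobius A \<bb> = \<aa>"
        using equiv[OF c(4) M(1)[OF c(3)]] unfolding M(2)[OF c(3)] by blast
      thus False using cusp_representatives_inequivalent[OF subgroup_Gamma0 R c(1,2) ab(4)] by blast
    qed
    show "(\<lambda>\<aa>. (cc \<aa>, u \<aa>)) ` I = ?T"
    proof (intro equalityI subsetI)
      fix p assume "p \<in> (\<lambda>\<aa>. (cc \<aa>, u \<aa>)) ` I"
      then obtain \<aa> where a: "\<aa> \<in> I" "p = (cc \<aa>, u \<aa>)" by blast
      hence c: "\<aa> \<in> cusps" "g (cc \<aa>) dvd N div ?D" using Rc sing by (auto simp: I_def)
      have "coprime (u \<aa>) (int (g (cc \<aa>)))"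
        using cusp_unit[OF M(1)[OF c(1)] N(2)] gN(2)[OF ccdvd] unfolding u_def gc[symmetric] by simp
      moreover have "0 \<le> u \<aa>" "u \<aa> < int (g (cc \<aa>))" using gN(2)[OF ccdvd, of \<aa>] by (simp_all add: u_def)
      ultimately show "p \<in> ?T" using ccdvd c(2) by (simp add: a(2))
    next
      fix p assume "p \<in> ?T"
      then obtain C v where C: "p = (C, v)" "C dvd N" "g C dvd N div ?D" "0 \<le> v" "v < int (g C)" "coprime v (int (g C))" by auto
      have C0: "int C dvd int N" "int C > 0" using C(2) N by (auto intro: Nat.gr0I)
      obtain a' b' c' d' where abcd: "a' * d' - b' * c' = 1" "gcd c' (int N) = int C" "[a' * (c' div gcd c' (int N)) = v] (mod int (g C))"
        using cusp_with_invariants[OF C0 C(6)[unfolded gi]] unfolding gi by metis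
      define \<bb> where "\<bb> = bdry_mobius (int_matrix a' b' c' d') None"
      have "None \<in> cusps" by (simp add: cusps_def)
      hence "\<bb> \<in> cusps" unfolding \<bb>_def using abcd(1) int_matrix_SL2Z SL2Z_cusps by blast
      then obtain \<aa> where a: "\<aa> \<in> R" "\<exists>A\<in>Gamma0 N. bdry_mobius A \<aa> = \<bb>"
        using R unfolding cusp_representatives_def by blast
      have ac: "\<aa> \<in> cusps" using a(1) Rc by blast
      have e: "gcd (c \<aa>) (int N) = gcd c' (int N)" "[a \<aa> * (c \<aa> div gcd (c \<aa>) (int N)) = a' * (c' div gcd c' (int N))] (mod int (g (cc \<aa>)))"
        using equiv[OF ac abcd(1)] a(2) unfolding \<bb>_def by blast+
      have cC: "cc \<aa> = C" using e(1) abcd(2) by (simp add: cc_def)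
      have "u \<aa> = v mod int (g C)" using e(2) abcd(3) unfolding u_def cC cong_def by simp
      hence "u \<aa> = v" using C(4,5) by simp
      moreover have "\<aa> \<in> I" using a(1) sing[OF ac] C(3) by (simp add: I_def cC)
      ultimately show "p \<in> (\<lambda>\<aa>. (cc \<aa>, u \<aa>)) ` I" using cC C(1) by blast
    qed
  qed
  have fin: "finite {u \<in> {0..<int (g C)}. coprime u (int (g C))}" for C
    by (rule finite_subset[of _ "{0..<int (g C)}"]) auto
  from bij have "card I = card ?T" by (rule bij_betw_same_card)
  also have "\<dots> = (\<Sum>C | C dvd N \<and> g C dvd N div ?D. card {u \<in> {0..<int (g C)}. coprime u (int (g C))})"
    by (rule card_SigmaI, use N in simp, use fin in blast)
  also have "\<dots> = (\<Sum>C | C dvd N \<and> g C dvd N div ?D. totient (g C))"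
    by (intro sum.cong refl card_units_mod gN(2)) simp
  finally have "card I = (\<Sum>C | C dvd N \<and> g C dvd N div ?D. totient (g C))" .
  moreover have "cfun.dim (H_sharp (2 - real m) (Gamma0 N) ?\<nu>) = card I"
    unfolding H(1) cfun.dim_span_eq_card_independent[OF H(3)] by (rule card_image[OF H(2)])
  ultimately show ?thesis by (simp only: g_def)
qed

theorem theorem1p5:
  fixes k :: real
  assumes half_integral: "2 * k \<in> \<int>" and k_gt_2: "k > 2"
  shows
    "(\<forall>(\<Gamma> :: (real^2^2) set) (\<nu> :: real^2^2 \<Rightarrow> complex) (R :: real option set)
        (\<sigma> :: real option \<Rightarrow> real^2^2).
        finite_index_subgroup \<Gamma> \<longrightarrow>
        multiplier_system \<Gamma> \<nu> (2 - k) \<longrightarrow>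
        cusp_representatives \<Gamma> R \<longrightarrow>
        (\<forall>\<aa>\<in>cusps. scaling_matrix \<Gamma> \<aa> (\<sigma> \<aa>)) \<longrightarrow>
          H_sharp (2 - k) \<Gamma> \<nu> =
            cfun.span {mock_eisenstein k \<Gamma> \<nu> \<aa> (\<sigma> \<aa>) | \<aa>.
                         \<aa> \<in> R \<and> singular_cusp \<Gamma> \<nu> (2 - k) \<aa> (\<sigma> \<aa>)} \<and>
          isomorphic_subspaces (H_sharp (2 - k) \<Gamma> \<nu>)
            (eisenstein_space k \<Gamma> (\<lambda>A. cnj (\<nu> A)) \<sigma>)) \<and>
     (\<forall>(m :: nat) (N :: nat) (\<psi> :: int \<Rightarrow> complex).
        k = real m \<longrightarrow> m \<ge> 3 \<longrightarrow>
        dirichlet_character N \<psi> \<longrightarrow> \<psi> (- 1) = (- 1) ^ m \<longrightarrow>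
          cfun.dim (H_sharp (2 - k) (Gamma0 N) (character_multiplier \<psi>)) =
            (\<Sum>C | C dvd N \<and> gcd C (N div C) dvd N div conductor N (\<lambda>a. cnj (\<psi> a)).
               totient (gcd C (N div C))))"
proof (intro conjI allI impI)
  fix \<Gamma> :: "(real^2^2) set" and \<nu> R and \<sigma> :: "real option \<Rightarrow> real^2^2"
  assume fi: "finite_index_subgroup \<Gamma>" and ms: "multiplier_system \<Gamma> \<nu> (2 - k)" and R: "cusp_representatives \<Gamma> R"
    and scal: "\<forall>\<aa>\<in>cusps. scaling_matrix \<Gamma> \<aa> (\<sigma> \<aa>)"
  show "H_sharp (2 - k) \<Gamma> \<nu> = cfun.span {mock_eisenstein k \<Gamma> \<nu> \<aa> (\<sigma> \<aa>) | \<aa>.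
      \<aa> \<in> R \<and> singular_cusp \<Gamma> \<nu> (2 - k) \<aa> (\<sigma> \<aa>)}"
    (is "_ = cfun.span ?E")
  proof -
    have "?E = (\<lambda>\<aa>. mock_eisenstein k \<Gamma> \<nu> \<aa> (\<sigma> \<aa>)) ` {\<aa> \<in> R. singular_cusp \<Gamma> \<nu> (2 - k) \<aa> (\<sigma> \<aa>)}"
      by blast
    thus ?thesis using H_sharp_eq_span(1)[OF fi ms k_gt_2 R] scal by simp
  qed
  show "isomorphic_subspaces (H_sharp (2 - k) \<Gamma> \<nu>) (eisenstein_space k \<Gamma> (\<lambda>A. cnj (\<nu> A)) \<sigma>)"
    by (rule H_sharp_isomorphic_eisenstein_space[OF fi ms k_gt_2 R bspec[OF scal]])
next
  fix m N :: nat and \<psi> :: "int \<Rightarrow> complex"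
  assume "k = real m" "m \<ge> 3" "dirichlet_character N \<psi>" "\<psi> (- 1) = (- 1) ^ m"
  thus "cfun.dim (H_sharp (2 - k) (Gamma0 N) (character_multiplier \<psi>)) =
      (\<Sum>C | C dvd N \<and> gcd C (N div C) dvd N div conductor N (\<lambda>a. cnj (\<psi> a)). totient (gcd C (N div C)))"
    using dim_H_sharp_Gamma0 by simp
qed

end
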